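(* Let $y_\Omega\in L^2(\Omega)$, $\beta\in C(\Gamma)$, $\nu>0$, and let $\bar u$ be the unique minimizer of $J(u)=\frac12\|Su-y_\Omega\|^2_{L^2(\Omega)}+\frac\nu2\|u\|^2_{L^2(\Gamma)}$ over $\{u\in L^2(\Gamma): u\le\beta\text{ a.e. on }\Gamma\}$. Consider the Newton-like method with parameter $c>0$: given $(u^0,\lambda^0)\in L^2(\Gamma)\times L^2(\Gamma)$, for $k=0,1,2,\dots$ let $$\Gamma_A(u^k,\lambda^k)=\{x\in\Gamma:\ \tfrac1c\lambda^k(x)+u^k(x)>\beta(x)\},\qquad\Gamma_F(u^k,\lambda^k)=\Gamma\setminus\Gamma_A(u^k,\lambda^k),$$ and let $(u^{k+1},\lambda^{k+1})=(u^+,\lambda^+)$ be the solution of $$\nu u^+=-S^*(Su^+-y_\Omega)-\lambda^+\ \text{ on }\Gamma,\qquad u^+=\beta\ \text{ on }\Gamma_A(u^k,\lambda^k),\qquad\lambda^+=0\ \text{ on }\Gamma_F(u^k,\lambda^k).$$ If $c=\nu>0$, then the sequence $(u^k)$ converges q-superlinearly to $\bar u$ in $L^2(\Gamma)$ provided $u^0$ is close enough to $\bar u$ in the sense of $L^2(\Gamma)$ and $\lambda^0=S^*y_\Omega-(S^*Su^0+\nu u^0)$.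
   Context: $\Omega\subset\mathbb{R}^d$, $d=2$ or $d=3$, is a bounded domain with Lipschitz boundary $\Gamma$; $(\cdot,\cdot)_X$ is the inner product of $L^2(X)$. Let $\Phi=\{\phi\in H^1_0(\Omega):\Delta\phi\in L^2(\Omega)\}$; functions in $\Phi$ have normal derivative $\partial_n\phi\in L^2(\Gamma)$, satisfying $(\partial_n\phi,z)_\Gamma=(\nabla\phi,\nabla z)_\Omega+(\Delta\phi,z)_\Omega$ for $z\in H^1(\Omega)$. The continuous linear operator $S:L^2(\Gamma)\to L^2(\Omega)$ is defined by $y=Su$ iff $(y,-\Delta\phi)_\Omega=-(u,\partial_n\phi)_\Gamma$ for all $\phi\in\Phi$ (transposition solution of $-\Delta y=0$ in $\Omega$, $y=u$ on $\Gamma$). Its adjoint $S^*:L^2(\Omega)\to L^2(\Gamma)$ is $S^*z=-\partial_n\phi$, where $\phi\in H^1_0(\Omega)$ is the weak solution of $-\Delta\phi=z$. As in the paper, only an upper control bound is considered. *)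

theory Defs
  imports "HOL-Analysis.Analysis" "HOL-Library.Landau_Symbols"
begin

section \<open>\<open>L\<^sup>2\<close> spaces\<close>

text \<open>Elements of \<open>L\<^sup>2\<close> are represented by square-integrable functions. Functions
  that agree almost everywhere are at distance 0, and every pointwise (in)equality between
  elements of \<open>L\<^sup>2\<close> is stated almost everywhere.\<close>

definition L2 :: "'a measure \<Rightarrow> ('a \<Rightarrow> 'b::euclidean_space) set" where
  "L2 M = {f \<in> borel_measurable M. integrable M (\<lambda>x. (norm (f x))\<^sup>2)}"

definition L2_inner :: "'a measure \<Rightarrow> ('a \<Rightarrow> 'b::euclidean_space) \<Rightarrow> ('a \<Rightarrow> 'b) \<Rightarrow> real" where
  "L2_inner M f g = (LINT x|M. f x \<bullet> g x)"

definition L2_norm :: "'a measure \<Rightarrow> ('a \<Rightarrow> 'b::euclidean_space) \<Rightarrow> real" where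
  "L2_norm M f = sqrt (L2_inner M f f)"

definition L2_dist :: "'a measure \<Rightarrow> ('a \<Rightarrow> 'b::euclidean_space) \<Rightarrow> ('a \<Rightarrow> 'b) \<Rightarrow> real" where
  "L2_dist M f g = L2_norm M (\<lambda>x. f x - g x)"

definition L2_adjoint ::
  "'a measure \<Rightarrow> 'b measure \<Rightarrow> (('a \<Rightarrow> real) \<Rightarrow> 'b \<Rightarrow> real) \<Rightarrow> ('b \<Rightarrow> real) \<Rightarrow> 'a \<Rightarrow> real" where
  "L2_adjoint M N T z = (SOME g. g \<in> L2 M \<and> (\<forall>u\<in>L2 M. L2_inner N (T u) z = L2_inner M u g))"

section \<open>Lipschitz domains and their surface measure\<close>

text \<open>Near each boundary point, \<open>\<Omega>\<close> is the strict epigraph of a Lipschitz function \<open>\<gamma>\<close> over the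
  hyperplane orthogonal to some unit vector \<open>e\<close>; choosing \<open>e\<close> amounts to choosing a rotated
  orthonormal coordinate system.\<close>

definition lipschitz_boundary :: "'a::euclidean_space set \<Rightarrow> bool" where
  "lipschitz_boundary \<Omega> \<longleftrightarrow>
     (\<forall>x\<in>frontier \<Omega>. \<exists>e r L (\<gamma> :: 'a \<Rightarrow> real).
        norm e = 1 \<and> r > 0 \<and> L-lipschitz_on {y. y \<bullet> e = 0} \<gamma> \<and>
        (\<forall>y\<in>ball x r. y \<in> \<Omega> \<longleftrightarrow> \<gamma> (y - (y \<bullet> e) *\<^sub>R e) < y \<bullet> e))"

definition bounded_lipschitz_domain :: "'a::euclidean_space set \<Rightarrow> bool" where
  "bounded_lipschitz_domain \<Omega> \<longleftrightarrow>
     open \<Omega> \<and> connected \<Omega> \<and> \<Omega> \<noteq> {} \<and> bounded \<Omega> \<and> lipschitz_boundary \<Omega>"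

text \<open>The \<open>s\<close>-dimensional Hausdorff measure (for \<open>s > 0\<close>), normalised as usual by the volume of
  the \<open>s\<close>-dimensional unit ball, so that it is the classical surface measure on hypersurfaces when
  \<open>s = d - 1\<close>. It is a metric outer measure, hence countably additive on the Borel sets,
  so \<^const>\<open>measure_of\<close> does not fall back to the null measure.\<close>

definition hausdorff_pre :: "real \<Rightarrow> real \<Rightarrow> 'a::metric_space set \<Rightarrow> ennreal" where
  "hausdorff_pre s \<delta> A =
     (INF U \<in> {U :: nat \<Rightarrow> 'a set. A \<subseteq> (\<Union>i. U i) \<and> (\<forall>i. bounded (U i) \<and> diameter (U i) \<le> \<delta>)}.
        \<Sum>i. ennreal (unit_ball_vol s * (diameter (U i) / 2) powr s))"

definition hausdorff_outer :: "real \<Rightarrow> 'a::metric_space set \<Rightarrow> ennreal" where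
  "hausdorff_outer s A = (SUP \<delta>\<in>{0<..}. hausdorff_pre s \<delta> A)"

definition hausdorff_measure :: "real \<Rightarrow> 'a::metric_space measure" where
  "hausdorff_measure s = measure_of UNIV (sets borel) (hausdorff_outer s)"

definition surface_measure :: "'a::euclidean_space set \<Rightarrow> 'a measure" where
  "surface_measure \<Omega> =
     restrict_space (hausdorff_measure (real DIM('a) - 1)) (frontier \<Omega>)"

section \<open>Sobolev spaces\<close>

definition grad :: "('a::euclidean_space \<Rightarrow> real) \<Rightarrow> 'a \<Rightarrow> 'a" where
  "grad f x = (\<Sum>i\<in>Basis. frechet_derivative f (at x) i *\<^sub>R i)"

primrec Ck :: "nat \<Rightarrow> ('a::euclidean_space \<Rightarrow> real) \<Rightarrow> bool" where
  "Ck 0 f \<longleftrightarrow> continuous_on UNIV f"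
| "Ck (Suc k) f \<longleftrightarrow> (\<forall>x. f differentiable at x) \<and> (\<forall>i\<in>Basis. Ck k (\<lambda>x. grad f x \<bullet> i))"

definition smooth :: "('a::euclidean_space \<Rightarrow> real) \<Rightarrow> bool" where
  "smooth f \<longleftrightarrow> (\<forall>k. Ck k f)"

definition test_functions :: "'a::euclidean_space set \<Rightarrow> ('a \<Rightarrow> real) set" where
  "test_functions \<Omega> =
     {\<psi>. smooth \<psi> \<and> compact (closure {x. \<psi> x \<noteq> 0}) \<and> closure {x. \<psi> x \<noteq> 0} \<subseteq> \<Omega>}"

definition is_weak_grad :: "'a::euclidean_space set \<Rightarrow> ('a \<Rightarrow> real) \<Rightarrow> ('a \<Rightarrow> 'a) \<Rightarrow> bool" where
  "is_weak_grad \<Omega> v G \<longleftrightarrow> G \<in> L2 (lebesgue_on \<Omega>) \<and>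
     (\<forall>\<psi>\<in>test_functions \<Omega>. \<forall>i\<in>Basis.
        L2_inner (lebesgue_on \<Omega>) v (\<lambda>x. grad \<psi> x \<bullet> i)
          = - L2_inner (lebesgue_on \<Omega>) (\<lambda>x. G x \<bullet> i) \<psi>)"

text \<open>Weak derivatives, traces and the operators below are determined only up to null sets; the
  choice operator picks a representative.\<close>

definition weak_grad :: "'a::euclidean_space set \<Rightarrow> ('a \<Rightarrow> real) \<Rightarrow> 'a \<Rightarrow> 'a" where
  "weak_grad \<Omega> v = (SOME G. is_weak_grad \<Omega> v G)"

definition H1 :: "'a::euclidean_space set \<Rightarrow> ('a \<Rightarrow> real) set" where
  "H1 \<Omega> = {v \<in> L2 (lebesgue_on \<Omega>). \<exists>G. is_weak_grad \<Omega> v G}"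

definition H1_norm :: "'a::euclidean_space set \<Rightarrow> ('a \<Rightarrow> real) \<Rightarrow> real" where
  "H1_norm \<Omega> v =
     sqrt ((L2_norm (lebesgue_on \<Omega>) v)\<^sup>2 + (L2_norm (lebesgue_on \<Omega>) (weak_grad \<Omega> v))\<^sup>2)"

definition H10 :: "'a::euclidean_space set \<Rightarrow> ('a \<Rightarrow> real) set" where
  "H10 \<Omega> = {v \<in> H1 \<Omega>. \<exists>\<psi>. (\<forall>n. \<psi> n \<in> test_functions \<Omega>) \<and>
     (\<lambda>n::nat. H1_norm \<Omega> (\<lambda>x. \<psi> n x - v x)) \<longlonglongrightarrow> 0}"

text \<open>The trace extends the restriction to \<open>\<Gamma>\<close> of functions smooth up to the boundary, by
  continuity from \<open>H\<^sup>1(\<Omega>)\<close> to \<open>L\<^sup>2(\<Gamma>)\<close>.\<close>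

definition is_trace :: "'a::euclidean_space set \<Rightarrow> ('a \<Rightarrow> real) \<Rightarrow> ('a \<Rightarrow> real) \<Rightarrow> bool" where
  "is_trace \<Omega> z t \<longleftrightarrow> t \<in> L2 (surface_measure \<Omega>) \<and>
     (\<exists>\<zeta>. (\<forall>n. smooth (\<zeta> n)) \<and>
        (\<lambda>n::nat. H1_norm \<Omega> (\<lambda>x. \<zeta> n x - z x)) \<longlonglongrightarrow> 0 \<and>
        (\<lambda>n. L2_dist (surface_measure \<Omega>) (\<zeta> n) t) \<longlonglongrightarrow> 0)"

definition boundary_trace :: "'a::euclidean_space set \<Rightarrow> ('a \<Rightarrow> real) \<Rightarrow> 'a \<Rightarrow> real" where
  "boundary_trace \<Omega> z = (SOME t. is_trace \<Omega> z t)"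

section \<open>Laplacian, normal derivative and solution operator\<close>

definition is_weak_laplacian ::
  "'a::euclidean_space set \<Rightarrow> ('a \<Rightarrow> real) \<Rightarrow> ('a \<Rightarrow> real) \<Rightarrow> bool" where
  "is_weak_laplacian \<Omega> \<phi> w \<longleftrightarrow> w \<in> L2 (lebesgue_on \<Omega>) \<and>
     (\<forall>\<psi>\<in>test_functions \<Omega>.
        L2_inner (lebesgue_on \<Omega>) (weak_grad \<Omega> \<phi>) (grad \<psi>) = - L2_inner (lebesgue_on \<Omega>) w \<psi>)"

definition weak_laplacian :: "'a::euclidean_space set \<Rightarrow> ('a \<Rightarrow> real) \<Rightarrow> 'a \<Rightarrow> real" where
  "weak_laplacian \<Omega> \<phi> = (SOME w. is_weak_laplacian \<Omega> \<phi> w)"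

definition Phi :: "'a::euclidean_space set \<Rightarrow> ('a \<Rightarrow> real) set" where
  "Phi \<Omega> = {\<phi> \<in> H10 \<Omega>. \<exists>w. is_weak_laplacian \<Omega> \<phi> w}"

definition is_normal_deriv ::
  "'a::euclidean_space set \<Rightarrow> ('a \<Rightarrow> real) \<Rightarrow> ('a \<Rightarrow> real) \<Rightarrow> bool" where
  "is_normal_deriv \<Omega> \<phi> g \<longleftrightarrow> g \<in> L2 (surface_measure \<Omega>) \<and>
     (\<forall>z\<in>H1 \<Omega>. L2_inner (surface_measure \<Omega>) g (boundary_trace \<Omega> z) =
        L2_inner (lebesgue_on \<Omega>) (weak_grad \<Omega> \<phi>) (weak_grad \<Omega> z)
        + L2_inner (lebesgue_on \<Omega>) (weak_laplacian \<Omega> \<phi>) z)"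

definition normal_deriv :: "'a::euclidean_space set \<Rightarrow> ('a \<Rightarrow> real) \<Rightarrow> 'a \<Rightarrow> real" where
  "normal_deriv \<Omega> \<phi> = (SOME g. is_normal_deriv \<Omega> \<phi> g)"

definition is_transposition_solution ::
  "'a::euclidean_space set \<Rightarrow> ('a \<Rightarrow> real) \<Rightarrow> ('a \<Rightarrow> real) \<Rightarrow> bool" where
  "is_transposition_solution \<Omega> u y \<longleftrightarrow> y \<in> L2 (lebesgue_on \<Omega>) \<and>
     (\<forall>\<phi>\<in>Phi \<Omega>. L2_inner (lebesgue_on \<Omega>) y (\<lambda>x. - weak_laplacian \<Omega> \<phi> x)
        = - L2_inner (surface_measure \<Omega>) u (normal_deriv \<Omega> \<phi>))"

definition S_op :: "'a::euclidean_space set \<Rightarrow> ('a \<Rightarrow> real) \<Rightarrow> 'a \<Rightarrow> real" where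
  "S_op \<Omega> u = (SOME y. is_transposition_solution \<Omega> u y)"

definition S_adj :: "'a::euclidean_space set \<Rightarrow> ('a \<Rightarrow> real) \<Rightarrow> 'a \<Rightarrow> real" where
  "S_adj \<Omega> = L2_adjoint (surface_measure \<Omega>) (lebesgue_on \<Omega>) (S_op \<Omega>)"

section \<open>Control problem and Newton-like method\<close>

definition cost :: "'a::euclidean_space set \<Rightarrow> ('a \<Rightarrow> real) \<Rightarrow> real \<Rightarrow> ('a \<Rightarrow> real) \<Rightarrow> real" where
  "cost \<Omega> y\<^sub>\<Omega> \<nu> u =
     (1/2) * (L2_dist (lebesgue_on \<Omega>) (S_op \<Omega> u) y\<^sub>\<Omega>)\<^sup>2
     + (\<nu>/2) * (L2_norm (surface_measure \<Omega>) u)\<^sup>2"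

definition admissible :: "'a::euclidean_space set \<Rightarrow> ('a \<Rightarrow> real) \<Rightarrow> ('a \<Rightarrow> real) set" where
  "admissible \<Omega> \<beta> =
     {u \<in> L2 (surface_measure \<Omega>). AE x in surface_measure \<Omega>. u x \<le> \<beta> x}"

definition active_set ::
  "'a::euclidean_space set \<Rightarrow> ('a \<Rightarrow> real) \<Rightarrow> real \<Rightarrow> ('a \<Rightarrow> real) \<Rightarrow> ('a \<Rightarrow> real) \<Rightarrow> 'a set" where
  "active_set \<Omega> \<beta> c u l = {x \<in> frontier \<Omega>. (1/c) * l x + u x > \<beta> x}"

definition free_set ::
  "'a::euclidean_space set \<Rightarrow> ('a \<Rightarrow> real) \<Rightarrow> real \<Rightarrow> ('a \<Rightarrow> real) \<Rightarrow> ('a \<Rightarrow> real) \<Rightarrow> 'a set" where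
  "free_set \<Omega> \<beta> c u l = frontier \<Omega> - active_set \<Omega> \<beta> c u l"

definition newton_step ::
  "'a::euclidean_space set \<Rightarrow> ('a \<Rightarrow> real) \<Rightarrow> ('a \<Rightarrow> real) \<Rightarrow> real \<Rightarrow> real \<Rightarrow>
   ('a \<Rightarrow> real) \<Rightarrow> ('a \<Rightarrow> real) \<Rightarrow> ('a \<Rightarrow> real) \<Rightarrow> ('a \<Rightarrow> real) \<Rightarrow> bool" where
  "newton_step \<Omega> y\<^sub>\<Omega> \<beta> \<nu> c u l u' l' \<longleftrightarrow>
     u' \<in> L2 (surface_measure \<Omega>) \<and> l' \<in> L2 (surface_measure \<Omega>) \<and>
     (AE x in surface_measure \<Omega>.
        \<nu> * u' x = - S_adj \<Omega> (\<lambda>\<xi>. S_op \<Omega> u' \<xi> - y\<^sub>\<Omega> \<xi>) x - l' x) \<and>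
     (AE x in surface_measure \<Omega>. x \<in> active_set \<Omega> \<beta> c u l \<longrightarrow> u' x = \<beta> x) \<and>
     (AE x in surface_measure \<Omega>. x \<in> free_set \<Omega> \<beta> c u l \<longrightarrow> l' x = 0)"

definition q_superlinear_L2 :: "'a measure \<Rightarrow> (nat \<Rightarrow> 'a \<Rightarrow> real) \<Rightarrow> ('a \<Rightarrow> real) \<Rightarrow> bool" where
  "q_superlinear_L2 M u v \<longleftrightarrow>
     (\<lambda>k. L2_dist M (u k) v) \<longlonglongrightarrow> 0 \<and>
     (\<lambda>k. L2_dist M (u (Suc k)) v) \<in> o(\<lambda>k. L2_dist M (u k) v)"

end

theory Submission
  imports Defs
begin

text \<open>The proof has two parts. For \<open>c = \<nu>\<close> and the prescribed \<open>\<lambda>\<close>, a step of the method is a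
  semismooth Newton step for \<open>u = min (-S\<^sup>*(S u - y\<^sub>\<Omega>) / \<nu>) \<beta>\<close>: its error equation involves the
  error only through \<open>S\<^sup>*S\<close> and through the set where the activity changes. Superlinearity follows
  from compactness of \<open>S\<^sup>*\<close>: on the precompact image of the unit ball the contribution of small sets
  is uniformly small.

  For the boundary value problem, the normal derivative of a solution of the Poisson equation is
  bounded in \<open>L\<^sup>2(\<Gamma>)\<close> by \<open>(\<parallel>\<nabla>\<phi>\<parallel>\<^sup>2 + \<parallel>f\<parallel> \<parallel>\<nabla>\<phi>\<parallel>)\<^sup>1\<^sup>/\<^sup>2\<close>. This is obtained by combining two estimates in a
  collar of width \<open>\<delta>\<close>: the energy of \<open>\<phi>\<close> there is \<open>O(\<delta>)\<close>, by testing the equation with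
  localised difference quotients (Savare), and the squared \<open>L\<^sup>2\<close> norm of a smooth \<open>\<zeta>\<close> there is
  \<open>O(\<delta>) \<parallel>\<zeta>\<parallel>\<^sup>2\<close> on the boundary, by comparison of Hausdorff and Lebesgue measure. Together with
  Rellich's theorem the bound also gives the compactness of \<open>S\<^sup>*\<close>.\<close>

text \<open>The collar argument balances powers of the width \<open>dl\<close>. Restricting a smooth
  \<open>zt\<close> to the collar by a cut-off leaves the defect
  \<open>(G, grad zt) - (f, zt)\<close> unchanged, but the gradient of the cut-off costs
  \<open>1 / dl\<close>. The norms of \<open>G\<close> and of \<open>zt\<close> on the collar each
  gain a square root of \<open>dl\<close>, so the critical product stays bounded as
  \<open>dl\<close> tends to 0 and keeps nothing of \<open>zt\<close> but its norm on \<Gamma>. The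
  form of the resulting bound matters too: it tends to 0 with the gradient of the solution while the
  data stay merely bounded. Rellich's theorem gives compactness of the solutions only; the energy
  identity passes it on to their gradients, and this bound to the normal derivatives. In the Newton
  method, a wrong prediction of activity costs \<open>S^* S e\<close> on the set where the
  prediction can fail. That this set shrinks to a null set is not enough, since
  \<open>S^* S e\<close> changes along with it and might concentrate there; compactness excludes
  this.\<close>

section \<open>The space \<open>L2\<close>: inner product calculus, completeness, Riesz
  representation\<close>

lemma L2_measurable [dest]: "f : L2 M ==> f : borel_measurable M"
 by (simp add: L2_def)

lemma L2_square_integrable: "f : L2 M ==> integrable M (%x. (norm (f x))\<^sup>2)"
 by (simp add: L2_def)

lemma L2_inner_self: "L2_inner M f f = (LINT x|M. (norm (f x))\<^sup>2)"
 by (simp add: L2_inner_def power2_norm_eq_inner)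

lemma L2_inner_self_nonneg: "0 <= L2_inner M f f"
 by (simp add: L2_inner_def)

lemma L2_norm_nonneg [simp]: "0 <= L2_norm M f"
 by (simp add: L2_norm_def L2_inner_self_nonneg)

lemma L2_norm_power2: "(L2_norm M f)\<^sup>2 = L2_inner M f f"
 by (simp add: L2_norm_def L2_inner_self_nonneg)

lemma L2_mult_norm_integrable:
 fixes f :: "'a => 'b::euclidean_space" and g :: "'a => 'c::euclidean_space"
 assumes "f : L2 M" "g : L2 M"
 shows "integrable M (%x. norm (f x) * norm (g x))"
proof (rule Bochner_Integration.integrable_bound)
 show "integrable M (%x. (norm (f x))\<^sup>2 + (norm (g x))\<^sup>2)"
  using assms by (intro Bochner_Integration.integrable_add L2_square_integrable)
 show "(%x. norm (f x) * norm (g x)) : borel_measurable M"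
  using assms[THEN L2_measurable] by measurable
 have "a * b <= a\<^sup>2 + b\<^sup>2" if "0 <= a" "0 <= b" for a b :: real
 proof -
  have "2 * (a * b) <= a\<^sup>2 + b\<^sup>2"
   using sum_squares_bound[of a b] by simp
  moreover have "0 <= a * b" using that by simp
  ultimately show ?thesis by linarith
 qed
 then show "AE x in M. norm (norm (f x) * norm (g x)) <= norm ((norm (f x))\<^sup>2 + (norm (g x))\<^sup>2)"
  by (intro AE_I2) (simp add: abs_mult)
qed

lemma L2_inner_integrable:
 assumes "f : L2 M" "g : L2 M"
 shows "integrable M (%x. f x \<bullet> g x)"
 using L2_mult_norm_integrable[OF assms] assms[THEN L2_measurable]
 by (elim Bochner_Integration.integrable_bound) (auto intro!: AE_I2 Cauchy_Schwarz_ineq2)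

lemma L2_mult_integrable:
 fixes f g :: "'a => real"
 assumes "f : L2 M" "g : L2 M"
 shows "integrable M (%x. f x * g x)"
 using L2_inner_integrable[OF assms] by simp

lemma L2_bound:
 fixes f :: "'a => 'b::euclidean_space" and g :: "'a => 'c::euclidean_space"
 assumes "f : L2 M" "g : borel_measurable M" "AE x in M. norm (g x) <= C * norm (f x)"
 shows "g : L2 M"
proof -
 have "integrable M (%x. (norm (g x))\<^sup>2)"
 proof (rule Bochner_Integration.integrable_bound)
  show "integrable M (%x. C\<^sup>2 * (norm (f x))\<^sup>2)"
   using assms by (intro integrable_mult_right L2_square_integrable)
  show "AE x in M. norm ((norm (g x))\<^sup>2) <= norm (C\<^sup>2 * (norm (f x))\<^sup>2)"
   using assms(3) by eventually_elim (auto simp flip: power_mult_distrib intro!: power_mono)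
 qed (use assms in measurable)
 with assms show ?thesis by (simp add: L2_def)
qed

lemma L2_zero [simp]: "(%x. 0) : L2 M"
 by (simp add: L2_def)

lemma L2_scale [intro]: "f : L2 M ==> (%x. c *\<^sub>R f x) : L2 M"
 by (rule L2_bound[where C = "\<bar>c\<bar>"]) auto

lemma L2_cmult [intro]:
 fixes f :: "'a => real"
 shows "f : L2 M ==> (%x. c * f x) : L2 M"
 using L2_scale[of f M c] by simp

lemma L2_uminus [intro]: "f : L2 M ==> (%x. - f x) : L2 M"
 by (rule L2_bound[where C = 1]) auto

lemma L2_add [intro]:
 assumes "f : L2 M" "g : L2 M"
 shows "(%x. f x + g x) : L2 M"
proof -
 have "integrable M (%x. (norm (f x + g x))\<^sup>2)"
 proof (rule Bochner_Integration.integrable_bound)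
  show "integrable M (%x. 2 * (norm (f x))\<^sup>2 + 2 * (norm (g x))\<^sup>2)"
   using assms by (intro Bochner_Integration.integrable_add integrable_mult_right L2_square_integrable)
  have "(norm (a + b))\<^sup>2 <= 2 * (norm a)\<^sup>2 + 2 * (norm b)\<^sup>2" for a b :: 'b
  proof -
   have "(norm (a + b))\<^sup>2 <= (norm a + norm b)\<^sup>2"
    by (intro power_mono norm_triangle_ineq) auto
   also have "\<dots> <= 2 * (norm a)\<^sup>2 + 2 * (norm b)\<^sup>2"
    using sum_squares_bound[of "norm a" "norm b"] by (simp add: power2_sum)
   finally show ?thesis .
  qed
  then show "AE x in M. norm ((norm (f x + g x))\<^sup>2) <= norm (2 * (norm (f x))\<^sup>2 + 2 * (norm (g x))\<^sup>2)"
   by (intro AE_I2) auto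
 qed (use assms[THEN L2_measurable] in measurable)
 with assms[THEN L2_measurable] show ?thesis by (simp add: L2_def)
qed

lemma L2_diff [intro]: "f : L2 M ==> g : L2 M ==> (%x. f x - g x) : L2 M"
 using L2_add[of f M "%x. - g x"] by auto

lemma L2_sum [intro]:
 "(!!i. i : I ==> f i : L2 M) ==> (%x. \<Sum>i\<in>I. f i x) : L2 M"
 by (induction I rule: infinite_finite_induct) auto

lemma L2_component [intro]:
 assumes "f : L2 M"
 shows "(%x. f x \<bullet> i) : L2 M"
 using L2_measurable[OF assms] Cauchy_Schwarz_ineq2[of "f _" i]
 by (intro L2_bound[OF assms, where C = "norm i"] AE_I2) (auto simp: mult.commute)

lemma L2_cong_AE:
 assumes "f : L2 M" "g : borel_measurable M" "AE x in M. f x = g x"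
 shows "g : L2 M"
 using assms by (intro L2_bound[OF assms(1,2), where C = 1]) auto

lemma L2_mult_bounded:
 assumes "f : L2 M" "h : borel_measurable M" "!!x. x : space M ==> \<bar>h x\<bar> <= C"
 shows "(%x. h x *\<^sub>R f x) : L2 M"
 using assms L2_measurable[OF assms(1)]
 by (intro L2_bound[OF assms(1), where C = C] AE_I2) (auto intro!: mult_right_mono)

lemma L2_inner_cong_AE:
 assumes "AE x in M. f x = f' x" "AE x in M. g x = g' x"
  "f : borel_measurable M" "f' : borel_measurable M" "g : borel_measurable M" "g' : borel_measurable M"
 shows "L2_inner M f g = L2_inner M f' g'"
 unfolding L2_inner_def
proof (rule integral_cong_AE)
 show "AE x in M. f x \<bullet> g x = f' x \<bullet> g' x"
  using assms(1,2) by eventually_elim auto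
qed (use assms in measurable)

lemma L2_norm_cong_AE:
 assumes "AE x in M. f x = f' x" "f : borel_measurable M" "f' : borel_measurable M"
 shows "L2_norm M f = L2_norm M f'"
 using L2_inner_cong_AE[OF assms(1,1,2,3,2,3)] by (simp add: L2_norm_def)

lemma L2_inner_commute: "L2_inner M f g = L2_inner M g f"
 by (simp add: L2_inner_def inner_commute)

lemma L2_inner_add_left:
 "f : L2 M ==> g : L2 M ==> h : L2 M ==>
  L2_inner M (%x. f x + g x) h = L2_inner M f h + L2_inner M g h"
 by (simp add: L2_inner_def inner_add_left L2_inner_integrable)

lemma L2_inner_diff_left:
 "f : L2 M ==> g : L2 M ==> h : L2 M ==>
  L2_inner M (%x. f x - g x) h = L2_inner M f h - L2_inner M g h"
 by (simp add: L2_inner_def inner_diff_left L2_inner_integrable)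

lemma L2_inner_scale_left: "L2_inner M (%x. c *\<^sub>R f x) g = c * L2_inner M f g"
 by (simp add: L2_inner_def)

lemma L2_inner_cmult_left:
 fixes f :: "'a => real"
 shows "L2_inner M (%x. c * f x) g = c * L2_inner M f g"
 using L2_inner_scale_left[of M c f g] by simp

lemma L2_inner_uminus_left: "L2_inner M (%x. - f x) g = - L2_inner M f g"
 by (simp add: L2_inner_def)

lemma L2_inner_add_right:
 "f : L2 M ==> g : L2 M ==> h : L2 M ==>
  L2_inner M h (%x. f x + g x) = L2_inner M h f + L2_inner M h g"
 by (simp add: L2_inner_commute[of M h] L2_inner_add_left)

lemma L2_inner_diff_right:
 "f : L2 M ==> g : L2 M ==> h : L2 M ==>
  L2_inner M h (%x. f x - g x) = L2_inner M h f - L2_inner M h g"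
 by (simp add: L2_inner_commute[of M h] L2_inner_diff_left)

lemma L2_inner_scale_right: "L2_inner M g (%x. c *\<^sub>R f x) = c * L2_inner M g f"
 by (simp add: L2_inner_def)

lemma L2_inner_cmult_right:
 fixes f :: "'a => real"
 shows "L2_inner M g (%x. c * f x) = c * L2_inner M g f"
 using L2_inner_scale_right[of M g c f] by simp

lemma L2_inner_uminus_right: "L2_inner M g (%x. - f x) = - L2_inner M g f"
 by (simp add: L2_inner_def)

lemma L2_inner_zero [simp]: "L2_inner M (%x. 0) f = 0" "L2_inner M f (%x. 0) = 0"
 by (simp_all add: L2_inner_def)

lemma L2_norm_zero [simp]: "L2_norm M (%x. 0) = 0"
 by (simp add: L2_norm_def)

lemma L2_norm_scale: "L2_norm M (%x. c *\<^sub>R f x) = \<bar>c\<bar> * L2_norm M f"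
proof -
 have "L2_inner M (%x. c *\<^sub>R f x) (%x. c *\<^sub>R f x) = c\<^sup>2 * L2_inner M f f"
  by (simp only: L2_inner_scale_left L2_inner_scale_right power2_eq_square mult.assoc)
 then show ?thesis by (simp add: L2_norm_def real_sqrt_mult)
qed

lemma L2_norm_cmult:
 fixes f :: "'a => real"
 shows "L2_norm M (%x. c * f x) = \<bar>c\<bar> * L2_norm M f"
 using L2_norm_scale[of M c f] by simp

lemma L2_norm_uminus: "L2_norm M (%x. - f x) = L2_norm M f"
 by (simp add: L2_norm_def L2_inner_def)

lemma L2_norm_minus_commute: "L2_norm M (%x. f x - g x) = L2_norm M (%x. g x - f x)"
 using L2_norm_uminus[of M "%x. f x - g x"] by simp

lemma L2_norm_add_scale_power2:
 assumes "f : L2 M" "g : L2 M"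
 shows "(L2_norm M (%x. f x + t *\<^sub>R g x))\<^sup>2 =
  (L2_norm M f)\<^sup>2 + 2 * t * L2_inner M f g + t\<^sup>2 * (L2_norm M g)\<^sup>2"
 using assms L2_scale[of g M t] L2_inner_commute[of M g f]
 by (simp add: L2_norm_power2 L2_inner_add_left L2_inner_add_right L2_add L2_inner_scale_left
   L2_inner_scale_right) (simp add: algebra_simps power2_eq_square)

lemma L2_Cauchy_Schwarz:
 assumes "f : L2 M" "g : L2 M"
 shows "\<bar>L2_inner M f g\<bar> <= L2_norm M f * L2_norm M g"
proof -
 define a b c where "a = (L2_norm M f)\<^sup>2" and "b = L2_inner M f g" and "c = (L2_norm M g)\<^sup>2"
 have *: "0 <= a + 2 * t * b + t\<^sup>2 * c" for t
  using L2_norm_add_scale_power2[OF assms, of t] zero_le_power2 unfolding a_def b_def c_def by metis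
 have "c \<ge> 0" "a \<ge> 0" by (auto simp: c_def a_def)
 \<comment> \<open>The discriminant of a nonnegative quadratic. A vanishing norm does not make
   \<open>g\<close> the zero function, so the degenerate case is settled by a \<open>t\<close> at
   which the affine function takes the value -1; otherwise \<open>t = - b / c\<close> is the
   minimum.\<close>
 have "b\<^sup>2 <= a * c"
 proof (cases "c = 0")
  case True
  have "b = 0"
  proof (rule ccontr)
   assume "b \<noteq> 0"
   then show False using *[of "- (a + 1) / (2 * b)"] True by (simp add: field_simps)
  qed
  then show ?thesis using True by simp
 next
  case False
  then have "0 <= a * c - b\<^sup>2"
   using mult_left_mono[OF *[of "- b / c"], of c] \<open>c \<ge> 0\<close>
   by (simp add: field_simps power2_eq_square)
  then show ?thesis by simp
 qed
 then have "b\<^sup>2 <= (L2_norm M f * L2_norm M g)\<^sup>2"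
  by (simp add: a_def c_def power_mult_distrib)
 then show ?thesis
  unfolding b_def by (simp add: abs_le_square_iff[symmetric])
qed

lemma L2_norm_triangle:
 assumes "f : L2 M" "g : L2 M"
 shows "L2_norm M (%x. f x + g x) <= L2_norm M f + L2_norm M g"
proof (rule power2_le_imp_le)
 have "L2_inner M f g <= L2_norm M f * L2_norm M g"
  using L2_Cauchy_Schwarz[OF assms] by simp
 then show "(L2_norm M (%x. f x + g x))\<^sup>2 <= (L2_norm M f + L2_norm M g)\<^sup>2"
  using L2_norm_add_scale_power2[OF assms, of 1] by (simp add: power2_sum)
qed simp

lemma L2_norm_triangle_diff:
 assumes "f : L2 M" "g : L2 M" "h : L2 M"
 shows "L2_norm M (%x. f x - h x) <= L2_norm M (%x. f x - g x) + L2_norm M (%x. g x - h x)"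
 using L2_norm_triangle[of "%x. f x - g x" M "%x. g x - h x"] assms by (simp add: L2_diff)

lemma L2_norm_diff_le:
 assumes "f : L2 M" "g : L2 M"
 shows "L2_norm M (%x. f x - g x) <= L2_norm M f + L2_norm M g"
 using L2_norm_triangle[OF assms(1) L2_uminus[OF assms(2)]] by (simp add: L2_norm_uminus)

lemma L2_norm_reverse_triangle:
 assumes "f : L2 M" "g : L2 M"
 shows "\<bar>L2_norm M f - L2_norm M g\<bar> <= L2_norm M (%x. f x - g x)"
 using L2_norm_triangle[of "%x. f x - g x" M g] L2_norm_triangle[of "%x. g x - f x" M f] assms
  L2_norm_minus_commute[of M f g] by (auto simp: L2_diff abs_le_iff)

lemma L2_norm_sum_le:
 "finite I ==> (!!i. i : I ==> f i : L2 M) ==>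
  L2_norm M (%x. \<Sum>i\<in>I. f i x) <= (\<Sum>i\<in>I. L2_norm M (f i))"
proof (induction I rule: finite_induct)
 case (insert i I)
 then have "L2_norm M (%x. f i x + (\<Sum>i\<in>I. f i x)) <= L2_norm M (f i) + L2_norm M (%x. \<Sum>i\<in>I. f i x)"
  by (intro L2_norm_triangle) auto
 with insert show ?case by (auto intro: order_trans)
qed simp

lemma L2_norm_eq_0_iff:
 assumes "f : L2 M"
 shows "L2_norm M f = 0 \<longleftrightarrow> (AE x in M. f x = 0)"
 using assms integral_nonneg_eq_0_iff_AE[OF L2_square_integrable[OF assms]]
 by (simp add: L2_norm_def L2_inner_self)

lemma L2_norm_mono:
 fixes f :: "'a => 'b::euclidean_space" and g :: "'a => 'c::euclidean_space"
 assumes "f : L2 M" "g : borel_measurable M" "AE x in M. norm (g x) <= C * norm (f x)" "C \<ge> 0"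
 shows "L2_norm M g <= C * L2_norm M f"
proof (rule power2_le_imp_le)
 have "(LINT x|M. (norm (g x))\<^sup>2) <= (LINT x|M. C\<^sup>2 * (norm (f x))\<^sup>2)"
 proof (rule integral_mono_AE)
  show "integrable M (%x. (norm (g x))\<^sup>2)"
   using L2_bound[OF assms(1,2,3)] by (rule L2_square_integrable)
  show "integrable M (%x. C\<^sup>2 * (norm (f x))\<^sup>2)"
   using assms by (intro integrable_mult_right L2_square_integrable)
  show "AE x in M. (norm (g x))\<^sup>2 <= C\<^sup>2 * (norm (f x))\<^sup>2"
   using assms(3) by eventually_elim (metis norm_ge_zero power_mono power_mult_distrib)
 qed
 then show "(L2_norm M g)\<^sup>2 <= (C * L2_norm M f)\<^sup>2"
  by (simp add: L2_norm_power2 L2_inner_self power_mult_distrib)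
qed (use assms in auto)

lemma L2_norm_component_le:
 assumes "f : L2 M" "i : Basis"
 shows "L2_norm M (%x. f x \<bullet> i) <= L2_norm M f"
 using L2_norm_mono[OF assms(1), of "%x. f x \<bullet> i" 1] assms Basis_le_norm[of i] by auto

lemma L2_iff_nn_integral:
 "f : L2 M \<longleftrightarrow> f : borel_measurable M \<and> (\<integral>\<^sup>+x. ennreal ((norm (f x))\<^sup>2) \<partial>M) < \<infinity>"
 by (auto simp: L2_def integrable_iff_bounded)

lemma L2_norm_nn_integral:
 "f : L2 M ==> (\<integral>\<^sup>+x. ennreal ((norm (f x))\<^sup>2) \<partial>M) = ennreal ((L2_norm M f)\<^sup>2)"
 by (subst nn_integral_eq_integral) (auto simp: L2_norm_power2 L2_inner_self L2_square_integrable)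

lemma L2_normI:
 assumes "f : borel_measurable M" "(\<integral>\<^sup>+x. ennreal ((norm (f x))\<^sup>2) \<partial>M) <= ennreal (C\<^sup>2)" "C \<ge> 0"
 shows "f : L2 M" "L2_norm M f <= C"
proof -
 show "f : L2 M"
  using assms by (auto simp: L2_iff_nn_integral intro: le_less_trans)
 then show "L2_norm M f <= C"
  using assms(2,3) by (simp add: L2_norm_nn_integral ennreal_le_iff power2_le_iff_abs_le)
qed

lemma L2_inner_tendsto:
 assumes "(%n. L2_norm M (%x. f n x - f' x)) \<longlonglongrightarrow> 0" "(%n. L2_norm M (%x. g n x - g' x)) \<longlonglongrightarrow> 0"
  "!!n. f n : L2 M" "f' : L2 M" "!!n. g n : L2 M" "g' : L2 M"
 shows "(%n. L2_inner M (f n) (g n)) \<longlonglongrightarrow> L2_inner M f' g'"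
proof -
 let ?a = "%n. L2_norm M (%x. f n x - f' x)" and ?b = "%n. L2_norm M (%x. g n x - g' x)"
 have "(%n. L2_inner M (f n) (g n) - L2_inner M f' g') \<longlonglongrightarrow> 0"
 proof (rule Lim_null_comparison)
  have "\<bar>L2_inner M (f n) (g n) - L2_inner M f' g'\<bar> <= ?a n * ?b n + ?a n * L2_norm M g' + L2_norm M f' * ?b n" for n
  proof -
   have "L2_inner M (f n) (g n) - L2_inner M f' g' =
    L2_inner M (%x. f n x - f' x) (%x. g n x - g' x) + L2_inner M (%x. f n x - f' x) g'
    + L2_inner M f' (%x. g n x - g' x)"
    using assms(3-6) by (simp add: L2_inner_diff_left L2_inner_diff_right L2_diff)
   moreover have "\<bar>L2_inner M (%x. f n x - f' x) (%x. g n x - g' x)\<bar> <= ?a n * ?b n"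
    "\<bar>L2_inner M (%x. f n x - f' x) g'\<bar> <= ?a n * L2_norm M g'"
    "\<bar>L2_inner M f' (%x. g n x - g' x)\<bar> <= L2_norm M f' * ?b n"
    using assms(3-6) by (intro L2_Cauchy_Schwarz L2_diff; simp)+
   ultimately show ?thesis by linarith
  qed
  then show "\<forall>\<^sub>F n in sequentially. norm (L2_inner M (f n) (g n) - L2_inner M f' g')
    <= ?a n * ?b n + ?a n * L2_norm M g' + L2_norm M f' * ?b n" by auto
  have "(%n. ?a n * ?b n + ?a n * L2_norm M g' + L2_norm M f' * ?b n) \<longlonglongrightarrow> 0 * 0 + 0 * L2_norm M g' + L2_norm M f' * 0"
   by (intro tendsto_intros assms(1,2))
  then show "(%n. ?a n * ?b n + ?a n * L2_norm M g' + L2_norm M f' * ?b n) \<longlonglongrightarrow> 0"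
   by simp
 qed
 then show ?thesis by (rule LIM_zero_cancel)
qed

lemma L2_norm_tendsto:
 assumes "(%n. L2_norm M (%x. f n x - f' x)) \<longlonglongrightarrow> 0" "!!n. f n : L2 M" "f' : L2 M"
 shows "(%n. L2_norm M (f n)) \<longlonglongrightarrow> L2_norm M f'"
 unfolding L2_norm_def using L2_inner_tendsto[OF assms(1,1,2,3,2,3)] by (rule tendsto_real_sqrt)

lemma L2_limit_unique:
 assumes "(%n. L2_norm M (%x. f n x - g x)) \<longlonglongrightarrow> 0" "(%n. L2_norm M (%x. f n x - h x)) \<longlonglongrightarrow> 0"
  "!!n. f n : L2 M" "g : L2 M" "h : L2 M"
 shows "AE x in M. g x = h x"
proof -
 have "L2_norm M (%x. g x - h x) <= L2_norm M (%x. f n x - g x) + L2_norm M (%x. f n x - h x)" for n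
  using L2_norm_triangle_diff[of g M "f n" h] assms L2_norm_minus_commute[of M g "f n"] by simp
 then have "L2_norm M (%x. g x - h x) <= 0"
  using tendsto_add[OF assms(1,2)] by (intro tendsto_lowerbound[of _ 0 sequentially]) auto
 then show ?thesis using L2_norm_eq_0_iff[of "%x. g x - h x" M] assms
  by (simp add: L2_diff order_antisym)
qed

lemma L2_complete:
 fixes f :: "nat => 'a => 'b::euclidean_space"
 assumes f: "!!n. f n : L2 M"
  and Cauchy: "!!e. e > 0 ==> \<exists>N. \<forall>m\<ge>N. \<forall>n\<ge>N. L2_norm M (%x. f m x - f n x) < e"
 obtains g where "g : L2 M" "(%n. L2_norm M (%x. f n x - g x)) \<longlonglongrightarrow> 0"
proof -
 have fm[measurable]: "f n : borel_measurable M" for n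
  using f by auto
 have "\<exists>N. \<forall>k. \<forall>m\<ge>N k. \<forall>n\<ge>N k. L2_norm M (%x. f m x - f n x) < (1/2)^k"
  by (intro choice allI Cauchy) simp
 then obtain N where N: "!!k m n. m \<ge> N k ==> n \<ge> N k ==> L2_norm M (%x. f m x - f n x) < (1/2)^k"
  by blast
 \<comment> \<open>Partial sums put both \<open>R k\<close> and \<open>R (Suc k)\<close> above
   \<open>N k\<close> without any monotonicity of \<open>N\<close>.\<close>
 define R where "R k = (\<Sum>j\<le>k. N j)" for k
 have R: "R k \<ge> N k" "R (Suc k) \<ge> N k" for k
  using member_le_sum[of k "{..k}" N] by (auto simp: R_def)
 define D where "D k = (%x. f (R (Suc k)) x - f (R k) x)" for k
 have [measurable]: "D k : borel_measurable M" for k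
  unfolding D_def by measurable
 have DL2: "D k : L2 M" for k
  unfolding D_def using f by auto
 have Dn: "L2_norm M (D k) <= (1/2)^k" for k
  using N[OF R(2,1), of k] by (simp add: D_def)
 \<comment> \<open>The weight \<open>2^k\<close> leaves the integrals summable, as the squared norms
   of \<open>D k\<close> decay like \<open>4^-k\<close>, and it makes the series of the norms
   themselves converge pointwise through \<open>a <= 1 / c + c * a^2\<close> with
   \<open>c = 2^k\<close>. This works for infinite measures as well.\<close>
 have "(\<integral>\<^sup>+x. (\<Sum>k. ennreal (2^k * (norm (D k x))\<^sup>2)) \<partial>M) = (\<Sum>k. \<integral>\<^sup>+x. ennreal (2^k * (norm (D k x))\<^sup>2) \<partial>M)"
  by (rule nn_integral_suminf) measurable
 also have "\<dots> = (\<Sum>k. ennreal (2^k * (L2_norm M (D k))\<^sup>2))"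
  by (simp add: ennreal_mult nn_integral_cmult L2_norm_nn_integral[OF DL2])
 also have "\<dots> <= (\<Sum>k. ennreal ((1/2)^k))"
 proof (intro suminf_le summableI ennreal_leI)
  fix k
  have "2^k * (L2_norm M (D k))\<^sup>2 <= 2^k * ((1/2)^k)\<^sup>2"
   by (intro mult_left_mono power_mono Dn) auto
  then show "2^k * (L2_norm M (D k))\<^sup>2 <= (1/2)^k"
   by (simp add: power2_eq_square power_divide)
 qed
 also have "\<dots> < \<infinity>"
  by (subst suminf_ennreal2) (auto simp: summable_geometric)
 finally have "(\<integral>\<^sup>+x. (\<Sum>k. ennreal (2^k * (norm (D k x))\<^sup>2)) \<partial>M) \<noteq> \<infinity>"
  by simp
 then have "AE x in M. (\<Sum>k. ennreal (2^k * (norm (D k x))\<^sup>2)) \<noteq> \<infinity>"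
  by (intro nn_integral_PInf_AE) measurable
 then have conv: "AE x in M. convergent (%k. f (R k) x)"
 proof eventually_elim
  case (elim x)
  then have s: "summable (%k. 2^k * (norm (D k x))\<^sup>2)"
   by (intro summable_suminf_not_top) auto
  have "summable (%k. norm (D k x))"
  proof (rule summable_comparison_test')
   show "summable (%k. (1/2)^k + 2^k * (norm (D k x))\<^sup>2)"
    by (intro summable_add s summable_geometric) simp
   fix k :: nat assume "k \<ge> 0"
   have "a <= 1 / c + c * a\<^sup>2" if "c > 0" for a c :: real
   proof -
    have "2 * (a * c) <= 1 + (a * c)\<^sup>2"
     using sum_squares_bound[of 1 "a * c"] by simp
    then have "a * c <= 1 + (a * c)\<^sup>2"
     using zero_le_power2[of "a * c"] by linarith
    then have "a <= (1 + (a * c)\<^sup>2) / c"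
     using that by (simp add: pos_le_divide_eq)
    also have "\<dots> = 1 / c + c * a\<^sup>2"
     using that by (simp add: field_simps power2_eq_square)
    finally show ?thesis .
   qed
   from this[of "2^k" "norm (D k x)"]
   show "norm (norm (D k x)) <= (1/2)^k + 2^k * (norm (D k x))\<^sup>2"
    by (simp add: power_divide)
  qed
  then have "summable (%k. D k x)"
   by (rule summable_norm_cancel)
  then have "convergent (%n. \<Sum>k<n. D k x)"
   by (simp add: summable_iff_convergent)
  then have "convergent (%n. f (R 0) x + (\<Sum>k<n. D k x))"
   by (intro convergent_add convergent_const)
  then show ?case
   by (simp add: D_def sum_lessThan_telescope[of "%k. f (R k) x"])
 qed
 define g where "g x = lim (%k. f (R k) x)" for x
 have gm[measurable]: "g : borel_measurable M"
  unfolding g_def by measurable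
 have lim: "AE x in M. (%k. f (R k) x) \<longlonglongrightarrow> g x"
  using conv by eventually_elim (simp add: g_def convergent_LIMSEQ_iff)
 \<comment> \<open>Fatou's lemma along the subsequence. \<open>R k\<close> may lie below
   \<open>K\<close>, so \<open>f n\<close> and \<open>f (R k)\<close> are compared through the index
   \<open>max K (R k)\<close>.\<close>
 have key: "(%x. f n x - g x) : L2 M \<and> L2_norm M (%x. f n x - g x) <= e"
  if e: "e > 0" and n: "n \<ge> K" and K: "!!m n. m \<ge> K ==> n \<ge> K ==> L2_norm M (%x. f m x - f n x) < e" for e n K
 proof -
  have bd: "L2_norm M (%x. f n x - f (R k) x) <= e + (1/2)^k" for k
  proof -
   have "L2_norm M (%x. f n x - f (R k) x) \<le>
    L2_norm M (%x. f n x - f (max K (R k)) x) + L2_norm M (%x. f (max K (R k)) x - f (R k) x)"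
    by (intro L2_norm_triangle_diff f)
   moreover have "L2_norm M (%x. f n x - f (max K (R k)) x) < e"
    by (intro K n) simp
   moreover have "L2_norm M (%x. f (max K (R k)) x - f (R k) x) < (1/2)^k"
    using R(1)[of k] by (intro N) auto
   ultimately show ?thesis by simp
  qed
  have "(\<integral>\<^sup>+x. ennreal ((norm (f n x - g x))\<^sup>2) \<partial>M) =
    (\<integral>\<^sup>+x. liminf (%k. ennreal ((norm (f n x - f (R k) x))\<^sup>2)) \<partial>M)"
  proof (rule nn_integral_cong_AE, use lim in eventually_elim)
   case (elim x)
   then have "(%k. ennreal ((norm (f n x - f (R k) x))\<^sup>2)) \<longlonglongrightarrow> ennreal ((norm (f n x - g x))\<^sup>2)"
    by (intro tendsto_intros) auto
   from lim_imp_Liminf[OF sequentially_bot this] show ?case by (rule sym)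
  qed
  also have "\<dots> <= liminf (%k. \<integral>\<^sup>+x. ennreal ((norm (f n x - f (R k) x))\<^sup>2) \<partial>M)"
   by (rule nn_integral_liminf) measurable
  also have "\<dots> <= liminf (%k. ennreal ((e + (1/2)^k)\<^sup>2))"
  proof (intro Liminf_mono always_eventually allI)
   fix k
   show "(\<integral>\<^sup>+x. ennreal ((norm (f n x - f (R k) x))\<^sup>2) \<partial>M) <= ennreal ((e + (1/2)^k)\<^sup>2)"
    using bd[of k] by (subst L2_norm_nn_integral) (auto intro!: L2_diff f ennreal_leI power_mono)
  qed
  also have "(%k. ennreal ((e + (1/2)^k)\<^sup>2)) \<longlonglongrightarrow> ennreal ((e + 0)\<^sup>2)"
   by (intro tendsto_intros LIMSEQ_realpow_zero) auto
  then have "liminf (%k. ennreal ((e + (1/2)^k)\<^sup>2)) = ennreal (e\<^sup>2)"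
   by (simp add: lim_imp_Liminf)
  finally show ?thesis
   using L2_normI[of "%x. f n x - g x" M e] e by auto
 qed
 show thesis
 proof
  obtain K where K: "!!m n. m \<ge> K ==> n \<ge> K ==> L2_norm M (%x. f m x - f n x) < 1"
   using Cauchy[of 1] by auto
  have "(%x. f K x - (f K x - g x)) : L2 M"
   by (rule L2_diff[OF f]) (use key[of 1 K K] K in auto)
  then show "g : L2 M" by simp
  show "(%n. L2_norm M (%x. f n x - g x)) \<longlonglongrightarrow> 0"
  proof (rule LIMSEQ_I)
   fix e :: real assume e: "e > 0"
   then obtain K where K: "!!m n. m \<ge> K ==> n \<ge> K ==> L2_norm M (%x. f m x - f n x) < e/2"
    using Cauchy[of "e/2"] by auto
   have "norm (L2_norm M (%x. f n x - g x) - 0) < e" if "n \<ge> K" for n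
    using key[OF _ that K] e by auto
   then show "\<exists>no. \<forall>n\<ge>no. norm (L2_norm M (%x. f n x - g x) - 0) < e" by auto
  qed
 qed
qed

text \<open>The Riesz representation theorem for a functional on a subspace \<open>T\<close> that is mapped into
 \<open>L\<^sup>2\<close> by \<open>j\<close>; the minimizing sequence of \<open>\<parallel>j p\<parallel>\<^sup>2 / 2 - l p\<close> is returned as well, so that for
 \<open>j = grad\<close> the limit can be identified as a weak gradient.\<close>

lemma L2_Riesz:
 fixes T :: "('c => real) set" and j :: "('c => real) => 'a => 'b::euclidean_space"
 assumes ne: "T \<noteq> {}"
  and T: "!!p q s. p : T ==> q : T ==> (%x. p x + s * q x) : T"
  and j: "!!p. p : T ==> j p : L2 M"
  and jlin: "!!p q s. p : T ==> q : T ==> AE x in M. j (%x. p x + s * q x) x = j p x + s *\<^sub>R j q x"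
  and llin: "!!p q s. p : T ==> q : T ==> l (%x. p x + s * q x) = l p + s * l q"
  and lb: "!!p. p : T ==> \<bar>l p\<bar> <= C * L2_norm M (j p)"
 obtains t g where "!!n. t n : T" "g : L2 M" "(%n::nat. L2_norm M (%x. j (t n) x - g x)) \<longlonglongrightarrow> 0"
  "!!p. p : T ==> L2_inner M g (j p) = l p"
proof -
 define J where "J p = (L2_norm M (j p))\<^sup>2 / 2 - l p" for p
 have Jexp: "J (%x. p x + s * q x) = J p + s * (L2_inner M (j p) (j q) - l q) + s\<^sup>2 / 2 * (L2_norm M (j q))\<^sup>2"
  if "p : T" "q : T" for p q s
 proof -
  have "L2_norm M (j (%x. p x + s * q x)) = L2_norm M (%x. j p x + s *\<^sub>R j q x)"
   using j[OF that(1)] j[OF that(2)] j[OF T[OF that]]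
   by (intro L2_norm_cong_AE jlin that L2_measurable) auto
  then show ?thesis
   using that by (simp add: J_def llin L2_norm_add_scale_power2 j field_simps)
 qed
 have low: "J p \<ge> - C\<^sup>2 / 2" if "p : T" for p
 proof -
  have "0 <= (L2_norm M (j p) - C)\<^sup>2" by simp
  then show ?thesis using lb[OF that] by (simp add: J_def power2_diff abs_le_iff mult.commute field_simps)
 qed
 define m where "m = Inf (J ` T)"
 have bdd: "bdd_below (J ` T)"
  using low by (auto simp: bdd_below_def)
 have m: "m <= J p" if "p : T" for p
  unfolding m_def using that bdd by (intro cINF_lower)
 have "\<exists>p. p : T \<and> J p < m + 1 / real (Suc n)" for n
  using cInf_lessD[of "J ` T" "m + 1 / real (Suc n)"] ne by (auto simp: m_def)
 then obtain t where t: "!!n. t n : T" "!!n. J (t n) < m + 1 / real (Suc n)"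
  by metis
 have Jt: "(%n. J (t n)) \<longlonglongrightarrow> m"
 proof (rule tendsto_sandwich[of "%_. m"])
  show "(%n. m + 1 / real (Suc n)) \<longlonglongrightarrow> m"
   using tendsto_add[OF tendsto_const LIMSEQ_inverse_real_of_nat, of m] by (simp add: divide_inverse)
 qed (use m t in \<open>auto intro!: always_eventually less_imp_le\<close>)
 \<comment> \<open>A midpoint argument: expanding \<open>J\<close> at \<open>q\<close> and at the
   midpoint of \<open>p\<close> and \<open>q\<close> eliminates the linear coefficient
   \<open>b\<close>, and what remains bounds the quadratic coefficient \<open>c\<close>.\<close>
 have par: "(L2_norm M (%x. j q x - j p x))\<^sup>2 <= 4 * (J p - m + (J q - m))" if p: "p : T" and q: "q : T" for p q
 proof -
  define d where "d = (%x. q x + (- 1) * p x)"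
  have d: "d : T" unfolding d_def by (intro T p q)
  have "AE x in M. j d x = j q x + (-1) *\<^sub>R j p x"
   unfolding d_def by (intro jlin p q)
  then have jd: "L2_norm M (j d) = L2_norm M (%x. j q x - j p x)"
   using j[OF p] j[OF q] j[OF d] by (intro L2_norm_cong_AE) (auto intro: borel_measurable_diff)
  define b c where "b = L2_inner M (j p) (j d) - l d" and "c = (L2_norm M (j d))\<^sup>2"
  have "J q = J p + b + c / 2"
   using Jexp[OF p d, of 1] by (simp add: d_def b_def c_def)
  moreover have "m <= J p + b / 2 + c / 8"
   using m[OF T[OF p d, of "1/2"]] Jexp[OF p d, of "1/2"] by (simp add: power_divide b_def c_def)
  ultimately have "c <= 4 * (J p - m + (J q - m))" by argo
  then show ?thesis unfolding c_def jd by simp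
 qed
 obtain g where g: "g : L2 M" "(%n. L2_norm M (%x. j (t n) x - g x)) \<longlonglongrightarrow> 0"
 proof (rule L2_complete[of "%n. j (t n)" M])
  fix e :: real assume "e > 0"
  then have "\<forall>\<^sub>F n in sequentially. J (t n) < m + e\<^sup>2 / 8"
   by (intro order_tendstoD[OF Jt]) simp
  then obtain N where N: "!!n. n \<ge> N ==> J (t n) < m + e\<^sup>2 / 8"
   by (auto simp: eventually_sequentially)
  have "L2_norm M (%x. j (t k) x - j (t n) x) < e" if "k \<ge> N" "n \<ge> N" for k n
  proof (rule power2_less_imp_less)
   show "(L2_norm M (%x. j (t k) x - j (t n) x))\<^sup>2 < e\<^sup>2"
    using par[OF t(1)[of n] t(1)[of k]] N[OF that(1)] N[OF that(2)] by simp
  qed (use \<open>e > 0\<close> in auto)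
  then show "\<exists>N. \<forall>m\<ge>N. \<forall>n\<ge>N. L2_norm M (%x. j (t m) x - j (t n) x) < e" by blast
 qed (use j t in auto)
 have "L2_inner M g (j p) = l p" if p: "p : T" for p
 proof -
  define b c where "b = L2_inner M g (j p) - l p" and "c = (L2_norm M (j p))\<^sup>2"
  have lim: "(%n. L2_inner M (j (t n)) (j p)) \<longlonglongrightarrow> L2_inner M g (j p)"
   using g(2) by (rule L2_inner_tendsto) (use j t p g in auto)
  have nn: "0 <= s * b + s\<^sup>2 / 2 * c" for s
  proof (rule tendsto_lowerbound)
   show "(%n. J (t n) - m + (s * (L2_inner M (j (t n)) (j p) - l p) + s\<^sup>2 / 2 * c)) \<longlonglongrightarrow> s * b + s\<^sup>2 / 2 * c"
    proof -
     have "(%n. J (t n) - m + (s * (L2_inner M (j (t n)) (j p) - l p) + s\<^sup>2 / 2 * c))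
       \<longlonglongrightarrow> m - m + (s * (L2_inner M g (j p) - l p) + s\<^sup>2 / 2 * c)"
      by (intro tendsto_intros Jt lim)
     then show ?thesis by (simp add: b_def)
    qed
   show "\<forall>\<^sub>F n in sequentially. 0 <= J (t n) - m + (s * (L2_inner M (j (t n)) (j p) - l p) + s\<^sup>2 / 2 * c)"
    using m[OF T[OF t(1) p]] by (intro always_eventually allI) (simp add: Jexp t p c_def algebra_simps)
  qed simp
  have c: "c \<ge> 0" by (simp add: c_def)
  \<comment> \<open>The minimum of the quadratic would be at \<open>- b / c\<close>; the shift by 1
    keeps the denominator positive when \<open>j p\<close> has norm 0 and still produces a negative
    value unless \<open>b = 0\<close>.\<close>
  have "(- b / (c + 1)) * b + (- b / (c + 1))\<^sup>2 / 2 * c = - (b\<^sup>2 * (c + 2)) / (2 * (c + 1)\<^sup>2)"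
   using c by (simp add: divide_simps power2_eq_square) (simp add: algebra_simps)
  then have "0 <= - (b\<^sup>2 * (c + 2)) / (2 * (c + 1)\<^sup>2)"
   using nn[of "- b / (c + 1)"] by simp
  then have "b\<^sup>2 * (c + 2) <= 0"
   using c by (auto simp: zero_le_divide_iff divide_le_0_iff)
  then have "b = 0" using c by (auto simp: mult_le_0_iff)
  then show ?thesis by (simp add: b_def)
 qed
 then show thesis using that t g by blast
qed

section \<open>Gradients and smooth functions\<close>

lemma has_derivative_grad:
 assumes "f differentiable at x"
 shows "(f has_derivative (%h. grad f x \<bullet> h)) (at x)"
proof -
 let ?D = "frechet_derivative f (at x)"
 have D: "(f has_derivative ?D) (at x)"
  using assms by (simp add: frechet_derivative_works)
 have "?D h = grad f x \<bullet> h" for h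
 proof -
  have "?D h = ?D (\<Sum>i\<in>Basis. (h \<bullet> i) *\<^sub>R i)"
   by (simp add: euclidean_representation)
  also have "\<dots> = (\<Sum>i\<in>Basis. (h \<bullet> i) * ?D i)"
   using linear_frechet_derivative[OF assms] by (simp add: linear_sum linear_scale)
  also have "\<dots> = grad f x \<bullet> h"
   unfolding grad_def inner_sum_left by (intro sum.cong) (auto simp: inner_commute)
  finally show ?thesis .
 qed
 then have "?D = (%h. grad f x \<bullet> h)" by (rule ext)
 with D show ?thesis by metis
qed

lemma grad_eqI:
 assumes "(f has_derivative (%h. g \<bullet> h)) (at x)"
 shows "grad f x = g"
proof (rule euclidean_eqI)
 fix i :: 'a assume "i : Basis"
 then show "grad f x \<bullet> i = g \<bullet> i"
  unfolding grad_def frechet_derivative_at[OF assms, symmetric]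
  by (simp add: inner_sum_left inner_Basis if_distrib cong: if_cong)
qed

lemma differentiableI_inner: "(f has_derivative (%h. g \<bullet> h)) (at x) ==> f differentiable at x"
 by (auto simp: differentiable_def)

lemma Ck_SucI:
 assumes "!!x. (f has_derivative (%h. g x \<bullet> h)) (at x)" "!!i. i : Basis ==> Ck k (%x. g x \<bullet> i)"
 shows "Ck (Suc k) f"
 using assms by (auto simp: grad_eqI[OF assms(1)] intro: differentiableI_inner)

lemma Ck_SucD_derivative: "Ck (Suc k) f ==> (f has_derivative (%h. grad f x \<bullet> h)) (at x)"
 by (simp add: has_derivative_grad)

lemma Ck_Suc_imp: "Ck (Suc k) f ==> Ck k f"
proof (induction k arbitrary: f)
 case 0
 then show ?case
  by (auto intro!: continuous_at_imp_continuous_on differentiable_imp_continuous_within)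
next
 case (Suc k)
 then show ?case by (metis Ck.simps(2))
qed

lemma Ck_continuous: "Ck k f ==> continuous_on UNIV f"
 by (induction k) (auto dest: Ck_Suc_imp simp del: Ck.simps(2))

lemma Ck_const: "Ck k (%x. c)"
proof (induction k arbitrary: c)
 case (Suc k)
 show ?case
  by (rule Ck_SucI[where g = "%x. 0"]) (use Suc in \<open>auto intro!: derivative_eq_intros\<close>)
qed auto

lemma Ck_inner: "Ck k (%x. x \<bullet> v)"
proof (cases k)
 case (Suc l)
 show ?thesis unfolding Suc
  by (rule Ck_SucI[where g = "%x. v"])
   (auto intro!: derivative_eq_intros Ck_const simp: inner_commute)
qed (auto intro!: continuous_intros)

lemma Ck_add: "Ck k f ==> Ck k g ==> Ck k (%x. f x + g x)"
proof (induction k arbitrary: f g)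
 case (Suc k)
 show ?case
 proof (rule Ck_SucI)
  show "((%x. f x + g x) has_derivative (%h. (grad f x + grad g x) \<bullet> h)) (at x)" for x
   using Suc.prems[THEN Ck_SucD_derivative] by (auto intro!: derivative_eq_intros simp: inner_add_left)
 qed (use Suc in \<open>auto simp: inner_add_left\<close>)
qed (auto intro: continuous_intros)

lemma Ck_mult: "Ck k f ==> Ck k g ==> Ck k (%x. f x * g x)"
proof (induction k arbitrary: f g)
 case (Suc k)
 show ?case
 proof (rule Ck_SucI)
  show "((%x. f x * g x) has_derivative (%h. (f x *\<^sub>R grad g x + g x *\<^sub>R grad f x) \<bullet> h)) (at x)" for x
   using Suc.prems[THEN Ck_SucD_derivative]
   by (auto intro!: derivative_eq_intros simp: inner_add_left mult.commute)
  show "Ck k (%x. (f x *\<^sub>R grad g x + g x *\<^sub>R grad f x) \<bullet> i)" if "i : Basis" for i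
   using Suc that Ck_Suc_imp[of k f] Ck_Suc_imp[of k g] by (auto simp: inner_add_left intro!: Ck_add)
 qed
qed (auto intro: continuous_intros)

lemma Ck_affine: "Ck k f ==> Ck k (%x. f (a + c *\<^sub>R x))"
proof (induction k arbitrary: f)
 case 0
 then show ?case by (auto intro!: continuous_intros continuous_on_compose2[of UNIV f])
next
 case (Suc k)
 show ?case
 proof (rule Ck_SucI)
  show "((%x. f (a + c *\<^sub>R x)) has_derivative (%h. (c *\<^sub>R grad f (a + c *\<^sub>R x)) \<bullet> h)) (at x)" for x
  proof (rule has_derivative_eq_rhs)
   show "((%x. f (a + c *\<^sub>R x)) has_derivative (%h. grad f (a + c *\<^sub>R x) \<bullet> (c *\<^sub>R h))) (at x)"
    by (rule has_derivative_compose[OF _ Ck_SucD_derivative[OF Suc.prems]])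
     (auto intro!: derivative_eq_intros)
  qed auto
  show "Ck k (%x. (c *\<^sub>R grad f (a + c *\<^sub>R x)) \<bullet> i)" if "i : Basis" for i
   using Suc that by (auto intro!: Ck_mult Ck_const)
 qed
qed

lemma smooth_const [intro]: "smooth (%x. c)"
 and smooth_inner [intro]: "smooth (%x. x \<bullet> v)"
 and smooth_add [intro]: "smooth f ==> smooth g ==> smooth (%x. f x + g x)"
 and smooth_mult [intro]: "smooth f ==> smooth g ==> smooth (%x. f x * g x)"
 and smooth_affine: "smooth f ==> smooth (%x. f (a + c *\<^sub>R x))"
 by (auto simp: smooth_def Ck_const Ck_inner Ck_add Ck_mult Ck_affine)

lemma smooth_uminus [intro]: "smooth f ==> smooth (%x. - f x)"
 using smooth_mult[OF smooth_const[of "-1"], of f] by simp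

lemma smooth_divide [intro]: "smooth f ==> smooth (%x. f x / c)"
 using smooth_mult[OF smooth_const[of "1 / c"], of f] by simp

lemma smooth_diff [intro]: "smooth f ==> smooth g ==> smooth (%x. f x - g x)"
 using smooth_add[of f "%x. - g x"] by auto

lemma smooth_translate: "smooth f ==> smooth (%x. f (x - a))"
 using smooth_affine[of f "- a" 1] by simp

lemma smooth_reflect: "smooth f ==> smooth (%x. f (a - x))"
 using smooth_affine[of f a "-1"] by simp

lemma smooth_sum [intro]: "(!!i. i : I ==> smooth (f i)) ==> smooth (%x. \<Sum>i\<in>I. f i x)"
 by (induction I rule: infinite_finite_induct) auto

lemma smooth_has_derivative: "smooth f ==> (f has_derivative (%h. grad f x \<bullet> h)) (at x)"
 using Ck_SucD_derivative[of 0 f x] by (simp add: smooth_def del: Ck.simps)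

lemma smooth_grad_component: "smooth f ==> i : Basis ==> smooth (%x. grad f x \<bullet> i)"
 by (metis smooth_def Ck.simps(2))

lemma smooth_continuous: "smooth f ==> continuous_on S f"
 using Ck_continuous[of 0 f] continuous_on_subset[of UNIV f S] by (auto simp: smooth_def)

lemma smooth_grad_continuous:
 assumes "smooth f"
 shows "continuous_on S (grad f)"
proof (rule continuous_on_subset)
 show "continuous_on UNIV (grad f)"
  using smooth_continuous[OF smooth_grad_component[OF assms]]
  by (subst continuous_on_componentwise) auto
qed auto

lemma smooth_measurable: "smooth f ==> f : borel_measurable borel"
 and smooth_grad_measurable: "smooth f ==> grad f : borel_measurable borel"
 by (simp_all add: borel_measurable_continuous_onI smooth_continuous smooth_grad_continuous)

lemma grad_const [simp]: "grad (%x. c) x = 0"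
 by (rule grad_eqI) (auto intro!: derivative_eq_intros)

lemma grad_add: "smooth f ==> smooth g ==> grad (%x. f x + g x) x = grad f x + grad g x"
 by (rule grad_eqI) (auto intro!: derivative_eq_intros smooth_has_derivative simp: inner_add_left)

lemma grad_mult: "smooth f ==> smooth g ==> grad (%x. f x * g x) x = f x *\<^sub>R grad g x + g x *\<^sub>R grad f x"
 by (rule grad_eqI)
  (auto intro!: derivative_eq_intros smooth_has_derivative simp: inner_add_left mult.commute)

lemma grad_cmult: "smooth f ==> grad (%x. c * f x) x = c *\<^sub>R grad f x"
 using grad_mult[OF smooth_const[of c], of f x] by simp

lemma grad_diff: "smooth f ==> smooth g ==> grad (%x. f x - g x) x = grad f x - grad g x"
 by (rule grad_eqI) (auto intro!: derivative_eq_intros smooth_has_derivative simp: inner_diff_left)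

lemma grad_affine:
 assumes "smooth f"
 shows "grad (%x. f (a + c *\<^sub>R x)) x = c *\<^sub>R grad f (a + c *\<^sub>R x)"
proof (rule grad_eqI, rule has_derivative_eq_rhs)
 show "((%x. f (a + c *\<^sub>R x)) has_derivative (%h. grad f (a + c *\<^sub>R x) \<bullet> (c *\<^sub>R h))) (at x)"
  by (rule has_derivative_compose[OF _ smooth_has_derivative[OF assms]])
   (auto intro!: derivative_eq_intros)
qed auto

lemma grad_translate: "smooth f ==> grad (%x. f (x - a)) x = grad f (x - a)"
 using grad_affine[of f "- a" 1] by simp

lemma grad_reflect: "smooth f ==> grad (%x. f (a - x)) x = - grad f (a - x)"
 using grad_affine[of f a "-1"] by simp

lemma grad_eq_0_outside_support:
 assumes "x \<notin> closure {x. f x \<noteq> 0}"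
 shows "grad f x = 0"
proof (rule grad_eqI)
 have "((%x. 0) has_derivative (%h. 0 \<bullet> h)) (at x)" by simp
 then show "(f has_derivative (%h. 0 \<bullet> h)) (at x)"
 proof (rule has_derivative_transform_within_open)
  show "open (- closure {x. f x \<noteq> 0})" by auto
  show "0 = f y" if "y : - closure {x. f x \<noteq> 0}" for y
   using that closure_subset[of "{x. f x \<noteq> 0}"] by auto
 qed (use assms in auto)
qed

lemma smooth_lipschitz_grad_le:
 assumes "smooth f" "L-lipschitz_on UNIV f"
 shows "norm (grad f x) <= L"
proof -
 have "\<bar>grad f x \<bullet> h\<bar> <= L * norm h" for h
 proof -
  have "((%t. f (x + t *\<^sub>R h)) has_derivative (%t. grad f x \<bullet> (t *\<^sub>R h))) (at 0)"
   by (rule has_derivative_compose[of "%t. x + t *\<^sub>R h" "%t. t *\<^sub>R h" 0 UNIV])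
    (auto intro!: derivative_eq_intros smooth_has_derivative assms)
  then have "((%t. f (x + t *\<^sub>R h)) has_real_derivative (grad f x \<bullet> h)) (at 0)"
   by (simp add: has_field_derivative_def mult_commute_abs)
  then have "((%t. (f (x + t *\<^sub>R h) - f x) / t) \<longlongrightarrow> grad f x \<bullet> h) (at 0)"
   by (simp add: has_field_derivative_iff)
  then have "((%t. \<bar>(f (x + t *\<^sub>R h) - f x) / t\<bar>) \<longlongrightarrow> \<bar>grad f x \<bullet> h\<bar>) (at 0)"
   by (rule tendsto_rabs)
  then show ?thesis
  proof (rule tendsto_upperbound)
   have "\<bar>(f (x + t *\<^sub>R h) - f x) / t\<bar> <= L * norm h" if "t \<noteq> 0" for t
    using lipschitz_onD[OF assms(2), of "x + t *\<^sub>R h" x] that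
    by (simp add: dist_norm divide_le_eq abs_mult mult.assoc mult.commute[of "norm h"])
   then show "\<forall>\<^sub>F t in at 0. \<bar>(f (x + t *\<^sub>R h) - f x) / t\<bar> <= L * norm h"
    by (auto simp: eventually_at_filter)
  qed simp
 qed
 from this[of "grad f x"] have "norm (grad f x) * norm (grad f x) <= L * norm (grad f x)"
  by (simp add: dot_square_norm power2_eq_square)
 then show ?thesis
  using lipschitz_on_nonneg[OF assms(2)] by (cases "grad f x = 0") auto
qed

section \<open>Smooth kernels of small support\<close>

text \<open>The powers of \<open>1 / s\<close> are carried along because the derivative of
  \<open>bump m\<close> is a combination of \<open>bump (m + 2)\<close> and
  \<open>bump (m + 1)\<close>: the family is closed under differentiation, so one induction over all
  \<open>m\<close> at once gives smoothness.\<close>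

definition bump :: "nat => real => real" where
 "bump m s = (if s > 0 then exp (- 1 / s) / s ^ m else 0)"

lemma bump_nonneg: "bump m s \<ge> 0"
 by (simp add: bump_def)

text \<open>Its purpose is the derivative at 0, where it makes the difference quotient vanish. It
  comes from \<open>(1 + x / n)^n <= exp x\<close> at \<open>x = 1 / s\<close> with
  \<open>n = m + 2\<close>; the two spare powers of \<open>s\<close> are the square.\<close>

lemma bump_le: "\<bar>bump m s\<bar> <= real (m + 2) ^ (m + 2) * s\<^sup>2"
proof (cases "s > 0")
 case True
 define n N where "n = m + 2" and "N = real n"
 have N: "N > 0" by (simp add: N_def n_def)
 have "(1 / (s * N)) ^ n <= (1 + 1 / s / N) ^ n"
  using True N by (intro power_mono) auto
 also have "\<dots> <= exp (1 / s)"
  unfolding N_def using True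
  by (intro exp_ge_one_plus_x_over_n_power_n) (auto simp: n_def intro: order_trans[of _ 0])
 finally have "1 <= exp (1 / s) * (s * N) ^ n"
  using True N by (simp add: power_divide divide_le_eq)
 then have "exp (- 1 / s) <= (s * N) ^ n"
  using True by (simp add: exp_minus field_simps)
 also have "\<dots> = s ^ m * (N ^ n * s\<^sup>2)"
  by (simp add: n_def power_mult_distrib power_add power2_eq_square mult_ac)
 finally show ?thesis
  using True unfolding N_def n_def by (simp add: bump_def divide_le_eq mult_ac)
qed (simp add: bump_def)

lemma bump_derivative:
 "(bump m has_real_derivative (bump (m + 2) s - real m * bump (m + 1) s)) (at s)"
proof -
 consider "s > 0" | "s < 0" | "s = 0" by linarith
 then show ?thesis
 proof cases
  case 1
  have "((%s. exp (- inverse s) * inverse s ^ m) has_real_derivative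
    exp (- inverse s) * (inverse s * inverse s) * inverse s ^ m
    + exp (- inverse s) * (real m * inverse s ^ (m - 1) * (- (inverse s * inverse s)))) (at s)"
   using 1 by (auto intro!: derivative_eq_intros simp: power2_eq_square algebra_simps)
  also have "exp (- inverse s) * (inverse s * inverse s) * inverse s ^ m
    + exp (- inverse s) * (real m * inverse s ^ (m - 1) * (- (inverse s * inverse s)))
    = bump (m + 2) s - real m * bump (m + 1) s"
   using 1 by (cases m) (simp_all add: bump_def divide_inverse power_inverse algebra_simps)
  finally have "((%s. exp (- 1 / s) / s ^ m) has_real_derivative (bump (m + 2) s - real m * bump (m + 1) s)) (at s)"
   by (simp add: divide_inverse power_inverse)
  then show ?thesis
   by (rule has_field_derivative_transform_within_open[where S = "{0<..}"]) (use 1 in \<open>auto simp: bump_def\<close>)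
 next
  case 2
  have "((%s. 0) has_real_derivative (bump (m + 2) s - real m * bump (m + 1) s)) (at s)"
   using 2 by (simp add: bump_def)
  then show ?thesis
   by (rule has_field_derivative_transform_within_open[where S = "{..<0}"]) (use 2 in \<open>auto simp: bump_def\<close>)
 next
  case 3
  define C where "C = real (m + 2) ^ (m + 2)"
  have "((%h. bump m h / h) \<longlongrightarrow> 0) (at 0)"
  proof (rule Lim_null_comparison)
   have "norm (bump m h / h) <= C * \<bar>h\<bar>" if "h \<noteq> 0" for h
    using bump_le[of m h] that by (simp add: C_def divide_le_eq power2_eq_square abs_mult_self_eq mult.assoc)
   then show "\<forall>\<^sub>F h in at 0. norm (bump m h / h) <= C * \<bar>h\<bar>"
    by (auto simp: eventually_at_filter)
   have "((%h. C * \<bar>h\<bar>) \<longlongrightarrow> C * \<bar>0\<bar>) (at (0::real))"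
    by (intro tendsto_intros)
   then show "((%h. C * \<bar>h\<bar>) \<longlongrightarrow> 0) (at (0::real))" by simp
  qed
  then show ?thesis
   by (simp add: 3 has_field_derivative_iff bump_def)
 qed
qed

lemma Ck_bump: "Ck k (%x. bump m (r - (x - a) \<bullet> (x - a)))"
proof (induction k arbitrary: m)
 case 0
 have "continuous_on UNIV (bump m)"
  using bump_derivative by (intro continuous_at_imp_continuous_on) (auto intro: DERIV_isCont)
 then show ?case by (auto intro!: continuous_on_compose2[of UNIV "bump m"] continuous_intros)
next
 case (Suc k)
 let ?q = "%x. r - (x - a) \<bullet> (x - a)"
 let ?b = "%x. bump (m + 2) (?q x) - real m * bump (m + 1) (?q x)"
 show ?case
 proof (rule Ck_SucI)
  show "((%x. bump m (?q x)) has_derivative (%h. (?b x *\<^sub>R (- 2) *\<^sub>R (x - a)) \<bullet> h)) (at x)" for x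
  proof (rule has_derivative_eq_rhs)
   show "((%x. bump m (?q x)) has_derivative (%h. ?b x * (- 2 * ((x - a) \<bullet> h)))) (at x)"
    by (rule has_derivative_compose[OF _ bump_derivative[unfolded has_field_derivative_def]])
     (auto intro!: derivative_eq_intros simp: inner_commute)
  qed (simp add: algebra_simps)
  have *: "Ck k (%x. (- 2 * real m) * bump (m + 1) (?q x))" "Ck k (%x. (- 2) * bump (m + 2) (?q x))"
   by (intro Ck_mult Ck_const Suc)+
  have "Ck k (%x. ((- 2) * bump (m + 2) (?q x) + (-1) * ((- 2 * real m) * bump (m + 1) (?q x))) * (x \<bullet> i + (- (a \<bullet> i))))" for i
   by (intro Ck_mult Ck_add Ck_const Ck_inner Suc)
  then show "Ck k (%x. (?b x *\<^sub>R (- 2) *\<^sub>R (x - a)) \<bullet> i)" for i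
   by (simp add: algebra_simps inner_diff_left)
 qed
qed

lemma integrable_bounded_support:
 fixes f :: "'a::euclidean_space => 'b::euclidean_space"
 assumes "continuous_on UNIV f" "bounded {x. f x \<noteq> 0}"
 shows "integrable lborel f"
proof -
 have "integrable lborel (%x. indicator (closure {x. f x \<noteq> 0}) x *\<^sub>R f x)"
  using assms by (intro borel_integrable_compact) (auto simp: compact_closure intro: continuous_on_subset)
 also have "(%x. indicator (closure {x. f x \<noteq> 0}) x *\<^sub>R f x) = f"
 proof
  show "indicator (closure {x. f x \<noteq> 0}) x *\<^sub>R f x = f x" for x
   using closure_subset[of "{x. f x \<noteq> 0}"] by (cases "f x = 0") auto
 qed
 finally show ?thesis .
qed

text \<open>The centre may be off the origin: \<open>conv k g x\<close> averages \<open>g\<close>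
  over the ball of radius \<open>dl\<close> about \<open>x - a\<close>. Near the boundary this lets
  a mollification look at points of the domain only.\<close>

definition kernel_at :: "'a::euclidean_space => real => ('a => real) => bool" where
 "kernel_at a dl k \<longleftrightarrow> smooth k \<and> (\<forall>x. 0 <= k x) \<and> (\<forall>x. k x \<noteq> 0 --> dist x a < dl) \<and>
   integrable lborel k \<and> integral\<^sup>L lborel k = 1"

lemma kernel_exists:
 fixes a :: "'a::euclidean_space"
 assumes "dl > 0"
 obtains k where "kernel_at a dl k"
proof -
 define b where "b x = bump 0 (dl\<^sup>2 - (x - a) \<bullet> (x - a))" for x :: 'a
 have sm: "smooth b"
  unfolding b_def[abs_def] smooth_def by (simp add: Ck_bump)
 have pos: "b x > 0 \<longleftrightarrow> dist x a < dl" for x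
 proof -
  have "b x > 0 \<longleftrightarrow> (dist x a)\<^sup>2 < dl\<^sup>2"
   by (simp add: b_def bump_def dist_norm power2_norm_eq_inner)
  also have "\<dots> \<longleftrightarrow> dist x a < dl"
   using assms by (meson less_imp_le power2_less_imp_less power_strict_mono zero_le_dist pos2)
  finally show ?thesis .
 qed
 have nn: "b x \<ge> 0" for x by (simp add: b_def bump_nonneg)
 have ne: "b x \<noteq> 0 \<longleftrightarrow> dist x a < dl" for x
  using pos[of x] nn[of x] by auto
 have "{x. b x \<noteq> 0} = ball a dl"
  by (auto simp: ne dist_commute)
 then have int: "integrable lborel b"
  by (intro integrable_bounded_support smooth_continuous sm) simp
 have "integral\<^sup>L lborel b \<noteq> 0"
 proof
  assume "integral\<^sup>L lborel b = 0"
  then have "AE x in lborel. b x = 0"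
   using integral_nonneg_eq_0_iff_AE[OF int] nn by auto
  then have "AE x in lborel. x \<notin> ball a dl"
   by eventually_elim (use ne in \<open>auto simp: dist_commute\<close>)
  then have "ball a dl : null_sets lborel"
   by (subst AE_iff_null_sets) auto
  then have "emeasure lborel (ball a dl) = 0" by auto
  then show False using assms content_ball_pos[of dl a] by (simp add: measure_def)
 qed
 moreover have "integral\<^sup>L lborel b \<ge> 0" using nn by simp
 ultimately have I: "integral\<^sup>L lborel b > 0" by simp
 have "kernel_at a dl (%x. (1 / integral\<^sup>L lborel b) * b x)"
  unfolding kernel_at_def using I int nn ne sm by auto
 then show thesis by (rule that)
qed

section \<open>Lebesgue integrals under translation and reflection\<close>

lemma lborel_distr_affine:
 fixes a :: "'a::euclidean_space"
 assumes "\<bar>c\<bar> = 1"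
 shows "distr lborel borel (%x. a + c *\<^sub>R x) = lborel"
proof -
 have "lborel = density (distr lborel borel (%x. a + c *\<^sub>R x)) (%_. ennreal (\<bar>c\<bar> ^ DIM('a)))"
  using assms by (intro lborel_affine) auto
 also have "\<dots> = density (distr lborel borel (%x. a + c *\<^sub>R x)) (%_. 1)"
  by (simp add: assms)
 finally show ?thesis by (simp add: density_1)
qed

lemma lborel_distr_minus: "distr lborel borel (%x. (a::'a::euclidean_space) - x) = lborel"
 using lborel_distr_affine[of "-1" a] by simp

lemma lborel_distr_translate: "distr lborel borel (%x. x - (a::'a::euclidean_space)) = lborel"
 using lborel_distr_affine[of 1 "- a"] by simp

lemma nn_integral_translate:
 fixes f :: "'a::euclidean_space => ennreal"
 assumes "f : borel_measurable borel"
 shows "(\<integral>\<^sup>+x. f (x - a) \<partial>lborel) = (\<integral>\<^sup>+x. f x \<partial>lborel)"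
 using nn_integral_distr[of "%x. x - a" lborel borel f] assms by (simp add: lborel_distr_translate)

lemma integral_translate:
 fixes f :: "'a::euclidean_space => 'b::euclidean_space"
 assumes "f : borel_measurable borel"
 shows "(LINT x|lborel. f (x - a)) = (LINT x|lborel. f x)"
 using integral_distr[of "%x. x - a" lborel borel f] assms by (simp add: lborel_distr_translate)

lemma integrable_translate:
 fixes f :: "'a::euclidean_space => 'b::euclidean_space"
 assumes "f : borel_measurable borel"
 shows "integrable lborel (%x. f (x - a)) \<longleftrightarrow> integrable lborel f"
 using integrable_distr_eq[of "%x. x - a" lborel borel f] assms by (simp add: lborel_distr_translate)

lemma integral_reflect:
 fixes f :: "'a::euclidean_space => 'b::euclidean_space"
 assumes "f : borel_measurable borel"
 shows "(LINT x|lborel. f (a - x)) = (LINT x|lborel. f x)"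
 using integral_distr[of "%x. a - x" lborel borel f] assms by (simp add: lborel_distr_minus)

lemma integrable_reflect:
 fixes f :: "'a::euclidean_space => 'b::euclidean_space"
 assumes "f : borel_measurable borel"
 shows "integrable lborel (%x. f (a - x)) \<longleftrightarrow> integrable lborel f"
 using integrable_distr_eq[of "%x. a - x" lborel borel f] assms by (simp add: lborel_distr_minus)

lemma L2_translate:
 fixes f :: "'a::euclidean_space => 'b::euclidean_space"
 assumes "f : L2 lborel"
 shows "(%x. f (x - a)) : L2 lborel"
proof -
 have [measurable]: "f : borel_measurable borel"
  using assms by (auto simp: L2_def)
 show ?thesis
  using assms integrable_translate[of "%x. (norm (f x))\<^sup>2" a] by (auto simp: L2_def)
qed

lemma L2_norm_translate:
 fixes f :: "'a::euclidean_space => 'b::euclidean_space"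
 assumes "f : L2 lborel"
 shows "L2_norm lborel (%x. f (x - a)) = L2_norm lborel f"
proof -
 have [measurable]: "f : borel_measurable borel"
  using assms by (auto simp: L2_def)
 show ?thesis
  using integral_translate[of "%x. (norm (f x))\<^sup>2" a] by (simp add: L2_norm_def L2_inner_self)
qed

lemma bounded_support_uniformly_continuous:
 fixes f :: "'a::euclidean_space => 'b::real_normed_vector"
 assumes "continuous_on UNIV f" "bounded {x. f x \<noteq> 0}"
 shows "uniformly_continuous_on UNIV f"
proof -
 obtain R where R: "!!x. f x \<noteq> 0 ==> norm x <= R"
  using assms(2) by (auto simp: bounded_iff)
 have uc: "uniformly_continuous_on (cball 0 (R + 1)) f"
  by (intro compact_uniformly_continuous continuous_on_subset[OF assms(1)]) auto
 show ?thesis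
  unfolding uniformly_continuous_on_def
 proof (intro allI impI)
  fix e :: real assume "e > 0"
  then obtain d where d: "d > 0" "!!x x'. norm x <= R + 1 ==> norm x' <= R + 1 ==> dist x' x < d ==> dist (f x') (f x) < e"
   using uc unfolding uniformly_continuous_on_def by (auto simp: dist_norm norm_minus_commute)
  have "dist (f x') (f x) < e" if "dist x' x < min d 1" for x x'
  proof (cases "norm x <= R + 1 \<and> norm x' <= R + 1")
   case True
   then show ?thesis using d that by auto
  next
   case False
   have "\<bar>norm x - norm x'\<bar> < 1"
    using that norm_triangle_ineq3[of x x'] by (simp add: dist_norm norm_minus_commute)
   then have "f x = 0" "f x' = 0" using False R[of x] R[of x'] by fastforce+
   then show ?thesis using \<open>e > 0\<close> by simp
  qed
  then show "\<exists>d>0. \<forall>x\<in>UNIV. \<forall>x'\<in>UNIV. dist x' x < d --> dist (f x') (f x) < e"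
   using d(1) by (intro exI[of _ "min d 1"]) auto
 qed
qed

lemma bounded_support_bounded:
 fixes f :: "'a::euclidean_space => 'b::real_normed_vector"
 assumes "continuous_on UNIV f" "bounded {x. f x \<noteq> 0}"
 obtains B where "B > 0" "!!x. norm (f x) <= B"
proof -
 have "compact (f ` closure {x. f x \<noteq> 0})"
  using assms by (intro compact_continuous_image) (auto simp: compact_closure intro: continuous_on_subset)
 then obtain B where B: "!!x. x : closure {x. f x \<noteq> 0} ==> norm (f x) <= B"
  by (meson bounded_iff compact_imp_bounded imageI)
 have "norm (f x) <= \<bar>B\<bar> + 1" for x
  using B[of x] closure_subset[of "{x. f x \<noteq> 0}"] by (cases "f x = 0") force+
 then show thesis by (intro that[of "\<bar>B\<bar> + 1"]) auto
qed

lemma integral_abs_le: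
 fixes f g :: "'a => real"
 assumes "integrable M f" "integrable M g" "!!x. \<bar>f x\<bar> <= g x"
 shows "\<bar>integral\<^sup>L M f\<bar> <= integral\<^sup>L M g"
 using assms by (intro order_trans[OF integral_abs_bound] integral_mono) auto

section \<open>Convolution and mollification\<close>

definition conv :: "('a::euclidean_space => real) => ('a => real) => 'a => real" where
 "conv k g x = (LINT y|lborel. k (x - y) * g y)"

lemma conv_integrable:
 fixes k g :: "'a::euclidean_space => real"
 assumes "continuous_on UNIV k" "bounded {x. k x \<noteq> 0}" "integrable lborel g"
 shows "integrable lborel (%y. k (x - y) * g y)"
proof -
 obtain B where B: "!!x. norm (k x) <= B"
  using bounded_support_bounded[OF assms(1,2)] by metis
 have [measurable]: "k : borel_measurable borel" "g : borel_measurable borel"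
  using assms by (auto intro: borel_measurable_continuous_onI)
 show ?thesis
 proof (rule Bochner_Integration.integrable_bound)
  show "integrable lborel (%y. B * g y)" using assms by auto
  show "AE y in lborel. norm (k (x - y) * g y) <= norm (B * g y)"
   using B order_trans[OF B abs_ge_self[of B]] by (intro AE_I2) (auto simp: abs_mult intro!: mult_right_mono)
 qed measurable
qed

lemma bounded_support_grad:
 assumes "bounded {x. k x \<noteq> 0}"
 shows "bounded {x. grad k x \<noteq> 0}"
 using grad_eq_0_outside_support[of _ k]
 by (intro bounded_subset[OF bounded_closure[OF assms]]) auto

lemma bounded_support_grad_component:
 assumes "bounded {x. k x \<noteq> 0}"
 shows "bounded {x. grad k x \<bullet> i \<noteq> 0}"
 by (rule bounded_subset[OF bounded_support_grad[OF assms]]) auto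

text \<open>Having bounded support, \<open>grad k\<close> is uniformly continuous, so the
  linearisation error of \<open>k\<close> is at most \<open>e' * norm h\<close> at all points at
  once, and this bound is integrated against the absolute value of \<open>g\<close>.\<close>

lemma conv_has_derivative:
 fixes k g :: "'a::euclidean_space => real"
 assumes k: "smooth k" "bounded {x. k x \<noteq> 0}" and g: "integrable lborel g"
 shows "(conv k g has_derivative
  (%h. (\<Sum>i\<in>Basis. conv (%z. grad k z \<bullet> i) g x *\<^sub>R i) \<bullet> h)) (at x)"
proof -
 let ?D = "%h. (\<Sum>i\<in>Basis. conv (%z. grad k z \<bullet> i) g x *\<^sub>R i) \<bullet> h"
 have [measurable]: "k : borel_measurable borel" "g : borel_measurable borel" "grad k : borel_measurable borel"
  using k g by (auto intro: smooth_measurable smooth_grad_measurable)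
 have ik: "integrable lborel (%y. k (x - y) * g y)" for x
  by (intro conv_integrable smooth_continuous k g)
 have ig: "integrable lborel (%y. (grad k (x - y) \<bullet> i) * g y)" if "i : Basis" for x i
  using conv_integrable[of "%z. grad k z \<bullet> i" g x] k g that
  by (auto intro: smooth_continuous smooth_grad_component bounded_support_grad_component)
 have D: "?D h = (LINT y|lborel. (grad k (x - y) \<bullet> h) * g y)"
  and iD: "integrable lborel (%y. (grad k (x - y) \<bullet> h) * g y)" for h
 proof -
  have *: "(grad k (x - y) \<bullet> h) * g y = (\<Sum>i\<in>Basis. (h \<bullet> i) * ((grad k (x - y) \<bullet> i) * g y))" for y
   by (subst euclidean_inner) (simp add: sum_distrib_right sum_distrib_left mult_ac)
  show "integrable lborel (%y. (grad k (x - y) \<bullet> h) * g y)"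
   unfolding * by (intro Bochner_Integration.integrable_sum integrable_mult_right ig)
  have "?D h = (\<Sum>i\<in>Basis. (h \<bullet> i) * (LINT y|lborel. (grad k (x - y) \<bullet> i) * g y))"
   unfolding inner_sum_left conv_def by (intro sum.cong) (auto simp: inner_commute)
  also have "\<dots> = (\<Sum>i\<in>Basis. (LINT y|lborel. (h \<bullet> i) * ((grad k (x - y) \<bullet> i) * g y)))"
   by (intro sum.cong refl integral_mult_right_zero[symmetric])
  also have "\<dots> = (LINT y|lborel. (\<Sum>i\<in>Basis. (h \<bullet> i) * ((grad k (x - y) \<bullet> i) * g y)))"
   by (rule Bochner_Integration.integral_sum[symmetric]) (intro integrable_mult_right ig)
  finally show "?D h = (LINT y|lborel. (grad k (x - y) \<bullet> h) * g y)"
   unfolding * .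
 qed
 define I where "I = (LINT y|lborel. \<bar>g y\<bar>)"
 have I: "I \<ge> 0" by (simp add: I_def)
 have uc: "uniformly_continuous_on UNIV (grad k)"
  by (intro bounded_support_uniformly_continuous smooth_grad_continuous bounded_support_grad k)
 show ?thesis
  unfolding has_derivative_at_alt
 proof (intro conjI allI impI)
  show "bounded_linear ?D" by (rule bounded_linear_inner_right)
  fix e :: real assume e: "e > 0"
  define e' where "e' = e / (I + 1)"
  have e': "e' > 0" using e I by (simp add: e'_def)
  then obtain d where d: "d > 0" "!!z z'. dist z' z < d ==> dist (grad k z') (grad k z) < e'"
   using uc unfolding uniformly_continuous_on_def by blast
  have est: "\<bar>k (z + h) - k z - grad k z \<bullet> h\<bar> <= norm h * e'" if h: "norm h < d" for z h
  proof -
   have "norm (k (z + h) - k z - grad k z \<bullet> ((z + h) - z)) <= norm ((z + h) - z) * e'"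
   proof (rule differentiable_bound_linearization[where S = "ball z d" and f = k and f' = "%w v. grad k w \<bullet> v" and ?x0.0 = z and a = z and b = "z + h"])
    show "(k has_derivative (%h. grad k w \<bullet> h)) (at w within ball z d)" for w
     using smooth_has_derivative[OF k(1)] by (rule has_derivative_at_withinI)
    show "onorm ((%v. grad k w \<bullet> v) - (%v. grad k z \<bullet> v)) <= e'" if "w : ball z d" for w
    proof (rule onorm_le)
     have "dist (grad k w) (grad k z) < e'"
      using that by (intro d) (simp add: dist_commute)
     then show "norm (((%v. grad k w \<bullet> v) - (%v. grad k z \<bullet> v)) v) <= e' * norm v" for v
      using Cauchy_Schwarz_ineq2[of "grad k w - grad k z" v]
       mult_right_mono[of "norm (grad k w - grad k z)" e' "norm v"]
      by (simp add: inner_diff_left dist_norm)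
    qed
    show "z + t *\<^sub>R ((z + h) - z) : ball z d" if "t : {0..1}" for t
    proof -
     have "norm (t *\<^sub>R h) <= norm h" using that by (auto intro: mult_left_le_one_le)
     then show ?thesis using h by (simp add: dist_norm)
    qed
   qed (use d in auto)
   then show ?thesis by simp
  qed
  show "\<exists>d>0. \<forall>y. norm (y - x) < d --> norm (conv k g y - conv k g x - ?D (y - x)) <= e * norm (y - x)"
  proof (intro exI[of _ d] conjI allI impI d(1))
   fix y assume y: "norm (y - x) < d"
   define h where "h = y - x"
   have h: "y = x + h" "norm h < d" using y by (auto simp: h_def)
   have "conv k g y - conv k g x - ?D h =
    (LINT w|lborel. (k (x + h - w) - k (x - w) - grad k (x - w) \<bullet> h) * g w)"
    unfolding D h(1) unfolding conv_def using ik iD by (simp add: left_diff_distrib)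
   also have "\<bar>\<dots>\<bar> <= (LINT w|lborel. (norm h * e') * \<bar>g w\<bar>)"
   proof (rule integral_abs_le)
    show "integrable lborel (%w. (k (x + h - w) - k (x - w) - grad k (x - w) \<bullet> h) * g w)"
     using ik iD by (simp add: left_diff_distrib)
    show "\<bar>(k (x + h - w) - k (x - w) - grad k (x - w) \<bullet> h) * g w\<bar> <= (norm h * e') * \<bar>g w\<bar>" for w
     using mult_right_mono[OF est[OF h(2), of "x - w"], of "\<bar>g w\<bar>"] by (simp add: abs_mult diff_add_eq)
   qed (use g in auto)
   also have "\<dots> = norm h * e' * I" by (simp add: I_def)
   also have "\<dots> <= norm h * e"
   proof -
    have "e' * I <= e' * (I + 1)" using e' by simp
    also have "\<dots> = e" using I by (simp add: e'_def)
    finally show ?thesis by (simp add: mult_left_mono mult.assoc)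
   qed
   finally show "norm (conv k g y - conv k g x - ?D (y - x)) <= e * norm (y - x)"
    by (simp add: h_def mult.commute)
  qed
 qed
qed

lemma grad_conv:
 assumes "smooth k" "bounded {x. k x \<noteq> 0}" "integrable lborel g" "i : Basis"
 shows "grad (conv k g) x \<bullet> i = conv (%z. grad k z \<bullet> i) g x"
 using assms(4) by (simp add: grad_eqI[OF conv_has_derivative[OF assms(1-3)]] inner_sum_left inner_Basis if_distrib cong: if_cong)

text \<open>All derivatives fall on the kernel, so the induction generalises over \<open>k\<close>
  and keeps \<open>g\<close> fixed.\<close>

lemma smooth_conv:
 assumes "smooth k" "bounded {x. k x \<noteq> 0}" "integrable lborel g"
 shows "smooth (conv k g)"
proof -
 have "Ck n (conv k g)" if "smooth k" "bounded {x. k x \<noteq> 0}" for n k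
  using that
 proof (induction n arbitrary: k)
  case 0
  then show ?case
   using conv_has_derivative[OF 0 assms(3)]
   by (auto intro!: continuous_at_imp_continuous_on has_derivative_continuous)
 next
  case (Suc n)
  show ?case
  proof (rule Ck_SucI[OF conv_has_derivative[OF Suc.prems assms(3)]])
   fix i :: 'a assume "i : Basis"
   then show "Ck n (%x. (\<Sum>i\<in>Basis. conv (%z. grad k z \<bullet> i) g x *\<^sub>R i) \<bullet> i)"
    using Suc.IH[OF smooth_grad_component[OF Suc.prems(1) \<open>i : Basis\<close>] bounded_support_grad_component[OF Suc.prems(2)]]
    by (simp add: inner_sum_left inner_Basis if_distrib cong: if_cong)
  qed
 qed
 with assms show ?thesis by (simp add: smooth_def)
qed

lemma conv_flip:
 assumes "k : borel_measurable borel" "g : borel_measurable borel"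
 shows "conv k g x = (LINT z|lborel. k z * g (x - z))"
proof -
 note [measurable] = assms
 have "(LINT y|lborel. k (x - y) * g y) = (LINT z|lborel. (%y. k (x - y) * g y) (x - z))"
  by (intro integral_reflect[symmetric]) measurable
 then show ?thesis by (simp add: conv_def)
qed

lemma kernel_at_bounded: "kernel_at a dl k ==> bounded {x. k x \<noteq> 0}"
 unfolding kernel_at_def by (intro bounded_subset[OF bounded_ball[of a dl]]) (auto simp: dist_commute)

lemma smooth_conv_kernel: "kernel_at a dl k ==> integrable lborel g ==> smooth (conv k g)"
 by (intro smooth_conv) (auto simp: kernel_at_def intro: kernel_at_bounded)

lemma kernel_weighted_integrable:
 assumes "kernel_at a dl k" "integrable lborel g"
 shows "integrable lborel (%z. k z * g (x - z))"
proof -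
 have [measurable]: "k : borel_measurable borel" "g : borel_measurable borel"
  using assms by (auto simp: kernel_at_def)
 have "integrable lborel (%y. k (x - y) * g y)"
  using assms by (intro conv_integrable smooth_continuous kernel_at_bounded) (auto simp: kernel_at_def)
 then show ?thesis
  using integrable_reflect[of "%y. k (x - y) * g y" x] by simp
qed

lemma conv_kernel_bounds:
 assumes k: "kernel_at a dl k" and g: "integrable lborel g"
 shows "(!!y. dist y (x - a) < dl ==> g y <= c) ==> conv k g x <= c"
  and "(!!y. dist y (x - a) < dl ==> c <= g y) ==> c <= conv k g x"
proof -
 have [measurable]: "k : borel_measurable borel" "g : borel_measurable borel"
  using assms by (auto simp: kernel_at_def)
 have ik: "integrable lborel (%z. k z * c)" "(LINT z|lborel. k z * c) = c"
  using k by (auto simp: kernel_at_def)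
 have near: "dist (x - z) (x - a) < dl" "k z \<ge> 0" if "k z \<noteq> 0" for z
  using k that by (auto simp: kernel_at_def dist_norm norm_minus_commute)
 show "conv k g x <= c" if "!!y. dist y (x - a) < dl ==> g y <= c"
 proof -
  have "(LINT z|lborel. k z * g (x - z)) <= (LINT z|lborel. k z * c)"
   using near that by (intro integral_mono kernel_weighted_integrable[OF k g] ik(1)) (metis mult_left_mono mult_zero_left order_refl)
  then show ?thesis unfolding ik(2) by (simp add: conv_flip)
 qed
 show "c <= conv k g x" if "!!y. dist y (x - a) < dl ==> c <= g y"
 proof -
  have "(LINT z|lborel. k z * c) <= (LINT z|lborel. k z * g (x - z))"
   using near that by (intro integral_mono kernel_weighted_integrable[OF k g] ik(1)) (metis mult_left_mono mult_zero_left order_refl)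
  then show ?thesis unfolding ik(2) by (simp add: conv_flip)
 qed
qed

lemma conv_kernel_lipschitz:
 assumes k: "kernel_at a dl k" and g: "integrable lborel g" "L-lipschitz_on UNIV g"
 shows "L-lipschitz_on UNIV (conv k g)"
proof (rule lipschitz_onI)
 have [measurable]: "k : borel_measurable borel" "g : borel_measurable borel"
  using assms by (auto simp: kernel_at_def)
 fix x y :: 'a
 have ik: "integrable lborel k" "integral\<^sup>L lborel k = 1" "!!z. k z \<ge> 0"
  using k by (auto simp: kernel_at_def)
 note int = kernel_weighted_integrable[OF k g(1)]
 have "conv k g x - conv k g y = (LINT z|lborel. k z * g (x - z) - k z * g (y - z))"
  using int by (simp add: conv_flip)
 also have "\<bar>\<dots>\<bar> <= (LINT z|lborel. k z * (L * dist x y))"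
 proof (rule integral_abs_le)
  show "\<bar>k z * g (x - z) - k z * g (y - z)\<bar> <= k z * (L * dist x y)" for z
   using lipschitz_onD[OF g(2), of "x - z" "y - z"] ik(3)[of z]
   by (auto simp: dist_norm abs_mult simp flip: right_diff_distrib intro!: mult_left_mono)
 qed (use int ik in auto)
 also have "\<dots> = L * dist x y" using ik(2) by simp
 finally show "dist (conv k g x) (conv k g y) <= L * dist x y" by (simp add: dist_norm)
qed (use lipschitz_on_nonneg[OF g(2)] in auto)

text \<open>Nonnegativity of the variance about the mean \<open>m\<close> for the probability
  density \<open>k\<close>. The right-hand side is an \<open>ennreal\<close> integral, so that its
  divergence is covered too.\<close>

lemma weighted_Jensen_square:
 fixes k w :: "'a => real"
 assumes k: "integrable M k" "integral\<^sup>L M k = 1" "!!z. k z \<ge> 0"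
  and kw: "integrable M (%z. k z * w z)" and [measurable]: "w : borel_measurable M"
 shows "ennreal ((LINT z|M. k z * w z)\<^sup>2) <= (\<integral>\<^sup>+z. ennreal (k z * (w z)\<^sup>2) \<partial>M)"
proof (cases "integrable M (%z. k z * (w z)\<^sup>2)")
 case True
 define m where "m = (LINT z|M. k z * w z)"
 have "0 <= (LINT z|M. k z * (w z - m)\<^sup>2)" using k by (intro integral_nonneg_AE) auto
 also have "\<dots> = (LINT z|M. k z * (w z)\<^sup>2 - 2 * m * (k z * w z) + m\<^sup>2 * k z)"
  by (intro Bochner_Integration.integral_cong) (auto simp: power2_diff algebra_simps)
 also have "\<dots> = (LINT z|M. k z * (w z)\<^sup>2) - m\<^sup>2"
  using True kw k by (simp add: m_def power2_eq_square)
 finally have "m\<^sup>2 <= (LINT z|M. k z * (w z)\<^sup>2)" by simp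
 then show ?thesis
  using True k(3) by (subst nn_integral_eq_integral) (auto simp: m_def intro: ennreal_leI)
next
 case False
 have [measurable]: "k : borel_measurable M" using k by auto
 have "(\<integral>\<^sup>+z. ennreal (norm (k z * (w z)\<^sup>2)) \<partial>M) = \<infinity>"
  using False by (auto simp: integrable_iff_bounded less_top[symmetric])
 then show ?thesis using k(3) by simp
qed

text \<open>\<open>conv k g - g\<close> is the \<open>k\<close>-average of the translation errors of
  \<open>g\<close>; Jensen's inequality for the square and Tonelli's theorem move the average
  outside.\<close>

lemma conv_kernel_error:
 fixes g :: "'a::euclidean_space => real"
 assumes k: "kernel_at a dl k" and g: "integrable lborel g"
 shows "(\<integral>\<^sup>+x. ennreal ((conv k g x - g x)\<^sup>2) \<partial>lborel) \<le>
  (\<integral>\<^sup>+z. ennreal (k z) * (\<integral>\<^sup>+x. ennreal ((g (x - z) - g x)\<^sup>2) \<partial>lborel) \<partial>lborel)"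
proof -
 have [measurable]: "k : borel_measurable borel" "g : borel_measurable borel"
  using assms by (auto simp: kernel_at_def)
 have ik: "integrable lborel k" "integral\<^sup>L lborel k = 1" "!!z. k z \<ge> 0"
  using k by (auto simp: kernel_at_def)
 have "ennreal ((conv k g x - g x)\<^sup>2) <= (\<integral>\<^sup>+z. ennreal (k z * (g (x - z) - g x)\<^sup>2) \<partial>lborel)" for x
 proof -
  have "integrable lborel (%z. k z * g (x - z) - k z * g x)"
   using kernel_weighted_integrable[OF k g] ik by auto
  then have "ennreal ((LINT z|lborel. k z * (g (x - z) - g x))\<^sup>2) <= (\<integral>\<^sup>+z. ennreal (k z * (g (x - z) - g x)\<^sup>2) \<partial>lborel)"
   by (intro weighted_Jensen_square ik) (auto simp: right_diff_distrib)
  also have "(LINT z|lborel. k z * (g (x - z) - g x)) = conv k g x - g x"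
   using kernel_weighted_integrable[OF k g, of x] ik by (simp add: right_diff_distrib conv_flip)
  finally show ?thesis .
 qed
 then have "(\<integral>\<^sup>+x. ennreal ((conv k g x - g x)\<^sup>2) \<partial>lborel) \<le>
   (\<integral>\<^sup>+x. \<integral>\<^sup>+z. ennreal (k z * (g (x - z) - g x)\<^sup>2) \<partial>lborel \<partial>lborel)"
  by (intro nn_integral_mono)
 also have "\<dots> = (\<integral>\<^sup>+z. \<integral>\<^sup>+x. ennreal (k z * (g (x - z) - g x)\<^sup>2) \<partial>lborel \<partial>lborel)"
  by (rule lborel_pair.Fubini') measurable
 also have "\<dots> = (\<integral>\<^sup>+z. ennreal (k z) * (\<integral>\<^sup>+x. ennreal ((g (x - z) - g x)\<^sup>2) \<partial>lborel) \<partial>lborel)"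
  by (intro nn_integral_cong) (simp add: ik ennreal_mult nn_integral_cmult)
 finally show ?thesis .
qed

lemma conv_kernel_error_le:
 fixes g :: "'a::euclidean_space => real"
 assumes k: "kernel_at a dl k" and g: "integrable lborel g" "g : L2 lborel"
  and E: "!!z. dist z a < dl ==> L2_norm lborel (%x. g (x - z) - g x) <= E" "E \<ge> 0"
 shows "(%x. conv k g x - g x) : L2 lborel" "L2_norm lborel (%x. conv k g x - g x) <= E"
proof -
 have [measurable]: "k : borel_measurable borel" "g : borel_measurable borel" "conv k g : borel_measurable borel"
  using assms smooth_conv_kernel[OF k g(1)] by (auto simp: kernel_at_def intro: smooth_measurable)
 have ik: "integrable lborel k" "integral\<^sup>L lborel k = 1" "!!z. k z \<ge> 0"
  using k by (auto simp: kernel_at_def)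
 have "(\<integral>\<^sup>+x. ennreal ((norm (conv k g x - g x))\<^sup>2) \<partial>lborel) \<le>
  (\<integral>\<^sup>+z. ennreal (k z) * (\<integral>\<^sup>+x. ennreal ((g (x - z) - g x)\<^sup>2) \<partial>lborel) \<partial>lborel)"
  using conv_kernel_error[OF k g(1)] by simp
 also have "\<dots> <= (\<integral>\<^sup>+z. ennreal (k z) * ennreal (E\<^sup>2) \<partial>lborel)"
 proof (intro nn_integral_mono)
  fix z
  show "ennreal (k z) * (\<integral>\<^sup>+x. ennreal ((g (x - z) - g x)\<^sup>2) \<partial>lborel) <= ennreal (k z) * ennreal (E\<^sup>2)"
  proof (cases "k z = 0")
   case False
   then have z: "dist z a < dl" using k by (auto simp: kernel_at_def)
   have "(\<integral>\<^sup>+x. ennreal ((norm (g (x - z) - g x))\<^sup>2) \<partial>lborel) = ennreal ((L2_norm lborel (%x. g (x - z) - g x))\<^sup>2)"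
    by (intro L2_norm_nn_integral L2_diff L2_translate g)
   also have "\<dots> <= ennreal (E\<^sup>2)"
    by (intro ennreal_leI power_mono E z) simp
   finally show ?thesis by (intro mult_left_mono) auto
  qed simp
 qed
 also have "\<dots> = ennreal (E\<^sup>2)"
  using ik by (simp add: nn_integral_multc nn_integral_eq_integral)
 finally have "(\<integral>\<^sup>+x. ennreal ((norm (conv k g x - g x))\<^sup>2) \<partial>lborel) <= ennreal (E\<^sup>2)" .
 from L2_normI[OF _ this E(2)]
 show "(%x. conv k g x - g x) : L2 lborel" "L2_norm lborel (%x. conv k g x - g x) <= E" by auto
qed

text \<open>The indicator of the closed \<open>e/2\<close>-neighbourhood of \<open>K\<close> is
  mollified at scale \<open>e/2\<close>: from points of \<open>K\<close> only the value 1 is seen,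
  and the support stays in the closed \<open>e\<close>-neighbourhood, which lies in
  \<open>U\<close>.\<close>

lemma smooth_cutoff:
 fixes K U :: "'a::euclidean_space set"
 assumes "compact K" "open U" "K \<subseteq> U"
 obtains \<theta> where "smooth \<theta>" "!!x. 0 <= \<theta> x" "!!x. \<theta> x <= 1" "!!x. x : K ==> \<theta> x = 1"
  "compact (closure {x. \<theta> x \<noteq> 0})" "closure {x. \<theta> x \<noteq> 0} \<subseteq> U"
proof -
 obtain e where e: "e > 0" "(\<Union>x\<in>K. cball x e) \<subseteq> U"
  using compact_subset_open_imp_cball_epsilon_subset[OF assms] by blast
 define A where "A = (\<Union>x\<in>K. cball x (e/2))"
 have cA: "compact (\<Union>x\<in>K. cball x r)" for r :: real
 proof -
  have "(\<Union>x\<in>K. cball x r) = {x + y |x y. x : K \<and> y : cball 0 r}"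
  proof (intro equalityI subsetI)
   fix z assume "z : (\<Union>x\<in>K. cball x r)"
   then obtain x where "x : K" "dist x z <= r" by auto
   then show "z : {x + y |x y. x : K \<and> y : cball 0 r}"
    by (intro CollectI exI[of _ x] exI[of _ "z - x"]) (auto simp: dist_norm norm_minus_commute)
  qed (auto simp: dist_norm intro!: bexI)
  then show ?thesis using compact_sums[OF assms(1) compact_cball[of 0 r]] by simp
 qed
 have cpA: "compact A" unfolding A_def by (rule cA)
 have A: "A : sets lborel" "emeasure lborel A < \<infinity>"
  using borel_compact[OF cpA] emeasure_bounded_finite[OF compact_imp_bounded[OF cpA]] by simp_all
 then have int: "integrable lborel (indicator A :: 'a => real)"
  by (simp add: integrable_indicator_iff)
 obtain k where k: "kernel_at (0::'a) (e/2) k"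
  using kernel_exists[of "e/2"] e by auto
 define \<theta> where "\<theta> = conv k (indicator A)"
 have sub: "closure {x. \<theta> x \<noteq> 0} \<subseteq> (\<Union>x\<in>K. cball x e)"
 proof (rule closure_minimal)
  show "closed (\<Union>x\<in>K. cball x e)" using cA compact_imp_closed by blast
  show "{x. \<theta> x \<noteq> 0} \<subseteq> (\<Union>x\<in>K. cball x e)"
  proof
   fix x assume "x : {x. \<theta> x \<noteq> 0}"
   then have ne: "conv k (indicator A) x \<noteq> 0" by (simp add: \<theta>_def)
   have "\<exists>y\<in>A. dist y x < e/2"
   proof (rule ccontr)
    assume "\<not> (\<exists>y\<in>A. dist y x < e/2)"
    then have "indicator A y = (0::real)" if "dist y (x - 0) < e/2" for y
     using that by (auto simp: indicator_def)
    then have "conv k (indicator A) x = 0"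
     by (intro antisym conv_kernel_bounds[OF k int]) simp_all
    with ne show False by simp
   qed
   then obtain y p where "p : K" "dist p y <= e/2" "dist y x < e/2" by (auto simp: A_def)
   then have "dist p x <= e" using dist_triangle[of p x y] by simp
   with \<open>p : K\<close> show "x : (\<Union>x\<in>K. cball x e)" by auto
  qed
 qed
 show thesis
 proof
  show "smooth \<theta>" unfolding \<theta>_def by (rule smooth_conv_kernel[OF k int])
  show "0 <= \<theta> x" "\<theta> x <= 1" for x
   unfolding \<theta>_def by (intro conv_kernel_bounds[OF k int]; simp)+
  show "\<theta> x = 1" if "x : K" for x
  proof (rule antisym)
   show "1 <= \<theta> x" unfolding \<theta>_def
   proof (rule conv_kernel_bounds(2)[OF k int])
    fix y assume "dist y (x - 0) < e / 2"
    then have "y : A" using that by (auto simp: A_def dist_commute intro!: bexI[of _ x])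
    then show "1 <= indicat_real A y" by simp
   qed
  qed fact
  show "closure {x. \<theta> x \<noteq> 0} \<subseteq> U" using sub e by auto
  show "compact (closure {x. \<theta> x \<noteq> 0})"
   using sub cA[of e] by (metis closed_closure compact_Int_closed inf.absorb_iff2)
 qed
qed

section \<open>Density of continuous functions and continuity of translations in
  \<open>L2\<close>\<close>

lemma indicator_mult_eq:
 fixes g :: "'a => real"
 assumes "!!x. g x \<noteq> 0 ==> x : A"
 shows "(%x. indicator A x * g x) = g"
proof
 show "indicator A x * g x = g x" for x
  using assms[of x] by (cases "g x = 0") auto
qed

lemma indicator_L2:
 assumes "A : sets M" "emeasure M A < \<infinity>"
 shows "(indicator A :: 'a => real) : L2 M"
proof -
 have "(%x. (norm (indicator A x :: real))\<^sup>2) = indicator A"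
  by (auto simp: indicator_def)
 with assms show ?thesis by (simp add: L2_def integrable_indicator_iff)
qed

lemma L2_dominated_convergence:
 fixes f :: "nat => 'a => 'b::euclidean_space"
 assumes f: "!!n. f n : borel_measurable M" and g: "g : borel_measurable M" and h: "h : L2 M"
  and le: "!!n. AE x in M. norm (f n x) <= h x" and lim: "AE x in M. (%n. f n x) \<longlonglongrightarrow> g x"
 shows "g : L2 M" "(%n. L2_norm M (%x. f n x - g x)) \<longlonglongrightarrow> 0"
proof -
 have [measurable]: "h : borel_measurable M" using h by auto
 note [measurable] = f g
 have "AE x in M. \<forall>n. norm (f n x) <= h x" using le by (simp add: AE_all_countable)
 with lim have gle: "AE x in M. norm (g x) <= h x"
 proof eventually_elim
  case (elim x)
  then show ?case by (intro tendsto_upperbound[OF tendsto_norm[OF elim(1)]]) auto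
 qed
 show gL: "g : L2 M"
  by (rule L2_bound[OF h g, where C = 1]) (use gle in eventually_elim, simp)
 have "(%n. LINT x|M. (norm (f n x - g x))\<^sup>2) \<longlonglongrightarrow> (LINT x|M. 0)"
 proof (rule integral_dominated_convergence)
  show "integrable M (%x. 4 * (norm (h x))\<^sup>2)"
   using L2_square_integrable[OF h] by auto
  show "AE x in M. (%n. (norm (f n x - g x))\<^sup>2) \<longlonglongrightarrow> 0"
   using lim
  proof eventually_elim
   case (elim x)
   then have "(%n. (norm (f n x - g x))\<^sup>2) \<longlonglongrightarrow> (norm (g x - g x))\<^sup>2" by (intro tendsto_intros)
   then show ?case by simp
  qed
  show "AE x in M. norm ((norm (f n x - g x))\<^sup>2) <= 4 * (norm (h x))\<^sup>2" for n
   using le[of n] gle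
  proof eventually_elim
   case (elim x)
   then have "norm (f n x - g x) <= 2 * norm (h x)"
    using norm_triangle_ineq4[of "f n x" "g x"] by simp
   then have "(norm (f n x - g x))\<^sup>2 <= (2 * norm (h x))\<^sup>2" by (intro power_mono) auto
   then show ?case by (simp add: power_mult_distrib)
  qed
 qed measurable
 then have "(%n. sqrt (LINT x|M. (norm (f n x - g x))\<^sup>2)) \<longlonglongrightarrow> sqrt (LINT x|M. 0)"
  by (rule tendsto_real_sqrt)
 then show "(%n. L2_norm M (%x. f n x - g x)) \<longlonglongrightarrow> 0"
  by (simp add: L2_norm_def L2_inner_self)
qed

lemma (in finite_measure) L2_bounded:
 fixes f :: "'a => 'b::euclidean_space"
 assumes "f : borel_measurable M" "!!x. x : space M ==> norm (f x) <= B"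
 shows "f : L2 M"
proof (rule L2_bound[where f = "%x. 1::real" and C = B])
 show "(%x. 1::real) : L2 M" by (simp add: L2_def)
qed (use assms in auto)

text \<open>Dynkin's lemma reduces membership in \<open>V\<close> to indicators of closed sets, which are limits of
 continuous functions of bounded support.\<close>

lemma L2_closed_subspace_eq:
 fixes M :: "'a::euclidean_space measure" and V :: "('a => real) set"
 assumes M: "finite_measure M" "sets M = sets borel"
  and V0: "!!f. continuous_on UNIV f ==> bounded {x. f x \<noteq> 0} ==> f : V"
  and comb: "!!p q s. p : V ==> q : V ==> (%x. p x + s * q x) : V"
  and lim: "!!f g. (!!n. f n : V) ==> g : L2 M ==> (%n::nat. L2_norm M (%x. f n x - g x)) \<longlonglongrightarrow> 0 ==> g : V"
  and f: "f : L2 M"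
 shows "f : V"
proof -
 interpret finite_measure M by fact
 note [measurable_cong] = M(2)
 have spM: "space M = UNIV" using sets_eq_imp_space_eq[OF M(2)] by simp
 have one: "(%x. 1::real) : L2 M" by (simp add: L2_def)
 have dom: "g : V" if "!!n. f n : V" "!!n. f n : borel_measurable M" "g : borel_measurable M"
  "!!n x. \<bar>f n x\<bar> <= 1" "!!x. (%n::nat. f n x) \<longlonglongrightarrow> g x" for f and g :: "'a => real"
  using L2_dominated_convergence[of f M g, OF that(2,3) one] that by (intro lim[of f g]) auto
 have zero: "(%x. 0) : V" by (rule V0) auto
 have cmult: "(%x. c * p x) : V" if "p : V" for c p
  using comb[OF zero that, of c] by simp
 have compact: "indicator K : V" if K: "compact K" for K :: "'a set"
 proof (cases "K = {}")
  case True
  then have "(indicator K :: 'a => real) = (%x. 0)" by auto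
  then show ?thesis using zero by simp
 next
  case False
  \<comment> \<open>Tents of width \<open>1 / n\<close> around \<open>K\<close>. They are used at
    \<open>Suc n\<close>, where the width is at most 1 and the support therefore bounded.\<close>
  let ?f = "%n x. max 0 (1 - real n * infdist x K)"
  show ?thesis
  proof (rule dom[of "%n. ?f (Suc n)"])
   show "?f (Suc n) : V" for n
   proof (rule V0)
    show "continuous_on UNIV (?f (Suc n))" by (intro continuous_intros)
    obtain R where R: "!!y. y : K ==> norm y <= R"
     using compact_imp_bounded[OF K] by (auto simp: bounded_iff)
    have "norm x <= R + 1" if "?f (Suc n) x \<noteq> 0" for x
    proof -
     have "infdist x K <= real (Suc n) * infdist x K"
      using infdist_nonneg[of x K] mult_right_mono[of 1 "real (Suc n)" "infdist x K"] by simp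
     also have "\<dots> < 1" using that by (auto simp: max_def split: if_splits)
     finally have "infdist x K < 1" .
     then obtain y where "y : K" "dist x y < 1"
      using infdist_attains_inf[OF compact_imp_closed[OF K] False, of x] by metis
     then show ?thesis using R[of y] norm_triangle_ineq2[of x y] by (simp add: dist_norm)
    qed
    then show "bounded {x. ?f (Suc n) x \<noteq> 0}" by (auto simp: bounded_iff)
   qed
   show "?f (Suc n) : borel_measurable M" for n
    by (auto simp: measurable_cong_sets[OF M(2) refl] intro!: borel_measurable_continuous_onI continuous_intros)
   show "indicator K : borel_measurable M" using borel_compact[OF K] by measurable
   show "\<bar>?f (Suc n) x\<bar> <= 1" for n x
    using infdist_nonneg[of x K] by (auto simp: max_def)
   show "(%n. ?f (Suc n) x) \<longlonglongrightarrow> indicator K x" for x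
   proof (cases "x : K")
    case False
    then have pos: "infdist x K > 0"
     using in_closed_iff_infdist_zero[OF compact_imp_closed[OF K] \<open>K \<noteq> {}\<close>, of x] infdist_nonneg[of x K] by linarith
    obtain N where N: "1 < real N * infdist x K"
     using reals_Archimedean3[OF pos] by blast
    have "?f (Suc n) x = 0" if "n \<ge> N" for n
    proof -
     have "real N * infdist x K <= real (Suc n) * infdist x K"
      using that pos by (intro mult_right_mono) auto
     with N show ?thesis by simp
    qed
    then have "\<forall>\<^sub>F n in sequentially. ?f (Suc n) x = indicator K x"
     using False by (auto simp: eventually_sequentially)
    then show ?thesis by (rule tendsto_eventually)
   qed simp
  qed
 qed
 have closed: "indicator F : V" if F: "closed F" for F :: "'a set"
 proof (rule dom[of "%n. indicator (F \<inter> cball 0 (real n))"])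
  show "indicator (F \<inter> cball 0 (real n)) : V" for n
   using F by (intro compact) auto
  show "indicator (F \<inter> cball 0 (real n)) : borel_measurable M" for n
   using F by (intro borel_measurable_indicator) (simp add: M(2) borel_closed closed_Int)
  show "indicator F : borel_measurable M"
   using F by (intro borel_measurable_indicator) (simp add: M(2) borel_closed)
  show "(%n. indicator (F \<inter> cball 0 (real n)) x) \<longlonglongrightarrow> (indicator F x :: real)" for x
  proof (rule tendsto_eventually)
   obtain N where N: "norm x <= real N" using real_arch_simple by blast
   have "indicator (F \<inter> cball 0 (real n)) x = (indicator F x :: real)" if "n \<ge> N" for n
    using N that by (auto simp: indicator_def)
   then show "\<forall>\<^sub>F n in sequentially. indicator (F \<inter> cball 0 (real n)) x = (indicator F x :: real)"
    by (auto simp: eventually_sequentially)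
  qed
 qed (auto simp: indicator_def)
 have ind: "indicator A : V" if A: "A : sets M" for A
 proof -
  have *: "A : sigma_sets UNIV {F::'a set. closed F}"
   using A by (simp add: M(2) borel_eq_closed)
  have "Int_stable {F::'a set. closed F}" "{F::'a set. closed F} \<subseteq> Pow UNIV" by (auto simp: Int_stable_def)
  from this * show ?thesis
  proof (induct rule: sigma_sets_induct_disjoint)
   case (compl A)
   have "(%x. indicator UNIV x + (-1) * indicator A x) : V"
    by (rule comb[OF closed compl(2)]) auto
   also have "(%x. indicator UNIV x + (-1) * indicator A x) = (indicator (UNIV - A) :: 'a => real)"
    by (auto simp: indicator_def)
   finally show ?case .
  next
   case (union A)
   have A: "A i : sets M" for i
    using union(2) by (auto simp: M(2) borel_eq_closed)
   have sum: "(%x. \<Sum>i<n. indicator (A i) x) : V" for n :: nat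
   proof (induction n)
    case (Suc n)
    show ?case using comb[OF Suc.IH union(3)[of n], of 1] by simp
   qed (simp add: zero)
   have eq: "(%x. \<Sum>i<n. indicator (A i) x :: real) = indicator (\<Union>i<n. A i)" for n
    by (rule ext, subst indicator_UN_disjoint) (use union(1) in \<open>auto simp: disjoint_family_on_def\<close>)
   show ?case
   proof (rule dom[of "%n. indicator (\<Union>i<n. A i)"])
    show "indicator (\<Union>i<n. A i) : V" for n using sum[of n] by (simp add: eq)
    show "(%n. indicator (\<Union>i<n. A i) x) \<longlonglongrightarrow> (indicator (\<Union>i. A i) x :: real)" for x
     by (rule LIMSEQ_indicator_UN)
   qed (use A in \<open>auto simp: indicator_def\<close>)
  qed (auto intro: closed simp: zero)
 qed
 have nonneg: "u : V" if "u : L2 M" "!!x. 0 <= u x" for u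
 proof -
  have "u : borel_measurable M" using that by auto
  \<comment> \<open>Membership in \<open>L2 M\<close> is carried as an implication: the simpler
    functions of the induction inherit it from \<open>u\<close>, by domination or scaling.\<close>
  from this that(2) have "u : L2 M --> u : V"
  proof (induct rule: borel_measurable_induct_real)
   case (set A) then show ?case using ind by auto
  next
   case (mult u c)
   show ?case
   proof (cases "c = 0")
    case False
    show ?thesis
    proof
     assume "(%x. c * u x) : L2 M"
     then have "(%x. (1 / c) * (c * u x)) : L2 M" by (rule L2_cmult)
     then show "(%x. c * u x) : V" using False mult cmult by auto
    qed
   qed (simp add: zero)
  next
   case (add u v)
   show ?case
   proof
    assume L: "(%x. v x + u x) : L2 M"
    have "u : L2 M" "v : L2 M"
     by (rule L2_bound[OF L, where C = 1]; use add in \<open>auto simp: spM\<close>)+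
    then show "(%x. v x + u x) : V" using comb[of v u 1] add by auto
   qed
  next
   case (seq U)
   show ?case
   proof
    assume L: "u : L2 M"
    have le: "U i x <= u x" for i x
     using seq(4) seq(5)[of x] by (intro incseq_le[of "%i. U i x"]) (auto simp: spM incseq_def le_fun_def)
    have "U i : L2 M" for i
     by (rule L2_bound[OF L, where C = 1]) (use seq in \<open>auto simp: spM intro!: AE_I2 order_trans[OF le abs_ge_self]\<close>)
    then have "U i : V" for i using seq by auto
    moreover have "(%n. L2_norm M (%x. U n x - u x)) \<longlonglongrightarrow> 0"
     by (rule L2_dominated_convergence(2)[OF _ _ L]) (use seq le L in \<open>auto simp: spM\<close>)
    ultimately show "u : V" using L lim by blast
   qed
  qed
  with that show ?thesis by simp
 qed
 have m: "f : borel_measurable M" using f by auto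
 have "(%x. max 0 (f x) + (-1) * max 0 (- f x)) : V"
  by (intro comb nonneg L2_bound[OF f, where C = 1]) (use m in \<open>auto intro!: AE_I2\<close>)
 also have "(%x. max 0 (f x) + (-1) * max 0 (- f x)) = f" by (auto simp: max_def)
 finally show ?thesis .
qed

lemma L2_density_indicator_iff:
 fixes f :: "'a::euclidean_space => real"
 assumes "A : sets borel" "f : borel_measurable borel"
 shows "f : L2 (density lborel (indicator A)) \<longleftrightarrow> (%x. indicator A x * f x) : L2 lborel"
  and "L2_norm (density lborel (indicator A)) f = L2_norm lborel (%x. indicator A x * f x)"
proof -
 note [measurable] = assms
 have eq: "(indicator A x * f x)\<^sup>2 = indicator A x * (f x)\<^sup>2" for x
  by (simp add: indicator_def)
 have d: "density lborel (indicator A) = density lborel (%x. ennreal (indicator A x))"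
  by (simp add: ennreal_indicator)
 show "f : L2 (density lborel (indicator A)) \<longleftrightarrow> (%x. indicator A x * f x) : L2 lborel"
  unfolding L2_def d using integrable_density[of "%x. (f x)\<^sup>2" lborel "indicator A"] by (simp add: eq)
 show "L2_norm (density lborel (indicator A)) f = L2_norm lborel (%x. indicator A x * f x)"
  unfolding L2_norm_def L2_inner_self d using integral_density[of "%x. (f x)\<^sup>2" lborel "indicator A"] by (simp add: eq)
qed

text \<open>Translations are isometries of \<open>L2\<close>, so the functions with this property
  form a closed subspace; by dominated convergence it contains the continuous functions of bounded
  support. The density lemma asks for a finite measure, hence Lebesgue measure on a ball that
  contains the support of \<open>g\<close>.\<close>

lemma L2_translation_continuous_seq:
 fixes g :: "'a::euclidean_space => real"
 assumes g: "g : L2 lborel" "bounded {x. g x \<noteq> 0}"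
  and z: "z \<longlonglongrightarrow> 0" "!!n. norm (z n) <= 1"
 shows "(%n. L2_norm lborel (%x. g (x - z n) - g x)) \<longlonglongrightarrow> 0"
proof -
 obtain R where "R > 0" "\<forall>x\<in>{x. g x \<noteq> 0}. norm x <= R"
  using g(2) unfolding bounded_pos by blast
 then have R: "!!x. g x \<noteq> 0 ==> x : cball 0 R" and R0: "R \<ge> 0" by auto
 let ?i = "%x. indicator (cball 0 R) x :: real"
 define M where "M = density lborel (indicator (cball (0::'a) R))"
 define P where "P h \<longleftrightarrow> (%n. L2_norm lborel (%x. h (x - z n) - h x)) \<longlonglongrightarrow> 0" for h :: "'a => real"
 define V where "V = {f. f : borel_measurable borel \<and> (%x. ?i x * f x) : L2 lborel \<and> P (%x. ?i x * f x)}"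
 have cb: "cball (0::'a) R : sets borel" by simp
 have "emeasure M (space M) = emeasure lborel (cball (0::'a) R)"
  unfolding M_def by (subst emeasure_density) (auto intro!: borel_measurable_indicator)
 also have "\<dots> < \<infinity>" by (intro emeasure_bounded_finite) simp
 finally have fin: "finite_measure M" by (intro finite_measureI) simp
 have limP: "P h" if h: "h : L2 lborel" and f: "!!n. f n : L2 lborel" "!!n. P (f n)"
  and lim: "(%n::nat. L2_norm lborel (%x. f n x - h x)) \<longlonglongrightarrow> 0" for f h
  unfolding P_def
 proof (rule LIMSEQ_I)
  fix e :: real assume e: "e > 0"
  obtain m where m: "L2_norm lborel (%x. f m x - h x) < e / 3"
   using order_tendstoD(2)[OF lim, of "e/3"] e by (auto simp: eventually_sequentially)
  have "\<forall>\<^sub>F n in sequentially. L2_norm lborel (%x. f m (x - z n) - f m x) < e / 3"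
   using f(2)[of m] e unfolding P_def by (intro order_tendstoD(2)) auto
  then obtain N where N: "!!n. n \<ge> N ==> L2_norm lborel (%x. f m (x - z n) - f m x) < e / 3"
   by (auto simp: eventually_sequentially)
  have "norm (L2_norm lborel (%x. h (x - z n) - h x) - 0) < e" if "n \<ge> N" for n
  proof -
   let ?A = "%x. h (x - z n) - f m (x - z n)" and ?B = "%x. f m (x - z n) - f m x" and ?C = "%x. f m x - h x"
   have L: "?A : L2 lborel" "?B : L2 lborel" "?C : L2 lborel"
    using h f by (auto intro!: L2_diff L2_translate)
   have "L2_norm lborel (%x. ?A x + (?B x + ?C x)) <= L2_norm lborel ?A + (L2_norm lborel ?B + L2_norm lborel ?C)"
    using L2_norm_triangle[OF L(1) L2_add[OF L(2,3)]] L2_norm_triangle[OF L(2,3)] by linarith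
   moreover have "L2_norm lborel ?A = L2_norm lborel ?C"
    using L2_norm_translate[OF L2_diff[OF h f(1)[of m]], of "z n"] L2_norm_minus_commute[of lborel h "f m"] by simp
   ultimately show ?thesis using m N[OF that] by simp
  qed
  then show "\<exists>no. \<forall>n\<ge>no. norm (L2_norm lborel (%x. h (x - z n) - h x) - 0) < e" by blast
 qed
 have cont: "P f" if f: "continuous_on UNIV f" "bounded {x. f x \<noteq> 0}" for f :: "'a => real"
  unfolding P_def
 proof -
  obtain S where S: "!!x. f x \<noteq> 0 ==> norm x <= S"
   using f(2) by (auto simp: bounded_iff)
  obtain B where B: "!!x. norm (f x) <= B" using bounded_support_bounded[OF f] by metis
  have [measurable]: "f : borel_measurable borel" using f by (intro borel_measurable_continuous_onI)
  have "(%x. B * indicator (cball 0 (S + 1)) x :: real) : L2 lborel"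
   by (intro L2_cmult indicator_L2 emeasure_bounded_finite) auto
  then show "(%n. L2_norm lborel (%x. f (x - z n) - f x)) \<longlonglongrightarrow> 0"
  proof (rule L2_dominated_convergence(2)[rotated 2])
   show "AE x in lborel. norm (f (x - z n)) <= B * indicator (cball 0 (S + 1)) x" for n
   proof (intro AE_I2)
    fix x
    show "norm (f (x - z n)) <= B * indicator (cball 0 (S + 1)) x"
    proof (cases "f (x - z n) = 0")
     case False
     then have "norm x <= S + 1"
      using S[OF False] z(2)[of n] norm_triangle_ineq2[of x "z n"] by linarith
     then show ?thesis using B by simp
    next
     case True
     then show ?thesis using B[of 0] by (auto simp: indicator_def)
    qed
   qed
   show "AE x in lborel. (%n. f (x - z n)) \<longlonglongrightarrow> f x"
   proof (intro AE_I2)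
    fix x
    have "(%n. x - z n) \<longlonglongrightarrow> x - 0" by (intro tendsto_intros z)
    then show "(%n. f (x - z n)) \<longlonglongrightarrow> f x"
     using f(1) by (auto intro: continuous_on_tendsto_compose)
   qed
  qed auto
 qed
 have gm: "g : borel_measurable borel" using g by auto
 have gi: "(%x. ?i x * g x) = g" using R by (rule indicator_mult_eq)
 have "g : V"
 proof (rule L2_closed_subspace_eq[where M = M])
  show "finite_measure M" by fact
  show "sets M = sets borel" by (simp add: M_def)
  show "g : L2 M" unfolding M_def using L2_density_indicator_iff(1)[OF cb gm] g gi by simp
  show "(%x. p x + s * q x) : V" if "p : V" "q : V" for p q s
  proof -
   let ?p = "%x. ?i x * p x" and ?q = "%x. ?i x * q x"
   have L: "?p : L2 lborel" "?q : L2 lborel" "P ?p" "P ?q" using that by (auto simp: V_def)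
   have eq: "(%x. ?i x * (p x + s * q x)) = (%x. ?p x + s * ?q x)" by (auto simp: algebra_simps)
   have "P (%x. ?p x + s * ?q x)"
    unfolding P_def
   proof (rule Lim_null_comparison)
    let ?A = "%n x. ?p (x - z n) - ?p x" and ?B = "%n x. ?q (x - z n) - ?q x"
    have "L2_norm lborel (%x. (?p (x - z n) + s * ?q (x - z n)) - (?p x + s * ?q x))
     <= L2_norm lborel (?A n) + \<bar>s\<bar> * L2_norm lborel (?B n)" for n
    proof -
     have L': "?A n : L2 lborel" "?B n : L2 lborel"
      using L L2_translate[OF L(1), of "z n"] L2_translate[OF L(2), of "z n"] by (auto intro!: L2_diff)
     have "L2_norm lborel (%x. ?A n x + s * ?B n x) <= L2_norm lborel (?A n) + L2_norm lborel (%x. s * ?B n x)"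
      using L' by (intro L2_norm_triangle L2_cmult)
     moreover have "(%x. (?p (x - z n) + s * ?q (x - z n)) - (?p x + s * ?q x)) = (%x. ?A n x + s * ?B n x)"
      by (auto simp: algebra_simps)
     ultimately show ?thesis by (simp only: L2_norm_cmult)
    qed
    then show "\<forall>\<^sub>F n in sequentially. norm (L2_norm lborel (%x. (?p (x - z n) + s * ?q (x - z n)) - (?p x + s * ?q x)))
     <= L2_norm lborel (?A n) + \<bar>s\<bar> * L2_norm lborel (?B n)" by simp
    have "(%n. L2_norm lborel (?A n) + \<bar>s\<bar> * L2_norm lborel (?B n)) \<longlonglongrightarrow> 0 + \<bar>s\<bar> * 0"
     using L(3,4) unfolding P_def by (intro tendsto_intros)
    then show "(%n. L2_norm lborel (?A n) + \<bar>s\<bar> * L2_norm lborel (?B n)) \<longlonglongrightarrow> 0" by simp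
   qed
   then show ?thesis using that L(1,2) by (auto simp: V_def eq)
  qed
  show "h : V" if f: "!!n. f n : V" and h: "h : L2 M" "(%n::nat. L2_norm M (%x. f n x - h x)) \<longlonglongrightarrow> 0" for f h
  proof -
   have hm: "h : borel_measurable borel" using h by (auto simp: M_def L2_def)
   have hL: "(%x. ?i x * h x) : L2 lborel"
    using h(1) hm unfolding M_def by (simp add: L2_density_indicator_iff)
   have fm: "f n : borel_measurable borel" "(%x. ?i x * f n x) : L2 lborel" "P (%x. ?i x * f n x)" for n
    using f[of n] by (auto simp: V_def)
   have "(%n. L2_norm lborel (%x. ?i x * f n x - ?i x * h x)) \<longlonglongrightarrow> 0"
    using h(2) fm hm unfolding M_def by (simp add: L2_density_indicator_iff right_diff_distrib)
   then have "P (%x. ?i x * h x)" by (rule limP[OF hL fm(2,3)])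
   then show ?thesis using hm hL by (simp add: V_def)
  qed
  show "f : V" if f: "continuous_on UNIV f" "bounded {x. f x \<noteq> 0}" for f
  proof -
   \<comment> \<open>Cutting \<open>f\<close> off at the ball destroys continuity; the
     \<open>w n\<close> are continuous cut-offs that converge to the sharp one in
     \<open>L2\<close>.\<close>
   define w where "w n x = max 0 (1 - real n * infdist x (cball 0 R)) * f x" for n :: nat and x
   have fm: "f : borel_measurable borel" using f by (intro borel_measurable_continuous_onI)
   have wc: "continuous_on UNIV (w n)" for n
    unfolding w_def using f by (intro continuous_intros)
   have wb: "bounded {x. w n x \<noteq> 0}" for n
    by (rule bounded_subset[OF f(2)]) (auto simp: w_def)
   have wL: "w n : L2 lborel" for n
   proof -
    have "integrable lborel (%x. (norm (w n x))\<^sup>2)"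
     using wc[of n] wb[of n] by (intro integrable_bounded_support continuous_intros) (auto elim: bounded_subset)
    then show ?thesis using wc[of n] by (simp add: L2_def borel_measurable_continuous_onI)
   qed
   have fL: "f : L2 lborel"
   proof -
    have "integrable lborel (%x. (norm (f x))\<^sup>2)"
     using f by (intro integrable_bounded_support continuous_intros) (auto elim: bounded_subset)
    then show ?thesis using fm by (simp add: L2_def)
   qed
   have ifL: "(%x. ?i x * f x) : L2 lborel"
    by (rule L2_bound[OF fL, where C = 1]) (use fm in \<open>auto simp: indicator_def\<close>)
   have "(%n. L2_norm lborel (%x. w n x - ?i x * f x)) \<longlonglongrightarrow> 0"
   proof (rule L2_dominated_convergence(2)[where h = "%x. \<bar>f x\<bar>"])
    show "(%x. \<bar>f x\<bar>) : L2 lborel" by (rule L2_bound[OF fL, where C = 1]) (use fm in auto)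
    show "AE x in lborel. norm (w n x) <= \<bar>f x\<bar>" for n
    proof (intro AE_I2)
     fix x :: 'a
     have "\<bar>max 0 (1 - real n * infdist x (cball 0 R))\<bar> <= 1"
      using infdist_nonneg[of x "cball 0 R"] by (auto simp: max_def)
     from mult_right_mono[OF this, of "\<bar>f x\<bar>"]
     show "norm (w n x) <= \<bar>f x\<bar>" by (simp add: w_def abs_mult)
    qed
    show "AE x in lborel. (%n. w n x) \<longlonglongrightarrow> ?i x * f x"
    proof (intro AE_I2)
     fix x :: 'a
     show "(%n. w n x) \<longlonglongrightarrow> ?i x * f x"
     proof (cases "x : cball 0 R")
      case False
       have ne: "cball (0::'a) R \<noteq> {}" using R0 by simp
       have pos: "infdist x (cball 0 R) > 0"
        using in_closed_iff_infdist_zero[OF closed_cball ne, of x] infdist_nonneg[of x "cball 0 R"] \<open>x \<notin> cball 0 R\<close> by linarith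
       obtain N where N: "1 < real N * infdist x (cball 0 R)"
        using reals_Archimedean3[OF pos] by blast
       have "w n x = 0" if "n \<ge> N" for n
       proof -
        have "real N * infdist x (cball 0 R) <= real n * infdist x (cball 0 R)"
         using that pos by (intro mult_right_mono) auto
        with N show ?thesis by (simp add: w_def)
       qed
       then have "\<forall>\<^sub>F n in sequentially. w n x = ?i x * f x"
        using \<open>x \<notin> cball 0 R\<close> by (auto simp: eventually_sequentially)
       then show ?thesis by (rule tendsto_eventually)
     qed (simp add: w_def)
    qed
   qed (use wc[THEN borel_measurable_continuous_onI] L2_measurable[OF ifL] in auto)
   then have "P (%x. ?i x * f x)"
    by (rule limP[OF ifL wL cont[OF wc wb]])
   then show ?thesis using fm ifL by (simp add: V_def)
  qed
 qed
 then have "P (%x. ?i x * g x)" by (simp only: V_def mem_Collect_eq)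
 then show ?thesis unfolding gi P_def .
qed

lemma L2_bounded_support_integrable:
 fixes g :: "'a::euclidean_space => real"
 assumes "g : L2 lborel" "bounded {x. g x \<noteq> 0}"
 shows "integrable lborel g"
proof -
 obtain R where R: "!!x. g x \<noteq> 0 ==> x : cball 0 R"
  using assms(2) by (auto simp: bounded_iff)
 have "(indicator (cball 0 R) :: 'a => real) : L2 lborel"
  by (intro indicator_L2 emeasure_bounded_finite) auto
 then have "integrable lborel (%x. indicator (cball 0 R) x * g x)"
  using assms by (intro L2_mult_integrable)
 also have "(%x. indicator (cball 0 R) x * g x) = g"
  using R by (rule indicator_mult_eq)
 finally show ?thesis .
qed

lemma L2_translation_continuous:
 fixes g :: "'a::euclidean_space => real"
 assumes g: "g : L2 lborel" "bounded {x. g x \<noteq> 0}" and e: "e > 0"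
 obtains d where "d > 0" "!!z. norm z < d ==> L2_norm lborel (%x. g (x - z) - g x) < e"
proof -
 have "\<exists>d>0. \<forall>z. norm z < d --> L2_norm lborel (%x. g (x - z) - g x) < e"
 proof (rule ccontr)
  assume "\<not> ?thesis"
  then have "\<forall>d>0. \<exists>z. norm z < d \<and> L2_norm lborel (%x. g (x - z) - g x) \<ge> e"
   by (meson not_less)
  then have "\<exists>z. norm z < 1 / real (Suc n) \<and> L2_norm lborel (%x. g (x - z) - g x) \<ge> e" for n
   by simp
  then obtain z where z: "!!n. norm (z n) < 1 / real (Suc n)"
   and ze: "!!n. L2_norm lborel (%x. g (x - z n) - g x) \<ge> e"
   by metis
  have "(%n. 1 / real (Suc n)) \<longlonglongrightarrow> 0"
   using LIMSEQ_inverse_real_of_nat by (simp add: divide_inverse)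
  then have "z \<longlonglongrightarrow> 0"
   by (rule Lim_null_comparison[rotated]) (use z in \<open>auto intro!: always_eventually less_imp_le\<close>)
  moreover have "norm (z n) <= 1" for n
  proof -
   have "1 / real (Suc n) <= 1" by simp
   with z[of n] show ?thesis by linarith
  qed
  ultimately have "(%n. L2_norm lborel (%x. g (x - z n) - g x)) \<longlonglongrightarrow> 0"
   by (intro L2_translation_continuous_seq g)
  then have "e <= 0" using ze by (intro tendsto_lowerbound) auto
  with e show False by simp
 qed
 then show thesis using that by blast
qed

lemma conv_kernel_L2:
 assumes "kernel_at a dl k" "g : L2 lborel" "bounded {x. g x \<noteq> 0}"
 shows "conv k g : L2 lborel"
proof -
 have "(%x. conv k g x - g x) : L2 lborel"
 proof (rule conv_kernel_error_le(1)[OF assms(1) L2_bounded_support_integrable[OF assms(2,3)] assms(2)])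
  show "L2_norm lborel (%x. g (x - z) - g x) <= 2 * L2_norm lborel g" for z
   using L2_norm_diff_le[OF L2_translate[OF assms(2)] assms(2), of z] by (simp add: L2_norm_translate assms)
 qed simp
 from L2_add[OF this assms(2)] show ?thesis by simp
qed

lemma conv_kernel_tendsto:
 fixes g :: "'a::euclidean_space => real"
 assumes g: "g : L2 lborel" "bounded {x. g x \<noteq> 0}"
  and k: "!!n. kernel_at (a n) (dl n) (k n)" and lim: "(%n. norm (a n) + dl n) \<longlonglongrightarrow> 0"
 shows "(%n. L2_norm lborel (%x. conv (k n) g x - g x)) \<longlonglongrightarrow> 0"
proof (rule LIMSEQ_I)
 fix e :: real assume e: "e > 0"
 obtain d where d: "d > 0" "!!z. norm z < d ==> L2_norm lborel (%x. g (x - z) - g x) < e/2"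
  using L2_translation_continuous[OF g, of "e/2"] e by auto
 obtain N where N: "!!n. n \<ge> N ==> norm (a n) + dl n < d"
  using order_tendstoD(2)[OF lim d(1)] by (auto simp: eventually_sequentially)
 have "L2_norm lborel (%x. conv (k n) g x - g x) <= e/2" if "n \<ge> N" for n
 proof (rule conv_kernel_error_le(2)[OF k L2_bounded_support_integrable[OF g] g(1)])
  fix z assume "dist z (a n) < dl n"
  then have "norm z < d" using N[OF that] norm_triangle_ineq2[of z "a n"] by (simp add: dist_norm)
  then show "L2_norm lborel (%x. g (x - z) - g x) <= e/2" using d(2)[of z] by simp
 qed (use e in simp)
 then show "\<exists>no. \<forall>n\<ge>no. norm (L2_norm lborel (%x. conv (k n) g x - g x) - 0) < e"
  using e by (intro exI[of _ N]) force
qed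

section \<open>Functions on the domain and their Borel representatives on the whole space\<close>

lemma AE_lebesgue_on_iff:
 assumes "Om : sets borel"
 shows "(AE x in lebesgue_on Om. P x) \<longleftrightarrow> (AE x in lborel. x : Om --> P x)"
 using assms by (subst AE_restrict_space_iff) (auto simp: AE_completion_iff)

lemma borel_measurable_lebesgue_onI:
 "f : borel_measurable borel ==> f : borel_measurable (lebesgue_on Om)"
 by (intro measurable_restrict_space1 measurable_completion) simp

lemma integral_lebesgue_on_borel:
 fixes h :: "'a::euclidean_space => real"
 assumes "Om : sets borel" "h : borel_measurable borel" "!!x. x \<notin> Om ==> h x = 0"
 shows "(LINT x|lebesgue_on Om. h x) = (LINT x|lborel. h x)"
  and "integrable (lebesgue_on Om) h \<longleftrightarrow> integrable lborel h"
proof -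
 have eq: "(%x. indicator Om x * h x) = h"
  using assms(3) by (intro indicator_mult_eq) blast
 show "(LINT x|lebesgue_on Om. h x) = (LINT x|lborel. h x)"
  using assms by (subst integral_restrict_space) (auto simp: eq integral_completion)
 show "integrable (lebesgue_on Om) h \<longleftrightarrow> integrable lborel h"
  using assms by (subst integrable_restrict_space) (auto simp: eq integrable_completion)
qed

lemma L2_lebesgue_on_borel_iff:
 fixes f :: "'a::euclidean_space => 'b::euclidean_space"
 assumes "Om : sets borel" "f : borel_measurable borel" "!!x. x \<notin> Om ==> f x = 0"
 shows "f : L2 (lebesgue_on Om) \<longleftrightarrow> f : L2 lborel"
 using integral_lebesgue_on_borel(2)[of Om "%x. (norm (f x))\<^sup>2"] assms borel_measurable_lebesgue_onI[OF assms(2), of Om]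
 by (simp add: L2_def)

lemma L2_inner_lebesgue_on_borel:
 fixes f g :: "'a::euclidean_space => 'b::euclidean_space"
 assumes "Om : sets borel" "f : borel_measurable borel" "g : borel_measurable borel"
  "!!x. x \<notin> Om ==> f x \<bullet> g x = 0"
 shows "L2_inner (lebesgue_on Om) f g = L2_inner lborel f g"
 unfolding L2_inner_def using assms by (intro integral_lebesgue_on_borel) auto

lemma L2_norm_lebesgue_on_borel:
 fixes f :: "'a::euclidean_space => 'b::euclidean_space"
 assumes "Om : sets borel" "f : borel_measurable borel" "!!x. x \<notin> Om ==> f x = 0"
 shows "L2_norm (lebesgue_on Om) f = L2_norm lborel f"
 unfolding L2_norm_def using assms by (subst L2_inner_lebesgue_on_borel) auto

text \<open>Elements of \<open>L2\<close> on \<open>Om\<close> are only Lebesgue measurable and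
  arbitrary outside \<open>Om\<close>, whereas translation and convolution work with Borel functions
  on the whole space. Each component is exchanged for a Borel function that agrees with it almost
  everywhere, and the result is cut off outside \<open>Om\<close>.\<close>

lemma lebesgue_on_borel_rep:
 fixes f :: "'a::euclidean_space => 'b::euclidean_space"
 assumes Om: "Om : sets borel" and f: "f : borel_measurable (lebesgue_on Om)"
 obtains f' where "f' : borel_measurable borel" "!!x. x \<notin> Om ==> f' x = 0" "AE x in lebesgue_on Om. f' x = f x"
proof -
 define F where "F x = indicator Om x *\<^sub>R f x" for x
 have F: "F : borel_measurable lebesgue"
  using f Om borel_measurable_restrict_space_iff[of Om lebesgue f] by (simp add: F_def[abs_def])
 have "\<exists>h\<in>borel_measurable lborel. AE x in lborel. F x \<bullet> i = h x" for i
  by (intro completion_ex_borel_measurable_real borel_measurable_inner F borel_measurable_const)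
 then obtain h where h: "!!i. h i : borel_measurable lborel" "!!i. AE x in lborel. F x \<bullet> i = h i x"
  by metis
 note [measurable] = h(1) Om
 define f' where "f' x = indicator Om x *\<^sub>R (\<Sum>i\<in>Basis. h i x *\<^sub>R i)" for x
 have "AE x in lborel. \<forall>i\<in>Basis. F x \<bullet> i = h i x"
  by (intro AE_finite_allI h) simp
 then have "AE x in lborel. x : Om --> f' x = f x"
 proof eventually_elim
  case (elim x)
  show ?case
  proof
   assume x: "x : Om"
   have "(\<Sum>i\<in>Basis. h i x *\<^sub>R i) = (\<Sum>i\<in>Basis. (F x \<bullet> i) *\<^sub>R i)"
    using elim by (intro sum.cong) auto
   then show "f' x = f x" using x by (simp add: f'_def F_def euclidean_representation)
  qed
 qed
 moreover have "f' : borel_measurable borel" unfolding f'_def[abs_def] by measurable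
 ultimately show thesis
  by (intro that[of f']) (auto simp: AE_lebesgue_on_iff[OF Om] f'_def)
qed

lemma L2_lebesgue_on_rep:
 fixes f :: "'a::euclidean_space => 'b::euclidean_space"
 assumes Om: "Om : sets borel" and f: "f : L2 (lebesgue_on Om)"
 obtains f' where "f' : borel_measurable borel" "!!x. x \<notin> Om ==> f' x = 0" "AE x in lebesgue_on Om. f' x = f x"
  "f' : L2 lborel" "L2_norm lborel f' = L2_norm (lebesgue_on Om) f"
  "!!g. g : borel_measurable borel ==> L2_inner (lebesgue_on Om) f g = L2_inner lborel f' g"
proof -
 obtain f' where f': "f' : borel_measurable borel" "!!x. x \<notin> Om ==> f' x = 0" "AE x in lebesgue_on Om. f' x = f x"
  by (rule lebesgue_on_borel_rep[OF Om L2_measurable[OF f]]) (rule that)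
 have m: "f' : borel_measurable (lebesgue_on Om)" by (rule borel_measurable_lebesgue_onI[OF f'(1)])
 have ae: "AE x in lebesgue_on Om. f x = f' x" using f'(3) by eventually_elim simp
 show thesis
 proof (rule that[OF f'])
  show "f' : L2 lborel"
   using L2_cong_AE[OF f m ae] L2_lebesgue_on_borel_iff[OF Om f'(1,2)] by simp
  show "L2_norm lborel f' = L2_norm (lebesgue_on Om) f"
   using L2_norm_cong_AE[OF f'(3) m L2_measurable[OF f]] L2_norm_lebesgue_on_borel[OF Om f'(1,2)] by simp
  show "L2_inner (lebesgue_on Om) f g = L2_inner lborel f' g" if "g : borel_measurable borel" for g
  proof -
   have "L2_inner (lebesgue_on Om) f g = L2_inner (lebesgue_on Om) f' g"
    using f m borel_measurable_lebesgue_onI[OF that, of Om] by (intro L2_inner_cong_AE ae) auto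
   then show ?thesis using L2_inner_lebesgue_on_borel[OF Om f'(1) that] f'(2) by simp
  qed
 qed
qed

section \<open>Test functions and increments of smooth functions\<close>

lemma test_functionsD:
 assumes "ps : test_functions Om"
 shows "smooth ps" "bounded {x. ps x \<noteq> 0}" "!!x. x \<notin> Om ==> ps x = 0" "!!x. x \<notin> Om ==> grad ps x = 0"
  "ps : borel_measurable borel" "grad ps : borel_measurable borel" "bounded {x. grad ps x \<noteq> 0}"
proof -
 have *: "smooth ps" "compact (closure {x. ps x \<noteq> 0})" "closure {x. ps x \<noteq> 0} \<subseteq> Om"
  using assms by (auto simp: test_functions_def)
 show "smooth ps" "bounded {x. ps x \<noteq> 0}"
  using * by (auto intro: bounded_subset[OF compact_imp_bounded closure_subset])
 then show "bounded {x. grad ps x \<noteq> 0}" by (intro bounded_support_grad)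
 show "ps x = 0" "grad ps x = 0" if "x \<notin> Om" for x
  using * that closure_subset[of "{x. ps x \<noteq> 0}"] grad_eq_0_outside_support[of x ps] by blast+
 show "ps : borel_measurable borel" "grad ps : borel_measurable borel"
  using * by (auto intro: smooth_measurable smooth_grad_measurable)
qed

lemma test_functionsI:
 assumes "smooth ps" "compact K" "K \<subseteq> Om" "!!x. ps x \<noteq> 0 ==> x : K"
 shows "ps : test_functions Om"
proof -
 have "closure {x. ps x \<noteq> 0} \<subseteq> K"
  using assms compact_imp_closed by (intro closure_minimal) auto
 moreover from this have "compact (closure {x. ps x \<noteq> 0})"
  using assms(2) by (metis closed_closure compact_Int_closed inf.absorb_iff2)
 ultimately show ?thesis using assms by (auto simp: test_functions_def)
qed

lemma test_functions_comb:
 assumes "ps : test_functions Om" "\<phi> : test_functions Om"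
 shows "(%x. ps x + s * \<phi> x) : test_functions Om"
proof (rule test_functionsI)
 let ?K = "closure {x. ps x \<noteq> 0} \<union> closure {x. \<phi> x \<noteq> 0}"
 show "compact ?K" "?K \<subseteq> Om" using assms by (auto simp: test_functions_def)
 show "x : ?K" if "ps x + s * \<phi> x \<noteq> 0" for x
  using that closure_subset[of "{x. ps x \<noteq> 0}"] closure_subset[of "{x. \<phi> x \<noteq> 0}"] by fastforce
 show "smooth (%x. ps x + s * \<phi> x)"
  using assms by (intro smooth_add smooth_mult smooth_const) (simp_all add: test_functions_def)
qed

lemma test_functions_mult:
 assumes "ps : test_functions Om" "smooth \<theta>"
 shows "(%x. \<theta> x * ps x) : test_functions Om"
proof (rule test_functionsI)
 let ?K = "closure {x. ps x \<noteq> 0}"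
 show "compact ?K" "?K \<subseteq> Om" using assms by (auto simp: test_functions_def)
 show "x : ?K" if "\<theta> x * ps x \<noteq> 0" for x
  using that closure_subset[of "{x. ps x \<noteq> 0}"] by fastforce
 show "smooth (%x. \<theta> x * ps x)"
  using assms by (intro smooth_mult) (simp_all add: test_functions_def)
qed

lemma bounded_support_L2:
 fixes f :: "'a::euclidean_space => 'b::euclidean_space"
 assumes "continuous_on UNIV f" "bounded {x. f x \<noteq> 0}"
 shows "f : L2 lborel"
proof -
 have "integrable lborel (%x. (norm (f x))\<^sup>2)"
  using assms by (intro integrable_bounded_support continuous_intros) (auto elim: bounded_subset)
 then show ?thesis using assms by (simp add: L2_def borel_measurable_continuous_onI)
qed

lemma test_functions_L2:
 assumes "ps : test_functions Om"
 shows "ps : L2 lborel" "grad ps : L2 lborel"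
 using test_functionsD[OF assms]
 by (auto intro!: bounded_support_L2 smooth_continuous smooth_grad_continuous)

text \<open>With \<open>B\<close> the indicator of a large ball, \<open>conv f B\<close> is constant
  near 0, its value being the integral of \<open>f\<close>. Its gradient at 0 therefore vanishes,
  and \<open>grad_conv\<close> identifies that gradient with the integral of \<open>grad f\<close>.
  This replaces integration in one variable at a time.\<close>

lemma integral_grad_eq_0:
 fixes f :: "'a::euclidean_space => real"
 assumes f: "smooth f" "bounded {x. f x \<noteq> 0}" and i: "i : Basis"
 shows "(LINT x|lborel. grad f x \<bullet> i) = 0"
proof -
 obtain R where R: "!!x. x : {x. f x \<noteq> 0} \<union> {x. grad f x \<noteq> 0} ==> norm x <= R"
  using bounded_support_grad[OF f(2)] f(2) by (metis bounded_Un bounded_iff)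
 define B where "B = (indicator (cball 0 (R + 1)) :: 'a => real)"
 have B: "integrable lborel B"
  unfolding B_def using emeasure_bounded_finite[of "cball (0::'a) (R + 1)"] by (simp add: integrable_indicator_iff)
 have [measurable]: "f : borel_measurable borel" "grad f : borel_measurable borel"
  using f by (auto intro: smooth_measurable smooth_grad_measurable)
 have const: "conv f B x = integral\<^sup>L lborel f" if "x : ball 0 1" for x
 proof -
  have "f (x - y) * B y = f (x - y)" for y
  proof (cases "f (x - y) = 0")
   case False
   then have "norm y <= R + 1"
    using R[of "x - y"] that norm_triangle_ineq2[of y x] by (simp add: norm_minus_commute)
   then show ?thesis by (simp add: B_def)
  qed simp
  then have "conv f B x = (LINT y|lborel. f (x - y))" by (simp only: conv_def)
  also have "\<dots> = integral\<^sup>L lborel f" by (rule integral_reflect) measurable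
  finally show ?thesis .
 qed
 have "(conv f B has_derivative (%h. 0 \<bullet> h)) (at 0)"
  by (rule has_derivative_transform_within_open[of "%x. integral\<^sup>L lborel f" _ _ _ "ball 0 1"])
   (auto simp: const)
 then have "grad (conv f B) 0 = 0" by (rule grad_eqI)
 then have "0 = grad (conv f B) 0 \<bullet> i" by simp
 also have "\<dots> = conv (%z. grad f z \<bullet> i) B 0"
  by (rule grad_conv[OF f B i])
 also have "\<dots> = (LINT y|lborel. grad f (0 - y) \<bullet> i)"
 proof -
  have "(grad f (0 - y) \<bullet> i) * B y = grad f (0 - y) \<bullet> i" for y
   using R[of "- y"] by (cases "grad f (- y) = 0") (auto simp: B_def)
  then show ?thesis by (simp only: conv_def)
 qed
 also have "\<dots> = (LINT x|lborel. grad f x \<bullet> i)"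
  by (rule integral_reflect) measurable
 finally show ?thesis by simp
qed

lemma smooth_increment_le:
 fixes ps :: "'a::euclidean_space => real"
 assumes "smooth ps"
 shows "ennreal ((ps (x + h) - ps x)\<^sup>2) \<le>
  (\<integral>\<^sup>+t. ennreal (indicator {0..1} t * (grad ps (x + t *\<^sub>R h) \<bullet> h)\<^sup>2) \<partial>lborel)"
proof -
 let ?w = "%t. grad ps (x + t *\<^sub>R h) \<bullet> h"
 have cont: "continuous_on UNIV ?w"
  by (intro continuous_intros continuous_on_compose2[OF smooth_grad_continuous[OF assms, of UNIV]]) auto
 have deriv: "((%t. ps (x + t *\<^sub>R h)) has_real_derivative ?w t) (at t)" for t
 proof -
  have "((%t. ps (x + t *\<^sub>R h)) has_derivative (%s. grad ps (x + t *\<^sub>R h) \<bullet> (s *\<^sub>R h))) (at t)"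
   by (rule has_derivative_compose[OF _ smooth_has_derivative[OF assms]]) (auto intro!: derivative_eq_intros)
  then show ?thesis by (simp add: has_field_derivative_def mult_commute_abs)
 qed
 have FTC: "(LBINT t. ?w t * indicator {0..1} t) = ps (x + 1 *\<^sub>R h) - ps (x + 0 *\<^sub>R h)"
  by (rule integral_FTC_Icc_real) (use deriv cont in \<open>auto simp: continuous_on_eq_continuous_at\<close>)
 have "integrable lborel (%t. indicator {0..1} t *\<^sub>R ?w t)"
  by (intro borel_integrable_compact continuous_on_subset[OF cont]) auto
 then have "ennreal ((LBINT t. indicator {0..1} t * ?w t)\<^sup>2) <= (\<integral>\<^sup>+t. ennreal (indicator {0..1} t * (?w t)\<^sup>2) \<partial>lborel)"
  using cont by (intro weighted_Jensen_square) (auto intro: borel_measurable_continuous_onI)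
 also have "(LBINT t. indicator {0..1} t * ?w t) = ps (x + h) - ps x"
  using FTC by (simp add: mult.commute)
 finally show ?thesis .
qed

text \<open>The increment is the integral of the derivative along the segment; Jensen's inequality
  on the unit interval, Tonelli's theorem and translation invariance for each \<open>t\<close> leave
  the factor \<open>norm z\<close>.\<close>

lemma smooth_translation_le:
 fixes ps :: "'a::euclidean_space => real"
 assumes ps: "smooth ps" "bounded {x. ps x \<noteq> 0}"
 shows "L2_norm lborel (%x. ps (x - z) - ps x) <= norm z * L2_norm lborel (grad ps)"
proof -
 have [measurable]: "ps : borel_measurable borel" "grad ps : borel_measurable borel"
  using ps by (auto intro: smooth_measurable smooth_grad_measurable)
 have gL: "grad ps : L2 lborel"
  using ps by (intro bounded_support_L2 smooth_grad_continuous bounded_support_grad)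
 let ?h = "- z"
 have "(\<integral>\<^sup>+x. ennreal ((ps (x - z) - ps x)\<^sup>2) \<partial>lborel) \<le>
  (\<integral>\<^sup>+x. \<integral>\<^sup>+t. ennreal (indicator {0..1} t * (grad ps (x + t *\<^sub>R ?h) \<bullet> ?h)\<^sup>2) \<partial>lborel \<partial>lborel)"
  using smooth_increment_le[OF ps(1), of _ ?h] by (intro nn_integral_mono) simp
 also have "\<dots> = (\<integral>\<^sup>+t. \<integral>\<^sup>+x. ennreal (indicator {0..1::real} t * (grad ps (x + t *\<^sub>R ?h) \<bullet> ?h)\<^sup>2) \<partial>lborel \<partial>lborel)"
  by (rule lborel_pair.Fubini') measurable
 also have "\<dots> <= (\<integral>\<^sup>+t. indicator {0..1::real} t * ennreal ((norm z * L2_norm lborel (grad ps))\<^sup>2) \<partial>lborel)"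
 proof (intro nn_integral_mono)
  fix t :: real
  have "(\<integral>\<^sup>+x. ennreal ((grad ps (x + t *\<^sub>R ?h) \<bullet> ?h)\<^sup>2) \<partial>lborel) = (\<integral>\<^sup>+x. ennreal ((grad ps (x - t *\<^sub>R z) \<bullet> ?h)\<^sup>2) \<partial>lborel)"
   by simp
  also have "\<dots> = (\<integral>\<^sup>+x. ennreal ((grad ps x \<bullet> ?h)\<^sup>2) \<partial>lborel)"
   by (rule nn_integral_translate[of "%x. ennreal ((grad ps x \<bullet> ?h)\<^sup>2)"]) measurable
  also have "\<dots> <= (\<integral>\<^sup>+x. ennreal ((norm z)\<^sup>2) * ennreal ((norm (grad ps x))\<^sup>2) \<partial>lborel)"
  proof (intro nn_integral_mono)
   fix x
   have "(grad ps x \<bullet> ?h)\<^sup>2 <= (norm z * norm (grad ps x))\<^sup>2"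
    using Cauchy_Schwarz_ineq2[of "grad ps x" ?h] by (intro abs_le_square_iff[THEN iffD1]) (simp add: mult.commute)
   then show "ennreal ((grad ps x \<bullet> ?h)\<^sup>2) <= ennreal ((norm z)\<^sup>2) * ennreal ((norm (grad ps x))\<^sup>2)"
    by (simp add: power_mult_distrib flip: ennreal_mult)
  qed
  also have "\<dots> = ennreal ((norm z * L2_norm lborel (grad ps))\<^sup>2)"
   using L2_norm_nn_integral[OF gL] by (simp add: nn_integral_cmult power_mult_distrib ennreal_mult)
  finally show "(\<integral>\<^sup>+x. ennreal (indicator {0..1} t * (grad ps (x + t *\<^sub>R ?h) \<bullet> ?h)\<^sup>2) \<partial>lborel)
    <= indicator {0..1} t * ennreal ((norm z * L2_norm lborel (grad ps))\<^sup>2)"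
   by (cases "t : {0..1}") auto
 qed
 also have "\<dots> = ennreal ((norm z * L2_norm lborel (grad ps))\<^sup>2)"
  by (simp add: nn_integral_multc)
 finally have "(\<integral>\<^sup>+x. ennreal ((norm (ps (x - z) - ps x))\<^sup>2) \<partial>lborel) <= ennreal ((norm z * L2_norm lborel (grad ps))\<^sup>2)"
  by simp
 then show ?thesis by (intro L2_normI(2)) auto
qed

lemma kernel_test_function:
 assumes "kernel_at a dl k" "cball (x - a) dl \<subseteq> Om"
 shows "(%y. k (x - y)) : test_functions Om"
proof (rule test_functionsI)
 show "y : cball (x - a) dl" if "k (x - y) \<noteq> 0" for y
 proof -
  have "dist (x - y) a < dl" using assms(1) that by (auto simp: kernel_at_def)
  moreover have "dist (x - a) y = dist (x - y) a" by (simp add: dist_norm algebra_simps)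
  ultimately show ?thesis by simp
 qed
qed (use assms in \<open>auto simp: kernel_at_def intro: smooth_reflect\<close>)

section \<open>Weak gradients on a bounded open set\<close>

locale bounded_open_set =
 fixes Om :: "'a::euclidean_space set"
 assumes open_domain: "open Om" and bounded_domain: "bounded Om"
begin

abbreviation "LO \<equiv> lebesgue_on Om"

lemma domain_borel [simp, measurable]: "Om : sets borel"
 using open_domain by (rule borel_open)

lemma domain_ne_UNIV: "- Om \<noteq> {}"
 using bounded_domain not_bounded_UNIV by (metis Compl_empty_eq double_complement)

lemma finite_measure_LO: "finite_measure LO"
 using bounded_domain by (intro finite_measure_lebesgue_on bounded_set_imp_lmeasurable) auto

lemma continuous_bounded_domain:
 fixes f :: "'a => 'b::real_normed_vector"
 assumes "continuous_on UNIV f"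
 obtains B where "B > 0" "!!x. x : Om ==> norm (f x) <= B"
proof -
 have "bounded (f ` closure Om)"
  using bounded_domain assms
  by (intro compact_imp_bounded compact_continuous_image) (auto simp: compact_closure intro: continuous_on_subset)
 then show thesis
  using that closure_subset[of Om] by (auto simp: bounded_pos)
qed

lemma L2_mult_continuous:
 fixes f :: "'a => 'b::euclidean_space"
 assumes "f : L2 LO" "continuous_on UNIV h"
 shows "(%x. h x *\<^sub>R f x) : L2 LO"
proof -
 obtain B where B: "!!x. x : Om ==> norm (h x) <= B"
  using continuous_bounded_domain[OF assms(2)] by metis
 show ?thesis
  by (rule L2_mult_bounded[OF assms(1), where C = B])
   (use B assms(2) in \<open>auto intro: borel_measurable_lebesgue_onI borel_measurable_continuous_onI\<close>)
qed

lemma L2_mult_continuous_vector: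
 fixes f :: "'a => real" and h :: "'a => 'b::euclidean_space"
 assumes "f : L2 LO" "continuous_on UNIV h"
 shows "(%x. f x *\<^sub>R h x) : L2 LO"
proof -
 obtain B where B: "!!x. x : Om ==> norm (h x) <= B"
  using continuous_bounded_domain[OF assms(2)] by metis
 have [measurable]: "f : borel_measurable LO" "h : borel_measurable LO"
  using assms by (auto intro: borel_measurable_lebesgue_onI borel_measurable_continuous_onI)
 show ?thesis
  by (rule L2_bound[OF assms(1), where C = B])
   (use B in \<open>auto intro!: AE_I2 simp: mult.commute[of B] mult_left_mono\<close>)
qed

lemma continuous_L2:
 fixes f :: "'a => 'b::euclidean_space"
 assumes "continuous_on UNIV f"
 shows "f : L2 LO"
proof -
 obtain B where B: "!!x. x : Om ==> norm (f x) <= B"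
  using continuous_bounded_domain[OF assms] by metis
 show ?thesis
  by (rule finite_measure.L2_bounded[OF finite_measure_LO, where B = B])
   (use B assms in \<open>auto intro: borel_measurable_lebesgue_onI borel_measurable_continuous_onI\<close>)
qed

lemma smooth_L2: "smooth f ==> f : L2 LO" and smooth_grad_L2: "smooth f ==> grad f : L2 LO"
 by (auto intro: continuous_L2 smooth_continuous smooth_grad_continuous)

lemma test_L2_LO:
 assumes "ps : test_functions Om"
 shows "ps : L2 LO" "grad ps : L2 LO"
 using test_functionsD[OF assms] by (auto intro: smooth_L2 smooth_grad_L2)

lemma L2_zero_outside_bounded:
 assumes "!!x. x \<notin> Om ==> g x = (0::real)"
 shows "bounded {x. g x \<noteq> 0}"
 using assms by (intro bounded_subset[OF bounded_domain]) auto

text \<open>At a point whose distance to the complement exceeds the scale, mollification is a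
  pairing with a test function, hence 0. The mollifications thus vanish eventually on each set
  \<open>infdist x (- Om) > 1 / Suc m\<close>, and so does their \<open>L2\<close> limit
  \<open>g'\<close>.\<close>

lemma L2_orthogonal_test_functions:
 fixes g :: "'a => real"
 assumes g: "g : L2 LO" and 0: "!!ps. ps : test_functions Om ==> L2_inner LO g ps = 0"
 shows "AE x in LO. g x = 0"
proof -
 obtain g' where g': "g' : borel_measurable borel" "!!x. x \<notin> Om ==> g' x = 0" "AE x in LO. g' x = g x"
  "g' : L2 lborel" "!!ps. ps : borel_measurable borel ==> L2_inner LO g ps = L2_inner lborel g' ps"
  by (rule L2_lebesgue_on_rep[OF domain_borel g]) blast
 note [measurable] = g'(1)
 have bs: "bounded {x. g' x \<noteq> 0}" by (rule L2_zero_outside_bounded[OF g'(2)])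
 have "\<forall>n. \<exists>k. kernel_at (0::'a) (1 / real (Suc n)) k"
  using kernel_exists[of "1 / real (Suc _)" "0::'a"] by (metis of_nat_0_less_iff zero_less_Suc zero_less_divide_1_iff)
 then obtain k where k: "!!n. kernel_at (0::'a) (1 / real (Suc n)) (k n)" by metis
 have lim: "(%n. L2_norm lborel (%x. conv (k n) g' x - g' x)) \<longlonglongrightarrow> 0"
 proof (rule conv_kernel_tendsto[OF g'(4) bs k])
  show "(%n. norm (0::'a) + 1 / real (Suc n)) \<longlonglongrightarrow> 0"
   using LIMSEQ_inverse_real_of_nat by (simp add: divide_inverse)
 qed
 have zero: "conv (k n) g' x = 0" if "infdist x (- Om) > 1 / real (Suc n)" for n x
 proof -
  have "cball (x - 0) (1 / real (Suc n)) \<subseteq> Om"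
  proof
   fix y assume y: "y : cball (x - 0) (1 / real (Suc n))"
   show "y : Om"
   proof (rule ccontr)
    assume "y \<notin> Om"
    then have "infdist x (- Om) <= dist x y" by (intro infdist_le) auto
    with y that show False by simp
   qed
  qed
  from kernel_test_function[OF k this]
  have t: "(%y. k n (x - y)) : test_functions Om" .
  have "L2_inner lborel g' (%y. k n (x - y)) = 0"
   using 0[OF t] g'(5)[OF test_functionsD(5)[OF t]] by simp
  then show ?thesis by (simp add: conv_def L2_inner_def mult.commute)
 qed
 define h where "h m x = (if infdist x (- Om) > 1 / real (Suc m) then g' x else 0)" for m x
 have hm[measurable]: "h m : borel_measurable borel" for m
  unfolding h_def[abs_def] using borel_measurable_continuous_onI[OF continuous_on_infdist[OF continuous_on_id, of UNIV "- Om"]]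
  by measurable
 have hL: "h m : L2 lborel" for m
  by (rule L2_bound[OF g'(4), where C = 1]) (auto simp: h_def)
 have "L2_norm lborel (h m) = 0" for m
 proof -
  have "L2_norm lborel (h m) <= 0"
  proof (rule tendsto_lowerbound[OF lim])
   have "L2_norm lborel (h m) <= L2_norm lborel (%x. conv (k n) g' x - g' x)" if "n \<ge> m" for n
   proof -
    have L: "(%x. conv (k n) g' x - g' x) : L2 lborel"
     by (intro L2_diff conv_kernel_L2[OF k] g' bs)
    have "1 / real (Suc n) <= 1 / real (Suc m)" using that by (simp add: frac_le)
    then have "norm (h m x) <= 1 * norm (conv (k n) g' x - g' x)" for x
     using zero[of n x] by (auto simp: h_def)
    then show ?thesis
     using L2_norm_mono[OF L, of "h m" 1] by simp
   qed
   then show "\<forall>\<^sub>F n in sequentially. L2_norm lborel (h m) <= L2_norm lborel (%x. conv (k n) g' x - g' x)"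
    by (auto simp: eventually_sequentially)
  qed simp
  then show ?thesis by (simp add: order_antisym)
 qed
 then have "AE x in lborel. h m x = 0" for m
  using L2_norm_eq_0_iff[OF hL] by simp
 then have "AE x in lborel. \<forall>m. h m x = 0"
  by (simp add: AE_all_countable)
 then have "AE x in lborel. x : Om --> g' x = 0"
 proof eventually_elim
  case (elim x)
  show ?case
  proof
   assume "x : Om"
   then have "infdist x (- Om) > 0"
    using in_closed_iff_infdist_zero[of "- Om" x] open_domain domain_ne_UNIV infdist_nonneg[of x "- Om"]
    by (auto simp: closed_def order_less_le)
   then obtain m where "1 / real (Suc m) < infdist x (- Om)"
    using nat_approx_posE by metis
   then show "g' x = 0" using elim[rule_format, of m] by (simp add: h_def)
  qed
 qed
 then have "AE x in LO. g' x = 0" by (simp add: AE_lebesgue_on_iff)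
 with g'(3) show ?thesis by eventually_elim simp
qed

lemma smooth_integration_by_parts:
 assumes zt: "smooth zt" and ps: "ps : test_functions Om" and i: "i : Basis"
 shows "L2_inner LO zt (%x. grad ps x \<bullet> i) = - L2_inner LO (%x. grad zt x \<bullet> i) ps"
proof -
 note psD = test_functionsD[OF ps]
 have t: "(%x. zt x * ps x) : test_functions Om" by (rule test_functions_mult[OF ps zt])
 note tD = test_functionsD[OF t]
 have "0 = (LINT x|lborel. grad (%x. zt x * ps x) x \<bullet> i)"
  using integral_grad_eq_0[OF tD(1,2) i] by simp
 also have "\<dots> = (LINT x|LO. grad (%x. zt x * ps x) x \<bullet> i)"
  using tD(4,6) by (intro integral_lebesgue_on_borel(1)[symmetric]) auto
 also have "\<dots> = (LINT x|LO. zt x * (grad ps x \<bullet> i) + (grad zt x \<bullet> i) * ps x)"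
  by (intro Bochner_Integration.integral_cong refl) (subst grad_mult[OF zt psD(1)], simp add: inner_add_left mult.commute)
 also have "\<dots> = (LINT x|LO. zt x * (grad ps x \<bullet> i)) + (LINT x|LO. (grad zt x \<bullet> i) * ps x)"
  by (intro Bochner_Integration.integral_add L2_mult_integrable smooth_L2 smooth_grad_component zt psD(1) i)
 finally show ?thesis by (simp add: L2_inner_def)
qed

lemma is_weak_grad_smooth: "smooth zt ==> is_weak_grad Om zt (grad zt)"
 by (simp add: is_weak_grad_def smooth_grad_L2 smooth_integration_by_parts)

lemma is_weak_grad_unique:
 assumes "is_weak_grad Om v G" "is_weak_grad Om v H"
 shows "AE x in LO. G x = H x"
proof -
 have L: "G : L2 LO" "H : L2 LO" using assms by (auto simp: is_weak_grad_def)
 have "AE x in LO. G x \<bullet> i - H x \<bullet> i = 0" if i: "i : Basis" for i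
 proof (rule L2_orthogonal_test_functions)
  show "(%x. G x \<bullet> i - H x \<bullet> i) : L2 LO" using L by auto
  show "L2_inner LO (%x. G x \<bullet> i - H x \<bullet> i) ps = 0" if "ps : test_functions Om" for ps
   using assms i that L test_L2_LO[OF that]
   by (simp add: L2_inner_diff_left L2_component) (simp add: is_weak_grad_def)
 qed
 then have "AE x in LO. \<forall>i\<in>Basis. G x \<bullet> i - H x \<bullet> i = 0"
  by (intro AE_finite_allI) auto
 then show ?thesis by eventually_elim (auto intro: euclidean_eqI)
qed

lemma is_weak_grad_comb:
 assumes "is_weak_grad Om v G" "is_weak_grad Om w H" "v : L2 LO" "w : L2 LO"
 shows "is_weak_grad Om (%x. v x + s * w x) (%x. G x + s *\<^sub>R H x)"
 unfolding is_weak_grad_def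
proof (intro conjI ballI)
 have L: "G : L2 LO" "H : L2 LO" using assms by (auto simp: is_weak_grad_def)
 then show "(%x. G x + s *\<^sub>R H x) : L2 LO" by auto
 fix ps and i :: 'a assume ps: "ps : test_functions Om" and i: "i : Basis"
 have "L2_inner LO v (%x. grad ps x \<bullet> i) = - L2_inner LO (%x. G x \<bullet> i) ps"
  "L2_inner LO w (%x. grad ps x \<bullet> i) = - L2_inner LO (%x. H x \<bullet> i) ps"
  using assms ps i by (auto simp: is_weak_grad_def)
 then show "L2_inner LO (%x. v x + s * w x) (%x. grad ps x \<bullet> i) = - L2_inner LO (%x. (G x + s *\<^sub>R H x) \<bullet> i) ps"
  using assms L test_L2_LO[OF ps]
  by (simp add: inner_add_left L2_inner_add_left L2_component L2_cmult L2_inner_cmult_left algebra_simps)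
qed

lemma is_weak_grad_diff:
 assumes "is_weak_grad Om v G" "is_weak_grad Om w H" "v : L2 LO" "w : L2 LO"
 shows "is_weak_grad Om (%x. v x - w x) (%x. G x - H x)"
 using is_weak_grad_comb[OF assms, of "-1"] by simp

lemma is_weak_grad_mult:
 assumes G: "is_weak_grad Om v G" and v: "v : L2 LO" and \<theta>: "smooth \<theta>"
 shows "is_weak_grad Om (%x. \<theta> x * v x) (%x. \<theta> x *\<^sub>R G x + v x *\<^sub>R grad \<theta> x)"
  and "(%x. \<theta> x * v x) : L2 LO"
proof -
 have GL: "G : L2 LO" using G by (auto simp: is_weak_grad_def)
 have L: "(%x. \<theta> x *\<^sub>R G x) : L2 LO" "(%x. v x *\<^sub>R grad \<theta> x) : L2 LO"
  by (intro L2_mult_continuous L2_mult_continuous_vector GL v smooth_continuous smooth_grad_continuous \<theta>)+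
 show vL: "(%x. \<theta> x * v x) : L2 LO"
  using L2_mult_continuous[OF v smooth_continuous[OF \<theta>]] by simp
 show "is_weak_grad Om (%x. \<theta> x * v x) (%x. \<theta> x *\<^sub>R G x + v x *\<^sub>R grad \<theta> x)"
  unfolding is_weak_grad_def
 proof (intro conjI ballI)
  show "(%x. \<theta> x *\<^sub>R G x + v x *\<^sub>R grad \<theta> x) : L2 LO" using L by auto
  fix ps and i :: 'a assume ps: "ps : test_functions Om" and i: "i : Basis"
  note psD = test_functionsD[OF ps]
  have t: "(%x. \<theta> x * ps x) : test_functions Om" by (rule test_functions_mult[OF ps \<theta>])
  have "L2_inner LO (%x. \<theta> x * v x) (%x. grad ps x \<bullet> i)
    = L2_inner LO v (%x. grad (%x. \<theta> x * ps x) x \<bullet> i - (grad \<theta> x \<bullet> i) * ps x)"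
   unfolding L2_inner_def
   by (intro Bochner_Integration.integral_cong refl) (subst grad_mult[OF \<theta> psD(1)], simp add: inner_add_left algebra_simps)
  also have "\<dots> = L2_inner LO v (%x. grad (%x. \<theta> x * ps x) x \<bullet> i) - L2_inner LO v (%x. (grad \<theta> x \<bullet> i) * ps x)"
   using \<theta> psD(1) i t
   by (intro L2_inner_diff_right v L2_component test_L2_LO smooth_L2 smooth_mult smooth_grad_component)
  also have "L2_inner LO v (%x. grad (%x. \<theta> x * ps x) x \<bullet> i) = - L2_inner LO (%x. G x \<bullet> i) (%x. \<theta> x * ps x)"
   using G t i by (simp add: is_weak_grad_def)
  also have "- L2_inner LO (%x. G x \<bullet> i) (%x. \<theta> x * ps x) - L2_inner LO v (%x. (grad \<theta> x \<bullet> i) * ps x)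
   = - (L2_inner LO (%x. (\<theta> x *\<^sub>R G x) \<bullet> i) ps + L2_inner LO (%x. (v x *\<^sub>R grad \<theta> x) \<bullet> i) ps)"
   by (simp add: L2_inner_def mult_ac)
  also have "\<dots> = - L2_inner LO (%x. (\<theta> x *\<^sub>R G x + v x *\<^sub>R grad \<theta> x) \<bullet> i) ps"
   using L2_inner_add_left[OF L2_component[OF L(1)] L2_component[OF L(2)] test_L2_LO(1)[OF ps], of i i]
   by (simp add: inner_add_left)
  finally show "L2_inner LO (%x. \<theta> x * v x) (%x. grad ps x \<bullet> i)
   = - L2_inner LO (%x. (\<theta> x *\<^sub>R G x + v x *\<^sub>R grad \<theta> x) \<bullet> i) ps" .
 qed
qed

lemma is_weak_grad_weak_grad:
 assumes "is_weak_grad Om v G"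
 shows "is_weak_grad Om v (weak_grad Om v)" "AE x in LO. weak_grad Om v x = G x"
proof -
 show "is_weak_grad Om v (weak_grad Om v)" unfolding weak_grad_def using someI[of "is_weak_grad Om v" G] assms by simp
 then show "AE x in LO. weak_grad Om v x = G x" using assms by (rule is_weak_grad_unique)
qed

lemma H1_weak_grad: "v : H1 Om ==> is_weak_grad Om v (weak_grad Om v)"
 using is_weak_grad_weak_grad(1) by (auto simp: H1_def)

lemma H1_I: "v : L2 LO ==> is_weak_grad Om v G ==> v : H1 Om"
 by (auto simp: H1_def)

lemma is_weak_grad_L2: "is_weak_grad Om v G ==> G : L2 LO"
 by (auto simp: is_weak_grad_def)

lemma H1_norm_eq:
 assumes "is_weak_grad Om v G"
 shows "H1_norm Om v = sqrt ((L2_norm LO v)\<^sup>2 + (L2_norm LO G)\<^sup>2)"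
proof -
 have "L2_norm LO (weak_grad Om v) = L2_norm LO G"
  using is_weak_grad_weak_grad[OF assms] assms is_weak_grad_L2
  by (intro L2_norm_cong_AE) blast+
 then show ?thesis by (simp add: H1_norm_def)
qed

lemma H1_norm_bounds:
 assumes "is_weak_grad Om v G"
 shows "L2_norm LO v <= H1_norm Om v" "L2_norm LO G <= H1_norm Om v" "H1_norm Om v <= L2_norm LO v + L2_norm LO G"
 by (auto simp: H1_norm_eq[OF assms] real_le_rsqrt sqrt_sum_squares_le_sum)

text \<open>\<open>z\<close> is longer than the diameter of \<open>Om\<close>, so \<open>ps\<close>
  and its translate have disjoint supports and their difference has twice the squared norm of
  \<open>ps\<close>; on the other side stands the increment bound of
  \<open>smooth_translation_le\<close>.\<close>

lemma test_Poincare: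
 obtains C where "C > 0" "!!ps. ps : test_functions Om ==> L2_norm LO ps <= C * L2_norm LO (grad ps)"
proof -
 obtain R where R: "R > 0" "!!x. x : Om ==> norm x <= R"
  using bounded_domain by (auto simp: bounded_pos)
 obtain b :: 'a where b: "b : Basis" using nonempty_Basis by blast
 define z where "z = (2 * R + 1) *\<^sub>R b"
 have nz: "norm z = 2 * R + 1" using R b by (simp add: z_def)
 show thesis
 proof (rule that[of "2 * R + 1"])
  fix ps assume ps: "ps : test_functions Om"
  note psD = test_functionsD[OF ps] and psL = test_functions_L2[OF ps]
  have disj: "ps (x - z) * ps x = 0" for x
  proof (rule ccontr)
   assume "ps (x - z) * ps x \<noteq> 0"
   then have "x - z : Om" "x : Om" using psD(3) by auto
   then have "norm (x - z) <= R" "norm x <= R" using R(2) by blast+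
   moreover have "norm z <= norm x + norm (x - z)" using norm_triangle_ineq4[of x "x - z"] by simp
   ultimately have "norm z <= 2 * R" by linarith
   with nz show False by simp
  qed
  have "(L2_norm lborel (%x. ps (x - z) - ps x))\<^sup>2 = (L2_norm lborel ps)\<^sup>2 + (L2_norm lborel ps)\<^sup>2"
   using L2_norm_add_scale_power2[OF L2_translate[OF psL(1), of z] psL(1), of "-1"] disj
   by (simp add: L2_norm_translate[OF psL(1)] L2_inner_def)
  then have "(L2_norm lborel ps)\<^sup>2 <= (L2_norm lborel (%x. ps (x - z) - ps x))\<^sup>2"
   using zero_le_power2[of "L2_norm lborel ps"] by linarith
  then have "L2_norm lborel ps <= L2_norm lborel (%x. ps (x - z) - ps x)"
   by (rule power2_le_imp_le) simp
  also have "\<dots> <= norm z * L2_norm lborel (grad ps)"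
   by (rule smooth_translation_le[OF psD(1,2)])
  finally show "L2_norm LO ps <= (2 * R + 1) * L2_norm LO (grad ps)"
   using nz psD by (simp add: L2_norm_lebesgue_on_borel)
 qed (use R in simp)
qed

end

section \<open>Hausdorff measure on Lipschitz graphs compared with the volume of strips\<close>

lemma emeasure_lborel_translate:
 fixes A :: "'a::euclidean_space set"
 assumes "A : sets borel"
 shows "emeasure lborel {x. x - a : A} = emeasure lborel A"
proof -
 have "emeasure (distr lborel borel (%x. x - a)) A = emeasure lborel ((%x. x - a) -` A \<inter> space lborel)"
  using assms by (intro emeasure_distr) auto
 then show ?thesis by (simp add: lborel_distr_translate vimage_def)
qed

lemma nn_integral_le_measure:
 fixes M N :: "'a measure" and F :: "'a => ennreal"
 assumes sets: "sets M = sets N" and le: "!!A. A : sets M ==> emeasure M A <= c * emeasure N A"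
 shows "nn_integral M F <= c * nn_integral N F"
 unfolding nn_integral_def[of M F]
proof (rule SUP_least)
 have sp: "space M = space N" using sets by (rule sets_eq_imp_space_eq)
 fix g assume "g : {g. simple_function M g \<and> g <= F}"
 then have g: "simple_function M g" "g <= F" by auto
 then have gN: "simple_function N g" by (simp add: simple_function_def sets sp)
 have "integral\<^sup>S M g <= (\<Sum>x\<in>g ` space M. c * (x * emeasure N (g -` {x} \<inter> space N)))"
  unfolding simple_integral_def
 proof (rule sum_mono)
  fix x :: ennreal
  have "g -` {x} \<inter> space M : sets M" using g(1) by (rule simple_functionD(2))
  then have "x * emeasure M (g -` {x} \<inter> space M) <= x * (c * emeasure N (g -` {x} \<inter> space M))"
   by (intro mult_left_mono le) simp_all
  then show "x * emeasure M (g -` {x} \<inter> space M) <= c * (x * emeasure N (g -` {x} \<inter> space N))"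
   by (simp add: sp mult_ac)
 qed
 also have "\<dots> = c * integral\<^sup>S N g"
  by (simp add: simple_integral_def sp sum_distrib_left)
 also have "\<dots> <= c * nn_integral N F"
  using g gN by (intro mult_left_mono) (auto simp: nn_integral_def intro!: SUP_upper)
 finally show "integral\<^sup>S M g <= c * nn_integral N F" .
qed

lemma hausdorff_pre_antimono: "dl <= dl' ==> hausdorff_pre s dl' A <= hausdorff_pre s dl A"
 unfolding hausdorff_pre_def by (rule INF_superset_mono) (auto intro: order_trans)

text \<open>A height function \<open>s\<close> in the direction \<open>e\<close>: the level set \<open>s = 0\<close> is a Lipschitz graph over
 the hyperplane orthogonal to \<open>e\<close>, and \<open>proj\<close> is the projection onto it along \<open>e\<close>.\<close>

locale height_function =
 fixes e :: "'a::euclidean_space" and s :: "'a => real" and \<Lambda> :: real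
 assumes norm_e: "norm e = 1" and lipschitz_s: "\<Lambda>-lipschitz_on UNIV s"
  and s_shift: "!!x t. s (x + t *\<^sub>R e) = s x + t" and Lambda_ge_1: "\<Lambda> \<ge> 1"
begin

definition proj :: "'a => 'a" where "proj x = x - s x *\<^sub>R e"

text \<open>Half-open in the height, so that translates along \<open>e\<close> stack without
  overlap. Points of \<open>A\<close> off the level set contribute nothing, since
  \<open>s (proj y) = 0\<close>.\<close>

definition strip :: "real => 'a set => 'a set" where
 "strip \<epsilon> A = {y. 0 <= s y \<and> s y < \<epsilon> \<and> proj y : A}"

lemma s_shift_minus: "s (x - t *\<^sub>R e) = s x - t"
 using s_shift[of x "- t"] by simp

lemma s_proj [simp]: "s (proj x) = 0"
 by (simp add: proj_def s_shift_minus)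

lemma proj_shift: "proj (x + t *\<^sub>R e) = proj x" "proj (x - t *\<^sub>R e) = proj x"
 by (simp_all add: proj_def s_shift s_shift_minus algebra_simps)

lemma s_diff_le: "\<bar>s x - s y\<bar> <= \<Lambda> * norm (x - y)"
 using lipschitz_onD[OF lipschitz_s, of x y] by (simp add: dist_norm)

lemma continuous_s: "continuous_on S s"
 using lipschitz_on_continuous_on[OF lipschitz_s] continuous_on_subset by blast

lemma continuous_proj: "continuous_on S proj"
 unfolding proj_def[abs_def] by (intro continuous_intros continuous_s)

lemma measurable_s [measurable]: "s : borel_measurable borel"
 and measurable_proj [measurable]: "proj : borel_measurable borel"
 by (auto intro!: borel_measurable_continuous_onI continuous_s continuous_proj)

lemma strip_borel [measurable]:
 assumes [measurable]: "A : sets borel"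
 shows "strip \<epsilon> A : sets borel"
 unfolding strip_def by measurable

lemma dist_proj: "norm (y - proj y) = \<bar>s y\<bar>"
 by (simp add: proj_def norm_e)

lemma strip_bounded:
 assumes "bounded A"
 shows "bounded (strip \<epsilon> A)"
proof -
 obtain R where R: "!!x. x : A ==> norm x <= R" using assms by (auto simp: bounded_iff)
 have "norm y <= R + \<epsilon>" if "y : strip \<epsilon> A" for y
  using that R[of "proj y"] dist_proj[of y] norm_triangle_ineq2[of y "proj y"] by (auto simp: strip_def)
 then show ?thesis by (auto simp: bounded_iff)
qed

text \<open>Translation along \<open>e\<close> changes the height and keeps the projection, so the
  layers are congruent although the base is curved. This makes it possible to pass between thin
  strips and strips of fixed height.\<close>

lemma strip_multiple:
 assumes [measurable]: "A : sets borel" and \<epsilon>: "\<epsilon> \<ge> 0"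
 shows "emeasure lborel (strip (real N * \<epsilon>) A) = of_nat N * emeasure lborel (strip \<epsilon> A)"
proof (induction N)
 case 0
 have "strip 0 A = {}" by (auto simp: strip_def)
 then show ?case by simp
next
 case (Suc N)
 let ?T = "{x. x - (real N * \<epsilon>) *\<^sub>R e : strip \<epsilon> A}"
 have nn: "0 <= \<epsilon> * real N" using \<epsilon> by simp
 have eq: "strip (real (Suc N) * \<epsilon>) A = strip (real N * \<epsilon>) A \<union> ?T"
  using \<epsilon> by (auto simp: strip_def s_shift_minus proj_shift algebra_simps dest: order_trans[OF nn])
 have [measurable]: "?T : sets borel"
  unfolding strip_def by measurable
 have "emeasure lborel (strip (real (Suc N) * \<epsilon>) A) = emeasure lborel (strip (real N * \<epsilon>) A) + emeasure lborel ?T"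
  unfolding eq by (rule plus_emeasure[symmetric]) (auto simp: strip_def s_shift_minus)
 also have "emeasure lborel ?T = emeasure lborel (strip \<epsilon> A)"
  by (rule emeasure_lborel_translate) measurable
 finally show ?case using Suc by (simp add: distrib_right)
qed

text \<open>If \<open>U\<close> has diameter \<open>d\<close>, its strip is covered by
  \<open>K\<close> balls of radius \<open>2 * d\<close> whose centres are \<open>d\<close> apart
  along \<open>e\<close>. As \<open>d <= \<epsilon>\<close>, \<open>K\<close> is at most
  \<open>2 * \<epsilon> / d\<close>; the cancelled power of \<open>d\<close> turns the volume into a
  summand of dimension \<open>n - 1\<close>, and the powers of 2 collect to
  \<open>4 ^ n\<close>.\<close>

lemma strip_cover_volume:
 fixes U :: "'a set"
 assumes dim: "DIM('a) \<ge> 2" and U: "bounded U" "diameter U <= \<epsilon>" and \<epsilon>: "\<epsilon> > 0"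
 obtains W where "W : sets borel" "strip \<epsilon> U \<subseteq> W"
  "emeasure lborel W <= ennreal (\<epsilon> * 4 ^ DIM('a) * unit_ball_vol (DIM('a)) * (diameter U / 2) powr (real DIM('a) - 1))"
proof -
 let ?n = "DIM('a)" and ?d = "diameter U"
 have d0: "?d \<ge> 0" using U(1) by (rule diameter_ge_0)
 consider "U = {}" | "U \<noteq> {}" "?d = 0" | "U \<noteq> {}" "?d > 0" using d0 by linarith
 then show thesis
 proof cases
  case 1
  then show thesis by (intro that[of "{}"]) (auto simp: strip_def)
 next
  \<comment> \<open>For diameter 0 the bound is 0, so the strip over the single point has to be
    enclosed in a null set: a line, in dimension at least 2.\<close>
  case 2
  then obtain a where a: "a : U" by blast
  have Ua: "x = a" if "x : U" for x
   using diameter_bounded_bound[OF U(1) that a] 2 by simp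
  define W where "W = (+) a ` span {e}"
  have "dim (span {e}) <= 1" by (simp add: dim_span dim_singleton)
  then have "negligible (span {e})" using dim by (intro negligible_lowdim) simp
  then have neg: "negligible W" unfolding W_def by (rule negligible_translation)
  have cl: "closed W" unfolding W_def by (intro closed_translation closed_subspace subspace_span)
  have "emeasure lebesgue W = 0"
   using neg by (auto simp: negligible_iff_null_sets)
  then have "emeasure lborel W = 0"
   using borel_closed[OF cl] by simp
  moreover have "strip \<epsilon> U \<subseteq> W"
  proof
   fix y assume "y : strip \<epsilon> U"
   then have "proj y = a" by (auto simp: strip_def intro: Ua)
   then have "y = a + s y *\<^sub>R e" by (simp add: proj_def algebra_simps)
   then show "y : W" unfolding W_def by (metis imageI span_base span_scale singletonI)
  qed
  ultimately show thesis using cl by (intro that[of W]) auto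
 next
  case 3
  then obtain a where a: "a : U" by blast
  define K where "K = nat \<lceil>\<epsilon> / ?d\<rceil>"
  define W where "W = (\<Union>k<K. cball (a + (real k * ?d) *\<^sub>R e) (2 * ?d))"
  have K: "real K <= 2 * \<epsilon> / ?d"
  proof -
   have "real K <= \<epsilon> / ?d + 1" using \<epsilon> 3 by (simp add: K_def)
   also have "1 <= \<epsilon> / ?d" using U 3 by simp
   finally show ?thesis by simp
  qed
  have sub: "strip \<epsilon> U \<subseteq> W"
  proof
   fix y assume "y : strip \<epsilon> U"
   then have y: "0 <= s y" "s y < \<epsilon>" "proj y : U" by (auto simp: strip_def)
   define k where "k = nat \<lfloor>s y / ?d\<rfloor>"
   have q: "0 <= s y / ?d" using y 3 by simp
   have rk: "real k = of_int \<lfloor>s y / ?d\<rfloor>" using q by (simp add: k_def)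
   then have k1: "real k <= s y / ?d" "s y / ?d < real k + 1" by linarith+
   have "real k < \<epsilon> / ?d" using k1 y 3 by (meson divide_strict_right_mono le_less_trans)
   then have "k < K" unfolding K_def by linarith
   have kd: "real k * ?d <= s y" "s y - real k * ?d <= ?d"
    using k1 3 by (auto simp: field_simps)
   have "norm (y - (a + (real k * ?d) *\<^sub>R e)) = norm ((proj y - a) + (s y - real k * ?d) *\<^sub>R e)"
    by (simp add: proj_def algebra_simps)
   also have "\<dots> <= norm (proj y - a) + \<bar>s y - real k * ?d\<bar>"
    using norm_triangle_ineq[of "proj y - a" "(s y - real k * ?d) *\<^sub>R e"] by (simp add: norm_e)
   also have "\<dots> <= 2 * ?d"
    using diameter_bounded_bound[OF U(1) y(3) a] kd by (simp add: dist_norm)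
   finally show "y : W"
    using \<open>k < K\<close> by (auto simp: W_def dist_norm norm_minus_commute)
  qed
  have "emeasure lborel W <= (\<Sum>k<K. emeasure lborel (cball (a + (real k * ?d) *\<^sub>R e) (2 * ?d)))"
   unfolding W_def by (rule emeasure_subadditive_finite) auto
  also have "\<dots> = (\<Sum>k<K. ennreal (unit_ball_vol ?n * (2 * ?d) ^ ?n))"
   using d0 by (intro sum.cong refl emeasure_cball) simp
  also have "\<dots> = ennreal (real K * (unit_ball_vol ?n * (2 * ?d) ^ ?n))"
   using d0 by (simp add: ennreal_of_nat_eq_real_of_nat ennreal_mult)
  also have "\<dots> <= ennreal ((2 * \<epsilon> / ?d) * (unit_ball_vol ?n * (2 * ?d) ^ ?n))"
   using d0 K by (intro ennreal_leI mult_right_mono) auto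
  also have "(2 * \<epsilon> / ?d) * (unit_ball_vol ?n * (2 * ?d) ^ ?n) = \<epsilon> * 4 ^ ?n * unit_ball_vol ?n * (?d / 2) powr (real ?n - 1)"
  proof -
   obtain m where m: "?n = Suc m" using dim by (cases "DIM('a)") auto
   have "(?d / 2) powr (real ?n - 1) = (?d / 2) ^ m"
    using 3 by (simp add: m powr_realpow)
   moreover have "(4::real) ^ m = 2 ^ m * 2 ^ m" by (simp flip: power_mult_distrib)
   ultimately show ?thesis
    using 3 unfolding m by (simp add: field_simps power_mult_distrib power_divide)
  qed
  finally show thesis using sub by (intro that[of W]) (auto simp: W_def)
 qed
qed

text \<open>The normalisation of a Hausdorff summand divided by the constant of
  \<open>strip_cover_volume\<close>, so that the covering sum becomes termwise the sum that defines
  the Hausdorff measure.\<close>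

definition strip_const :: real where
 "strip_const = unit_ball_vol (real DIM('a) - 1) / (4 ^ DIM('a) * unit_ball_vol (DIM('a)))"

lemma strip_const_pos: "strip_const > 0"
proof -
 have "real DIM('a) - 1 \<ge> 0" using DIM_positive[where 'a = 'a] by linarith
 then show ?thesis by (simp add: strip_const_def)
qed

lemma strip_le_hausdorff:
 assumes dim: "DIM('a) \<ge> 2" and A: "A : sets borel" and \<epsilon>: "\<epsilon> > 0"
 shows "ennreal (strip_const / \<epsilon>) * emeasure lborel (strip \<epsilon> A) <= hausdorff_outer (real DIM('a) - 1) A"
proof -
 let ?n = "DIM('a)" and ?p = "real DIM('a) - 1"
 have "ennreal (strip_const / \<epsilon>) * emeasure lborel (strip \<epsilon> A) <= hausdorff_pre ?p \<epsilon> A"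
  unfolding hausdorff_pre_def
 proof (rule INF_greatest)
  fix U assume "U : {U. A \<subseteq> (\<Union>i. U i) \<and> (\<forall>i::nat. bounded (U i) \<and> diameter (U i) <= \<epsilon>)}"
  then have U: "A \<subseteq> (\<Union>i. U i)" "!!i. bounded (U i)" "!!i. diameter (U i) <= \<epsilon>" by auto
  have "\<forall>i. \<exists>W. W : sets borel \<and> strip \<epsilon> (U i) \<subseteq> W \<and>
   emeasure lborel W <= ennreal (\<epsilon> * 4 ^ ?n * unit_ball_vol ?n * (diameter (U i) / 2) powr ?p)"
   using strip_cover_volume[OF dim U(2,3) \<epsilon>] by metis
  then obtain W where W: "!!i. W i : sets borel" "!!i. strip \<epsilon> (U i) \<subseteq> W i"
   "!!i. emeasure lborel (W i) <= ennreal (\<epsilon> * 4 ^ ?n * unit_ball_vol ?n * (diameter (U i) / 2) powr ?p)"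
   by metis
  have "strip \<epsilon> A \<subseteq> (\<Union>i. strip \<epsilon> (U i))" using U(1) by (fastforce simp: strip_def)
  also have "\<dots> \<subseteq> (\<Union>i. W i)" using W(2) by fast
  finally have "emeasure lborel (strip \<epsilon> A) <= emeasure lborel (\<Union>i. W i)"
   using W(1) by (intro emeasure_mono) auto
  also have "\<dots> <= (\<Sum>i. emeasure lborel (W i))"
   using W(1) by (intro emeasure_subadditive_countably) auto
  also have "\<dots> <= (\<Sum>i. ennreal (\<epsilon> * 4 ^ ?n * unit_ball_vol ?n * (diameter (U i) / 2) powr ?p))"
   by (intro suminf_le W summableI)
  finally have "ennreal (strip_const / \<epsilon>) * emeasure lborel (strip \<epsilon> A)
   <= ennreal (strip_const / \<epsilon>) * (\<Sum>i. ennreal (\<epsilon> * 4 ^ ?n * unit_ball_vol ?n * (diameter (U i) / 2) powr ?p))"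
   by (rule mult_left_mono) simp
  also have "\<dots> = (\<Sum>i. ennreal (strip_const / \<epsilon>) * ennreal (\<epsilon> * 4 ^ ?n * unit_ball_vol ?n * (diameter (U i) / 2) powr ?p))"
   by simp
  also have "\<dots> = (\<Sum>i. ennreal (unit_ball_vol ?p * (diameter (U i) / 2) powr ?p))"
  proof (intro suminf_cong)
   fix i
   have "unit_ball_vol (real ?n) \<noteq> 0" using unit_ball_vol_pos[of "real ?n"] by linarith
   then have "strip_const / \<epsilon> * (\<epsilon> * 4 ^ ?n * unit_ball_vol ?n * (diameter (U i) / 2) powr ?p)
    = unit_ball_vol ?p * (diameter (U i) / 2) powr ?p"
    using \<epsilon> by (simp add: strip_const_def field_simps)
   then show "ennreal (strip_const / \<epsilon>) * ennreal (\<epsilon> * 4 ^ ?n * unit_ball_vol ?n * (diameter (U i) / 2) powr ?p)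
    = ennreal (unit_ball_vol ?p * (diameter (U i) / 2) powr ?p)"
    using \<epsilon> strip_const_pos by (subst ennreal_mult[symmetric]) auto
  qed
  finally show "ennreal (strip_const / \<epsilon>) * emeasure lborel (strip \<epsilon> A)
   <= (\<Sum>i. ennreal (unit_ball_vol ?p * (diameter (U i) / 2) powr ?p))" .
 qed
 also have "\<dots> <= hausdorff_outer ?p A"
  unfolding hausdorff_outer_def using \<epsilon> by (intro SUP_upper) simp
 finally show ?thesis .
qed

text \<open>The price of one ball in the Vitali covering: the Hausdorff summand of radius
  \<open>5 * \<epsilon>\<close>, divided by the volume of a ball of radius
  \<open>\<epsilon> / (2 * \<Lambda>)\<close> inside the strip, is
  \<open>graph_const / \<epsilon>\<close>.\<close>

definition graph_const :: real where
 "graph_const = unit_ball_vol (real DIM('a) - 1) * 5 ^ (DIM('a) - 1) * (2 * \<Lambda>) ^ DIM('a) / unit_ball_vol (DIM('a))"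

lemma graph_const_nonneg: "graph_const \<ge> 0"
proof -
 have "real DIM('a) - 1 \<ge> 0" using DIM_positive[where 'a = 'a] by linarith
 then show ?thesis using Lambda_ge_1 by (simp add: graph_const_def)
qed

text \<open>Covering against packing: Vitali's lemma gives disjoint balls of radius \<epsilon>
  centred on \<open>A\<close> whose fivefold enlargements cover \<open>A\<close>. Their number is
  bounded by volume, because each contains a smaller ball that lies in the strip.\<close>

lemma hausdorff_pre_le_strip:
 assumes A: "compact A" "A \<noteq> {}" "!!x. x : A ==> s x = 0" and \<epsilon>: "\<epsilon> > 0"
 shows "hausdorff_pre (real DIM('a) - 1) (10 * \<epsilon>) A
  <= ennreal (graph_const / \<epsilon>) * emeasure lborel (strip \<epsilon> {x. infdist x A <= 2 * \<epsilon>})"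
proof -
 let ?n = "DIM('a)" and ?p = "real DIM('a) - 1"
 have p0: "?p \<ge> 0" using DIM_positive[where 'a = 'a] by linarith
 have "A \<subseteq> (\<Union>x\<in>A. ball x \<epsilon>)" using \<epsilon> by force
 then obtain F where F: "F \<subseteq> A" "finite F" "A \<subseteq> (\<Union>x\<in>F. ball x \<epsilon>)"
  using compactE_image[OF A(1), of A "%x. ball x \<epsilon>"] by auto
 have "(\<Union>x\<in>F. ball x \<epsilon>) \<subseteq> (\<Union>x\<in>F. cball x \<epsilon>)"
  by (intro UN_mono ball_subset_cball order_refl)
 with F(3) have cov: "A \<subseteq> (\<Union>x\<in>F. cball x \<epsilon>)" by (rule order_trans)
 obtain C where C: "countable C" "C \<subseteq> F" "pairwise (%i j. disjnt (cball i \<epsilon>) (cball j \<epsilon>)) C"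
  "A \<subseteq> (\<Union>i\<in>C. cball i (5 * \<epsilon>))"
 proof (rule Vitali_covering_lemma_cballs[where S = A and K = F and a = "%i. i" and r = "%i. \<epsilon>" and B = \<epsilon>])
  show "A \<subseteq> (\<Union>i\<in>F. cball i \<epsilon>)" by (rule cov)
  show "0 < \<epsilon> \<and> \<epsilon> <= \<epsilon>" using \<epsilon> by simp
 qed (rule that)
 have finC: "finite C" using C(2) F(2) finite_subset by blast
 \<comment> \<open>About a centre lifted to height \<open>\<epsilon>/2\<close>, \<open>s\<close>
   varies by less than \<open>\<epsilon>/2\<close> on a ball of radius
   \<open>\<kappa> * \<epsilon>\<close>, which keeps that ball in the strip; the projections of its
   points are within \<open>2 * \<epsilon>\<close> of \<open>A\<close>.\<close>
 define \<kappa> where "\<kappa> = 1 / (2 * \<Lambda>)"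
 have \<kappa>: "\<kappa> > 0" "\<kappa> <= 1/2" "\<Lambda> * \<kappa> = 1/2" using Lambda_ge_1 by (auto simp: \<kappa>_def)
 let ?S = "strip \<epsilon> {x. infdist x A <= 2 * \<epsilon>}"
 let ?B = "%a. ball (a + (\<epsilon>/2) *\<^sub>R e) (\<kappa> * \<epsilon>)"
 have clS: "{x. infdist x A <= 2 * \<epsilon>} : sets borel"
  by (intro borel_closed closed_Collect_le continuous_intros)
 have near: "norm (y - a) <= \<epsilon>" "y : ?S" if a: "a : C" and y: "y : ?B a" for a y
 proof -
  have ny: "norm (y - (a + (\<epsilon>/2) *\<^sub>R e)) < \<kappa> * \<epsilon>" using y by (simp add: dist_norm norm_minus_commute)
  have aA: "a : A" using a C(2) F(1) by blast
  have "norm (y - a) <= norm (y - (a + (\<epsilon>/2) *\<^sub>R e)) + norm ((\<epsilon>/2) *\<^sub>R e)"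
   using norm_triangle_ineq[of "y - (a + (\<epsilon>/2) *\<^sub>R e)" "(\<epsilon>/2) *\<^sub>R e"] by (simp add: algebra_simps)
  also have "\<dots> <= \<epsilon>/2 + \<epsilon>/2"
  proof -
   have "\<kappa> * \<epsilon> <= 1/2 * \<epsilon>" using \<kappa>(2) \<epsilon> by (intro mult_right_mono) auto
   moreover have "norm ((\<epsilon>/2) *\<^sub>R e) = \<epsilon>/2" using \<epsilon> by (simp add: norm_e)
   ultimately show ?thesis using ny by linarith
  qed
  finally show 1: "norm (y - a) <= \<epsilon>" by simp
  have "\<bar>s y - s (a + (\<epsilon>/2) *\<^sub>R e)\<bar> <= \<Lambda> * norm (y - (a + (\<epsilon>/2) *\<^sub>R e))" by (rule s_diff_le)
  also have "\<dots> < \<Lambda> * (\<kappa> * \<epsilon>)" using ny Lambda_ge_1 by (intro mult_strict_left_mono) auto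
  also have "\<dots> = \<epsilon> / 2" using \<kappa>(3) by (simp flip: mult.assoc)
  finally have "\<bar>s y - \<epsilon>/2\<bar> < \<epsilon>/2" using A(3)[OF aA] by (simp add: s_shift)
  then have sy: "0 < s y" "s y < \<epsilon>" by linarith+
  have "norm (proj y - a) <= norm (y - a) + norm (y - proj y)"
   using norm_triangle_ineq4[of "y - a" "y - proj y"] by simp
  also have "\<dots> <= 2 * \<epsilon>" using 1 sy by (simp add: dist_proj)
  finally have "infdist (proj y) A <= 2 * \<epsilon>"
   using infdist_le[OF aA, of "proj y"] by (simp add: dist_norm)
  then show "y : ?S" using sy by (simp add: strip_def)
 qed
 have "of_nat (card C) * ennreal (unit_ball_vol ?n * (\<kappa> * \<epsilon>) ^ ?n) = (\<Sum>a\<in>C. emeasure lborel (?B a))"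
  using \<kappa> \<epsilon> by (simp add: emeasure_ball)
 also have "\<dots> = emeasure lborel (\<Union>a\<in>C. ?B a)"
 proof (rule sum_emeasure)
  show "disjoint_family_on ?B C"
   unfolding disjoint_family_on_def
  proof (intro ballI impI)
   fix i j assume ij: "i : C" "j : C" "i \<noteq> j"
   then have "cball i \<epsilon> \<inter> cball j \<epsilon> = {}" using C(3) by (auto simp: pairwise_def disjnt_def)
   moreover have "?B i \<subseteq> cball i \<epsilon>" "?B j \<subseteq> cball j \<epsilon>"
    using near(1)[OF ij(1)] near(1)[OF ij(2)] by (auto simp: dist_norm norm_minus_commute)
   ultimately show "?B i \<inter> ?B j = {}" by blast
  qed
 qed (use finC in auto)
 also have "\<dots> <= emeasure lborel ?S"
  using near(2) strip_borel[OF clS] by (intro emeasure_mono) auto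
 finally have cardC: "of_nat (card C) * ennreal (unit_ball_vol ?n * (\<kappa> * \<epsilon>) ^ ?n) <= emeasure lborel ?S" .
 obtain h where h: "bij_betw h {..<card C} C"
  using ex_bij_betw_nat_finite[OF finC] by (auto simp: atLeast0LessThan)
 define U where "U i = (if i < card C then cball (h i) (5 * \<epsilon>) else {})" for i
 have "hausdorff_pre ?p (10 * \<epsilon>) A <= (\<Sum>i. ennreal (unit_ball_vol ?p * (diameter (U i) / 2) powr ?p))"
  unfolding hausdorff_pre_def
 proof (rule INF_lower, intro CollectI conjI allI)
  show "A \<subseteq> (\<Union>i. U i)"
  proof
   fix x assume "x : A"
   then obtain c where c: "c : C" "x : cball c (5 * \<epsilon>)" using C(4) by blast
   have "c : h ` {..<card C}" using c(1) h by (simp add: bij_betw_def)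
   then obtain i where "i < card C" "h i = c" by blast
   with c have "x : U i" by (simp add: U_def)
   then show "x : (\<Union>i. U i)" by blast
  qed
  show "bounded (U i)" "diameter (U i) <= 10 * \<epsilon>" for i using \<epsilon> by (auto simp: U_def)
 qed
 also have "\<dots> = (\<Sum>i<card C. ennreal (unit_ball_vol ?p * (diameter (U i) / 2) powr ?p))"
  by (rule suminf_finite) (auto simp: U_def)
 also have "\<dots> = of_nat (card C) * ennreal (unit_ball_vol ?p * (5 * \<epsilon>) powr ?p)"
  using \<epsilon> by (simp add: U_def)
 also have "unit_ball_vol ?p * (5 * \<epsilon>) powr ?p = (graph_const / \<epsilon>) * (unit_ball_vol ?n * (\<kappa> * \<epsilon>) ^ ?n)"
 proof -
  obtain m where m: "?n = Suc m" by (cases "DIM('a)") auto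
  have p5: "(5 * \<epsilon>) powr ?p = (5 * \<epsilon>) ^ m" using \<epsilon> by (simp add: m powr_realpow)
  have "unit_ball_vol (real (Suc m)) \<noteq> 0" using unit_ball_vol_pos[of "real (Suc m)"] by linarith
  have pw: "(2 * \<Lambda>) ^ Suc m * (\<kappa> * \<epsilon>) ^ Suc m = \<epsilon> ^ Suc m"
  proof -
   have "(2 * \<Lambda>) * (\<kappa> * \<epsilon>) = 2 * (\<Lambda> * \<kappa>) * \<epsilon>" by (simp only: mult_ac)
   then have "(2 * \<Lambda>) * (\<kappa> * \<epsilon>) = \<epsilon>" unfolding \<kappa>(3) by simp
   then show ?thesis by (simp only: power_mult_distrib[symmetric])
  qed
  have gc: "graph_const / \<epsilon> * (unit_ball_vol (real (Suc m)) * (\<kappa> * \<epsilon>) ^ Suc m) =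
   unit_ball_vol (real m) * 5 ^ m * ((2 * \<Lambda>) ^ Suc m * (\<kappa> * \<epsilon>) ^ Suc m) / \<epsilon>"
   using \<open>unit_ball_vol (real (Suc m)) \<noteq> 0\<close> unfolding graph_const_def m
   by (simp add: field_simps del: power_Suc)
  have "graph_const / \<epsilon> * (unit_ball_vol (real (Suc m)) * (\<kappa> * \<epsilon>) ^ Suc m)
   = unit_ball_vol (real m) * 5 ^ m * \<epsilon> ^ Suc m / \<epsilon>"
   by (rule gc[unfolded pw])
  also have "\<dots> = unit_ball_vol (real m) * (5 * \<epsilon>) ^ m" using \<epsilon> by (simp add: power_mult_distrib)
  finally have "graph_const / \<epsilon> * (unit_ball_vol (real (Suc m)) * (\<kappa> * \<epsilon>) ^ Suc m)
   = unit_ball_vol (real m) * (5 * \<epsilon>) ^ m" .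
  moreover have "?p = real m" by (simp add: m)
  ultimately show ?thesis using p5 by (simp only: m)
 qed
 also have "of_nat (card C) * ennreal ((graph_const / \<epsilon>) * (unit_ball_vol ?n * (\<kappa> * \<epsilon>) ^ ?n))
  = ennreal (graph_const / \<epsilon>) * (of_nat (card C) * ennreal (unit_ball_vol ?n * (\<kappa> * \<epsilon>) ^ ?n))"
  using graph_const_nonneg \<epsilon> \<kappa> by (subst ennreal_mult) (auto simp: mult_ac)
 also have "\<dots> <= ennreal (graph_const / \<epsilon>) * emeasure lborel ?S"
  by (intro mult_left_mono cardC) simp
 finally show ?thesis .
qed

text \<open>The strips of the preceding bound become thin, but \<open>Suc N\<close> of them stack to
  the fixed height \<open>r\<close>. After that only the base shrinks, to the compact set
  \<open>A\<close>, and continuity of Lebesgue measure from above applies.\<close>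

lemma hausdorff_compact_le_strip:
 assumes A: "compact A" "A \<noteq> {}" "!!x. x : A ==> s x = 0" and r: "r > 0"
 shows "hausdorff_outer (real DIM('a) - 1) A <= ennreal (graph_const / r) * emeasure lborel (strip r A)"
 unfolding hausdorff_outer_def
proof (rule SUP_least)
 let ?p = "real DIM('a) - 1"
 fix dl :: real assume dl: "dl : {0<..}"
 define \<epsilon> where "\<epsilon> N = r / real (Suc N)" for N
 have \<epsilon>: "\<epsilon> N > 0" for N using r by (simp add: \<epsilon>_def)
 define B where "B N = {x. infdist x A <= 2 * \<epsilon> N}" for N
 have Bb: "B N : sets borel" for N
  unfolding B_def by (intro borel_closed closed_Collect_le continuous_intros)
 have mono: "\<epsilon> n <= \<epsilon> m" if "m <= n" for m n
  using that r by (simp add: \<epsilon>_def frac_le)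
 have lim\<epsilon>: "\<epsilon> \<longlonglongrightarrow> 0"
  using tendsto_mult_right_zero[OF LIMSEQ_inverse_real_of_nat, of r] by (simp add: \<epsilon>_def[abs_def] divide_inverse)
 have Bint: "(\<Inter>N. strip r (B N)) = strip r A"
 proof -
  have "(\<Inter>N. B N) = A"
  proof (intro equalityI subsetI)
   fix x assume "x : (\<Inter>N. B N)"
   then have "infdist x A <= 2 * \<epsilon> N" for N by (auto simp: B_def)
   then have "infdist x A <= 2 * 0"
    by (intro tendsto_lowerbound[OF tendsto_mult_left[OF lim\<epsilon>]]) auto
   then have "infdist x A = 0" using infdist_nonneg[of x A] by linarith
   then show "x : A" using in_closed_iff_infdist_zero[OF compact_imp_closed[OF A(1)] A(2)] by blast
  qed (use \<epsilon> in \<open>auto simp: B_def less_imp_le\<close>)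
  then show ?thesis by (auto simp: strip_def)
 qed
 have bB: "bounded (B N)" for N
 proof -
  obtain R where R: "!!y. y : A ==> norm y <= R"
   using compact_imp_bounded[OF A(1)] by (auto simp: bounded_iff)
  have "norm x <= R + 2 * \<epsilon> N" if "x : B N" for x
  proof -
   obtain y where "y : A" "infdist x A = dist x y"
    using infdist_attains_inf[OF compact_imp_closed[OF A(1)] A(2), of x] by metis
   then show ?thesis using that R[of y] norm_triangle_ineq2[of x y] by (simp add: B_def dist_norm)
  qed
  then show ?thesis by (auto simp: bounded_iff)
 qed
 have lim: "(%N. emeasure lborel (strip r (B N))) \<longlonglongrightarrow> emeasure lborel (\<Inter>N. strip r (B N))"
 proof (rule Lim_emeasure_decseq)
  show "range (%N. strip r (B N)) \<subseteq> sets lborel" using Bb by auto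
  show "decseq (%N. strip r (B N))"
   using mono by (fastforce simp: decseq_def strip_def B_def)
  show "emeasure lborel (strip r (B N)) \<noteq> \<infinity>" for N
   using emeasure_bounded_finite[OF strip_bounded[OF bB[of N]], of r] by simp
 qed
 have pre: "hausdorff_pre ?p (10 * \<epsilon> N) A <= ennreal (graph_const / r) * emeasure lborel (strip r (B N))" for N
 proof -
  have "real (Suc N) * \<epsilon> N = r" by (simp add: \<epsilon>_def)
  then have "emeasure lborel (strip r (B N)) = of_nat (Suc N) * emeasure lborel (strip (\<epsilon> N) (B N))"
   using strip_multiple[OF Bb[of N], of "\<epsilon> N" "Suc N"] \<epsilon>[of N] by simp
  moreover have "ennreal (graph_const / r) * of_nat (Suc N) = ennreal (graph_const / \<epsilon> N)"
   using r graph_const_nonneg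
   by (simp only: ennreal_of_nat_eq_real_of_nat) (subst ennreal_mult[symmetric], auto simp: \<epsilon>_def mult.commute)
  ultimately have "ennreal (graph_const / r) * emeasure lborel (strip r (B N))
   = ennreal (graph_const / \<epsilon> N) * emeasure lborel (strip (\<epsilon> N) (B N))"
   by (simp only: mult.assoc[symmetric])
  then show ?thesis using hausdorff_pre_le_strip[OF A \<epsilon>[of N]] by (simp add: B_def)
 qed
 have "hausdorff_pre ?p dl A <= ennreal (graph_const / r) * emeasure lborel (\<Inter>N. strip r (B N))"
 proof (rule tendsto_lowerbound)
  show "(%N. ennreal (graph_const / r) * emeasure lborel (strip r (B N)))
   \<longlonglongrightarrow> ennreal (graph_const / r) * emeasure lborel (\<Inter>N. strip r (B N))"
   by (intro ennreal_tendsto_cmult lim) simp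
  have "\<forall>\<^sub>F N in sequentially. \<epsilon> N < dl / 10"
   using dl by (intro order_tendstoD(2)[OF lim\<epsilon>]) simp
  then show "\<forall>\<^sub>F N in sequentially. hausdorff_pre ?p dl A <= ennreal (graph_const / r) * emeasure lborel (strip r (B N))"
  proof eventually_elim
   case (elim N)
   then have "hausdorff_pre ?p dl A <= hausdorff_pre ?p (10 * \<epsilon> N) A" by (intro hausdorff_pre_antimono) simp
   with pre[of N] show ?case by simp
  qed
 qed simp
 then show "hausdorff_pre ?p dl A <= ennreal (graph_const / r) * emeasure lborel (strip r A)" unfolding Bint .
qed

end

abbreviation hausm :: "'a::euclidean_space measure" where
 "hausm \<equiv> hausdorff_measure (real DIM('a) - 1)"

lemma sets_hausm [simp, measurable_cong]: "sets hausm = sets borel"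
 unfolding hausdorff_measure_def by (subst sets_measure_of) (auto simp: sets.sigma_sets_eq[of borel, simplified])

lemma space_hausm [simp]: "space hausm = UNIV"
 using sets_eq_imp_space_eq[OF sets_hausm] by simp

text \<open>If the Hausdorff outer measure were not countably additive on the Borel sets, then
 \<^const>\<open>measure_of\<close> would return the null measure and all statements about the surface
 measure would be trivial; hence additivity may be assumed.\<close>

locale hausdorff_height = height_function e s \<Lambda> for e :: "'a::euclidean_space" and s \<Lambda> +
 assumes dim2: "DIM('a) \<ge> 2"
  and H_eq: "!!A :: 'a set. A : sets borel ==>
   emeasure hausm A = hausdorff_outer (real DIM('a) - 1) A"
begin

lemma H_compact_le_strip:
 assumes "compact A" "!!x. x : A ==> s x = 0" "r > 0"
 shows "emeasure hausm A <= ennreal (graph_const / r) * emeasure lborel (strip r A)"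
 using hausdorff_compact_le_strip[OF assms(1) _ assms(2,3)] H_eq[OF borel_compact[OF assms(1)]]
 by (cases "A = {}") auto

lemma H_compact_finite:
 assumes "compact A" "!!x. x : A ==> s x = 0"
 shows "emeasure hausm A < \<infinity>"
proof -
 have "emeasure hausm A <= ennreal (graph_const / 1) * emeasure lborel (strip 1 A)"
  using assms by (intro H_compact_le_strip) auto
 also have "\<dots> < \<infinity>"
  using emeasure_bounded_finite[OF strip_bounded[OF compact_imp_bounded[OF assms(1)]], of 1]
  by (simp add: ennreal_mult_less_top)
 finally show ?thesis .
qed

text \<open>Inner regularity carries the comparison from compact to Borel sets. It asks for a finite
  measure, which is why all takes place inside a compact patch \<open>P\<close>: the compact case
  already shows that \<open>P\<close> has finite measure.\<close>

lemma H_le_strip: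
 assumes P: "compact P" "!!x. x : P ==> s x = 0" and A: "A : sets borel" "A \<subseteq> P" and r: "r > 0"
 shows "emeasure hausm A <= ennreal (graph_const / r) * emeasure lborel (strip r A)"
proof -
 define M where "M = density hausm (indicator P)"
 have Pb: "P : sets borel" using P(1) by (rule borel_compact)
 have M: "emeasure M B = emeasure hausm (B \<inter> P)" if "B : sets borel" for B
 proof -
  have "emeasure M B = (\<integral>\<^sup>+x. indicator P x * indicator B x \<partial>hausm)"
   unfolding M_def using that Pb by (intro emeasure_density) auto
  also have "\<dots> = (\<integral>\<^sup>+x. indicator (B \<inter> P) x \<partial>hausm)"
   by (intro nn_integral_cong) (auto simp: indicator_def)
  also have "\<dots> = emeasure hausm (B \<inter> P)"
   using that Pb by (intro nn_integral_indicator) auto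
  finally show ?thesis .
 qed
 have "emeasure M (space M) = emeasure hausm P"
  using M[of UNIV] by (simp add: M_def)
 then have fin: "emeasure M (space M) \<noteq> \<infinity>" using H_compact_finite[OF P] by auto
 have AP: "A \<inter> P = A" using A by blast
 have "emeasure hausm A = (SUP K \<in> {K. K \<subseteq> A \<and> compact K}. emeasure M K)"
  using inner_regular[OF _ fin A(1)] M[OF A(1)] by (simp add: AP M_def)
 also have "\<dots> <= ennreal (graph_const / r) * emeasure lborel (strip r A)"
 proof (rule SUP_least)
  fix K assume "K : {K. K \<subseteq> A \<and> compact K}"
  then have K: "K \<subseteq> A" "compact K" by auto
  have "emeasure M K = emeasure hausm K"
   using M[OF borel_compact[OF K(2)]] K(1) A(2) by (simp add: Int_absorb2 subset_trans)
  also have "\<dots> <= ennreal (graph_const / r) * emeasure lborel (strip r K)"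
   using K A P r by (intro H_compact_le_strip) auto
  also have "\<dots> <= ennreal (graph_const / r) * emeasure lborel (strip r A)"
  proof (intro mult_left_mono emeasure_mono)
   show "strip r K \<subseteq> strip r A" using K(1) by (auto simp: strip_def)
  qed (use A(1) in auto)
  finally show "emeasure M K <= ennreal (graph_const / r) * emeasure lborel (strip r A)" .
 qed
 finally show ?thesis .
qed

text \<open>As a function of the base, the volume of a strip is a measure, namely the image under
  \<open>proj\<close> of Lebesgue measure on the strip over \<open>P\<close>. This turns comparisons
  of sets into comparisons of integrals of \<open>F\<close> on the surface and of \<open>F\<close>
  after \<open>proj\<close> in the strip.\<close>

lemma emeasure_strip_distr:
 assumes P: "P : sets borel" and A: "A : sets borel"
 shows "emeasure (distr (density lborel (indicator (strip r P))) borel proj) A = emeasure lborel (strip r (A \<inter> P))"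
proof -
 have "emeasure (distr (density lborel (indicator (strip r P))) borel proj) A
  = emeasure (density lborel (indicator (strip r P))) (proj -` A)"
  using A by (subst emeasure_distr) auto
 also have "\<dots> = (\<integral>\<^sup>+x. indicator (strip r P) x * indicator (proj -` A) x \<partial>lborel)"
 proof (rule emeasure_density)
  show "proj -` A : sets lborel"
   using measurable_sets[OF measurable_proj A] by simp
 qed (use strip_borel[OF P, of r] in simp)
 also have "\<dots> = (\<integral>\<^sup>+x. indicator (strip r (A \<inter> P)) x \<partial>lborel)"
  by (intro nn_integral_cong) (auto simp: indicator_def strip_def)
 also have "\<dots> = emeasure lborel (strip r (A \<inter> P))"
  using strip_borel[of "A \<inter> P" r] P A by (intro nn_integral_indicator) auto
 finally show ?thesis .
qed

lemma nn_integral_strip_distr: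
 assumes P: "P : sets borel" and F: "F : borel_measurable borel"
 shows "(\<integral>\<^sup>+x. F x \<partial>distr (density lborel (indicator (strip r P))) borel proj)
  = (\<integral>\<^sup>+y. indicator (strip r P) y * F (proj y) \<partial>lborel)"
proof -
 note [measurable] = F strip_borel[OF P]
 have "(\<integral>\<^sup>+x. F x \<partial>distr (density lborel (indicator (strip r P))) borel proj)
  = (\<integral>\<^sup>+y. F (proj y) \<partial>density lborel (indicator (strip r P)))"
  by (rule nn_integral_distr) measurable
 also have "\<dots> = (\<integral>\<^sup>+y. indicator (strip r P) y * F (proj y) \<partial>lborel)"
  by (rule nn_integral_density) measurable
 finally show ?thesis .
qed

lemma emeasure_H_density:
 assumes "P : sets borel" "A : sets borel"
 shows "emeasure (density hausm (indicator P)) A = emeasure hausm (A \<inter> P)"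
proof -
 have "emeasure (density hausm (indicator P)) A = (\<integral>\<^sup>+x. indicator P x * indicator A x \<partial>hausm)"
  using assms by (intro emeasure_density) auto
 also have "\<dots> = (\<integral>\<^sup>+x. indicator (A \<inter> P) x \<partial>hausm)"
  by (intro nn_integral_cong) (auto simp: indicator_def)
 also have "\<dots> = emeasure hausm (A \<inter> P)"
  using assms by (intro nn_integral_indicator) auto
 finally show ?thesis .
qed

lemma nn_integral_H_density:
 assumes "P : sets borel" "F : borel_measurable borel"
 shows "(\<integral>\<^sup>+x. F x \<partial>density hausm (indicator P)) = (\<integral>\<^sup>+x. indicator P x * F x \<partial>hausm)"
 using assms by (intro nn_integral_density) (auto simp: measurable_cong_sets[OF sets_hausm refl])

lemma nn_integral_H_le_strip:
 assumes P: "compact P" "!!x. x : P ==> s x = 0" and F: "F : borel_measurable borel" and r: "r > 0"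
 shows "(\<integral>\<^sup>+x. indicator P x * F x \<partial>hausm)
  <= ennreal (graph_const / r) * (\<integral>\<^sup>+y. indicator (strip r P) y * F (proj y) \<partial>lborel)"
proof -
 have Pb: "P : sets borel" using P(1) by (rule borel_compact)
 have "nn_integral (density hausm (indicator P)) F
  <= ennreal (graph_const / r) * nn_integral (distr (density lborel (indicator (strip r P))) borel proj) F"
 proof (rule nn_integral_le_measure)
  fix A assume "A : sets (density hausm (indicator P))"
  then have A: "A : sets borel" by simp
  show "emeasure (density hausm (indicator P)) A
   <= ennreal (graph_const / r) * emeasure (distr (density lborel (indicator (strip r P))) borel proj) A"
   unfolding emeasure_H_density[OF Pb A] emeasure_strip_distr[OF Pb A]
   using A Pb r by (intro H_le_strip[OF P]) auto
 qed simp
 then show ?thesis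
  unfolding nn_integral_strip_distr[OF Pb F] nn_integral_H_density[OF Pb F] .
qed

lemma nn_integral_strip_le_H:
 assumes Pb: "P : sets borel" and F: "F : borel_measurable borel" and r: "r > 0"
 shows "(\<integral>\<^sup>+y. indicator (strip r P) y * F (proj y) \<partial>lborel)
  <= ennreal (r / strip_const) * (\<integral>\<^sup>+x. indicator P x * F x \<partial>hausm)"
proof -
 have "nn_integral (distr (density lborel (indicator (strip r P))) borel proj) F
  <= ennreal (r / strip_const) * nn_integral (density hausm (indicator P)) F"
 proof (rule nn_integral_le_measure)
  fix A assume "A : sets (distr (density lborel (indicator (strip r P))) borel proj)"
  then have A: "A : sets borel" by simp
  have AP: "A \<inter> P : sets borel" using A Pb by auto
  have "emeasure lborel (strip r (A \<inter> P)) = ennreal (r / strip_const) * (ennreal (strip_const / r) * emeasure lborel (strip r (A \<inter> P)))"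
  proof -
   have "ennreal (r / strip_const) * ennreal (strip_const / r) = 1"
    using r strip_const_pos by (subst ennreal_mult[symmetric]) auto
   then show ?thesis by (simp flip: mult.assoc)
  qed
  also have "\<dots> <= ennreal (r / strip_const) * emeasure hausm (A \<inter> P)"
   using strip_le_hausdorff[OF dim2 AP r] by (intro mult_left_mono) (simp_all add: H_eq[OF AP])
  finally show "emeasure (distr (density lborel (indicator (strip r P))) borel proj) A
   <= ennreal (r / strip_const) * emeasure (density hausm (indicator P)) A"
   unfolding emeasure_H_density[OF Pb A] emeasure_strip_distr[OF Pb A] .
 qed simp
 then show ?thesis
  unfolding nn_integral_strip_distr[OF Pb F] nn_integral_H_density[OF Pb F] .
qed

end

section \<open>Charts of the boundary and the trace inequality\<close>

lemma smooth_ray_increment_le: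
 fixes ps :: "'a::euclidean_space => real"
 assumes ps: "smooth ps" and a: "a > 0" and e: "norm e = 1"
 shows "ennreal ((ps (x - a *\<^sub>R e) - ps x)\<^sup>2) \<le>
  ennreal a * (\<integral>\<^sup>+t. ennreal (indicator {0..a} t * (norm (grad ps (x - t *\<^sub>R e)))\<^sup>2) \<partial>lborel)"
proof -
 let ?w = "%t. grad ps (x - t *\<^sub>R e) \<bullet> (- e)" and ?k = "%t. indicator {0..a} t / a"
 have cont: "continuous_on UNIV ?w"
  by (intro continuous_intros continuous_on_compose2[OF smooth_grad_continuous[OF ps, of UNIV]]) auto
 have m[measurable]: "?w : borel_measurable borel" by (rule borel_measurable_continuous_onI[OF cont])
 have [measurable]: "grad ps : borel_measurable borel" by (rule smooth_grad_measurable[OF ps])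
 have deriv: "((%t. ps (x - t *\<^sub>R e)) has_real_derivative ?w t) (at t)" for t
 proof -
  have "((%t. ps (x - t *\<^sub>R e)) has_derivative (%s. grad ps (x - t *\<^sub>R e) \<bullet> (- (s *\<^sub>R e)))) (at t)"
   by (rule has_derivative_compose[OF _ smooth_has_derivative[OF ps]]) (auto intro!: derivative_eq_intros)
  then show ?thesis by (rule has_derivative_imp_has_field_derivative) simp
 qed
 have FTC: "(LBINT t. ?w t * indicator {0..a} t) = ps (x - a *\<^sub>R e) - ps (x - 0 *\<^sub>R e)"
  by (rule integral_FTC_Icc_real) (use a deriv cont in \<open>auto simp: continuous_on_eq_continuous_at\<close>)
 have "integrable lborel (%t. indicator {0..a} t *\<^sub>R ?w t)"
  by (intro borel_integrable_compact continuous_on_subset[OF cont]) auto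
 then have int: "integrable lborel (%t. ?k t * ?w t)" by simp
 have "ennreal ((LBINT t. ?k t * ?w t)\<^sup>2) <= (\<integral>\<^sup>+t. ennreal (?k t * (?w t)\<^sup>2) \<partial>lborel)"
 proof (rule weighted_Jensen_square)
  show "integrable lborel ?k" "(LBINT t. ?k t) = 1" using a by auto
  show "?k t \<ge> 0" for t using a by simp
 qed (use int m in auto)
 also have "\<dots> <= (\<integral>\<^sup>+t. ennreal (1 / a) * ennreal (indicator {0..a} t * (norm (grad ps (x - t *\<^sub>R e)))\<^sup>2) \<partial>lborel)"
 proof (intro nn_integral_mono)
  fix t
  have "(?w t)\<^sup>2 <= (norm (grad ps (x - t *\<^sub>R e)))\<^sup>2"
   using Cauchy_Schwarz_ineq2[of "grad ps (x - t *\<^sub>R e)" "- e"] e by (intro abs_le_square_iff[THEN iffD1]) simp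
  then have "?k t * (?w t)\<^sup>2 <= (1 / a) * (indicator {0..a} t * (norm (grad ps (x - t *\<^sub>R e)))\<^sup>2)"
   using a by (auto simp: indicator_def divide_right_mono)
  then show "ennreal (?k t * (?w t)\<^sup>2) <= ennreal (1 / a) * ennreal (indicator {0..a} t * (norm (grad ps (x - t *\<^sub>R e)))\<^sup>2)"
   using a by (subst ennreal_mult[symmetric]) (auto intro: ennreal_leI)
 qed
 also have "\<dots> = ennreal (1 / a) * (\<integral>\<^sup>+t. ennreal (indicator {0..a} t * (norm (grad ps (x - t *\<^sub>R e)))\<^sup>2) \<partial>lborel)"
  by (intro nn_integral_cmult) measurable
 finally have "ennreal (a\<^sup>2) * ennreal ((LBINT t. ?k t * ?w t)\<^sup>2) \<le>
  ennreal (a\<^sup>2) * (ennreal (1 / a) * (\<integral>\<^sup>+t. ennreal (indicator {0..a} t * (norm (grad ps (x - t *\<^sub>R e)))\<^sup>2) \<partial>lborel))"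
  by (rule mult_left_mono) simp
 moreover have "ennreal (a\<^sup>2) * ennreal (1 / a) = ennreal a"
  using a by (subst ennreal_mult[symmetric]) (auto simp: power2_eq_square)
 moreover have "(ps (x - a *\<^sub>R e) - ps x)\<^sup>2 = a\<^sup>2 * (LBINT t. ?k t * ?w t)\<^sup>2"
 proof -
  have "(LBINT t. ?k t * ?w t) = (LBINT t. ?w t * indicator {0..a} t / a)"
   by (intro Bochner_Integration.integral_cong) auto
  also have "\<dots> = (LBINT t. ?w t * indicator {0..a} t) / a" by (rule integral_divide_zero)
  also have "\<dots> = (ps (x - a *\<^sub>R e) - ps x) / a" by (simp only: FTC scaleR_zero_left diff_zero)
  finally show ?thesis using a by (simp add: power_divide)
 qed
 ultimately show ?thesis
  by (simp add: ennreal_mult mult.assoc[symmetric])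
qed

context height_function
begin

text \<open>The level set over \<open>P\<close> lies in strips of height \<open>1 / Suc n\<close>,
  whose volumes are the corresponding fractions of one finite volume. Hence a strip over the
  boundary may be treated as part of the open domain, although it contains its base.\<close>

lemma level_null:
 assumes "P : sets borel" "bounded P"
 shows "AE y in lborel. proj y : P --> s y \<noteq> 0"
proof -
 have [measurable]: "P : sets borel" by fact
 define Z where "Z = {y. s y = 0 \<and> proj y : P}"
 have Z: "Z : sets lborel" unfolding Z_def by measurable
 obtain v where v: "emeasure lborel (strip 1 P) = ennreal v" "v \<ge> 0"
  using emeasure_bounded_finite[OF strip_bounded[OF assms(2)], of 1] by (cases "emeasure lborel (strip 1 P)") auto
 have "emeasure lborel Z <= ennreal (v / real (Suc n))" for n
 proof -
  have "emeasure lborel Z <= emeasure lborel (strip (1 / real (Suc n)) P)"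
   using strip_borel[OF assms(1)] by (intro emeasure_mono) (auto simp: Z_def strip_def)
  moreover have "of_nat (Suc n) * emeasure lborel (strip (1 / real (Suc n)) P) = ennreal v"
   using strip_multiple[OF assms(1), of "1 / real (Suc n)" "Suc n"] v(1) by simp
  moreover obtain w where w: "emeasure lborel (strip (1 / real (Suc n)) P) = ennreal w" "w \<ge> 0"
   using emeasure_bounded_finite[OF strip_bounded[OF assms(2)], of "1 / real (Suc n)"]
   by (cases "emeasure lborel (strip (1 / real (Suc n)) P)") auto
  ultimately have "ennreal (real (Suc n) * w) = ennreal v" "emeasure lborel Z <= ennreal w"
   by (simp_all add: ennreal_of_nat_eq_real_of_nat ennreal_mult del: of_nat_Suc)
  then have "real (Suc n) * w = v" using v(2) w(2) by (simp del: of_nat_Suc)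
  then have "w = v / real (Suc n)" by (simp add: field_simps)
  then show ?thesis using \<open>emeasure lborel Z <= ennreal w\<close> by simp
 qed
 moreover have "(%n. ennreal (v / real (Suc n))) \<longlonglongrightarrow> ennreal 0"
  using tendsto_mult_right_zero[OF LIMSEQ_inverse_real_of_nat, of v] by (intro tendsto_ennrealI) (simp add: divide_inverse)
 ultimately have "emeasure lborel Z <= ennreal 0"
  by (intro tendsto_lowerbound) auto
 then have "Z : null_sets lborel" using Z by auto
 then have "AE y in lborel. y \<notin> Z" by (rule AE_not_in)
 then show ?thesis by eventually_elim (auto simp: Z_def)
qed

end

definition chart :: "'a::euclidean_space set => 'a => real => 'a => ('a => real) => real => bool" where
 "chart Om x0 r e s \<Lambda> \<longleftrightarrow> height_function e s \<Lambda> \<and> 0 < r \<and> (\<forall>y\<in>ball x0 r. y : Om \<longleftrightarrow> s y > 0)"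

lemma norm_orthogonal_part_le:
 fixes w e :: "'a::euclidean_space"
 assumes "norm e = 1"
 shows "norm (w - (w \<bullet> e) *\<^sub>R e) <= norm w"
proof -
 have "e \<bullet> e = 1" using assms by (simp add: dot_square_norm)
 then have "(w - (w \<bullet> e) *\<^sub>R e) \<bullet> (w - (w \<bullet> e) *\<^sub>R e) = w \<bullet> w - (w \<bullet> e) * (w \<bullet> e)"
  by (simp add: inner_diff_left inner_diff_right inner_commute[of e w])
 then have "(norm (w - (w \<bullet> e) *\<^sub>R e))\<^sup>2 = (norm w)\<^sup>2 - (w \<bullet> e)\<^sup>2"
  by (simp only: power2_norm_eq_inner power2_eq_square[of "w \<bullet> e"])
 then have "(norm (w - (w \<bullet> e) *\<^sub>R e))\<^sup>2 <= (norm w)\<^sup>2" by simp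
 then show ?thesis by (rule power2_le_imp_le) simp
qed

text \<open>\<open>s\<close> is the height above the graph measured along \<open>e\<close>. The
  linear term has Lipschitz constant 1 and \<gamma> is composed with a contraction, which gives
  \<open>1 + L\<close>.\<close>

lemma chart_exists:
 assumes "lipschitz_boundary Om" "x : frontier Om"
 shows "\<exists>r e s \<Lambda>. chart Om x r e s \<Lambda>"
proof -
 obtain e r L \<gamma> where e: "norm e = 1" and r: "r > 0" and L: "L-lipschitz_on {y. y \<bullet> e = 0} \<gamma>"
  and graph: "!!y. y : ball x r ==> y : Om \<longleftrightarrow> \<gamma> (y - (y \<bullet> e) *\<^sub>R e) < y \<bullet> e"
  using assms unfolding lipschitz_boundary_def by metis
 have ee: "e \<bullet> e = 1" using e by (simp add: dot_square_norm)
 define s where "s y = y \<bullet> e - \<gamma> (y - (y \<bullet> e) *\<^sub>R e)" for y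
 have L0: "L \<ge> 0" by (rule lipschitz_on_nonneg[OF L])
 have "height_function e s (1 + L)"
 proof
  show "(1 + L)-lipschitz_on UNIV s"
  proof (rule lipschitz_onI)
   fix y z :: 'a
   have "dist (\<gamma> (y - (y \<bullet> e) *\<^sub>R e)) (\<gamma> (z - (z \<bullet> e) *\<^sub>R e)) <= L * dist (y - (y \<bullet> e) *\<^sub>R e) (z - (z \<bullet> e) *\<^sub>R e)"
    by (rule lipschitz_onD[OF L]) (simp_all add: inner_diff_left ee)
   also have "dist (y - (y \<bullet> e) *\<^sub>R e) (z - (z \<bullet> e) *\<^sub>R e) = norm ((y - z) - ((y - z) \<bullet> e) *\<^sub>R e)"
    by (simp add: dist_norm inner_diff_left algebra_simps)
   also have "L * \<dots> <= L * norm (y - z)"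
    by (intro mult_left_mono norm_orthogonal_part_le e L0)
   finally have "\<bar>\<gamma> (y - (y \<bullet> e) *\<^sub>R e) - \<gamma> (z - (z \<bullet> e) *\<^sub>R e)\<bar> <= L * norm (y - z)"
    by (simp add: dist_norm)
   moreover have "\<bar>y \<bullet> e - z \<bullet> e\<bar> <= norm (y - z)"
    using Cauchy_Schwarz_ineq2[of "y - z" e] e by (simp add: inner_diff_left)
   ultimately show "dist (s y) (s z) <= (1 + L) * dist y z"
    by (simp add: s_def dist_norm distrib_right)
  qed (use L0 in simp)
  show "s (y + t *\<^sub>R e) = s y + t" for y t
   by (simp add: s_def inner_add_left ee algebra_simps)
 qed (use e L0 in auto)
 then show ?thesis
  using r graph
  by (intro exI[of _ r] exI[of _ e] exI[of _ s] exI[of _ "1 + L"]) (auto simp: chart_def s_def)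
qed

locale lipschitz_domain = bounded_open_set Om for Om :: "'a::euclidean_space set" +
 assumes dim2: "DIM('a) \<ge> 2" and lipschitz_boundary: "lipschitz_boundary Om"
  and H_eq: "!!A :: 'a set. A : sets borel ==>
   emeasure hausm A = hausdorff_outer (real DIM('a) - 1) A"
begin

abbreviation "\<Gamma> \<equiv> frontier Om"
abbreviation "sg \<equiv> surface_measure Om"
lemma chart_hausdorff_height: "chart Om x r e s \<Lambda> ==> hausdorff_height e s \<Lambda>"
 unfolding hausdorff_height_def hausdorff_height_axioms_def chart_def using dim2 H_eq by auto

lemma compact_Gamma: "compact \<Gamma>"
 using bounded_domain by (rule compact_frontier_bounded)

lemma Gamma_borel [simp, measurable]: "\<Gamma> : sets borel"
 using compact_Gamma by (rule borel_compact)

lemma space_sigma [simp]: "space sg = \<Gamma>"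
 by (simp add: surface_measure_def)

lemma nn_integral_sigma:
 assumes "F : borel_measurable borel"
 shows "(\<integral>\<^sup>+x. F x \<partial>sg) = (\<integral>\<^sup>+x. indicator \<Gamma> x * F x \<partial>hausm)"
 unfolding surface_measure_def by (subst nn_integral_restrict_space) (auto simp: mult.commute)

lemma borel_measurable_sigma:
 "f : borel_measurable borel ==> f : borel_measurable sg"
 unfolding surface_measure_def
 by (intro measurable_restrict_space1) (simp add: measurable_cong_sets[OF sets_hausm refl])

lemma chart_Gamma:
 assumes c: "chart Om x r e s \<Lambda>" and y: "y : ball x r"
 shows "y : \<Gamma> \<longleftrightarrow> s y = 0"
proof -
 interpret height_function e s \<Lambda> using c by (simp add: chart_def)
 have iff: "!!y. y : ball x r ==> y : Om \<longleftrightarrow> s y > 0" using c by (auto simp: chart_def)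
 have Gam: "y : \<Gamma> \<longleftrightarrow> y : closure Om \<and> y \<notin> Om" for y
  using open_domain by (auto simp: frontier_def interior_open)
 show ?thesis
 proof
  assume "y : \<Gamma>"
  then have yc: "y : closure Om" and "\<not> s y > 0" using Gam iff[OF y] by auto
  moreover have "\<not> s y < 0"
  proof
   assume "s y < 0"
   let ?U = "ball x r \<inter> {z. s z < 0}"
   have "open ?U" by (intro open_Int open_ball open_Collect_less continuous_s continuous_on_const)
   moreover have "y : ?U" using y \<open>s y < 0\<close> by simp
   ultimately have "?U \<inter> Om \<noteq> {}" using yc by (metis disjoint_iff open_Int_closure_eq_empty)
   then show False using iff by force
  qed
  ultimately show "s y = 0" by linarith
 next
  assume s0: "s y = 0"
  have "y : closure Om"
   unfolding closure_approachable
  proof (intro allI impI)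
   fix \<epsilon> :: real assume "\<epsilon> > 0"
   define t where "t = min (\<epsilon>/2) ((r - dist x y)/2)"
   have t: "t > 0" "t < \<epsilon>" "t < r - dist x y" using \<open>\<epsilon> > 0\<close> y by (auto simp: t_def min_def)
   have d: "dist (y + t *\<^sub>R e) y = t" using t norm_e by (simp add: dist_norm)
   have "dist x (y + t *\<^sub>R e) < r"
    using dist_triangle[of x "y + t *\<^sub>R e" y] d t by (simp add: dist_commute)
   then have "y + t *\<^sub>R e : Om" using iff t s0 by (simp add: s_shift)
   then show "\<exists>z\<in>Om. dist z y < \<epsilon>" using d t by metis
  qed
  then show "y : \<Gamma>" using Gam iff[OF y] s0 by simp
 qed
qed

text \<open>Balls of radius \<open>r / 8\<close> leave room in each chart: cut-offs can fall from 1
  to 0 before \<open>r / 4\<close>, and short shifts along \<open>e\<close> do not leave the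
  chart.\<close>

lemma charts:
 obtains F and r :: "'a => real" and e s and \<Lambda> :: "'a => real" where "finite F" "F \<subseteq> \<Gamma>"
  "!!x. x : F ==> chart Om x (r x) (e x) (s x) (\<Lambda> x)" "\<Gamma> \<subseteq> (\<Union>x\<in>F. ball x (r x / 8))"
proof -
 have "\<forall>x. \<exists>r e s \<Lambda>. x : \<Gamma> --> chart Om x r e s \<Lambda>"
  using chart_exists[OF lipschitz_boundary] by blast
 then obtain r e s \<Lambda> where c: "!!x. x : \<Gamma> ==> chart Om x (r x) (e x) (s x) (\<Lambda> x)"
  by metis
 have "x : ball x (r x / 8)" if "x : \<Gamma>" for x using c[OF that] by (simp add: chart_def)
 then have "\<Gamma> \<subseteq> (\<Union>x\<in>\<Gamma>. ball x (r x / 8))" by blast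
 then obtain F where "F \<subseteq> \<Gamma>" "finite F" "\<Gamma> \<subseteq> (\<Union>x\<in>F. ball x (r x / 8))"
  using compactE_image[OF compact_Gamma, of \<Gamma> "%x. ball x (r x / 8)"] by auto
 then show thesis using c that by blast
qed

text \<open>A boundary value is the value at a point of the strip above it plus an increment along
  the segment in direction \<open>e\<close>. Squaring, integrating over a strip of fixed height
  \<rho> and returning to the surface by \<open>nn_integral_H_le_strip\<close> gives the bound,
  because these segments run inside \<open>Om\<close>.\<close>

lemma chart_trace_inequality:
 assumes c: "chart Om x r e s \<Lambda>"
 obtains C where "C \<ge> 0" "!!zt. smooth zt ==> (\<integral>\<^sup>+y. indicator (\<Gamma> \<inter> cball x (r/4)) y * ennreal ((zt y)\<^sup>2) \<partial>hausm)
  <= ennreal C * (ennreal ((L2_norm LO zt)\<^sup>2) + ennreal ((L2_norm LO (grad zt))\<^sup>2))"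
proof -
 interpret hausdorff_height e s \<Lambda> by (rule chart_hausdorff_height[OF c])
 have r: "r > 0" and iff: "!!y. y : ball x r ==> y : Om \<longleftrightarrow> s y > 0" using c by (auto simp: chart_def)
 define \<rho> where "\<rho> = r / 4"
 have \<rho>: "\<rho> > 0" using r by (simp add: \<rho>_def)
 define P where "P = \<Gamma> \<inter> cball x \<rho>"
 have cP: "compact P" unfolding P_def by (intro compact_Int compact_Gamma compact_cball)
 have P0: "s y = 0" if "y : P" for y
  using chart_Gamma[OF c, of y] that r by (auto simp: P_def \<rho>_def)
 have Pb[measurable]: "P : sets borel" using cP by (rule borel_compact)
 define C where "C = graph_const / \<rho> * (2 + 2 * \<rho>\<^sup>2)"
 show thesis
 proof (rule that[of C])
  show "C \<ge> 0" using graph_const_nonneg \<rho> by (simp add: C_def)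
  fix zt :: "'a => real" assume zt: "smooth zt"
  have [measurable]: "zt : borel_measurable borel" "grad zt : borel_measurable borel"
   using zt by (auto intro: smooth_measurable smooth_grad_measurable)
  let ?A = "ennreal ((L2_norm LO zt)\<^sup>2)" and ?B = "ennreal ((L2_norm LO (grad zt))\<^sup>2)"
  define g where "g y = indicator Om y * ennreal ((norm (grad zt y))\<^sup>2)" for y
  define a where "a y = indicator Om y * ennreal ((zt y)\<^sup>2)" for y
  have [measurable]: "g : borel_measurable borel" "a : borel_measurable borel"
   unfolding g_def[abs_def] a_def[abs_def] by measurable
  have lo: "(\<integral>\<^sup>+y. indicator Om y * F y \<partial>lborel) = (\<integral>\<^sup>+y. F y \<partial>LO)" if "F : borel_measurable borel" for F
   using that by (subst nn_integral_restrict_space) (auto simp: nn_integral_completion mult.commute)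
  have intA: "(\<integral>\<^sup>+y. a y \<partial>lborel) = ?A" and intB: "(\<integral>\<^sup>+y. g y \<partial>lborel) = ?B"
   using L2_norm_nn_integral[OF smooth_L2[OF zt]] L2_norm_nn_integral[OF smooth_grad_L2[OF zt]]
   by (simp_all add: a_def g_def lo)
  have "(\<integral>\<^sup>+y. indicator P y * ennreal ((zt y)\<^sup>2) \<partial>hausm)
   <= ennreal (graph_const / \<rho>) * (\<integral>\<^sup>+y. indicator (strip \<rho> P) y * ennreal ((zt (proj y))\<^sup>2) \<partial>lborel)"
   by (rule nn_integral_H_le_strip[OF cP P0 _ \<rho>]) measurable
  also have "(\<integral>\<^sup>+y. indicator (strip \<rho> P) y * ennreal ((zt (proj y))\<^sup>2) \<partial>lborel)
   <= (\<integral>\<^sup>+y. ennreal 2 * a y + ennreal (2 * \<rho>) * (\<integral>\<^sup>+t. indicator {0..\<rho>} t * g (y - t *\<^sub>R e) \<partial>lborel) \<partial>lborel)"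
  proof (rule nn_integral_mono_AE, use level_null[OF Pb compact_imp_bounded[OF cP]] in eventually_elim)
   case (elim y)
   show ?case
   proof (cases "y : strip \<rho> P")
    case True
    then have y: "0 < s y" "s y < \<rho>" "proj y : P" using elim by (auto simp: strip_def order_less_le)
    have near: "y - t *\<^sub>R e : ball x r" if "0 <= t" "t <= s y" for t
    proof -
     have "y - t *\<^sub>R e = proj y + (s y - t) *\<^sub>R e" by (simp add: proj_def algebra_simps)
     then have "dist (proj y) (y - t *\<^sub>R e) = \<bar>s y - t\<bar>" by (simp add: dist_norm norm_e)
     then have "dist x (y - t *\<^sub>R e) <= \<rho> + \<rho>"
      using dist_triangle[of x "y - t *\<^sub>R e" "proj y"] y that by (simp add: P_def)
     then show ?thesis using r by (simp add: \<rho>_def)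
    qed
    have inOm: "y - t *\<^sub>R e : Om" if "0 <= t" "t < s y" for t
     using iff[OF near[of t]] that by (simp add: s_shift_minus)
    have "ennreal ((zt (proj y) - zt y)\<^sup>2) \<le>
     ennreal (s y) * (\<integral>\<^sup>+t. ennreal (indicator {0..s y} t * (norm (grad zt (y - t *\<^sub>R e)))\<^sup>2) \<partial>lborel)"
     using smooth_ray_increment_le[OF zt y(1) norm_e, of y] by (simp add: proj_def)
    also have "\<dots> <= ennreal \<rho> * (\<integral>\<^sup>+t. indicator {0..\<rho>} t * g (y - t *\<^sub>R e) \<partial>lborel)"
    proof (intro mult_mono)
     \<comment> \<open>The end \<open>t = s y\<close> of the segment lies on \<Gamma>, where
       \<open>g\<close> is 0; this single value of \<open>t\<close> is discarded.\<close>
     show "(\<integral>\<^sup>+t. ennreal (indicator {0..s y} t * (norm (grad zt (y - t *\<^sub>R e)))\<^sup>2) \<partial>lborel)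
      <= (\<integral>\<^sup>+t. indicator {0..\<rho>} t * g (y - t *\<^sub>R e) \<partial>lborel)"
     proof (rule nn_integral_mono_AE, use AE_lborel_singleton[of "s y"] in eventually_elim)
      case (elim t)
      show ?case
       using elim inOm[of t] y by (cases "t : {0..s y}") (auto simp: g_def)
     qed
    qed (use y in \<open>auto intro: ennreal_leI\<close>)
    finally have inc: "ennreal ((zt (proj y) - zt y)\<^sup>2) <= ennreal \<rho> * (\<integral>\<^sup>+t. indicator {0..\<rho>} t * g (y - t *\<^sub>R e) \<partial>lborel)" .
    have "(zt (proj y))\<^sup>2 <= 2 * (zt y)\<^sup>2 + 2 * (zt (proj y) - zt y)\<^sup>2"
     using zero_le_power2[of "zt (proj y) - 2 * zt y"] by (simp add: power2_eq_square algebra_simps)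
    then have "ennreal ((zt (proj y))\<^sup>2) <= ennreal (2 * (zt y)\<^sup>2 + 2 * (zt (proj y) - zt y)\<^sup>2)"
     by (rule ennreal_leI)
    also have "\<dots> = ennreal 2 * ennreal ((zt y)\<^sup>2) + ennreal 2 * ennreal ((zt (proj y) - zt y)\<^sup>2)"
     by (simp add: ennreal_mult)
    also have "\<dots> <= ennreal 2 * a y + ennreal 2 * (ennreal \<rho> * (\<integral>\<^sup>+t. indicator {0..\<rho>} t * g (y - t *\<^sub>R e) \<partial>lborel))"
     using inOm[of 0] y by (intro add_mono mult_left_mono inc) (auto simp: a_def)
    also have "\<dots> = ennreal 2 * a y + ennreal (2 * \<rho>) * (\<integral>\<^sup>+t. indicator {0..\<rho>} t * g (y - t *\<^sub>R e) \<partial>lborel)"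
     using \<rho> by (simp add: ennreal_mult mult.assoc)
    finally show ?thesis using True by simp
   qed simp
  qed
  also have "\<dots> = ennreal 2 * ?A + ennreal (2 * \<rho>) * (\<integral>\<^sup>+y. \<integral>\<^sup>+t. indicator {0..\<rho>} t * g (y - t *\<^sub>R e) \<partial>lborel \<partial>lborel)"
   by (subst nn_integral_add) (auto simp: nn_integral_cmult intA)
  also have "(\<integral>\<^sup>+y. \<integral>\<^sup>+t. indicator {0..\<rho>} t * g (y - t *\<^sub>R e) \<partial>lborel \<partial>lborel)
   = (\<integral>\<^sup>+t. \<integral>\<^sup>+y. indicator {0..\<rho>} t * g (y - t *\<^sub>R e) \<partial>lborel \<partial>lborel)"
   by (rule lborel_pair.Fubini') measurable
  also have "\<dots> = (\<integral>\<^sup>+t. indicator {0..\<rho>} t * ?B \<partial>lborel)"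
   by (intro nn_integral_cong) (simp add: nn_integral_cmult nn_integral_translate intB)
  also have "\<dots> = ennreal \<rho> * ?B" using \<rho> by (simp add: nn_integral_multc)
  also have "ennreal 2 * ?A + ennreal (2 * \<rho>) * (ennreal \<rho> * ?B) <= ennreal (2 + 2 * \<rho>\<^sup>2) * (?A + ?B)"
  proof -
   have "ennreal (2 * \<rho>) * (ennreal \<rho> * ?B) = ennreal (2 * \<rho>\<^sup>2) * ?B"
    using \<rho> by (simp add: ennreal_mult power2_eq_square mult_ac)
   then show ?thesis
    using \<rho> unfolding distrib_left by (auto intro!: add_mono mult_right_mono ennreal_leI)
  qed
  finally have "(\<integral>\<^sup>+y. indicator P y * ennreal ((zt y)\<^sup>2) \<partial>hausm)
   <= ennreal (graph_const / \<rho>) * (ennreal (2 + 2 * \<rho>\<^sup>2) * (?A + ?B))"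
   by (simp add: mult_left_mono)
  also have "\<dots> = ennreal C * (?A + ?B)"
   using graph_const_nonneg \<rho> unfolding C_def by (subst ennreal_mult) (auto simp: mult.assoc)
  finally show "(\<integral>\<^sup>+y. indicator (\<Gamma> \<inter> cball x (r/4)) y * ennreal ((zt y)\<^sup>2) \<partial>hausm) <= ennreal C * (?A + ?B)"
   by (simp add: P_def \<rho>_def)
 qed
qed

lemma trace_inequality:
 obtains C where "C \<ge> 0" "!!zt. smooth zt ==> zt : L2 sg"
  "!!zt. smooth zt ==> L2_norm sg zt <= C * (L2_norm LO zt + L2_norm LO (grad zt))"
proof -
 obtain F r e s \<Lambda> where F: "finite F" "F \<subseteq> \<Gamma>"
  and ch: "!!x. x : F ==> chart Om x (r x) (e x) (s x) (\<Lambda> x)" and cov: "\<Gamma> \<subseteq> (\<Union>x\<in>F. ball x (r x / 8))"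
  using charts by blast
 have "\<forall>x\<in>F. \<exists>C\<ge>0. \<forall>zt. smooth zt --> (\<integral>\<^sup>+y. indicator (\<Gamma> \<inter> cball x (r x/4)) y * ennreal ((zt y)\<^sup>2) \<partial>hausm)
  <= ennreal C * (ennreal ((L2_norm LO zt)\<^sup>2) + ennreal ((L2_norm LO (grad zt))\<^sup>2))"
 proof
  fix x assume "x : F"
  show "\<exists>C\<ge>0. \<forall>zt. smooth zt --> (\<integral>\<^sup>+y. indicator (\<Gamma> \<inter> cball x (r x/4)) y * ennreal ((zt y)\<^sup>2) \<partial>hausm)
   <= ennreal C * (ennreal ((L2_norm LO zt)\<^sup>2) + ennreal ((L2_norm LO (grad zt))\<^sup>2))"
   by (rule chart_trace_inequality[OF ch[OF \<open>x : F\<close>]]) blast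
 qed
 from bchoice[OF this] obtain C where C: "!!x. x : F ==> C x \<ge> 0" "!!x zt. x : F ==> smooth zt ==>
  (\<integral>\<^sup>+y. indicator (\<Gamma> \<inter> cball x (r x/4)) y * ennreal ((zt y)\<^sup>2) \<partial>hausm)
  <= ennreal (C x) * (ennreal ((L2_norm LO zt)\<^sup>2) + ennreal ((L2_norm LO (grad zt))\<^sup>2))"
  by blast
 define K where "K = (\<Sum>x\<in>F. C x)"
 have K: "K \<ge> 0" unfolding K_def by (intro sum_nonneg C)
 have main: "zt : L2 sg \<and> L2_norm sg zt <= sqrt K * (L2_norm LO zt + L2_norm LO (grad zt))" if zt: "smooth zt" for zt
 proof -
  have m[measurable]: "zt : borel_measurable borel" using zt by (rule smooth_measurable)
  let ?N = "ennreal ((L2_norm LO zt)\<^sup>2) + ennreal ((L2_norm LO (grad zt))\<^sup>2)"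
  have "(\<integral>\<^sup>+y. ennreal ((norm (zt y))\<^sup>2) \<partial>sg) = (\<integral>\<^sup>+y. indicator \<Gamma> y * ennreal ((zt y)\<^sup>2) \<partial>hausm)"
   by (subst nn_integral_sigma) auto
  also have "\<dots> <= (\<integral>\<^sup>+y. (\<Sum>x\<in>F. indicator (\<Gamma> \<inter> cball x (r x/4)) y * ennreal ((zt y)\<^sup>2)) \<partial>hausm)"
  proof (intro nn_integral_mono)
   fix y
   show "indicator \<Gamma> y * ennreal ((zt y)\<^sup>2) <= (\<Sum>x\<in>F. indicator (\<Gamma> \<inter> cball x (r x/4)) y * ennreal ((zt y)\<^sup>2))"
   proof (cases "y : \<Gamma>")
    case True
    then obtain x where x: "x : F" "dist x y < r x / 8" using cov by auto
    moreover have "r x > 0" using ch[OF x(1)] by (simp add: chart_def)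
    ultimately have "y : \<Gamma> \<inter> cball x (r x/4)" using True by auto
    then have "indicator \<Gamma> y * ennreal ((zt y)\<^sup>2) = indicator (\<Gamma> \<inter> cball x (r x/4)) y * ennreal ((zt y)\<^sup>2)"
     using True by simp
    also have "\<dots> <= (\<Sum>x\<in>F. indicator (\<Gamma> \<inter> cball x (r x/4)) y * ennreal ((zt y)\<^sup>2))"
     using x(1) F(1) by (intro member_le_sum) auto
    finally show ?thesis .
   qed simp
  qed
  also have "\<dots> = (\<Sum>x\<in>F. \<integral>\<^sup>+y. indicator (\<Gamma> \<inter> cball x (r x/4)) y * ennreal ((zt y)\<^sup>2) \<partial>hausm)"
  proof (rule nn_integral_sum)
   fix x
   have [measurable]: "\<Gamma> \<inter> cball x (r x / 4) : sets borel" by (intro sets.Int Gamma_borel borel_closed closed_cball)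
   have "(%y. indicator (\<Gamma> \<inter> cball x (r x/4)) y * ennreal ((zt y)\<^sup>2)) : borel_measurable borel"
    by (intro borel_measurable_times_ennreal borel_measurable_indicator) measurable
   then show "(%y. indicator (\<Gamma> \<inter> cball x (r x/4)) y * ennreal ((zt y)\<^sup>2)) : borel_measurable hausm"
    by (simp only: measurable_cong_sets[OF sets_hausm refl])
  qed
  also have "\<dots> <= (\<Sum>x\<in>F. ennreal (C x) * ?N)"
   using C(2) zt by (intro sum_mono) blast
  also have "\<dots> = ennreal K * ?N"
  proof -
   have "(\<Sum>x\<in>F. ennreal (C x)) = ennreal (sum C F)" by (rule sum_ennreal) (rule C(1))
   then show ?thesis unfolding K_def by (simp only: sum_distrib_right[symmetric])
  qed
  also have "\<dots> = ennreal (K * ((L2_norm LO zt)\<^sup>2 + (L2_norm LO (grad zt))\<^sup>2))"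
   using K by (simp add: ennreal_mult)
  also have "\<dots> <= ennreal ((sqrt K * (L2_norm LO zt + L2_norm LO (grad zt)))\<^sup>2)"
   using K by (intro ennreal_leI) (simp add: power_mult_distrib power2_sum mult_left_mono)
  finally show ?thesis
   using L2_normI[OF borel_measurable_sigma[OF m]] K by simp
 qed
 show thesis by (rule that[of "sqrt K"]) (use main K in auto)
qed

lemma smooth_L2_sigma: "smooth zt ==> zt : L2 sg"
 using trace_inequality by metis

text \<open>Read off from the trace inequality: the constant 1 is smooth, hence square integrable on
  \<Gamma>.\<close>

lemma finite_measure_sigma: "finite_measure sg"
proof -
 have "(%x. 1::real) : L2 sg" by (rule smooth_L2_sigma[OF smooth_const])
 then have "integrable sg (%x. 1::real)" by (auto simp: L2_def)
 then show ?thesis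
  by (intro finite_measureI) (simp add: integrable_iff_bounded less_top)
qed

end

section \<open>Density of smooth functions in \<open>H1\<close>\<close>

lemma L2_norm_le_sum_components:
 assumes "f : L2 M"
 shows "L2_norm M f <= (\<Sum>i\<in>Basis. L2_norm M (%x. f x \<bullet> i))"
proof -
 have c: "(%x. \<bar>f x \<bullet> i\<bar>) : L2 M" for i
  using L2_measurable[OF assms] by (intro L2_bound[OF L2_component[OF assms], where C = 1]) auto
 have "L2_norm M f <= 1 * L2_norm M (%x. \<Sum>i\<in>Basis. \<bar>f x \<bullet> i\<bar>)"
 proof (rule L2_norm_mono)
  show "(%x. \<Sum>i\<in>Basis. \<bar>f x \<bullet> i\<bar>) : L2 M" by (intro L2_sum c)
  show "AE x in M. norm (f x) <= 1 * norm (\<Sum>i\<in>Basis. \<bar>f x \<bullet> i\<bar>)"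
   using norm_le_l1 by (intro AE_I2) (simp add: sum_nonneg abs_of_nonneg)
 qed (use assms in auto)
 also have "\<dots> <= (\<Sum>i\<in>Basis. L2_norm M (%x. \<bar>f x \<bullet> i\<bar>))"
  using L2_norm_sum_le[of "Basis :: 'b set" "%i x. \<bar>f x \<bullet> i\<bar>" M] c by simp
 also have "\<dots> = (\<Sum>i\<in>Basis. L2_norm M (%x. f x \<bullet> i))"
  by (simp add: L2_norm_def L2_inner_def)
 finally show ?thesis .
qed

lemma smooth_prod: "(!!i. i : I ==> smooth (f i)) ==> smooth (%x. \<Prod>i\<in>I. f i x)"
 by (induction I rule: infinite_finite_induct) (auto intro: smooth_const smooth_mult)

lemma kernel_at_grad_support:
 assumes "kernel_at a dl k" "grad k z \<noteq> 0"
 shows "dist z a <= dl"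
proof -
 have "closure {x. k x \<noteq> 0} \<subseteq> cball a dl"
  using assms(1) by (intro closure_minimal) (auto simp: kernel_at_def dist_commute less_imp_le)
 moreover have "z : closure {x. k x \<noteq> 0}" using assms(2) grad_eq_0_outside_support[of z k] by blast
 ultimately have "z : cball a dl" by blast
 then show ?thesis by (simp add: dist_commute)
qed

context bounded_open_set
begin

lemma L2_norm_LO_le:
 fixes f :: "'a => 'b::euclidean_space"
 assumes "f : L2 lborel"
 shows "f : L2 LO" "L2_norm LO f <= L2_norm lborel f"
proof -
 have m[measurable]: "f : borel_measurable borel" using assms by (auto simp: L2_def)
 let ?f = "%x. indicator Om x *\<^sub>R f x"
 have mf: "?f : borel_measurable borel" by measurable
 have L: "?f : L2 lborel" by (rule L2_bound[OF assms, where C = 1]) (use mf in \<open>auto simp: indicator_def\<close>)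
 have L': "?f : L2 LO" using L L2_lebesgue_on_borel_iff[OF domain_borel mf] by simp
 have mLO: "f : borel_measurable LO" by (rule borel_measurable_lebesgue_onI[OF m])
 have ae: "AE x in LO. ?f x = f x" by (intro AE_I2) simp
 show "f : L2 LO" by (rule L2_cong_AE[OF L' mLO ae])
 have "L2_norm LO f = L2_norm LO ?f"
  using L2_norm_cong_AE[OF ae L2_measurable[OF L'] mLO] by simp
 also have "\<dots> = L2_norm lborel ?f" by (rule L2_norm_lebesgue_on_borel[OF domain_borel mf]) simp
 also have "\<dots> <= 1 * L2_norm lborel f"
  by (rule L2_norm_mono[OF assms]) (use mf in \<open>auto simp: indicator_def\<close>)
 finally show "L2_norm LO f <= L2_norm lborel f" by simp
qed

lemma H1_difference_bound:
 assumes zt: "smooth zt" "smooth \<xi>" and z: "z : L2 LO" "is_weak_grad Om z G"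
 shows "L2_norm LO (%x. zt x - \<xi> x) + L2_norm LO (grad (%x. zt x - \<xi> x))
  <= 2 * H1_norm Om (%x. zt x - z x) + 2 * H1_norm Om (%x. \<xi> x - z x)"
proof -
 note W1 = is_weak_grad_diff[OF is_weak_grad_smooth[OF zt(1)] z(2) smooth_L2[OF zt(1)] z(1)]
 note W2 = is_weak_grad_diff[OF is_weak_grad_smooth[OF zt(2)] z(2) smooth_L2[OF zt(2)] z(1)]
 have GL: "G : L2 LO" using z(2) by (rule is_weak_grad_L2)
 have "L2_norm LO (%x. zt x - \<xi> x) <= L2_norm LO (%x. zt x - z x) + L2_norm LO (%x. \<xi> x - z x)"
  using L2_norm_triangle_diff[OF smooth_L2[OF zt(1)] z(1) smooth_L2[OF zt(2)]]
  by (simp add: L2_norm_minus_commute[of LO z \<xi>])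
 moreover have "L2_norm LO (%x. grad zt x - grad \<xi> x) <= L2_norm LO (%x. grad zt x - G x) + L2_norm LO (%x. grad \<xi> x - G x)"
  using L2_norm_triangle_diff[OF smooth_grad_L2[OF zt(1)] GL smooth_grad_L2[OF zt(2)]]
  by (simp add: L2_norm_minus_commute[of LO G "grad \<xi>"])
 moreover have "grad (%x. zt x - \<xi> x) = (%x. grad zt x - grad \<xi> x)"
  using grad_diff[OF zt] by auto
 ultimately show ?thesis
  using H1_norm_bounds(1,2)[OF W1] H1_norm_bounds(1,2)[OF W2] by simp
qed

definition smoothly_approximable :: "('a => real) => bool" where
 "smoothly_approximable v \<longleftrightarrow> (\<forall>\<epsilon>>0. \<exists>zt. smooth zt \<and> H1_norm Om (%x. zt x - v x) < \<epsilon>)"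

lemma smoothly_approximable_add:
 assumes v: "v : L2 LO" "is_weak_grad Om v G" "smoothly_approximable v"
  and w: "w : L2 LO" "is_weak_grad Om w H" "smoothly_approximable w"
 shows "smoothly_approximable (%x. v x + w x)"
 unfolding smoothly_approximable_def
proof (intro allI impI)
 fix \<epsilon> :: real assume "\<epsilon> > 0"
 then have "\<epsilon> / 4 > 0" by simp
 then obtain zt \<xi> where zt: "smooth zt" "H1_norm Om (%x. zt x - v x) < \<epsilon>/4"
  and \<xi>: "smooth \<xi>" "H1_norm Om (%x. \<xi> x - w x) < \<epsilon>/4"
  using v(3) w(3) unfolding smoothly_approximable_def by meson
 note W1 = is_weak_grad_diff[OF is_weak_grad_smooth[OF zt(1)] v(2) smooth_L2[OF zt(1)] v(1)]
 note W2 = is_weak_grad_diff[OF is_weak_grad_smooth[OF \<xi>(1)] w(2) smooth_L2[OF \<xi>(1)] w(1)]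
 have L: "(%x. zt x - v x) : L2 LO" "(%x. \<xi> x - w x) : L2 LO"
  using smooth_L2[OF zt(1)] smooth_L2[OF \<xi>(1)] v w by auto
 have W: "is_weak_grad Om (%x. (zt x + \<xi> x) - (v x + w x)) (%x. (grad zt x - G x) + (grad \<xi> x - H x))"
  using is_weak_grad_comb[OF W1 W2 L, of 1] by (simp add: algebra_simps)
 have "H1_norm Om (%x. (zt x + \<xi> x) - (v x + w x))
  <= L2_norm LO (%x. (zt x + \<xi> x) - (v x + w x)) + L2_norm LO (%x. (grad zt x - G x) + (grad \<xi> x - H x))"
  by (rule H1_norm_bounds(3)[OF W])
 also have "L2_norm LO (%x. (zt x + \<xi> x) - (v x + w x)) <= L2_norm LO (%x. zt x - v x) + L2_norm LO (%x. \<xi> x - w x)"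
  using L2_norm_triangle[OF L] by (simp add: algebra_simps)
 also have "L2_norm LO (%x. (grad zt x - G x) + (grad \<xi> x - H x))
  <= L2_norm LO (%x. grad zt x - G x) + L2_norm LO (%x. grad \<xi> x - H x)"
  by (rule L2_norm_triangle[OF is_weak_grad_L2[OF W1] is_weak_grad_L2[OF W2]])
 finally have "H1_norm Om (%x. (zt x + \<xi> x) - (v x + w x)) < \<epsilon>"
  using H1_norm_bounds(1,2)[OF W1] H1_norm_bounds(1,2)[OF W2] zt(2) \<xi>(2) by linarith
 then show "\<exists>zt. smooth zt \<and> H1_norm Om (%x. zt x - (v x + w x)) < \<epsilon>"
  using smooth_add[OF zt(1) \<xi>(1)] by (intro exI[of _ "%x. zt x + \<xi> x"]) simp
qed

text \<open>Mollification with a kernel centred at \<open>- t e\<close> samples \<open>v\<close> only at points of \<open>Om\<close>, so that it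
 commutes with the weak derivative in all of \<open>Om\<close>.\<close>

lemma smoothly_approximable_local:
 assumes v: "v : L2 LO" and G: "is_weak_grad Om v G"
  and A: "!!x. x : Om ==> x \<notin> A ==> v x = 0 \<and> G x = 0"
  and c: "c > 0" "t0 > 0"
  and cone: "!!t x. 0 < t ==> t < t0 ==> x : Om ==> cball (x + t *\<^sub>R e) (c * t / 2) \<inter> A \<inter> Om \<noteq> {} ==>
   cball (x + t *\<^sub>R e) (c * t / 2) \<subseteq> Om"
 shows "smoothly_approximable v"
proof -
 obtain v' where v': "v' : borel_measurable borel" "!!x. x \<notin> Om ==> v' x = 0" "AE x in LO. v' x = v x"
  "v' : L2 lborel" "!!g. g : borel_measurable borel ==> L2_inner LO v g = L2_inner lborel v' g"
  by (rule L2_lebesgue_on_rep[OF domain_borel v]) blast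
 have GL: "G : L2 LO" by (rule is_weak_grad_L2[OF G])
 have "\<forall>i. \<exists>g'. g' : borel_measurable borel \<and> (\<forall>x. x \<notin> Om --> g' x = 0) \<and> (AE x in LO. g' x = G x \<bullet> i) \<and>
  g' : L2 lborel \<and> (\<forall>h. h : borel_measurable borel --> L2_inner LO (%x. G x \<bullet> i) h = L2_inner lborel g' h)"
  by (intro allI, rule L2_lebesgue_on_rep[OF domain_borel L2_component[OF GL]], blast)
 from choice[OF this] obtain g where g: "!!i. g i : borel_measurable borel" "!!i x. x \<notin> Om ==> g i x = 0"
  "!!i. AE x in LO. g i x = G x \<bullet> i" "!!i. g i : L2 lborel"
  "!!i h. h : borel_measurable borel ==> L2_inner LO (%x. G x \<bullet> i) h = L2_inner lborel (g i) h"
  by blast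
 have bsv: "bounded {x. v' x \<noteq> 0}" and bsg: "bounded {x. g i x \<noteq> 0}" for i
  using v'(2) g(2) by (auto intro: L2_zero_outside_bounded)
 have iv: "integrable lborel v'" by (rule L2_bounded_support_integrable[OF v'(4) bsv])
 \<comment> \<open>\<open>Suc (Suc n)\<close> keeps even the first shift strictly below
   \<open>t0\<close>.\<close>
 define t where "t n = t0 * inverse (real (Suc (Suc n)))" for n :: nat
 have t: "0 < t n" "t n < t0" for n
 proof -
  show "0 < t n" using c by (simp add: t_def)
  have "inverse (real (Suc (Suc n))) < 1" by (simp add: inverse_less_1_iff)
  from mult_strict_left_mono[OF this c(2)] show "t n < t0" by (simp add: t_def)
 qed
 have tlim: "t \<longlonglongrightarrow> 0"
  unfolding t_def[abs_def] by (rule tendsto_mult_right_zero[OF LIMSEQ_Suc[OF LIMSEQ_inverse_real_of_nat]])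
 have "\<exists>k. kernel_at (- (t n *\<^sub>R e)) (c * t n / 2) k" for n
  using kernel_exists[of "c * t n / 2"] c t[of n] by (metis mult_pos_pos half_gt_zero)
 then obtain k where k: "!!n. kernel_at (- (t n *\<^sub>R e)) (c * t n / 2) (k n)" by metis
 have lim: "(%n. norm (- (t n *\<^sub>R e)) + c * t n / 2) \<longlonglongrightarrow> 0"
 proof -
  have "(%n. \<bar>t n\<bar> * norm e + c * t n / 2) \<longlonglongrightarrow> \<bar>0\<bar> * norm e + c * 0 / 2" by (intro tendsto_intros tlim) simp
  then show ?thesis by simp
 qed
 note cvl = conv_kernel_tendsto[OF v'(4) bsv k lim]
 note cgl = conv_kernel_tendsto[OF g(4) bsg k lim]
 define zt where "zt n = conv (k n) v'" for n
 have sm: "smooth (zt n)" for n unfolding zt_def by (rule smooth_conv_kernel[OF k iv])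
 have ks: "smooth (k n)" "bounded {x. k n x \<noteq> 0}" for n
  using k[of n] kernel_at_bounded[OF k[of n]] by (auto simp: kernel_at_def)
 \<comment> \<open>Either the ball sampled at \<open>x\<close> does not meet \<open>A\<close> inside
   \<open>Om\<close>, and both sides are 0 because \<open>v\<close> and \<open>G\<close> vanish on
   it; or the cone condition puts the ball into \<open>Om\<close>, and the reflected kernel is a
   test function for the weak gradient.\<close>
 have gradeq: "grad (zt n) x \<bullet> i = conv (k n) (g i) x" if x: "x : Om" and i: "i : Basis" for n x i
 proof (cases "cball (x + t n *\<^sub>R e) (c * t n / 2) \<inter> A \<inter> Om = {}")
  case True
  have near: "y : cball (x + t n *\<^sub>R e) (c * t n / 2)" if "dist (x - y) (- (t n *\<^sub>R e)) <= c * t n / 2" for y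
  proof -
   have "dist (x + t n *\<^sub>R e) y = dist (x - y) (- (t n *\<^sub>R e))" by (simp add: dist_norm algebra_simps)
   then show ?thesis using that by simp
  qed
  have supp: "y : cball (x + t n *\<^sub>R e) (c * t n / 2)" if "k n (x - y) \<noteq> 0" for y
   using k[of n] that by (intro near less_imp_le) (auto simp: kernel_at_def)
  have gsupp: "y : cball (x + t n *\<^sub>R e) (c * t n / 2)" if "grad (k n) (x - y) \<noteq> 0" for y
   using kernel_at_grad_support[OF k that] by (rule near)
  have z: "AE y in lborel. y : cball (x + t n *\<^sub>R e) (c * t n / 2) --> v' y = 0 \<and> g i y = 0"
   using v'(3) g(3)[of i] unfolding AE_lebesgue_on_iff[OF domain_borel]
  proof eventually_elim
   case (elim y)
   show ?case
   proof (cases "y : Om")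
    case inOm: True
    show ?thesis
    proof
     assume "y : cball (x + t n *\<^sub>R e) (c * t n / 2)"
     then have "y \<notin> A" using True inOm by blast
     then show "v' y = 0 \<and> g i y = 0" using A[OF inOm] elim inOm by simp
    qed
   qed (use v'(2) g(2) in simp)
  qed
  have "conv (k n) (g i) x = 0"
   unfolding conv_def
   by (rule integral_eq_zero_AE, use z in eventually_elim) (use supp in auto)
  moreover have "conv (%z. grad (k n) z \<bullet> i) v' x = 0"
   unfolding conv_def
  proof (rule integral_eq_zero_AE, use z in eventually_elim)
   case (elim y)
   then show ?case using gsupp[of y] by (cases "grad (k n) (x - y) = 0") auto
  qed
  ultimately show ?thesis
   unfolding zt_def grad_conv[OF ks iv i] by simp
 next
  case False
  have cb: "cball (x - - (t n *\<^sub>R e)) (c * t n / 2) \<subseteq> Om"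
   using cone[OF t x False] by simp
  from kernel_test_function[OF k cb] have T: "(%y. k n (x - y)) : test_functions Om" .
  note TD = test_functionsD[OF T]
  have "L2_inner LO v (%y. grad (%y. k n (x - y)) y \<bullet> i) = - L2_inner LO (%y. G y \<bullet> i) (%y. k n (x - y))"
   using G T i by (simp add: is_weak_grad_def)
  also have "L2_inner LO v (%y. grad (%y. k n (x - y)) y \<bullet> i) = L2_inner lborel v' (%y. grad (%y. k n (x - y)) y \<bullet> i)"
   by (intro v'(5) borel_measurable_inner borel_measurable_const TD(6))
  also have "\<dots> = - (LINT y|lborel. (grad (k n) (x - y) \<bullet> i) * v' y)"
   by (simp add: L2_inner_def grad_reflect[OF ks(1)] mult.commute)
  also have "L2_inner LO (%y. G y \<bullet> i) (%y. k n (x - y)) = L2_inner lborel (g i) (%y. k n (x - y))"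
   by (rule g(5)[OF TD(5)])
  also have "\<dots> = (LINT y|lborel. k n (x - y) * g i y)" by (simp add: L2_inner_def mult.commute)
  finally show ?thesis
   unfolding zt_def grad_conv[OF ks iv i] by (simp add: conv_def)
 qed
 define E where "E n = L2_norm lborel (%x. conv (k n) v' x - v' x) +
  (\<Sum>i\<in>Basis. L2_norm lborel (%x. conv (k n) (g i) x - g i x))" for n
 have "E \<longlonglongrightarrow> 0 + (\<Sum>i\<in>(Basis::'a set). 0)"
  unfolding E_def[abs_def] by (intro tendsto_add tendsto_sum cvl cgl)
 then have Elim: "E \<longlonglongrightarrow> 0" by simp
 have W: "is_weak_grad Om (%x. zt n x - v x) (%x. grad (zt n) x - G x)" for n
  by (rule is_weak_grad_diff[OF is_weak_grad_smooth[OF sm] G smooth_L2[OF sm] v])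
 have HE: "H1_norm Om (%x. zt n x - v x) <= E n" for n
 proof -
  have L1: "(%x. conv (k n) v' x - v' x) : L2 lborel"
   by (intro L2_diff conv_kernel_L2[OF k] v' bsv)
  have "L2_norm LO (%x. zt n x - v x) = L2_norm LO (%x. conv (k n) v' x - v' x)"
  proof (rule L2_norm_cong_AE)
   show "AE x in LO. zt n x - v x = conv (k n) v' x - v' x"
    using v'(3) by eventually_elim (simp add: zt_def)
   show "(%x. zt n x - v x) : borel_measurable LO" using L2_measurable[OF L2_diff[OF smooth_L2[OF sm] v]] .
  qed (use L2_measurable[OF L2_norm_LO_le(1)[OF L1]] in simp)
  also have "\<dots> <= L2_norm lborel (%x. conv (k n) v' x - v' x)" by (rule L2_norm_LO_le(2)[OF L1])
  finally have 1: "L2_norm LO (%x. zt n x - v x) <= L2_norm lborel (%x. conv (k n) v' x - v' x)" .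
  have "L2_norm LO (%x. grad (zt n) x - G x) <= (\<Sum>i\<in>Basis. L2_norm LO (%x. (grad (zt n) x - G x) \<bullet> i))"
   by (rule L2_norm_le_sum_components[OF is_weak_grad_L2[OF W]])
  also have "\<dots> <= (\<Sum>i\<in>Basis. L2_norm lborel (%x. conv (k n) (g i) x - g i x))"
  proof (rule sum_mono)
   fix i :: 'a assume i: "i : Basis"
   have L2: "(%x. conv (k n) (g i) x - g i x) : L2 lborel"
    by (intro L2_diff conv_kernel_L2[OF k] g bsg)
   have "L2_norm LO (%x. (grad (zt n) x - G x) \<bullet> i) = L2_norm LO (%x. conv (k n) (g i) x - g i x)"
   proof (rule L2_norm_cong_AE)
    have "AE x in LO. x : Om" by (intro AE_I2) simp
    with g(3)[of i] show "AE x in LO. (grad (zt n) x - G x) \<bullet> i = conv (k n) (g i) x - g i x"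
     by eventually_elim (simp add: inner_diff_left gradeq i)
    show "(%x. (grad (zt n) x - G x) \<bullet> i) : borel_measurable LO"
     using L2_measurable[OF L2_component[OF is_weak_grad_L2[OF W]]] .
   qed (use L2_measurable[OF L2_norm_LO_le(1)[OF L2]] in simp)
   also have "\<dots> <= L2_norm lborel (%x. conv (k n) (g i) x - g i x)" by (rule L2_norm_LO_le(2)[OF L2])
   finally show "L2_norm LO (%x. (grad (zt n) x - G x) \<bullet> i) <= L2_norm lborel (%x. conv (k n) (g i) x - g i x)" .
  qed
  finally show ?thesis using H1_norm_bounds(3)[OF W[of n]] 1 by (simp add: E_def)
 qed
 show ?thesis
  unfolding smoothly_approximable_def
 proof (intro allI impI)
  fix \<epsilon> :: real assume "\<epsilon> > 0"
  then obtain n where "E n < \<epsilon>"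
   using order_tendstoD(2)[OF Elim] by (auto simp: eventually_sequentially)
  then show "\<exists>zt. smooth zt \<and> H1_norm Om (%x. zt x - v x) < \<epsilon>"
   using HE[of n] sm[of n] by (intro exI[of _ "zt n"]) simp
 qed
qed

end

context lipschitz_domain
begin

text \<open>The shift by \<open>t\<close> along \<open>e\<close> raises \<open>s\<close> by
  \<open>t\<close>, while over a ball of radius \<open>t / (2 * \<Lambda>)\<close> it varies by at
  most \<open>t / 2\<close>; the sampled ball therefore stays above the graph. Support in the ball
  of radius \<open>r / 4\<close> keeps all points concerned inside the chart.\<close>

lemma chart_smoothly_approximable:
 assumes ch: "chart Om x0 r e s \<Lambda>" and v: "v : L2 LO" "is_weak_grad Om v G"
  and A: "!!x. x : Om ==> x \<notin> ball x0 (r/4) ==> v x = 0 \<and> G x = 0"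
 shows "smoothly_approximable v"
proof -
 interpret height_function e s \<Lambda> using ch by (simp add: chart_def)
 have r: "r > 0" and iff: "!!y. y : ball x0 r ==> y : Om \<longleftrightarrow> s y > 0" using ch by (auto simp: chart_def)
 have \<Lambda>: "0 < 1 / \<Lambda>" "1 / \<Lambda> <= 1" using Lambda_ge_1 by auto
 show ?thesis
 proof (rule smoothly_approximable_local[OF v A \<Lambda>(1)])
  show "r / 4 > 0" using r by simp
  fix t x assume t: "0 < t" "t < r / 4" and x: "x : Om"
   and "cball (x + t *\<^sub>R e) (1 / \<Lambda> * t / 2) \<inter> ball x0 (r / 4) \<inter> Om \<noteq> {}"
  then obtain y where y: "dist (x + t *\<^sub>R e) y <= 1 / \<Lambda> * t / 2" "dist x0 y < r / 4" by auto
  have ct: "1 / \<Lambda> * t / 2 <= t / 2" using mult_right_mono[OF \<Lambda>(2), of t] t by simp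
  have d1: "dist x (x + t *\<^sub>R e) = t" using t norm_e by (simp add: dist_norm)
  have d2: "dist x0 (x + t *\<^sub>R e) < r / 4 + t / 2"
   using dist_triangle[of x0 "x + t *\<^sub>R e" y] y ct by (simp add: dist_commute)
  have "dist x0 x < r / 4 + t / 2 + t"
   using dist_triangle[of x0 x "x + t *\<^sub>R e"] d1 d2 by (simp add: dist_commute)
  then have "x : ball x0 r" using t by simp
  then have sx: "s x > 0" using iff x by blast
  show "cball (x + t *\<^sub>R e) (1 / \<Lambda> * t / 2) \<subseteq> Om"
  proof
   fix z assume "z : cball (x + t *\<^sub>R e) (1 / \<Lambda> * t / 2)"
   then have z: "dist (x + t *\<^sub>R e) z <= 1 / \<Lambda> * t / 2" by simp
   have "dist x0 z < r / 4 + t / 2 + t / 2"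
    using dist_triangle[of x0 z "x + t *\<^sub>R e"] d2 z ct by simp
   then have zb: "z : ball x0 r" using t by simp
   have "\<bar>s (x + t *\<^sub>R e) - s z\<bar> <= \<Lambda> * norm (x + t *\<^sub>R e - z)" by (rule s_diff_le)
   also have "\<dots> <= \<Lambda> * (1 / \<Lambda> * t / 2)" using z Lambda_ge_1 by (intro mult_left_mono) (auto simp: dist_norm)
   also have "\<dots> = t / 2" using Lambda_ge_1 by simp
   finally have "s z > 0" using sx t(1) s_shift[of x t] by linarith
   then show "z : Om" using iff[OF zb] by simp
  qed
 qed
qed

text \<open>A partition of unity in product form: \<open>v = \<eta> * v + (1 - \<eta>) * v\<close>
  splits off one chart at a time, and the remaining factor \<theta>, the product of all
  \<open>1 - \<eta>\<close>, vanishes near \<Gamma>.\<close>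

lemma H1_smoothly_approximable:
 assumes v: "v : L2 LO" "is_weak_grad Om v G"
 shows "smoothly_approximable v"
proof -
 obtain F r e s \<Lambda> where F: "finite F" "F \<subseteq> \<Gamma>"
  and ch: "!!x. x : F ==> chart Om x (r x) (e x) (s x) (\<Lambda> x)" and cov: "\<Gamma> \<subseteq> (\<Union>x\<in>F. ball x (r x / 8))"
  using charts by blast
 have "\<exists>\<eta>. smooth \<eta> \<and> (\<forall>y\<in>cball x (r x / 8). \<eta> y = 1) \<and> closure {y. \<eta> y \<noteq> 0} \<subseteq> ball x (r x / 4)" if "x : F" for x
 proof -
  have "cball x (r x / 8) \<subseteq> ball x (r x / 4)" using ch[OF that] by (auto simp: chart_def)
  from smooth_cutoff[OF compact_cball open_ball this] show ?thesis by metis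
 qed
 then obtain \<eta> where \<eta>: "!!x. x : F ==> smooth (\<eta> x)" "!!x y. x : F ==> y : cball x (r x / 8) ==> \<eta> x y = 1"
  "!!x. x : F ==> closure {y. \<eta> x y \<noteq> 0} \<subseteq> ball x (r x / 4)"
  by metis
 have step: "smoothly_approximable v"
  if "finite I" "I \<subseteq> F" "v : L2 LO" "is_weak_grad Om v G" "smoothly_approximable (%y. (\<Prod>x\<in>I. 1 - \<eta> x y) * v y)"
  for I v G
  using that
 proof (induction I arbitrary: v G rule: finite_induct)
  case (insert x I)
  have x: "x : F" and I: "I \<subseteq> F" using insert.prems(1) by auto
  have s1: "smooth (%y. 1 - \<eta> x y)" using \<eta>(1)[OF x] by (intro smooth_diff smooth_const)
  note M1 = is_weak_grad_mult[OF insert.prems(3,2) \<eta>(1)[OF x]]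
  note M2 = is_weak_grad_mult[OF insert.prems(3,2) s1]
  have a1: "smoothly_approximable (%y. \<eta> x y * v y)"
  proof (rule chart_smoothly_approximable[OF ch[OF x] M1(2,1)])
   fix y assume "y \<notin> ball x (r x / 4)"
   then have "y \<notin> closure {y. \<eta> x y \<noteq> 0}" using \<eta>(3)[OF x] by blast
   then show "\<eta> x y * v y = 0 \<and> \<eta> x y *\<^sub>R G y + v y *\<^sub>R grad (\<eta> x) y = 0"
    using closure_subset[of "{y. \<eta> x y \<noteq> 0}"] grad_eq_0_outside_support[of y "\<eta> x"] by auto
  qed
  have a2: "smoothly_approximable (%y. (1 - \<eta> x y) * v y)"
  proof (rule insert.IH[OF I M2(2,1)])
   show "smoothly_approximable (%y. (\<Prod>x\<in>I. 1 - \<eta> x y) * ((1 - \<eta> x y) * v y))"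
    using insert.prems(4) insert.hyps by (simp add: mult_ac)
  qed
  have "smoothly_approximable (%y. \<eta> x y * v y + (1 - \<eta> x y) * v y)"
   by (rule smoothly_approximable_add[OF M1(2,1) a1 M2(2,1) a2])
  then show ?case by (simp add: algebra_simps)
 qed simp
 define \<theta> where "\<theta> y = (\<Prod>x\<in>F. 1 - \<eta> x y)" for y
 have s\<theta>: "smooth \<theta>" unfolding \<theta>_def[abs_def] using \<eta>(1) by (intro smooth_prod smooth_diff smooth_const)
 define U where "U = (\<Union>x\<in>F. ball x (r x / 8))"
 have \<theta>0: "\<theta> y = 0" if "y : U" for y
 proof -
  from that obtain x where "x : F" "y : ball x (r x / 8)" by (auto simp: U_def)
  then show ?thesis using \<eta>(2)[of x y] F(1) by (auto simp: \<theta>_def prod_zero_iff less_imp_le)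
 qed
 have oU: "open U" by (auto simp: U_def)
 have g\<theta>0: "grad \<theta> y = 0" if "y : U" for y
 proof (rule grad_eq_0_outside_support)
  have "U \<inter> {y. \<theta> y \<noteq> 0} = {}" using \<theta>0 by auto
  then have "U \<inter> closure {y. \<theta> y \<noteq> 0} = {}" using open_Int_closure_eq_empty[OF oU] by blast
  then show "y \<notin> closure {y. \<theta> y \<noteq> 0}" using that by blast
 qed
 define K where "K = closure Om - U"
 have cK: "compact K" unfolding K_def using bounded_domain oU by (intro compact_diff) (auto simp: compact_closure)
 have KO: "K \<subseteq> Om"
  using cov closure_Un_frontier[of Om] by (auto simp: K_def U_def)
 obtain \<rho> where \<rho>: "\<rho> > 0" "(\<Union>x\<in>K. cball x \<rho>) \<subseteq> Om"
  using compact_subset_open_imp_cball_epsilon_subset[OF cK open_domain KO] by blast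
 note M = is_weak_grad_mult[OF v(2,1) s\<theta>]
 \<comment> \<open>Away from the boundary, mollification with centred kernels suffices, hence the
   direction \<open>e = 0\<close>; \<rho> is a distance by which \<open>K\<close> can be enlarged
   within \<open>Om\<close>.\<close>
 have "smoothly_approximable (%y. \<theta> y * v y)"
 proof (rule smoothly_approximable_local[OF M(2,1), where A = K and c = 1 and e = 0])
  show "\<theta> x * v x = 0 \<and> \<theta> x *\<^sub>R G x + v x *\<^sub>R grad \<theta> x = 0" if "x : Om" "x \<notin> K" for x
   using that \<theta>0[of x] g\<theta>0[of x] closure_subset[of Om] by (auto simp: K_def)
  show "\<rho> > 0" by (rule \<rho>(1))
  fix t x assume t: "0 < t" "t < \<rho>" and "cball (x + t *\<^sub>R 0) (1 * t / 2) \<inter> K \<inter> Om \<noteq> {}"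
  then obtain y where y: "dist x y <= t / 2" "y : K" by auto
  show "cball (x + t *\<^sub>R 0) (1 * t / 2) \<subseteq> Om"
  proof
   fix z assume "z : cball (x + t *\<^sub>R 0) (1 * t / 2)"
   then have "dist y z <= \<rho>" using y(1) t dist_triangle[of y z x] by (simp add: dist_commute)
   then have "z : (\<Union>x\<in>K. cball x \<rho>)" using y(2) by auto
   then show "z : Om" by (rule subsetD[OF \<rho>(2)])
  qed
 qed simp
 then show ?thesis using step[OF F(1) order_refl v] by (simp add: \<theta>_def)
qed

section \<open>Boundary traces\<close>

text \<open>The trace inequality is applied to the difference of two smooth approximations of
  \<open>z\<close>, which tends to 0 together with its gradient whatever the two sequences
  are.\<close>

lemma is_trace_unique:
 assumes "z : H1 Om" "is_trace Om z t" "is_trace Om z t'"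
 shows "AE x in sg. t x = t' x"
proof -
 have zL: "z : L2 LO" and W: "is_weak_grad Om z (weak_grad Om z)"
  using assms(1) H1_weak_grad by (auto simp: H1_def)
 obtain C where C: "C \<ge> 0" "!!zt. smooth zt ==> L2_norm sg zt <= C * (L2_norm LO zt + L2_norm LO (grad zt))"
  using trace_inequality by metis
 obtain zt where 1: "t : L2 sg" "!!n. smooth (zt n)" "(%n::nat. H1_norm Om (%x. zt n x - z x)) \<longlonglongrightarrow> 0"
  "(%n. L2_norm sg (%x. zt n x - t x)) \<longlonglongrightarrow> 0"
  using assms(2) unfolding is_trace_def L2_dist_def by blast
 obtain \<xi> where 2: "t' : L2 sg" "!!n. smooth (\<xi> n)" "(%n::nat. H1_norm Om (%x. \<xi> n x - z x)) \<longlonglongrightarrow> 0"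
  "(%n. L2_norm sg (%x. \<xi> n x - t' x)) \<longlonglongrightarrow> 0"
  using assms(3) unfolding is_trace_def L2_dist_def by blast
 note t = 1(1) 2(1) and zt = 1(2) 2(2) and h = 1(3) 2(3) and l = 1(4) 2(4)
 have est: "L2_norm sg (%x. zt n x - \<xi> n x) \<le>
   C * (2 * H1_norm Om (%x. zt n x - z x) + 2 * H1_norm Om (%x. \<xi> n x - z x))" for n
  by (rule order_trans[OF C(2)[OF smooth_diff[OF zt]] mult_left_mono[OF H1_difference_bound[OF zt zL W] C(1)]])
 have "(%n. L2_norm sg (%x. zt n x - \<xi> n x)) \<longlonglongrightarrow> 0"
 proof (rule tendsto_sandwich[OF _ _ tendsto_const])
  have "(%n. C * (2 * H1_norm Om (%x. zt n x - z x) + 2 * H1_norm Om (%x. \<xi> n x - z x))) \<longlonglongrightarrow> C * (2 * 0 + 2 * 0)"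
   by (intro tendsto_intros h)
  then show "(%n. C * (2 * H1_norm Om (%x. zt n x - z x) + 2 * H1_norm Om (%x. \<xi> n x - z x))) \<longlonglongrightarrow> 0" by simp
 qed (use est in auto)
 then have "(%n. L2_norm sg (%x. zt n x - \<xi> n x) + L2_norm sg (%x. \<xi> n x - t' x)) \<longlonglongrightarrow> 0 + 0"
  using l(2) by (rule tendsto_add)
 then have lim: "(%n. L2_norm sg (%x. zt n x - \<xi> n x) + L2_norm sg (%x. \<xi> n x - t' x)) \<longlonglongrightarrow> 0" by simp
 have "(%n. L2_norm sg (%x. zt n x - t' x)) \<longlonglongrightarrow> 0"
  by (rule tendsto_sandwich[OF _ _ tendsto_const lim])
   (use L2_norm_triangle_diff[OF smooth_L2_sigma[OF zt(1)] smooth_L2_sigma[OF zt(2)] t(2)] in auto)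
 then show ?thesis by (rule L2_limit_unique[OF l(1) _ smooth_L2_sigma[OF zt(1)] t])
qed

lemma is_trace_exists:
 assumes "z : H1 Om"
 shows "is_trace Om z (boundary_trace Om z)"
proof -
 have zL: "z : L2 LO" and W: "is_weak_grad Om z (weak_grad Om z)"
  using assms H1_weak_grad by (auto simp: H1_def)
 obtain C where C: "C \<ge> 0" "!!zt. smooth zt ==> L2_norm sg zt <= C * (L2_norm LO zt + L2_norm LO (grad zt))"
  using trace_inequality by metis
 have "\<exists>zt. smooth zt \<and> H1_norm Om (%x. zt x - z x) < 1 / real (Suc n)" for n
  using H1_smoothly_approximable[OF zL W] unfolding smoothly_approximable_def by simp
 then obtain zt where zt: "!!n. smooth (zt n)" "!!n. H1_norm Om (%x. zt n x - z x) < 1 / real (Suc n)"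
  by metis
 have nn: "0 <= H1_norm Om f" for f by (simp add: H1_norm_def)
 have lim1: "(%n. 1 / real (Suc n)) \<longlonglongrightarrow> 0"
  using LIMSEQ_inverse_real_of_nat by (simp add: divide_inverse)
 have h: "(%n. H1_norm Om (%x. zt n x - z x)) \<longlonglongrightarrow> 0"
  by (rule tendsto_sandwich[OF _ _ tendsto_const lim1])
   (use less_imp_le[OF zt(2)] nn in \<open>auto simp del: of_nat_Suc\<close>)
 obtain t where t: "t : L2 sg" "(%n. L2_norm sg (%x. zt n x - t x)) \<longlonglongrightarrow> 0"
 proof (rule L2_complete[of zt sg])
  fix \<epsilon> :: real assume \<epsilon>: "\<epsilon> > 0"
  define \<epsilon>' where "\<epsilon>' = \<epsilon> / (C + 1) / 4"
  have C1: "C + 1 > 0" using C(1) by linarith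
  have "\<epsilon>' > 0" using \<epsilon> C(1) by (simp add: \<epsilon>'_def)
  then obtain N where N: "!!n. n \<ge> N ==> H1_norm Om (%x. zt n x - z x) < \<epsilon>'"
   using order_tendstoD(2)[OF h] by (auto simp: eventually_sequentially)
  have "L2_norm sg (%x. zt m x - zt n x) < \<epsilon>" if "m \<ge> N" "n \<ge> N" for m n
  proof -
   have "L2_norm sg (%x. zt m x - zt n x) <= C * (2 * H1_norm Om (%x. zt m x - z x) + 2 * H1_norm Om (%x. zt n x - z x))"
    by (rule order_trans[OF C(2)[OF smooth_diff[OF zt(1) zt(1)]] mult_left_mono[OF H1_difference_bound[OF zt(1) zt(1) zL W] C(1)]])
   also have "\<dots> <= C * (4 * \<epsilon>')"
    using N[OF that(1)] N[OF that(2)] C(1) by (intro mult_left_mono) auto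
   also have "\<dots> < (C + 1) * (4 * \<epsilon>')" using \<open>\<epsilon>' > 0\<close> by (intro mult_strict_right_mono) auto
   also have "4 * \<epsilon>' = \<epsilon> / (C + 1)"
   proof -
    have "4 * (x / 4) = x" for x :: real by simp
    then show ?thesis unfolding \<epsilon>'_def .
   qed
   also have "(C + 1) * (\<epsilon> / (C + 1)) = \<epsilon>"
    unfolding times_divide_eq_right by (rule nonzero_mult_div_cancel_left) (use C1 in linarith)
   finally show ?thesis .
  qed
  then show "\<exists>N. \<forall>m\<ge>N. \<forall>n\<ge>N. L2_norm sg (%x. zt m x - zt n x) < \<epsilon>" by blast
 qed (auto intro: smooth_L2_sigma zt)
 then have "is_trace Om z t" using zt(1) h unfolding is_trace_def L2_dist_def by blast
 then show ?thesis unfolding boundary_trace_def by (rule someI[of "is_trace Om z"])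
qed

lemma boundary_trace_smooth:
 assumes zt: "smooth zt"
 shows "AE x in sg. boundary_trace Om zt x = zt x"
proof (rule is_trace_unique)
 show H: "zt : H1 Om" using H1_I[OF smooth_L2[OF zt] is_weak_grad_smooth[OF zt]] .
 then show "is_trace Om zt (boundary_trace Om zt)" by (rule is_trace_exists)
 have "grad (%x::'a. 0::real) = (%x. 0)" by (rule ext) (simp add: grad_const)
 then have "H1_norm Om (%x. 0) = 0"
  using H1_norm_eq[OF is_weak_grad_smooth[OF smooth_const[of 0]]] by simp
 then show "is_trace Om zt zt"
  unfolding is_trace_def L2_dist_def using zt smooth_L2_sigma[OF zt]
  by (intro conjI exI[of _ "%n. zt"]) auto
qed

lemma trace_approximation:
 assumes "z : H1 Om"
 obtains zt where "!!n::nat. smooth (zt n)" "(%n. L2_norm LO (%x. zt n x - z x)) \<longlonglongrightarrow> 0"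
  "(%n. L2_norm LO (%x. grad (zt n) x - weak_grad Om z x)) \<longlonglongrightarrow> 0"
  "(%n. L2_norm sg (%x. zt n x - boundary_trace Om z x)) \<longlonglongrightarrow> 0"
  "boundary_trace Om z : L2 sg"
proof -
 have zL: "z : L2 LO" and W: "is_weak_grad Om z (weak_grad Om z)"
  using assms H1_weak_grad by (auto simp: H1_def)
 obtain zt where tL: "boundary_trace Om z : L2 sg" and zt: "!!n. smooth (zt n)"
  and h: "(%n::nat. H1_norm Om (%x. zt n x - z x)) \<longlonglongrightarrow> 0"
  and l: "(%n. L2_norm sg (%x. zt n x - boundary_trace Om z x)) \<longlonglongrightarrow> 0"
  using is_trace_exists[OF assms] unfolding is_trace_def L2_dist_def by blast
 note Wd = is_weak_grad_diff[OF is_weak_grad_smooth[OF zt] W smooth_L2[OF zt] zL]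
 have "(%n. L2_norm LO (%x. zt n x - z x)) \<longlonglongrightarrow> 0" "(%n. L2_norm LO (%x. grad (zt n) x - weak_grad Om z x)) \<longlonglongrightarrow> 0"
  by (rule tendsto_sandwich[OF _ _ tendsto_const h]; use H1_norm_bounds[OF Wd] in simp)+
 then show thesis using that zt l tL by blast
qed

text \<open>The functions orthogonal to \<open>f'\<close> form a closed subspace that contains the
  smooth functions and, by uniform mollification, the continuous functions of bounded support;
  density puts \<open>f'\<close> itself into it. The surface measure is first moved to the whole
  space, where \<open>L2_closed_subspace_eq\<close> applies.\<close>

lemma L2_sigma_orthogonal_smooth:
 assumes f: "f : L2 sg" and 0: "!!zt. smooth zt ==> L2_inner sg f zt = 0"
 shows "AE x in sg. f x = (0::real)"
proof -
 define M where "M = density hausm (indicator \<Gamma> :: 'a => ennreal)"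
 have dM: "M = density hausm (%x. ennreal (indicator \<Gamma> x))" by (simp add: M_def ennreal_indicator)
 have int: "integral\<^sup>L M h = integral\<^sup>L sg h" "integrable M h \<longleftrightarrow> integrable sg h"
  if "h : borel_measurable borel" for h :: "'a => real"
  using that unfolding dM surface_measure_def
  by (simp_all add: integral_density integrable_density integral_restrict_space integrable_restrict_space
    measurable_cong_sets[OF sets_hausm refl])
 have setsM: "sets M = sets borel" by (simp add: M_def)
 note mM = measurable_cong_sets[OF setsM refl]
 have L2eq: "h : L2 M \<longleftrightarrow> h : L2 sg" if "h : borel_measurable borel" for h :: "'a => real"
  using that int(2)[of "%x. (norm (h x))\<^sup>2"] borel_measurable_sigma[OF that] by (simp add: L2_def mM)
 have innereq: "L2_inner M g h = L2_inner sg g h"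
  if "g : borel_measurable borel" "h : borel_measurable borel" for g h :: "'a => real"
  unfolding L2_inner_def using that by (intro int) auto
 define f' where "f' x = indicator \<Gamma> x * f x" for x
 have f'm: "f' : borel_measurable borel"
 proof -
  have "f : borel_measurable (restrict_space hausm \<Gamma>)" using f by (auto simp: surface_measure_def)
  then have "(%x. indicator \<Gamma> x *\<^sub>R f x) : borel_measurable hausm"
   by (subst (asm) borel_measurable_restrict_space_iff) auto
  then show ?thesis by (simp add: f'_def[abs_def] measurable_cong_sets[OF sets_hausm refl])
 qed
 have ff': "AE x in sg. f x = f' x" by (intro AE_I2) (simp add: f'_def)
 have f'sg: "f' : L2 sg" by (rule L2_cong_AE[OF f borel_measurable_sigma[OF f'm] ff'])
 then have f'M: "f' : L2 M" using L2eq[OF f'm] by simp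
 have zero': "L2_inner M f' zt = 0" if zt: "smooth zt" for zt
 proof -
  have "L2_inner sg f' zt = L2_inner sg f zt"
   using ff' f f'sg smooth_L2_sigma[OF zt] by (intro L2_inner_cong_AE) (auto elim: eventually_mono)
  then show ?thesis using 0[OF zt] innereq[OF f'm smooth_measurable[OF zt]] by simp
 qed
 have sL: "zt : L2 M" if "smooth zt" for zt using L2eq[OF smooth_measurable[OF that]] smooth_L2_sigma[OF that] by simp
 have "(%x. 1::real) : L2 M" by (rule sL[OF smooth_const])
 then have fin: "finite_measure M"
  by (intro finite_measureI) (simp add: L2_def integrable_iff_bounded less_top)
 interpret finite_measure M by fact
 define V where "V = {h : L2 M. L2_inner M f' h = 0}"
 have "f' : V"
 proof (rule L2_closed_subspace_eq[OF fin setsM _ _ _ f'M])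
  show "(%x. p x + a * q x) : V" if "p : V" "q : V" for p q a
   using that f'M by (auto simp: V_def L2_add L2_cmult L2_inner_add_right L2_inner_cmult_right)
  show lim: "g : V" if h: "!!n. h n : V" and g: "g : L2 M" and l: "(%n::nat. L2_norm M (%x. h n x - g x)) \<longlonglongrightarrow> 0" for h g
  proof -
   have "(%n. L2_inner M f' (h n)) \<longlonglongrightarrow> L2_inner M f' g"
    by (rule L2_inner_tendsto[OF _ l]) (use f'M h g in \<open>auto simp: V_def\<close>)
   moreover have "L2_inner M f' (h n) = 0" for n using h[of n] unfolding V_def by blast
   ultimately have "L2_inner M f' g = 0" by (simp add: LIMSEQ_const_iff)
   then show ?thesis using g by (simp add: V_def)
  qed
  show "h : V" if h: "continuous_on UNIV h" "bounded {x. h x \<noteq> 0}" for h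
  proof -
   have hm: "h : borel_measurable borel" using h(1) by (rule borel_measurable_continuous_onI)
   obtain B where B: "!!x. norm (h x) <= B" using bounded_support_bounded[OF h] by metis
   have hL: "h : L2 M" by (rule L2_bounded[where B = B]) (use hm B in \<open>simp_all add: mM\<close>)
   have ih: "integrable lborel h" by (rule integrable_bounded_support[OF h])
   have "\<exists>zt. smooth zt \<and> (\<forall>x. \<bar>zt x - h x\<bar> <= inverse (real (Suc n)))" for n
   proof -
    have "inverse (real (Suc n)) > 0" by simp
    then obtain dl where dl: "dl > 0" "!!x y. dist y x < dl ==> dist (h y) (h x) < inverse (real (Suc n))"
     using bounded_support_uniformly_continuous[OF h] unfolding uniformly_continuous_on_def by (metis UNIV_I)
    obtain k where k: "kernel_at (0::'a) dl k" using kernel_exists[OF dl(1)] by blast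
    have "\<bar>conv k h x - h x\<bar> <= inverse (real (Suc n))" for x
    proof -
     have d: "dist (h y) (h x) < inverse (real (Suc n))" if "dist y (x - 0) < dl" for y using dl(2) that by simp
     have "conv k h x <= h x + inverse (real (Suc n))"
      by (rule conv_kernel_bounds(1)[OF k ih]) (use d in \<open>force simp: dist_norm abs_less_iff\<close>)
     moreover have "h x - inverse (real (Suc n)) <= conv k h x"
      by (rule conv_kernel_bounds(2)[OF k ih]) (use d in \<open>force simp: dist_norm abs_less_iff\<close>)
     ultimately show ?thesis by linarith
    qed
    then show ?thesis using smooth_conv_kernel[OF k ih] by blast
   qed
   then obtain zt where zt: "!!n. smooth (zt n)" "!!n x. \<bar>zt n x - h x\<bar> <= inverse (real (Suc n))"
    by metis
   have zV: "zt n : V" for n using sL[OF zt(1)] zero'[OF zt(1)] by (simp add: V_def)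
   have "(%n. inverse (real (Suc n)) * L2_norm M (%x. 1::real)) \<longlonglongrightarrow> 0"
    by (rule tendsto_mult_left_zero[OF LIMSEQ_inverse_real_of_nat])
   then have "(%n. L2_norm M (%x. zt n x - h x)) \<longlonglongrightarrow> 0"
   proof (rule tendsto_sandwich[OF _ _ tendsto_const, rotated 2])
    show "\<forall>\<^sub>F n in sequentially. L2_norm M (%x. zt n x - h x) <= inverse (real (Suc n)) * L2_norm M (%x. 1::real)"
     by (intro always_eventually allI L2_norm_mono[OF sL[OF smooth_const]])
      (use zt(2) L2_measurable[OF L2_diff[OF sL[OF zt(1)] hL]] in auto)
   qed simp
   then show ?thesis by (rule lim[OF zV hL])
  qed
 qed
 then have "L2_norm M f' = 0" by (simp add: V_def L2_norm_def)
 then have "L2_norm sg f' = 0" using innereq[OF f'm f'm] by (simp add: L2_norm_def)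
 then have "AE x in sg. f' x = 0" using L2_norm_eq_0_iff[OF f'sg] by simp
 with ff' show ?thesis by eventually_elim simp
qed

end

section \<open>Estimates in a collar of the boundary\<close>

lemma grad_bound_lipschitz:
 fixes f :: "'a::euclidean_space => real"
 assumes f: "smooth f" and B: "!!x. norm (grad f x) <= B"
 shows "\<bar>f x - f y\<bar> <= B * norm (x - y)"
proof -
 have "norm (f x - f y) <= B * norm (x - y)"
 proof (rule differentiable_bound[of UNIV f "%x h. grad f x \<bullet> h"])
  show "(f has_derivative (%h. grad f x \<bullet> h)) (at x within UNIV)" for x
   by (rule smooth_has_derivative[OF f])
  show "onorm (%h. grad f x \<bullet> h) <= B" for x
  proof (rule onorm_bound)
   show "0 <= B" using norm_ge_zero B by (rule order_trans)
   show "norm (grad f x \<bullet> h) <= B * norm h" for h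
    using order_trans[OF Cauchy_Schwarz_ineq2[of "grad f x" h] mult_right_mono[OF B[of x] norm_ge_zero]] by simp
  qed
 qed simp_all
 then show ?thesis by simp
qed

context lipschitz_domain
begin

definition collar :: "real => 'a set" where
 "collar dl = {x\<in>Om. \<exists>y. y \<notin> Om \<and> dist x y < dl}"

lemma collar_borel [measurable]: "collar dl : sets borel"
proof -
 have "collar dl = Om \<inter> (\<Union>y\<in>-Om. ball y dl)" by (auto simp: collar_def dist_commute)
 then show ?thesis using open_domain by (auto intro!: borel_open)
qed

definition layer :: "'a => real => ('a => real) => real => 'a set" where
 "layer x0 r s a = {x. dist x0 x < r / 4 \<and> 0 < s x \<and> s x <= a}"

lemma layer_borel:
 assumes "chart Om x0 r e s \<Lambda>"
 shows "layer x0 r s a : sets borel"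
proof -
 interpret height_function e s \<Lambda> using assms by (simp add: chart_def)
 show ?thesis unfolding layer_def by measurable
qed

text \<open>The segment from \<open>x\<close> to a nearby point outside \<open>Om\<close> meets
  \<Gamma> in some \<open>p\<close>. There \<open>s\<close> is 0, so \<open>s x\<close> is at most
  \<Lambda> times the distance. Widths below every \<open>r / 8\<close> keep \<open>x\<close> and
  \<open>p\<close> in a common chart.\<close>

lemma collar_charts:
 obtains F and r :: "'a => real" and e s and \<Lambda> :: "'a => real" and dl0 where "finite F"
  "!!c. c : F ==> chart Om c (r c) (e c) (s c) (\<Lambda> c)" "!!c. c : F ==> \<Lambda> c \<ge> 1" "dl0 > 0"
  "!!dl. dl < dl0 ==> collar dl \<subseteq> (\<Union>c\<in>F. layer c (r c) (s c) (\<Lambda> c * dl))"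
proof -
 obtain F r e s \<Lambda> where F: "finite F" "F \<subseteq> \<Gamma>"
  and ch: "!!x. x : F ==> chart Om x (r x) (e x) (s x) (\<Lambda> x)" and cov: "\<Gamma> \<subseteq> (\<Union>x\<in>F. ball x (r x / 8))"
  using charts by blast
 have \<Lambda>: "\<Lambda> c \<ge> 1" if "c : F" for c
  using ch[OF that] height_function.Lambda_ge_1 by (auto simp: chart_def)
 have r: "r c > 0" if "c : F" for c using ch[OF that] by (simp add: chart_def)
 define dl0 where "dl0 = Min (insert 1 ((%c. r c / 8) ` F))"
 have dl0: "dl0 > 0" unfolding dl0_def using F(1) r by (subst Min_gr_iff) auto
 show thesis
 proof (rule that[OF F(1) ch \<Lambda> dl0])
  fix dl assume dl: "dl < dl0"
  show "collar dl \<subseteq> (\<Union>c\<in>F. layer c (r c) (s c) (\<Lambda> c * dl))"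
  proof
   fix x assume "x : collar dl"
   then obtain y where x: "x : Om" and y: "y \<notin> Om" "dist x y < dl" by (auto simp: collar_def)
   have "closed_segment x y \<inter> \<Gamma> \<noteq> {}"
    by (rule connected_Int_frontier) (use x y in auto)
   then obtain p where p: "p : closed_segment x y" "p : \<Gamma>" by blast
   have dp: "dist x p < dl" using dist_in_closed_segment[OF p(1)] y(2) by (simp add: dist_commute)
   obtain c where c: "c : F" "dist c p < r c / 8" using cov p(2) by auto
   interpret height_function "e c" "s c" "\<Lambda> c" using ch[OF c(1)] by (simp add: chart_def)
   have "dl0 <= r c / 8" unfolding dl0_def using F(1) c(1) by (intro Min_le) auto
   then have dx: "dist c x < r c / 4"
    using dist_triangle[of c x p] dp c(2) dl by (simp add: dist_commute)
   have "s c p = 0" using chart_Gamma[OF ch[OF c(1)], of p] p(2) c(2) r[OF c(1)] by simp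
   moreover have "s c x > 0" using ch[OF c(1)] x dx r[OF c(1)] by (auto simp: chart_def)
   moreover have "\<Lambda> c * norm (x - p) <= \<Lambda> c * dl"
    using dp \<Lambda>[OF c(1)] by (intro mult_left_mono) (auto simp: dist_norm)
   ultimately have "s c x <= \<Lambda> c * dl" using s_diff_le[of x p] by linarith
   then have "x : layer c (r c) (s c) (\<Lambda> c * dl)" using dx \<open>s c x > 0\<close> by (simp add: layer_def)
   then show "x : (\<Union>c\<in>F. layer c (r c) (s c) (\<Lambda> c * dl))" using c(1) by blast
  qed
 qed
qed

lemma collar_integral_le:
 assumes F: "finite F" and cov: "collar dl \<subseteq> (\<Union>c\<in>F. A c)" and A: "!!c. c : F ==> A c : sets borel"
  and h[measurable]: "h : borel_measurable borel"
  and le: "!!c. c : F ==> (\<integral>\<^sup>+x. indicator (A c) x * h x \<partial>lborel) <= ennreal (b c)"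
  and b: "!!c. c : F ==> b c \<ge> 0"
 shows "(\<integral>\<^sup>+x. indicator (collar dl) x * h x \<partial>lborel) <= ennreal (\<Sum>c\<in>F. b c)"
proof -
 have "(\<integral>\<^sup>+x. indicator (collar dl) x * h x \<partial>lborel) <= (\<integral>\<^sup>+x. (\<Sum>c\<in>F. indicator (A c) x * h x) \<partial>lborel)"
 proof (intro nn_integral_mono)
  fix x
  show "indicator (collar dl) x * h x <= (\<Sum>c\<in>F. indicator (A c) x * h x)"
  proof (cases "x : collar dl")
   case True
   then obtain c where c: "c : F" "x : A c" using cov by blast
   have "indicator (A c) x * h x <= (\<Sum>c\<in>F. indicator (A c) x * h x)"
    by (rule member_le_sum[OF c(1)]) (use F in auto)
   then show ?thesis using True c by simp
  qed simp
 qed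
 also have "\<dots> = (\<Sum>c\<in>F. \<integral>\<^sup>+x. indicator (A c) x * h x \<partial>lborel)"
  using A h by (intro nn_integral_sum borel_measurable_times_ennreal borel_measurable_indicator) auto
 also have "\<dots> <= (\<Sum>c\<in>F. ennreal (b c))" by (intro sum_mono le)
 also have "\<dots> = ennreal (\<Sum>c\<in>F. b c)" using b by (rule sum_ennreal)
 finally show ?thesis .
qed

lemma L2_norm_LO_indicator_le:
 fixes h :: "'a => 'b::euclidean_space"
 assumes [measurable]: "h : borel_measurable borel" "A : sets borel"
  and le: "(\<integral>\<^sup>+x. indicator A x * ennreal ((norm (h x))\<^sup>2) \<partial>lborel) <= ennreal b" and b: "b \<ge> 0"
 shows "(L2_norm LO (%x. indicator A x *\<^sub>R h x))\<^sup>2 <= b"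
proof -
 let ?k = "%x. indicator A x *\<^sub>R h x"
 have m: "?k : borel_measurable lborel" by measurable
 have eq: "ennreal ((norm (?k x))\<^sup>2) = indicator A x * ennreal ((norm (h x))\<^sup>2)" for x
  by (cases "x : A") auto
 have "(\<integral>\<^sup>+x. ennreal ((norm (?k x))\<^sup>2) \<partial>lborel) <= ennreal ((sqrt b)\<^sup>2)"
  unfolding eq using le b by simp
 from L2_normI[OF m this] have k: "?k : L2 lborel" "L2_norm lborel ?k <= sqrt b" using b by auto
 have "L2_norm LO ?k <= sqrt b" using L2_norm_LO_le(2)[OF k(1)] k(2) by linarith
 then have "(L2_norm LO ?k)\<^sup>2 <= (sqrt b)\<^sup>2" by (intro power_mono) auto
 then show ?thesis using b by simp
qed

text \<open>On a thin layer \<open>zt\<close> is uniformly close to its value at the projection, and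
  the volume of a strip is controlled by its height times the surface measure of its base. The order
  of the quantifiers is essential: \<open>C\<close> depends on the chart alone, while the threshold
  \<open>a1\<close> may depend on \<open>zt\<close> and \<rho>.\<close>

lemma chart_trace_layer:
 assumes c: "chart Om x0 r e s \<Lambda>"
 shows "\<exists>C\<ge>0. \<forall>zt \<rho>. smooth zt --> \<rho> > 0 --> (\<exists>a1>0. \<forall>a. 0 < a --> a < a1 \<longrightarrow>
  (\<integral>\<^sup>+x. indicator (layer x0 r s a) x * ennreal ((norm (zt x))\<^sup>2) \<partial>lborel) <= ennreal (a * (C * ((L2_norm sg zt)\<^sup>2 + \<rho>))))"
proof -
 interpret hausdorff_height e s \<Lambda> by (rule chart_hausdorff_height[OF c])
 have r: "r > 0" and iff: "!!y. y : ball x0 r ==> y : Om \<longleftrightarrow> s y > 0" using c by (auto simp: chart_def)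
 define P where "P = \<Gamma> \<inter> cball x0 (r/2)"
 have Pb[measurable]: "P : sets borel" unfolding P_def by simp
 show ?thesis
 proof (rule exI[of _ "2 / strip_const"], intro conjI allI impI)
  show "0 <= 2 / strip_const" using strip_const_pos by simp
  fix zt :: "'a => real" and \<rho> :: real assume zt: "smooth zt" and \<rho>: "\<rho> > 0"
  have [measurable]: "zt : borel_measurable borel" by (rule smooth_measurable[OF zt])
  define v where "v = measure sg \<Gamma>"
  have v: "emeasure sg \<Gamma> = ennreal v" "v \<ge> 0"
   using finite_measure.emeasure_eq_measure[OF finite_measure_sigma] by (simp_all add: v_def)
  define \<omega> where "\<omega> = \<rho> / (v + 1)"
  have \<omega>: "\<omega> > 0" using \<rho> v(2) by (simp add: \<omega>_def)
  have "\<omega> * v <= \<omega> * (v + 1)" using \<omega> by (intro mult_left_mono) auto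
  also have "\<dots> = \<rho>" using v(2) by (simp add: \<omega>_def)
  finally have \<omega>v: "\<omega> * v <= \<rho>" .
  have "uniformly_continuous_on (cball x0 r) (%x. (norm (zt x))\<^sup>2)"
   by (intro compact_uniformly_continuous continuous_intros smooth_continuous[OF zt]) auto
  then obtain d where d: "d > 0" "!!x y. x : cball x0 r ==> y : cball x0 r ==> dist y x < d ==>
    dist ((norm (zt y))\<^sup>2) ((norm (zt x))\<^sup>2) < \<omega>"
   using \<omega> unfolding uniformly_continuous_on_def by meson
  show "\<exists>a1>0. \<forall>a. 0 < a --> a < a1 --> (\<integral>\<^sup>+x. indicator (layer x0 r s a) x * ennreal ((norm (zt x))\<^sup>2) \<partial>lborel)
   <= ennreal (a * (2 / strip_const * ((L2_norm sg zt)\<^sup>2 + \<rho>)))"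
  proof (rule exI[of _ "min (r/4) d"], intro conjI allI impI)
   show "0 < min (r/4) d" using r d(1) by simp
   fix a assume a: "0 < a" "a < min (r/4) d"
   define Fu where "Fu y = ennreal ((norm (zt y))\<^sup>2) + ennreal \<omega>" for y
   have Fum[measurable]: "Fu : borel_measurable borel" unfolding Fu_def[abs_def] by measurable
   \<comment> \<open>Height \<open>2 * a\<close>, because a layer contains its top level and a strip
     does not; this is the 2 in the constant.\<close>
   have pt: "indicator (layer x0 r s a) x * ennreal ((norm (zt x))\<^sup>2) <= indicator (strip (2 * a) P) x * Fu (proj x)" for x
   proof (cases "x : layer x0 r s a")
    case True
    then have x: "dist x0 x < r / 4" "0 < s x" "s x <= a" by (auto simp: layer_def)
    have dp: "dist x (proj x) <= a" using dist_proj[of x] x by (simp add: dist_norm)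
    have dx: "dist x0 (proj x) < r / 2" using dist_triangle[of x0 "proj x" x] x dp a by simp
    then have "proj x : \<Gamma>" using chart_Gamma[OF c, of "proj x"] r by simp
    then have xs: "x : strip (2 * a) P" using x a dx by (simp add: strip_def P_def)
    have "dist ((norm (zt x))\<^sup>2) ((norm (zt (proj x)))\<^sup>2) < \<omega>"
     by (rule d(2)) (use x dx dp a r in auto)
    then have "(norm (zt x))\<^sup>2 <= (norm (zt (proj x)))\<^sup>2 + \<omega>" unfolding dist_real_def by linarith
    then have "ennreal ((norm (zt x))\<^sup>2) <= ennreal ((norm (zt (proj x)))\<^sup>2 + \<omega>)" by (rule ennreal_leI)
    then have "ennreal ((norm (zt x))\<^sup>2) <= Fu (proj x)" using \<omega> by (simp only: Fu_def) (simp add: ennreal_plus)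
    then show ?thesis using True xs by simp
   qed simp
   have "(\<integral>\<^sup>+x. indicator (layer x0 r s a) x * ennreal ((norm (zt x))\<^sup>2) \<partial>lborel)
    <= (\<integral>\<^sup>+x. indicator (strip (2 * a) P) x * Fu (proj x) \<partial>lborel)" by (intro nn_integral_mono pt)
   also have "\<dots> <= ennreal (2 * a / strip_const) * (\<integral>\<^sup>+x. indicator P x * Fu x \<partial>hausm)"
    by (rule nn_integral_strip_le_H[OF Pb Fum]) (use a in simp)
   also have "\<dots> <= ennreal (2 * a / strip_const) * (\<integral>\<^sup>+x. indicator \<Gamma> x * Fu x \<partial>hausm)"
    by (intro mult_left_mono nn_integral_mono) (auto simp: P_def indicator_def)
   also have "(\<integral>\<^sup>+x. indicator \<Gamma> x * Fu x \<partial>hausm) = (\<integral>\<^sup>+x. Fu x \<partial>sg)"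
    by (rule nn_integral_sigma[OF Fum, symmetric])
   also have "\<dots> = (\<integral>\<^sup>+x. ennreal ((norm (zt x))\<^sup>2) \<partial>sg) + (\<integral>\<^sup>+x. ennreal \<omega> \<partial>sg)"
    unfolding Fu_def by (intro nn_integral_add borel_measurable_sigma) measurable
   also have "\<dots> = ennreal ((L2_norm sg zt)\<^sup>2) + ennreal (\<omega> * v)"
    using L2_norm_nn_integral[OF smooth_L2_sigma[OF zt]] v \<omega> by (simp add: ennreal_mult)
   also have "\<dots> <= ennreal ((L2_norm sg zt)\<^sup>2 + \<rho>)"
    using \<omega>v \<rho> by (simp add: ennreal_plus ennreal_leI add_left_mono)
   also have "ennreal (2 * a / strip_const) * ennreal ((L2_norm sg zt)\<^sup>2 + \<rho>)
    = ennreal (a * (2 / strip_const * ((L2_norm sg zt)\<^sup>2 + \<rho>)))"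
    using a \<rho> strip_const_pos by (subst ennreal_mult[symmetric]) (auto simp: mult_ac)
   finally show "(\<integral>\<^sup>+x. indicator (layer x0 r s a) x * ennreal ((norm (zt x))\<^sup>2) \<partial>lborel)
    <= ennreal (a * (2 / strip_const * ((L2_norm sg zt)\<^sup>2 + \<rho>)))" by (simp add: mult_left_mono)
  qed
 qed
qed

lemma trace_collar:
 obtains C where "C \<ge> 0" "!!zt \<rho>. smooth zt ==> \<rho> > 0 ==>
  \<exists>dl1>0. \<forall>dl. 0 < dl --> dl < dl1 \<longrightarrow>
   (L2_norm LO (%x. indicator (collar dl) x *\<^sub>R zt x))\<^sup>2 <= dl * (C * ((L2_norm sg zt)\<^sup>2 + \<rho>))"
proof -
 obtain F r e s \<Lambda> dl0 where F: "finite F"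
  and ch: "!!c. c : F ==> chart Om c (r c) (e c) (s c) (\<Lambda> c)" and \<Lambda>: "!!c. c : F ==> \<Lambda> c \<ge> 1" and dl0: "dl0 > 0"
  and cov: "!!dl. dl < dl0 ==> collar dl \<subseteq> (\<Union>c\<in>F. layer c (r c) (s c) (\<Lambda> c * dl))"
  using collar_charts by blast
 let ?Q = "%c a zt b. (\<integral>\<^sup>+x. indicator (layer c (r c) (s c) a) x * ennreal ((norm (zt x :: real))\<^sup>2) \<partial>lborel) <= ennreal (a * b)"
 have "\<forall>c\<in>F. \<exists>C\<ge>0. \<forall>zt \<rho>. smooth zt --> \<rho> > 0 --> (\<exists>a1>0. \<forall>a. 0 < a --> a < a1 --> ?Q c a zt (C * ((L2_norm sg zt)\<^sup>2 + \<rho>)))"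
  by (intro ballI chart_trace_layer[OF ch])
 from bchoice[OF this] obtain C where C0: "\<forall>c\<in>F. C c \<ge> 0 \<and> (\<forall>zt \<rho>. smooth zt --> \<rho> > 0 \<longrightarrow>
  (\<exists>a1>0. \<forall>a. 0 < a --> a < a1 --> ?Q c a zt (C c * ((L2_norm sg zt)\<^sup>2 + \<rho>))))" ..
 have C: "C c \<ge> 0" if "c : F" for c by (rule conjunct1[OF bspec[OF C0 that]])
 have C2: "\<exists>a1>0. \<forall>a. 0 < a --> a < a1 --> ?Q c a zt (C c * ((L2_norm sg zt)\<^sup>2 + \<rho>))"
  if "c : F" "smooth zt" "\<rho> > 0" for c zt \<rho>
  by (rule conjunct2[OF bspec[OF C0 that(1)], rule_format, OF that(2,3)])
 show thesis
 proof (rule that[of "\<Sum>c\<in>F. \<Lambda> c * C c"])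
  have pos: "0 <= \<Lambda> c * C c" if "c : F" for c using C[OF that] \<Lambda>[OF that] by simp
  then show "0 <= (\<Sum>c\<in>F. \<Lambda> c * C c)" by (rule sum_nonneg)
  fix zt :: "'a => real" and \<rho> :: real assume zt: "smooth zt" and \<rho>: "\<rho> > 0"
  let ?N = "(L2_norm sg zt)\<^sup>2 + \<rho>"
  have N: "?N \<ge> 0" using \<rho> by simp
  have "\<forall>c\<in>F. \<exists>a1>0. \<forall>a. 0 < a --> a < a1 --> ?Q c a zt (C c * ?N)" 
   by (intro ballI C2 zt \<rho>)
  from bchoice[OF this] obtain a1 where a10: "\<forall>c\<in>F. a1 c > 0 \<and> (\<forall>a. 0 < a --> a < a1 c --> ?Q c a zt (C c * ?N))" ..
  have a1: "a1 c > 0" if "c : F" for c by (rule conjunct1[OF bspec[OF a10 that]])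
  have a2: "?Q c a zt (C c * ?N)" if "c : F" "0 < a" "a < a1 c" for c a
   by (rule conjunct2[OF bspec[OF a10 that(1)], rule_format, OF that(2,3)])
  define dl1 where "dl1 = Min (insert dl0 ((%c. a1 c / \<Lambda> c) ` F))"
  have ap: "a1 c / \<Lambda> c > 0" if "c : F" for c using a1[OF that] \<Lambda>[OF that] by simp
  have dl1: "dl1 > 0" unfolding dl1_def using F ap dl0 by (subst Min_gr_iff) auto
  show "\<exists>dl1>0. \<forall>dl. 0 < dl --> dl < dl1 \<longrightarrow>
   (L2_norm LO (%x. indicator (collar dl) x *\<^sub>R zt x))\<^sup>2 <= dl * ((\<Sum>c\<in>F. \<Lambda> c * C c) * ?N)"
  proof (intro exI[of _ dl1] conjI allI impI dl1)
   fix dl assume dl: "0 < dl" "dl < dl1"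
   have "dl1 <= dl0" unfolding dl1_def using F by (intro Min_le) auto
   then have cov': "collar dl \<subseteq> (\<Union>c\<in>F. layer c (r c) (s c) (\<Lambda> c * dl))" using cov dl by simp
   have "(\<integral>\<^sup>+x. indicator (collar dl) x * ennreal ((norm (zt x))\<^sup>2) \<partial>lborel) <= ennreal (\<Sum>c\<in>F. \<Lambda> c * dl * (C c * ?N))"
   proof (rule collar_integral_le[OF F cov' layer_borel[OF ch]])
    show "(%x. ennreal ((norm (zt x))\<^sup>2)) : borel_measurable borel"
     using smooth_measurable[OF zt] by measurable
    fix c assume c: "c : F"
    have "dl1 <= a1 c / \<Lambda> c" unfolding dl1_def using F c by (intro Min_le) auto
    then have "dl < a1 c / \<Lambda> c" using dl(2) by linarith
    then have "\<Lambda> c * dl < a1 c" using \<Lambda>[OF c] by (simp add: pos_less_divide_eq mult.commute)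
    then show "?Q c (\<Lambda> c * dl) zt (C c * ?N)" using \<Lambda>[OF c] dl(1) by (intro a2 c) auto
    show "0 <= \<Lambda> c * dl * (C c * ?N)" using \<Lambda>[OF c] dl(1) C[OF c] N by (intro mult_nonneg_nonneg) auto
   qed
   also have "(\<Sum>c\<in>F. \<Lambda> c * dl * (C c * ?N)) = dl * ((\<Sum>c\<in>F. \<Lambda> c * C c) * ?N)"
    by (simp only: sum_distrib_left sum_distrib_right mult_ac)
   finally show "(L2_norm LO (%x. indicator (collar dl) x *\<^sub>R zt x))\<^sup>2 <= dl * ((\<Sum>c\<in>F. \<Lambda> c * C c) * ?N)"
    using \<open>0 <= (\<Sum>c\<in>F. \<Lambda> c * C c)\<close> N dl(1)
    by (intro L2_norm_LO_indicator_le smooth_measurable[OF zt] collar_borel mult_nonneg_nonneg) auto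
  qed
 qed
qed

text \<open>Only the gradient \<open>G\<close> of the solution is recorded; its zero boundary values
  are contained in \<open>G\<close> being a limit of gradients of test functions. In this form
  solutions combine linearly without any choice of representatives.\<close>

definition weak_poisson :: "('a => real) => ('a => 'a) => bool" where
 "weak_poisson f G \<longleftrightarrow> f : L2 LO \<and> G : L2 LO \<and>
   (\<exists>ps. (\<forall>n::nat. ps n : test_functions Om) \<and> (%n. L2_norm LO (%x. grad (ps n) x - G x)) \<longlonglongrightarrow> 0) \<and>
   (\<forall>ps\<in>test_functions Om. L2_inner LO G (grad ps) = L2_inner LO f ps)"

text \<open>The version on the whole space, with \<open>G\<close> equal to 0 outside
  \<open>Om\<close>, so that \<open>G\<close> can be translated across the boundary.\<close>

definition global_poisson :: "('a => real) => ('a => 'a) => bool" where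
 "global_poisson f G \<longleftrightarrow> f : L2 lborel \<and> G : L2 lborel \<and> (\<forall>x. x \<notin> Om --> G x = 0) \<and>
   (\<exists>ps. (\<forall>n::nat. ps n : test_functions Om) \<and> (%n. L2_norm lborel (%x. grad (ps n) x - G x)) \<longlonglongrightarrow> 0) \<and>
   (\<forall>ps\<in>test_functions Om. L2_inner lborel G (grad ps) = L2_inner lborel f ps)"

lemma weak_poisson_global:
 assumes "weak_poisson f G"
 obtains f' G' where "global_poisson f' G'" "G' : borel_measurable borel" "AE x in LO. G' x = G x"
  "L2_norm lborel f' = L2_norm LO f" "L2_norm lborel G' = L2_norm LO G"
proof -
 from assms have L: "f : L2 LO" "G : L2 LO"
  and eq: "!!ps. ps : test_functions Om ==> L2_inner LO G (grad ps) = L2_inner LO f ps"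
  by (auto simp: weak_poisson_def)
 from assms obtain ps where ps: "!!n::nat. ps n : test_functions Om" "(%n. L2_norm LO (%x. grad (ps n) x - G x)) \<longlonglongrightarrow> 0"
  by (auto simp: weak_poisson_def)
 obtain f' where f': "f' : L2 lborel" "L2_norm lborel f' = L2_norm LO f"
  "!!g. g : borel_measurable borel ==> L2_inner LO f g = L2_inner lborel f' g"
  by (rule L2_lebesgue_on_rep[OF domain_borel L(1)]) blast
 obtain G' where G': "G' : borel_measurable borel" "!!x. x \<notin> Om ==> G' x = 0" "AE x in LO. G' x = G x" "G' : L2 lborel"
  "L2_norm lborel G' = L2_norm LO G" "!!g. g : borel_measurable borel ==> L2_inner LO G g = L2_inner lborel G' g"
  by (rule L2_lebesgue_on_rep[OF domain_borel L(2)]) blast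
 have "L2_norm lborel (%x. grad (ps n) x - G' x) = L2_norm LO (%x. grad (ps n) x - G x)" for n
 proof -
  note D = test_functionsD[OF ps(1)[of n]]
  have m: "(%x. grad (ps n) x - G' x) : borel_measurable borel" using D(6) G'(1) by measurable
  have "L2_norm lborel (%x. grad (ps n) x - G' x) = L2_norm LO (%x. grad (ps n) x - G' x)"
   by (rule L2_norm_lebesgue_on_borel[OF domain_borel m, symmetric]) (use D(4) G'(2) in simp)
  also have "\<dots> = L2_norm LO (%x. grad (ps n) x - G x)"
  proof (rule L2_norm_cong_AE)
   show "AE x in LO. grad (ps n) x - G' x = grad (ps n) x - G x" using G'(3) by eventually_elim simp
   show "(%x. grad (ps n) x - G' x) : borel_measurable LO" by (rule borel_measurable_lebesgue_onI[OF m])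
   show "(%x. grad (ps n) x - G x) : borel_measurable LO"
    using test_L2_LO(2)[OF ps(1)[of n]] L(2) by (intro L2_measurable L2_diff)
  qed
  finally show ?thesis .
 qed
 then have "(%n. L2_norm lborel (%x. grad (ps n) x - G' x)) \<longlonglongrightarrow> 0" using ps(2) by simp
 moreover have "L2_inner lborel G' (grad ps) = L2_inner lborel f' ps" if "ps : test_functions Om" for ps
  using eq[OF that] f'(3)[OF test_functionsD(5)[OF that]] G'(6)[OF test_functionsD(6)[OF that]] by simp
 ultimately have "global_poisson f' G'" using f'(1) G'(2,4) ps(1) unfolding global_poisson_def by blast
 then show thesis using that G'(1,3,5) f'(2) by blast
qed

text \<open>Savare's translation argument: the equation is tested with a localised difference quotient of
 the solution in the direction pointing into the domain.\<close>

lemma translation_estimate: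
 assumes c: "chart Om x0 r e s \<Lambda>" and gp: "global_poisson f G"
  and \<theta>: "smooth \<theta>" "!!x. 0 <= \<theta> x" "!!x. \<theta> x <= 1"
   "compact (closure {x. \<theta> x \<noteq> 0})" "closure {x. \<theta> x \<noteq> 0} \<subseteq> ball x0 (r/2)"
  and B: "!!x. norm (grad \<theta> x) <= B" and t: "0 < t" "t < r / 2"
 shows "(\<integral>\<^sup>+x. ennreal (\<theta> x * (norm (G (x - t *\<^sub>R e) - G x))\<^sup>2) \<partial>lborel)
  <= ennreal (t * (3 * B * (L2_norm lborel G)\<^sup>2 + 2 * (L2_norm lborel f * L2_norm lborel G)))"
proof -
 interpret height_function e s \<Lambda> using c by (simp add: chart_def)
 have r: "r > 0" and iff: "!!y. y : ball x0 r ==> y : Om \<longleftrightarrow> s y > 0" using c by (auto simp: chart_def)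
 have B0: "B \<ge> 0" using norm_ge_zero B by (rule order_trans)
 have fL: "f : L2 lborel" and GL: "G : L2 lborel" using gp by (auto simp: global_poisson_def)
 have eq: "!!ps. ps : test_functions Om ==> L2_inner lborel G (grad ps) = L2_inner lborel f ps"
  using gp by (auto simp: global_poisson_def)
 obtain ps where ps: "!!n::nat. ps n : test_functions Om" "(%n. L2_norm lborel (%x. grad (ps n) x - G x)) \<longlonglongrightarrow> 0"
  using gp by (auto simp: global_poisson_def)
 have [measurable]: "G : borel_measurable borel" "\<theta> : borel_measurable borel"
  using GL smooth_measurable[OF \<theta>(1)] by (auto simp: L2_def)
 let ?N = "L2_norm lborel G" and ?f = "L2_norm lborel f"
 define W where "W x = G (x - t *\<^sub>R e) - G x" for x
 have tG: "(%x. G (x - t *\<^sub>R e)) : L2 lborel" by (rule L2_translate[OF GL])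
 have WL: "W : L2 lborel" unfolding W_def[abs_def] by (rule L2_diff[OF tG GL])
 have \<theta>L: "(%x. \<theta> x *\<^sub>R H x) : L2 lborel" if "H : L2 lborel" for H :: "'a => 'a"
  by (rule L2_mult_bounded[OF that, of _ 1]) (use \<theta>(2,3) in auto)
 have \<theta>N: "L2_norm lborel (%x. \<theta> x *\<^sub>R H x) <= 1 * L2_norm lborel H" if "H : L2 lborel" for H :: "'a => 'a"
  by (rule L2_norm_mono[OF that]) (use L2_measurable[OF \<theta>L[OF that]] \<theta>(2,3) in \<open>auto simp: mult_left_le_one_le\<close>)
 define w where "w n x = ps n (x - t *\<^sub>R e) - ps n x" for n x
 define g where "g n x = grad (ps n) (x - t *\<^sub>R e) - grad (ps n) x" for n x
 have sw: "smooth (w n)" for n unfolding w_def[abs_def]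
  by (intro smooth_diff smooth_translate test_functionsD(1)[OF ps(1)])
 have gw: "grad (w n) x = g n x" for n x
  unfolding w_def[abs_def] g_def
  by (simp add: grad_diff grad_translate smooth_translate test_functionsD(1)[OF ps(1)])
 have psL: "ps n : L2 lborel" "grad (ps n) : L2 lborel" for n using test_functions_L2[OF ps(1)] by auto
 have wL: "w n : L2 lborel" for n unfolding w_def[abs_def] by (intro L2_diff L2_translate psL)
 have gL: "g n : L2 lborel" for n unfolding g_def[abs_def] by (intro L2_diff L2_translate psL)
 have wN: "L2_norm lborel (w n) <= t * L2_norm lborel (grad (ps n))" for n
  using smooth_translation_le[OF test_functionsD(1,2)[OF ps(1)[of n]], of "t *\<^sub>R e"] t(1) norm_e
  by (simp add: w_def[abs_def])
 \<comment> \<open>Translation moves the support of \<open>ps n\<close> by \<open>t\<close> along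
   \<open>e\<close>; \<theta> confines the difference to the chart, where moving upwards cannot lead
   out of \<open>Om\<close>.\<close>
 have test: "(%x. \<theta> x * w n x) : test_functions Om" for n
 proof (rule test_functionsI)
  let ?S = "closure {x. ps n x \<noteq> 0}" and ?T = "closure {x. \<theta> x \<noteq> 0}"
  have S: "compact ?S" "?S \<subseteq> Om" using ps(1)[of n] by (auto simp: test_functions_def)
  let ?K = "?S \<union> (?T \<inter> (%x. x + t *\<^sub>R e) ` ?S)"
  show "smooth (%x. \<theta> x * w n x)" by (rule smooth_mult[OF \<theta>(1) sw])
  have "compact ((%x. x + t *\<^sub>R e) ` ?S)" by (intro compact_continuous_image continuous_intros S)
  then show "compact ?K" by (intro compact_Un S(1) compact_Int \<theta>(4))
  show "?K \<subseteq> Om"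
  proof (intro Un_least S(2) subsetI)
   fix x assume "x : ?T \<inter> (%x. x + t *\<^sub>R e) ` ?S"
   then obtain y where x: "x : ?T" and y: "y : ?S" "x = y + t *\<^sub>R e" by blast
   have d0: "dist x0 x < r / 2" using x \<theta>(5) by auto
   have "dist x y = t" using y(2) t(1) norm_e by (simp add: dist_norm)
   then have "dist x0 y < r" using dist_triangle[of x0 y x] d0 t by simp
   then have "s y > 0" using iff[of y] y(1) S(2) by auto
   then have "s x > 0" using t(1) by (simp add: y(2) s_shift)
   then show "x : Om" using iff[of x] d0 r by simp
  qed
  fix x assume "\<theta> x * w n x \<noteq> 0"
  then have n0: "\<theta> x \<noteq> 0" "ps n (x - t *\<^sub>R e) \<noteq> 0 \<or> ps n x \<noteq> 0" by (auto simp: w_def)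
  have xT: "x : ?T" by (rule subsetD[OF closure_subset]) (use n0(1) in simp)
  from n0(2) show "x : ?K"
  proof
   assume "ps n (x - t *\<^sub>R e) \<noteq> 0"
   then have "x - t *\<^sub>R e : ?S" by (intro subsetD[OF closure_subset]) simp
   then have "x : (%x. x + t *\<^sub>R e) ` ?S" by (rule rev_image_eqI) simp
   then show ?thesis using xT by blast
  next
   assume "ps n x \<noteq> 0"
   then have "x : ?S" by (intro subsetD[OF closure_subset]) simp
   then show ?thesis by blast
  qed
 qed
 have wgL: "(%x. w n x *\<^sub>R grad \<theta> x) : L2 lborel"
  and wgN: "L2_norm lborel (%x. w n x *\<^sub>R grad \<theta> x) <= B * L2_norm lborel (w n)" for n
 proof -
  have m: "(%x. w n x *\<^sub>R grad \<theta> x) : borel_measurable lborel"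
   using smooth_measurable[OF sw[of n]] smooth_grad_measurable[OF \<theta>(1)] by measurable
  have le: "AE x in lborel. norm (w n x *\<^sub>R grad \<theta> x) <= B * norm (w n x)"
   using mult_left_mono[OF B abs_ge_zero] by (intro AE_I2) (simp add: mult.commute)
  show "(%x. w n x *\<^sub>R grad \<theta> x) : L2 lborel" by (rule L2_bound[OF wL m le])
  show "L2_norm lborel (%x. w n x *\<^sub>R grad \<theta> x) <= B * L2_norm lborel (w n)"
   by (rule L2_norm_mono[OF wL m le B0])
 qed
 \<comment> \<open>Source of the factor \<open>t\<close>: the equation is tested with
   \<open>\<theta> * w n\<close>, and the increment \<open>w n\<close> is bounded in
   \<open>L2\<close> by \<open>t\<close> times the norm of the gradient.\<close>
 have key: "\<bar>L2_inner lborel G (%x. \<theta> x *\<^sub>R g n x)\<bar> <= t * (B * ?N + ?f) * L2_norm lborel (grad (ps n))" for n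
 proof -
  have tL: "(%x. \<theta> x * w n x) : L2 lborel" by (rule test_functions_L2[OF test])
  have ge: "grad (%x. \<theta> x * w n x) = (%x. \<theta> x *\<^sub>R g n x + w n x *\<^sub>R grad \<theta> x)"
   by (rule ext) (simp add: grad_mult[OF \<theta>(1) sw] gw)
  have "L2_inner lborel G (grad (%x. \<theta> x * w n x)) = L2_inner lborel G (%x. \<theta> x *\<^sub>R g n x) + L2_inner lborel G (%x. w n x *\<^sub>R grad \<theta> x)"
   unfolding ge by (rule L2_inner_add_right[OF \<theta>L[OF gL] wgL GL])
  then have "L2_inner lborel G (%x. \<theta> x *\<^sub>R g n x) = L2_inner lborel f (%x. \<theta> x * w n x) - L2_inner lborel G (%x. w n x *\<^sub>R grad \<theta> x)"
   using eq[OF test[of n]] by linarith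
  moreover have "\<bar>L2_inner lborel f (%x. \<theta> x * w n x)\<bar> <= ?f * (t * L2_norm lborel (grad (ps n)))"
  proof -
   have "L2_norm lborel (%x. \<theta> x * w n x) <= 1 * L2_norm lborel (w n)"
    by (rule L2_norm_mono[OF wL L2_measurable[OF tL]])
     (use \<theta>(2,3) in \<open>auto simp: abs_mult mult_left_le_one_le\<close>)
   then have "L2_norm lborel (%x. \<theta> x * w n x) <= t * L2_norm lborel (grad (ps n))" using wN[of n] by simp
   then show ?thesis
    by (intro order_trans[OF L2_Cauchy_Schwarz[OF fL tL]] mult_left_mono) auto
  qed
  moreover have "\<bar>L2_inner lborel G (%x. w n x *\<^sub>R grad \<theta> x)\<bar> <= ?N * (B * (t * L2_norm lborel (grad (ps n))))"
  proof -
   have "L2_norm lborel (%x. w n x *\<^sub>R grad \<theta> x) <= B * (t * L2_norm lborel (grad (ps n)))"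
    using order_trans[OF wgN mult_left_mono[OF wN B0]] .
   then show ?thesis
    by (intro order_trans[OF L2_Cauchy_Schwarz[OF GL wgL]] mult_left_mono) auto
  qed
  ultimately have "\<bar>L2_inner lborel G (%x. \<theta> x *\<^sub>R g n x)\<bar> <= ?f * (t * L2_norm lborel (grad (ps n))) + ?N * (B * (t * L2_norm lborel (grad (ps n))))"
   by linarith
  also have "\<dots> = t * (B * ?N + ?f) * L2_norm lborel (grad (ps n))" by (simp add: algebra_simps)
  finally show ?thesis .
 qed
 have lim1: "(%n. L2_norm lborel (%x. \<theta> x *\<^sub>R g n x - \<theta> x *\<^sub>R W x)) \<longlonglongrightarrow> 0"
 proof (rule tendsto_sandwich[OF _ _ tendsto_const])
  have "L2_norm lborel (%x. \<theta> x *\<^sub>R g n x - \<theta> x *\<^sub>R W x) <= 2 * L2_norm lborel (%x. grad (ps n) x - G x)" for n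
  proof -
   let ?d = "%x. grad (ps n) x - G x"
   have dL: "?d : L2 lborel" by (rule L2_diff[OF psL(2) GL])
   have "L2_norm lborel (%x. \<theta> x *\<^sub>R (g n x - W x)) <= L2_norm lborel (%x. g n x - W x)"
    using \<theta>N[OF L2_diff[OF gL WL]] by simp
   also have "L2_norm lborel (%x. g n x - W x) = L2_norm lborel (%x. ?d (x - t *\<^sub>R e) - ?d x)"
    by (rule arg_cong[where f = "L2_norm lborel"]) (auto simp: g_def W_def)
   also have "\<dots> <= L2_norm lborel (%x. ?d (x - t *\<^sub>R e)) + L2_norm lborel ?d"
    by (rule L2_norm_diff_le[OF L2_translate[OF dL] dL])
   also have "L2_norm lborel (%x. ?d (x - t *\<^sub>R e)) = L2_norm lborel ?d" by (rule L2_norm_translate[OF dL])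
   finally show ?thesis by (simp add: scaleR_diff_right)
  qed
  then show "\<forall>\<^sub>F n in sequentially. L2_norm lborel (%x. \<theta> x *\<^sub>R g n x - \<theta> x *\<^sub>R W x) <= 2 * L2_norm lborel (%x. grad (ps n) x - G x)"
   by simp
  show "(%n. 2 * L2_norm lborel (%x. grad (ps n) x - G x)) \<longlonglongrightarrow> 0"
   by (rule tendsto_mult_right_zero[OF ps(2)])
 qed simp
 have lim2: "(%n. L2_inner lborel G (%x. \<theta> x *\<^sub>R g n x)) \<longlonglongrightarrow> L2_inner lborel G (%x. \<theta> x *\<^sub>R W x)"
  by (rule L2_inner_tendsto[OF _ lim1]) (use GL \<theta>L[OF gL] \<theta>L[OF WL] in auto)
 have lim3: "(%n. t * (B * ?N + ?f) * L2_norm lborel (grad (ps n))) \<longlonglongrightarrow> t * (B * ?N + ?f) * ?N"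
  by (intro tendsto_mult_left L2_norm_tendsto[OF ps(2)] psL GL)
 have inn: "\<bar>L2_inner lborel G (%x. \<theta> x *\<^sub>R W x)\<bar> <= t * (B * ?N + ?f) * ?N"
  by (rule LIMSEQ_le[OF tendsto_rabs[OF lim2] lim3]) (use key in blast)
 have int: "integrable lborel (%x. \<theta> x * (norm (H x))\<^sup>2)" if "H : L2 lborel" for H :: "'a => 'a"
  using L2_inner_integrable[OF \<theta>L[OF that] that] by (simp add: power2_norm_eq_inner)
 have intGW: "integrable lborel (%x. G x \<bullet> (\<theta> x *\<^sub>R W x))" by (rule L2_inner_integrable[OF GL \<theta>L[OF WL]])
 have intG2: "integrable lborel (%x. (norm (G x))\<^sup>2)" by (rule L2_square_integrable[OF GL])
 \<comment> \<open>This identity avoids second derivatives. The first two terms differ by a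
   translation, which is moved onto \<theta> and costs \<open>B * t\<close>; the last one is
   controlled by the equation and contributes twice the bound \<open>inn\<close>, whence
   \<open>3 * B\<close> in the constant.\<close>
 have pt: "\<theta> x * (norm (W x))\<^sup>2 = \<theta> x * (norm (G (x - t *\<^sub>R e)))\<^sup>2 - \<theta> x * (norm (G x))\<^sup>2 - 2 * (G x \<bullet> (\<theta> x *\<^sub>R W x))" for x
  unfolding W_def power2_norm_eq_inner
  by (simp add: inner_diff_left inner_diff_right inner_commute[of "G x" "G (x - t *\<^sub>R e)"] algebra_simps)
 have shift: "(LINT x|lborel. \<theta> x * (norm (G (x - t *\<^sub>R e)))\<^sup>2) = (LINT x|lborel. \<theta> (x + t *\<^sub>R e) * (norm (G x))\<^sup>2)"
 proof -
  have [measurable]: "(%x. \<theta> (x + t *\<^sub>R e)) : borel_measurable borel" by measurable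
  have "(%x. \<theta> (x + t *\<^sub>R e) * (norm (G x))\<^sup>2) : borel_measurable borel" by measurable
  from integral_translate[OF this, of "t *\<^sub>R e"] show ?thesis by simp
 qed
 have intS: "integrable lborel (%x. \<theta> (x + t *\<^sub>R e) * (norm (G x))\<^sup>2)"
 proof -
  have [measurable]: "(%x. \<theta> (x + t *\<^sub>R e)) : borel_measurable borel" by measurable
  show ?thesis
   by (rule Bochner_Integration.integrable_bound[OF intG2])
    (use \<theta>(2,3) in \<open>auto simp: abs_mult mult_left_le_one_le\<close>)
 qed
 have "(LINT x|lborel. \<theta> x * (norm (W x))\<^sup>2) =
  (LINT x|lborel. \<theta> x * (norm (G (x - t *\<^sub>R e)))\<^sup>2) - (LINT x|lborel. \<theta> x * (norm (G x))\<^sup>2)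
   - 2 * L2_inner lborel G (%x. \<theta> x *\<^sub>R W x)"
  unfolding pt L2_inner_def using int[OF tG] int[OF GL] intGW by simp
 also have "\<dots> = (LINT x|lborel. \<theta> (x + t *\<^sub>R e) * (norm (G x))\<^sup>2 - \<theta> x * (norm (G x))\<^sup>2)
   - 2 * L2_inner lborel G (%x. \<theta> x *\<^sub>R W x)"
  using intS int[OF GL] by (simp add: shift)
 also have "\<dots> <= (LINT x|lborel. (B * t) * (norm (G x))\<^sup>2) + 2 * (t * (B * ?N + ?f) * ?N)"
 proof -
  have "(LINT x|lborel. \<theta> (x + t *\<^sub>R e) * (norm (G x))\<^sup>2 - \<theta> x * (norm (G x))\<^sup>2) <= (LINT x|lborel. (B * t) * (norm (G x))\<^sup>2)"
  proof (intro integral_mono)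
   fix x
   have "\<theta> (x + t *\<^sub>R e) - \<theta> x <= B * t"
    using grad_bound_lipschitz[OF \<theta>(1) B, of "x + t *\<^sub>R e" x] t(1) norm_e by simp
   from mult_right_mono[OF this, of "(norm (G x))\<^sup>2"]
   show "\<theta> (x + t *\<^sub>R e) * (norm (G x))\<^sup>2 - \<theta> x * (norm (G x))\<^sup>2 <= B * t * (norm (G x))\<^sup>2"
    by (simp add: left_diff_distrib)
  qed (use intS int[OF GL] intG2 in auto)
  then show ?thesis using inn by linarith
 qed
 also have "(LINT x|lborel. (B * t) * (norm (G x))\<^sup>2) = B * t * ?N\<^sup>2"
  by (simp add: L2_norm_power2 L2_inner_self)
 also have "B * t * ?N\<^sup>2 + 2 * (t * (B * ?N + ?f) * ?N) = t * (3 * B * ?N\<^sup>2 + 2 * (?f * ?N))"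
  by (simp add: power2_eq_square algebra_simps)
 finally have fin: "(LINT x|lborel. \<theta> x * (norm (W x))\<^sup>2) <= t * (3 * B * ?N\<^sup>2 + 2 * (?f * ?N))" .
 have "(\<integral>\<^sup>+x. ennreal (\<theta> x * (norm (W x))\<^sup>2) \<partial>lborel) = ennreal (LINT x|lborel. \<theta> x * (norm (W x))\<^sup>2)"
  using \<theta>(2) by (intro nn_integral_eq_integral int[OF WL]) auto
 also have "\<dots> <= ennreal (t * (3 * B * ?N\<^sup>2 + 2 * (?f * ?N)))" by (rule ennreal_leI[OF fin])
 finally show ?thesis by (simp add: W_def)
qed

text \<open>A shift by \<open>2 * a\<close> against \<open>e\<close> leads from the layer out of
  \<open>Om\<close>, where \<open>G\<close> is 0, so the increment of \<open>G\<close> there is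
  \<open>- G\<close> itself. \<open>6 * B + 4\<close> comes from the constant of
  \<open>translation_estimate\<close> at \<open>t = 2 * a\<close>.\<close>

lemma chart_gradient_layer:
 assumes c: "chart Om x0 r e s \<Lambda>"
 shows "\<exists>K\<ge>0. \<forall>f G a. global_poisson f G --> 0 < a --> a < r / 4 \<longrightarrow>
  (\<integral>\<^sup>+x. indicator (layer x0 r s a) x * ennreal ((norm (G x))\<^sup>2) \<partial>lborel)
   <= ennreal (a * (K * ((L2_norm lborel G)\<^sup>2 + L2_norm lborel f * L2_norm lborel G)))"
proof -
 interpret height_function e s \<Lambda> using c by (simp add: chart_def)
 have r: "r > 0" and iff: "!!y. y : ball x0 r ==> y : Om \<longleftrightarrow> s y > 0" using c by (auto simp: chart_def)
 have "cball x0 (r/4) \<subseteq> ball x0 (r/2)" using r by auto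
 then obtain \<theta> where \<theta>: "smooth \<theta>" "!!x. 0 <= \<theta> x" "!!x. \<theta> x <= 1" "!!x. x : cball x0 (r/4) ==> \<theta> x = 1"
  "compact (closure {x. \<theta> x \<noteq> 0})" "closure {x. \<theta> x \<noteq> 0} \<subseteq> ball x0 (r/2)"
  using smooth_cutoff[OF compact_cball open_ball] by metis
 have "bounded {x. \<theta> x \<noteq> 0}" by (rule bounded_subset[OF compact_imp_bounded[OF \<theta>(5)] closure_subset])
 then obtain B where B: "B > 0" "!!x. norm (grad \<theta> x) <= B"
  using bounded_support_bounded[OF smooth_grad_continuous[OF \<theta>(1)] bounded_support_grad] by metis
 show ?thesis
 proof (rule exI[of _ "6 * B + 4"], intro conjI allI impI)
  show "0 <= 6 * B + 4" using B by simp
  fix f :: "'a => real" and G :: "'a => 'a" and a :: real assume gp: "global_poisson f G" and a: "0 < a" "a < r / 4"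
  let ?N = "L2_norm lborel G" and ?f = "L2_norm lborel f"
  have G0: "G y = 0" if "y \<notin> Om" for y using gp that by (auto simp: global_poisson_def)
  have "(\<integral>\<^sup>+x. indicator (layer x0 r s a) x * ennreal ((norm (G x))\<^sup>2) \<partial>lborel)
   <= (\<integral>\<^sup>+x. ennreal (\<theta> x * (norm (G (x - (2 * a) *\<^sub>R e) - G x))\<^sup>2) \<partial>lborel)"
  proof (intro nn_integral_mono)
   fix x
   show "indicator (layer x0 r s a) x * ennreal ((norm (G x))\<^sup>2) <= ennreal (\<theta> x * (norm (G (x - (2 * a) *\<^sub>R e) - G x))\<^sup>2)"
   proof (cases "x : layer x0 r s a")
    case True
    then have x: "dist x0 x < r / 4" "0 < s x" "s x <= a" by (auto simp: layer_def)
    have "dist x (x - (2 * a) *\<^sub>R e) = 2 * a" using a norm_e by (simp add: dist_norm)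
    then have "x - (2 * a) *\<^sub>R e : ball x0 r" using dist_triangle[of x0 "x - (2 * a) *\<^sub>R e" x] x a r by simp
    then have "x - (2 * a) *\<^sub>R e \<notin> Om" using iff x a by (simp add: s_shift_minus)
    then show ?thesis using True \<theta>(4)[of x] x G0 by simp
   qed simp
  qed
  also have "\<dots> <= ennreal (2 * a * (3 * B * ?N\<^sup>2 + 2 * (?f * ?N)))"
   by (rule translation_estimate[OF c gp \<theta>(1,2,3,5,6) B(2)]) (use a in auto)
  also have "\<dots> <= ennreal (a * ((6 * B + 4) * (?N\<^sup>2 + ?f * ?N)))"
  proof (rule ennreal_leI)
   have "2 * (3 * B * ?N\<^sup>2 + 2 * (?f * ?N)) <= (6 * B + 4) * (?N\<^sup>2 + ?f * ?N)"
    using B by (simp add: algebra_simps)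
   from mult_left_mono[OF this, of a] show "2 * a * (3 * B * ?N\<^sup>2 + 2 * (?f * ?N)) <= a * ((6 * B + 4) * (?N\<^sup>2 + ?f * ?N))"
    using a by (simp add: mult_ac)
  qed
  finally show "(\<integral>\<^sup>+x. indicator (layer x0 r s a) x * ennreal ((norm (G x))\<^sup>2) \<partial>lborel)
   <= ennreal (a * ((6 * B + 4) * (?N\<^sup>2 + ?f * ?N)))" .
 qed
qed

lemma gradient_collar:
 obtains K dl0 where "K \<ge> 0" "dl0 > 0" "!!f G dl. weak_poisson f G ==> 0 < dl ==> dl < dl0 ==>
  (L2_norm LO (%x. indicator (collar dl) x *\<^sub>R G x))\<^sup>2 <= dl * (K * ((L2_norm LO G)\<^sup>2 + L2_norm LO f * L2_norm LO G))"
proof -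
 obtain F r e s \<Lambda> dl1 where F: "finite F"
  and ch: "!!c. c : F ==> chart Om c (r c) (e c) (s c) (\<Lambda> c)" and \<Lambda>: "!!c. c : F ==> \<Lambda> c \<ge> 1" and dl1: "dl1 > 0"
  and cov: "!!dl. dl < dl1 ==> collar dl \<subseteq> (\<Union>c\<in>F. layer c (r c) (s c) (\<Lambda> c * dl))"
  using collar_charts by blast
 let ?Q = "%c K f G a. (\<integral>\<^sup>+x. indicator (layer c (r c) (s c) a) x * ennreal ((norm (G x :: 'a))\<^sup>2) \<partial>lborel)
   <= ennreal (a * (K * ((L2_norm lborel G)\<^sup>2 + L2_norm lborel (f :: 'a => real) * L2_norm lborel G)))"
 have "\<forall>c\<in>F. \<exists>K\<ge>0. \<forall>f G a. global_poisson f G --> 0 < a --> a < r c / 4 --> ?Q c K f G a"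
  by (intro ballI chart_gradient_layer[OF ch])
 from bchoice[OF this] obtain K where K0: "\<forall>c\<in>F. K c \<ge> 0 \<and>
  (\<forall>f G a. global_poisson f G --> 0 < a --> a < r c / 4 --> ?Q c (K c) f G a)" ..
 have K: "K c \<ge> 0" if "c : F" for c by (rule conjunct1[OF bspec[OF K0 that]])
 have K2: "?Q c (K c) f G a" if "c : F" "global_poisson f G" "0 < a" "a < r c / 4" for c f G a
  by (rule conjunct2[OF bspec[OF K0 that(1)], rule_format, OF that(2,3,4)])
 define dl0 where "dl0 = Min (insert dl1 ((%c. r c / 4 / \<Lambda> c) ` F))"
 have ap: "r c / 4 / \<Lambda> c > 0" if "c : F" for c using ch[OF that] \<Lambda>[OF that] by (simp add: chart_def)
 have dl0: "dl0 > 0" unfolding dl0_def using F ap dl1 by (subst Min_gr_iff) auto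
 have pos: "0 <= \<Lambda> c * K c" if "c : F" for c using K[OF that] \<Lambda>[OF that] by simp
 then have pos': "0 <= (\<Sum>c\<in>F. \<Lambda> c * K c)" by (rule sum_nonneg)
 show thesis
 proof (rule that[OF pos' dl0])
  fix f G dl assume wp: "weak_poisson f G" and dl: "0 < dl" "dl < dl0"
  obtain f' G' where gp: "global_poisson f' G'" and G'm: "G' : borel_measurable borel" and ae: "AE x in LO. G' x = G x"
   and nf: "L2_norm lborel f' = L2_norm LO f" and nG: "L2_norm lborel G' = L2_norm LO G"
   by (rule weak_poisson_global[OF wp]) blast
  have GL: "G : L2 LO" using wp by (simp add: weak_poisson_def)
  let ?N = "(L2_norm LO G)\<^sup>2 + L2_norm LO f * L2_norm LO G"
  have N: "?N \<ge> 0" by simp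
  have "dl0 <= dl1" unfolding dl0_def using F by (intro Min_le) auto
  then have cov': "collar dl \<subseteq> (\<Union>c\<in>F. layer c (r c) (s c) (\<Lambda> c * dl))" using cov dl by simp
  have "(\<integral>\<^sup>+x. indicator (collar dl) x * ennreal ((norm (G' x))\<^sup>2) \<partial>lborel) <= ennreal (\<Sum>c\<in>F. \<Lambda> c * dl * (K c * ?N))"
  proof (rule collar_integral_le[OF F cov' layer_borel[OF ch]])
   show "(%x. ennreal ((norm (G' x))\<^sup>2)) : borel_measurable borel"
    using G'm by measurable
   fix c assume c: "c : F"
   have "dl0 <= r c / 4 / \<Lambda> c" unfolding dl0_def using F c by (intro Min_le) auto
   then have "dl < r c / 4 / \<Lambda> c" using dl(2) by linarith
   then have "\<Lambda> c * dl < r c / 4" using \<Lambda>[OF c] by (subst (asm) pos_less_divide_eq) (auto simp: mult.commute)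
   then have "?Q c (K c) f' G' (\<Lambda> c * dl)" using \<Lambda>[OF c] dl(1) by (intro K2 c gp) auto
   then show "(\<integral>\<^sup>+x. indicator (layer c (r c) (s c) (\<Lambda> c * dl)) x * ennreal ((norm (G' x))\<^sup>2) \<partial>lborel) <= ennreal (\<Lambda> c * dl * (K c * ?N))"
    by (simp only: nf nG)
   show "0 <= \<Lambda> c * dl * (K c * ?N)" using \<Lambda>[OF c] dl(1) K[OF c] N by (intro mult_nonneg_nonneg) auto
  qed
  also have "(\<Sum>c\<in>F. \<Lambda> c * dl * (K c * ?N)) = dl * ((\<Sum>c\<in>F. \<Lambda> c * K c) * ?N)"
   by (simp only: sum_distrib_left sum_distrib_right mult_ac)
  finally have "(L2_norm LO (%x. indicator (collar dl) x *\<^sub>R G' x))\<^sup>2 <= dl * ((\<Sum>c\<in>F. \<Lambda> c * K c) * ?N)"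
   using pos' N dl(1) by (intro L2_norm_LO_indicator_le G'm collar_borel mult_nonneg_nonneg) auto
  also have "L2_norm LO (%x. indicator (collar dl) x *\<^sub>R G' x) = L2_norm LO (%x. indicator (collar dl) x *\<^sub>R G x)"
  proof (rule L2_norm_cong_AE)
   show "AE x in LO. indicator (collar dl) x *\<^sub>R G' x = indicator (collar dl) x *\<^sub>R G x" using ae by eventually_elim simp
   have i: "(indicator (collar dl) :: 'a => real) : borel_measurable LO"
    by (rule borel_measurable_lebesgue_onI) measurable
   show "(%x. indicator (collar dl) x *\<^sub>R G' x) : borel_measurable LO"
    "(%x. indicator (collar dl) x *\<^sub>R G x) : borel_measurable LO"
    using i borel_measurable_lebesgue_onI[OF G'm] L2_measurable[OF GL] by (auto intro!: borel_measurable_scaleR)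
  qed
  finally show "(L2_norm LO (%x. indicator (collar dl) x *\<^sub>R G x))\<^sup>2 <= dl * ((\<Sum>c\<in>F. \<Lambda> c * K c) * ?N)" .
 qed
qed

end

section \<open>Boundary cut-offs, the Poisson problem and Rellich's theorem\<close>

lemma L2_norm_diff_const_tendsto:
 assumes "(%n. L2_norm M (%x. f n x - g x)) \<longlonglongrightarrow> 0" "!!n::nat. f n : L2 M" "g : L2 M" "h : L2 M"
 shows "(%n. L2_inner M h (f n)) \<longlonglongrightarrow> L2_inner M h g"
 by (rule L2_inner_tendsto[OF _ assms(1)]) (use assms in auto)

lemma L2_inner_cong_left:
 assumes "AE x in M. f x = f' x" "f : L2 M" "f' : L2 M" "g : L2 M"
 shows "L2_inner M f g = L2_inner M f' g"
 by (rule L2_inner_cong_AE[OF assms(1) _ assms(2-4)[THEN L2_measurable] assms(4)[THEN L2_measurable]]) simp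

lemma L2_inner_cong_right:
 assumes "AE x in M. f x = f' x" "f : L2 M" "f' : L2 M" "g : L2 M"
 shows "L2_inner M g f = L2_inner M g f'"
 unfolding L2_inner_commute[of M g] by (rule L2_inner_cong_left[OF assms])

context bounded_open_set
begin

text \<open>A piecewise linear function of the distance to the complement, 0 up to \<open>dl\<close>
  and 1 from \<open>2 * dl\<close>, has Lipschitz constant \<open>1 / dl\<close>. Mollification at
  scale \<open>dl / 2\<close> preserves that constant and keeps the support at distance at least
  \<open>dl / 2\<close>. The result is 1 from \<open>5 / 2 * dl\<close> on, so that its gradient
  certainly vanishes from \<open>3 * dl\<close> on.\<close>

lemma infdist_boundary_cutoff:
 assumes dl: "dl > 0"
 obtains \<omega> where "\<omega> : test_functions Om" "!!x. 0 <= \<omega> x" "!!x. \<omega> x <= 1"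
  "!!x. infdist x (-Om) \<ge> 3 * dl ==> \<omega> x = 1 \<and> grad \<omega> x = 0" "!!x. norm (grad \<omega> x) <= 1 / dl"
proof -
 let ?d = "%x. infdist x (-Om)"
 have ne: "-Om \<noteq> {}" using domain_ne_UNIV by auto
 define h where "h x = min 1 (max 0 (?d x / dl - 1))" for x
 have hl: "\<bar>h x - h y\<bar> <= 1 / dl * dist x y" for x y
 proof -
  have "\<bar>?d x - ?d y\<bar> <= dist x y"
   using infdist_triangle[of x "-Om" y] infdist_triangle[of y "-Om" x] by (simp add: dist_commute abs_le_iff)
  then have "\<bar>?d x - ?d y\<bar> / dl <= dist x y / dl" using dl by (intro divide_right_mono) auto
  moreover have "\<bar>?d x / dl - ?d y / dl\<bar> = \<bar>?d x - ?d y\<bar> / dl" using dl by (simp add: diff_divide_distrib[symmetric])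
  moreover have "\<bar>h x - h y\<bar> <= \<bar>?d x / dl - ?d y / dl\<bar>" unfolding h_def by (simp add: min_def max_def abs_if)
  ultimately show ?thesis by simp
 qed
 have lip: "(1 / dl)-lipschitz_on UNIV h" by (rule lipschitz_onI) (use hl dl in \<open>auto simp: dist_real_def\<close>)
 have hc: "continuous_on UNIV h" by (rule lipschitz_on_continuous_on[OF lip])
 have h01: "0 <= h x" "h x <= 1" for x by (auto simp: h_def)
 have h0: "h x = 0" if "?d x <= dl" for x
 proof -
  have "?d x / dl <= 1" using that dl by simp
  then show ?thesis by (simp add: h_def)
 qed
 have h1: "h x = 1" if "2 * dl <= ?d x" for x
 proof -
  have "2 <= ?d x / dl" using that dl by (simp add: pos_le_divide_eq)
  then show ?thesis by (simp add: h_def)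
 qed
 have "h x = 0" if "x \<notin> Om" for x using that dl by (intro h0) (simp add: infdist_zero)
 then have bs: "bounded {x. h x \<noteq> 0}" by (rule L2_zero_outside_bounded)
 have hi: "integrable lborel h" by (rule integrable_bounded_support[OF hc bs])
 obtain k where k: "kernel_at (0::'a) (dl/2) k" using kernel_exists[of "dl/2"] dl by auto
 define \<omega> where "\<omega> = conv k h"
 have s\<omega>: "smooth \<omega>" unfolding \<omega>_def by (rule smooth_conv_kernel[OF k hi])
 have near: "\<bar>?d x - ?d y\<bar> < dl / 2" if "dist y (x - 0) < dl / 2" for x y
 proof -
  have "dist y x < dl / 2" using that by simp
  then show ?thesis
   using infdist_triangle[of x "-Om" y] infdist_triangle[of y "-Om" x] dist_commute[of x y] by linarith
 qed
 have \<omega>1: "\<omega> x = 1" if "5 / 2 * dl <= ?d x" for x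
 proof -
  have "h y = 1" if y: "dist y (x - 0) < dl / 2" for y
   using near[OF y] \<open>5 / 2 * dl <= ?d x\<close> by (intro h1) linarith
  then show ?thesis unfolding \<omega>_def by (intro antisym conv_kernel_bounds[OF k hi]) simp_all
 qed
 show thesis
 proof (rule that)
  show "0 <= \<omega> x" "\<omega> x <= 1" for x unfolding \<omega>_def by (intro conv_kernel_bounds[OF k hi] h01)+
  show "norm (grad \<omega> x) <= 1 / dl" for x
   by (rule smooth_lipschitz_grad_le[OF s\<omega>]) (use conv_kernel_lipschitz[OF k hi lip] in \<open>simp add: \<omega>_def\<close>)
  show "\<omega> x = 1 \<and> grad \<omega> x = 0" if x: "3 * dl <= ?d x" for x
  proof
   show "\<omega> x = 1" using x dl by (intro \<omega>1) simp
   show "grad \<omega> x = 0"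
   proof (rule grad_eqI)
    have "(\<omega> has_derivative (%h. 0)) (at x)"
    proof (rule has_derivative_transform_within_open[of "%x. 1" _ _ _ "ball x (dl/2)"])
     show "1 = \<omega> y" if "y : ball x (dl/2)" for y
     proof -
      have "\<bar>?d x - ?d y\<bar> < dl / 2" by (rule near) (use that in \<open>simp add: dist_commute\<close>)
      then show ?thesis using x by (intro \<omega>1[symmetric]) linarith
     qed
    qed (use dl in auto)
    then show "(\<omega> has_derivative (%h. 0 \<bullet> h)) (at x)" by simp
   qed
  qed
  show "\<omega> : test_functions Om"
  proof (rule test_functionsI[OF s\<omega>])
   let ?K = "{x. dl / 2 <= ?d x}"
   show sub: "?K \<subseteq> Om"
   proof
    fix x assume "x : ?K"
    then have "?d x \<noteq> 0" using dl by auto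
    then show "x : Om" by (rule contrapos_np) (rule infdist_zero, simp)
   qed
   have "closed ?K" by (intro closed_Collect_le continuous_intros)
   then show "compact ?K" using bounded_subset[OF bounded_domain sub] by (simp add: compact_eq_bounded_closed)
   show "x : ?K" if "\<omega> x \<noteq> 0" for x
   proof (rule ccontr)
    assume "x \<notin> ?K"
    then have dx: "?d x < dl / 2" by (simp add: not_le)
    have "h y = 0" if y: "dist y (x - 0) < dl / 2" for y
     using near[OF y] dx by (intro h0) linarith
    then have "\<omega> x = 0" unfolding \<omega>_def by (intro antisym conv_kernel_bounds[OF k hi]) simp_all
    with that show False by simp
   qed
  qed
 qed
qed

lemma H10_approximation:
 assumes "\<phi> : H10 Om"
 obtains ps where "!!n::nat. ps n : test_functions Om" "(%n. L2_norm LO (%x. ps n x - \<phi> x)) \<longlonglongrightarrow> 0"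
  "(%n. L2_norm LO (%x. grad (ps n) x - weak_grad Om \<phi> x)) \<longlonglongrightarrow> 0" "\<phi> : L2 LO" "weak_grad Om \<phi> : L2 LO"
proof -
 have H: "\<phi> : H1 Om" using assms by (simp add: H10_def)
 then have L: "\<phi> : L2 LO" and W: "is_weak_grad Om \<phi> (weak_grad Om \<phi>)" using H1_weak_grad by (auto simp: H1_def)
 obtain ps where ps: "!!n::nat. ps n : test_functions Om" and h: "(%n. H1_norm Om (%x. ps n x - \<phi> x)) \<longlonglongrightarrow> 0"
  using assms by (auto simp: H10_def)
 note s = test_functionsD(1)[OF ps]
 note Wd = is_weak_grad_diff[OF is_weak_grad_smooth[OF s] W smooth_L2[OF s] L]
 have "(%n. L2_norm LO (%x. ps n x - \<phi> x)) \<longlonglongrightarrow> 0" "(%n. L2_norm LO (%x. grad (ps n) x - weak_grad Om \<phi> x)) \<longlonglongrightarrow> 0"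
  by (rule tendsto_sandwich[OF _ _ tendsto_const h]; use H1_norm_bounds[OF Wd] in simp)+
 then show thesis using that ps L is_weak_grad_L2[OF W] by blast
qed

lemma is_weak_laplacian_unique:
 assumes "is_weak_laplacian Om \<phi> w" "is_weak_laplacian Om \<phi> w'"
 shows "AE x in LO. w x = w' x"
proof -
 have L: "w : L2 LO" "w' : L2 LO" using assms by (auto simp: is_weak_laplacian_def)
 have "AE x in LO. w x - w' x = 0"
 proof (rule L2_orthogonal_test_functions[OF L2_diff[OF L]])
  fix ps assume ps: "ps : test_functions Om"
  have "- L2_inner LO w ps = - L2_inner LO w' ps" using assms ps unfolding is_weak_laplacian_def by metis
  then show "L2_inner LO (%x. w x - w' x) ps = 0" using L2_inner_diff_left[OF L test_L2_LO(1)[OF ps]] by simp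
 qed
 then show ?thesis by simp
qed

lemma Phi_weak_laplacian:
 assumes "\<phi> : Phi Om"
 shows "is_weak_laplacian Om \<phi> (weak_laplacian Om \<phi>)" "\<phi> : H10 Om" "weak_laplacian Om \<phi> : L2 LO"
proof -
 show "is_weak_laplacian Om \<phi> (weak_laplacian Om \<phi>)"
  using assms someI_ex[of "is_weak_laplacian Om \<phi>"] by (auto simp: Phi_def weak_laplacian_def)
 then show "weak_laplacian Om \<phi> : L2 LO" by (simp add: is_weak_laplacian_def)
 show "\<phi> : H10 Om" using assms by (simp add: Phi_def)
qed

lemma H10_Poincare:
 obtains C where "C > 0" "!!\<phi>. \<phi> : H10 Om ==> L2_norm LO \<phi> <= C * L2_norm LO (weak_grad Om \<phi>)"
proof -
 obtain C where C: "C > 0" "!!ps. ps : test_functions Om ==> L2_norm LO ps <= C * L2_norm LO (grad ps)"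
  using test_Poincare by blast
 have "L2_norm LO \<phi> <= C * L2_norm LO (weak_grad Om \<phi>)" if "\<phi> : H10 Om" for \<phi>
 proof (rule H10_approximation[OF that])
  fix ps assume ps: "!!n::nat. ps n : test_functions Om" and l: "(%n. L2_norm LO (%x. ps n x - \<phi> x)) \<longlonglongrightarrow> 0"
   "(%n. L2_norm LO (%x. grad (ps n) x - weak_grad Om \<phi> x)) \<longlonglongrightarrow> 0" "\<phi> : L2 LO" "weak_grad Om \<phi> : L2 LO"
  show ?thesis
   by (rule LIMSEQ_le[OF L2_norm_tendsto[OF l(1) test_L2_LO(1)[OF ps] l(3)]
      tendsto_mult_left[OF L2_norm_tendsto[OF l(2) test_L2_LO(2)[OF ps] l(4)]]])
    (use C(2)[OF ps] in blast)
 qed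
 then show thesis using that C(1) by blast
qed

text \<open>Riesz representation in the inner product of gradients yields \<open>G\<close> together
  with a sequence of test functions; by Poincare's inequality that sequence converges as well, and
  its limit is the solution, with weak gradient \<open>G\<close>.\<close>

lemma poisson_solution_exists:
 assumes f: "f : L2 LO"
 obtains \<phi> where "\<phi> : Phi Om" "AE x in LO. weak_laplacian Om \<phi> x = - f x"
proof -
 obtain C where C: "C > 0" "!!ps. ps : test_functions Om ==> L2_norm LO ps <= C * L2_norm LO (grad ps)"
  using test_Poincare by blast
 let ?T = "test_functions Om"
 have T0: "(%x. 0) : ?T" by (rule test_functionsI[of _ "{}"]) (auto intro: smooth_const)
 have glin: "grad (%x. p x + s * q x) x = grad p x + s *\<^sub>R grad q x" if "p : ?T" "q : ?T" for p q s x
  using test_functionsD(1)[OF that(1)] test_functionsD(1)[OF that(2)]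
  by (simp add: grad_add grad_cmult smooth_mult smooth_const)
 obtain t G where t: "!!n. t n : ?T" and G: "G : L2 LO" and lim: "(%n::nat. L2_norm LO (%x. grad (t n) x - G x)) \<longlonglongrightarrow> 0"
  and eq: "!!p. p : ?T ==> L2_inner LO G (grad p) = L2_inner LO f p"
 proof (rule L2_Riesz[where T = ?T and j = grad and l = "%p. L2_inner LO f p" and M = LO and C = "L2_norm LO f * C"])
  show "?T \<noteq> {}" using T0 by blast
  show "(%x. p x + s * q x) : ?T" if "p : ?T" "q : ?T" for p q s by (rule test_functions_comb[OF that])
  show "grad p : L2 LO" if "p : ?T" for p by (rule test_L2_LO(2)[OF that])
  show "AE x in LO. grad (%x. p x + s * q x) x = grad p x + s *\<^sub>R grad q x" if "p : ?T" "q : ?T" for p q s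
   using glin[OF that] by simp
  show "L2_inner LO f (%x. p x + s * q x) = L2_inner LO f p + s * L2_inner LO f q" if "p : ?T" "q : ?T" for p q s
   using L2_inner_add_right[OF test_L2_LO(1)[OF that(1)] L2_cmult[OF test_L2_LO(1)[OF that(2)]] f]
   by (simp add: L2_inner_cmult_right)
  show "\<bar>L2_inner LO f p\<bar> <= L2_norm LO f * C * L2_norm LO (grad p)" if "p : ?T" for p
   using order_trans[OF L2_Cauchy_Schwarz[OF f test_L2_LO(1)[OF that]] mult_left_mono[OF C(2)[OF that], of "L2_norm LO f"]]
   by (simp add: mult.assoc)
 qed blast
 note tL = test_L2_LO(1)[OF t] and gL = test_L2_LO(2)[OF t]
 obtain \<phi> where \<phi>: "\<phi> : L2 LO" "(%n. L2_norm LO (%x. t n x - \<phi> x)) \<longlonglongrightarrow> 0"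
 proof (rule L2_complete[of t LO, OF tL])
  fix \<epsilon> :: real assume \<epsilon>: "\<epsilon> > 0"
  have "\<epsilon> / (2 * C) > 0" using \<epsilon> C(1) by simp
  then obtain N where N: "!!n. n \<ge> N ==> L2_norm LO (%x. grad (t n) x - G x) < \<epsilon> / (2 * C)"
   using order_tendstoD(2)[OF lim] by (auto simp: eventually_sequentially)
  have "L2_norm LO (%x. t m x - t n x) < \<epsilon>" if "m \<ge> N" "n \<ge> N" for m n
  proof -
   have tt: "(%x. t m x - t n x) : ?T" using test_functions_comb[OF t t, of m "-1" n] by simp
   have ge: "grad (%x. t m x - t n x) = (%x. grad (t m) x - grad (t n) x)"
    by (rule ext) (simp add: grad_diff test_functionsD(1)[OF t])
   have "L2_norm LO (%x. t m x - t n x) <= C * L2_norm LO (%x. grad (t m) x - grad (t n) x)"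
    using C(2)[OF tt] by (simp add: ge)
   also have "\<dots> <= C * (L2_norm LO (%x. grad (t m) x - G x) + L2_norm LO (%x. G x - grad (t n) x))"
    using L2_norm_triangle_diff[OF gL G gL] C(1) by (intro mult_left_mono) auto
   also have "\<dots> = C * (L2_norm LO (%x. grad (t m) x - G x) + L2_norm LO (%x. grad (t n) x - G x))"
    by (simp add: L2_norm_minus_commute[of LO G])
   also have "\<dots> < C * (\<epsilon> / (2 * C) + \<epsilon> / (2 * C))"
    using N[OF that(1)] N[OF that(2)] C(1) by (intro mult_strict_left_mono add_strict_mono)
   also have "\<dots> = \<epsilon>" using C(1) by simp
   finally show ?thesis .
  qed
  then show "\<exists>N. \<forall>m\<ge>N. \<forall>n\<ge>N. L2_norm LO (%x. t m x - t n x) < \<epsilon>" by blast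
 qed blast
 have W: "is_weak_grad Om \<phi> G"
  unfolding is_weak_grad_def
 proof (intro conjI ballI G)
  fix ps and i :: 'a assume ps: "ps : ?T" and i: "i : Basis"
  have l1: "(%n. L2_inner LO (t n) (%x. grad ps x \<bullet> i)) \<longlonglongrightarrow> L2_inner LO \<phi> (%x. grad ps x \<bullet> i)"
   using L2_norm_diff_const_tendsto[OF \<phi>(2) tL \<phi>(1) L2_component[OF test_L2_LO(2)[OF ps]]] by (simp add: L2_inner_commute)
  have "(%n. L2_norm LO (%x. grad (t n) x \<bullet> i - G x \<bullet> i)) \<longlonglongrightarrow> 0"
  proof (rule tendsto_sandwich[OF _ _ tendsto_const lim])
   show "\<forall>\<^sub>F n in sequentially. L2_norm LO (%x. grad (t n) x \<bullet> i - G x \<bullet> i) <= L2_norm LO (%x. grad (t n) x - G x)"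
    using L2_norm_component_le[OF L2_diff[OF gL G] i] by (simp add: inner_diff_left)
  qed simp
  from L2_norm_diff_const_tendsto[OF this L2_component[OF gL] L2_component[OF G] test_L2_LO(1)[OF ps]]
  have l2: "(%n. L2_inner LO (%x. grad (t n) x \<bullet> i) ps) \<longlonglongrightarrow> L2_inner LO (%x. G x \<bullet> i) ps"
   by (simp add: L2_inner_commute)
  have "L2_inner LO (t n) (%x. grad ps x \<bullet> i) = - L2_inner LO (%x. grad (t n) x \<bullet> i) ps" for n
   using is_weak_grad_smooth[OF test_functionsD(1)[OF t[of n]]] ps i by (simp add: is_weak_grad_def)
  then have "(%n. L2_inner LO (t n) (%x. grad ps x \<bullet> i)) \<longlonglongrightarrow> - L2_inner LO (%x. G x \<bullet> i) ps"
   using tendsto_minus[OF l2] by simp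
  then show "L2_inner LO \<phi> (%x. grad ps x \<bullet> i) = - L2_inner LO (%x. G x \<bullet> i) ps"
   by (rule LIMSEQ_unique[OF l1])
 qed
 note Wd = is_weak_grad_diff[OF is_weak_grad_smooth[OF test_functionsD(1)[OF t]] W tL \<phi>(1)]
 have "(%n. L2_norm LO (%x. t n x - \<phi> x) + L2_norm LO (%x. grad (t n) x - G x)) \<longlonglongrightarrow> 0 + 0"
  by (intro tendsto_add \<phi>(2) lim)
 then have l0: "(%n. L2_norm LO (%x. t n x - \<phi> x) + L2_norm LO (%x. grad (t n) x - G x)) \<longlonglongrightarrow> 0" by simp
 have nn: "0 <= H1_norm Om v" for v by (simp add: H1_norm_def)
 have h: "(%n. H1_norm Om (%x. t n x - \<phi> x)) \<longlonglongrightarrow> 0"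
  by (rule tendsto_sandwich[OF _ _ tendsto_const l0]) (use nn H1_norm_bounds(3)[OF Wd] in auto)
 have H10: "\<phi> : H10 Om" using H1_I[OF \<phi>(1) W] t h unfolding H10_def by blast
 have lap: "is_weak_laplacian Om \<phi> (%x. - f x)"
  unfolding is_weak_laplacian_def
 proof (intro conjI ballI L2_uminus f)
  fix ps assume ps: "ps : ?T"
  have "L2_inner LO (weak_grad Om \<phi>) (grad ps) = L2_inner LO G (grad ps)"
   by (rule L2_inner_cong_left[OF is_weak_grad_weak_grad(2)[OF W] is_weak_grad_L2[OF is_weak_grad_weak_grad(1)[OF W]] G test_L2_LO(2)[OF ps]])
  then show "L2_inner LO (weak_grad Om \<phi>) (grad ps) = - L2_inner LO (%x. - f x) ps"
   by (simp add: eq[OF ps] L2_inner_uminus_left)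
 qed
 have P: "\<phi> : Phi Om" using H10 lap by (auto simp: Phi_def)
 show thesis by (rule that[OF P is_weak_laplacian_unique[OF Phi_weak_laplacian(1)[OF P] lap]])
qed

lemma finite_representatives:
 fixes g :: "nat => 'c"
 assumes "finite (range g)"
 obtains F where "finite F" "!!n. \<exists>m\<in>F. g m = g n"
proof
 show "finite ((%v. SOME m. g m = v) ` range g)" using assms by simp
 show "\<exists>m\<in>(%v. SOME m. g m = v) ` range g. g m = g n" for n
  by (rule bexI[of _ "SOME m. g m = g n"]) (auto intro: someI)
qed

text \<open>Rellich's theorem: mollification is uniformly close to the identity on bounded sets of
 gradients, and maps them to equicontinuous families.\<close>

lemma test_functions_totally_bounded:
 assumes ps: "!!n::nat. ps n : test_functions Om" and R: "R > 0"
  and b: "!!n. L2_norm LO (ps n) <= R" "!!n. L2_norm LO (grad (ps n)) <= R" and \<eta>: "\<eta> > 0"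
 shows "\<exists>F. finite F \<and> (\<forall>n. \<exists>m\<in>F. L2_norm LO (%x. ps n x - ps m x) < \<eta>)"
proof -
 define A where "A = L2_norm LO (%x. 1::real)"
 have A0: "A \<ge> 0" by (simp add: A_def)
 have one: "(%x. 1::real) : L2 LO" by (rule continuous_L2) simp
 \<comment> \<open>Translations shorter than \<open>h\<close> change every \<open>ps n\<close> by at
   most \<open>h * R = \<eta> / 8\<close>, and mollification at this scale does no worse.\<close>
 define h where "h = \<eta> / (8 * R)"
 have h: "h > 0" "h * R = \<eta> / 8" using \<eta> R by (auto simp: h_def)
 obtain k where k: "kernel_at (0::'a) h k" using kernel_exists[OF h(1)] by blast
 have ks: "smooth k" and kb: "bounded {x. k x \<noteq> 0}"
  using k kernel_at_bounded[OF k] by (auto simp: kernel_at_def)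
 obtain B0 where B0: "B0 > 0" "!!x. norm (k x) <= B0"
  using bounded_support_bounded[OF smooth_continuous[OF ks] kb] by blast
 obtain B where B: "B > 0" "!!x. norm (grad k x) <= B"
  using bounded_support_bounded[OF smooth_grad_continuous[OF ks] bounded_support_grad[OF kb]] by blast
 have psi: "integrable lborel (ps n)" for n
  by (rule integrable_bounded_support[OF smooth_continuous test_functionsD(2)]; use ps test_functionsD(1) in blast)
 have M1: "(LINT x|lborel. \<bar>ps n x\<bar>) <= A * R" for n
 proof -
  have [measurable]: "ps n : borel_measurable borel" by (rule test_functionsD(5)[OF ps])
  have L: "(%x. \<bar>ps n x\<bar>) : L2 LO"
   by (rule L2_bound[OF test_L2_LO(1)[OF ps[of n]], of _ 1]) (auto intro!: borel_measurable_lebesgue_onI)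
  have "(LINT x|lborel. \<bar>ps n x\<bar>) = (LINT x|LO. \<bar>ps n x\<bar>)"
   by (rule integral_lebesgue_on_borel(1)[symmetric, OF domain_borel]) (use test_functionsD(3)[OF ps] in auto)
  also have "\<dots> = L2_inner LO (%x. 1::real) (%x. \<bar>ps n x\<bar>)" by (simp add: L2_inner_def)
  also have "\<dots> <= A * L2_norm LO (%x. \<bar>ps n x\<bar>)" using L2_Cauchy_Schwarz[OF one L] by (simp add: A_def)
  also have "L2_norm LO (%x. \<bar>ps n x\<bar>) = L2_norm LO (ps n)" by (simp add: L2_norm_def L2_inner_def)
  also have "A * \<dots> <= A * R" using b(1) A0 by (intro mult_left_mono) auto
  finally show ?thesis .
 qed
 define w where "w n = conv k (ps n)" for n
 have ci: "integrable lborel (%y. k (x - y) * ps n y)" for x n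
  by (rule conv_integrable[OF smooth_continuous[OF ks] kb psi])
 have wb: "\<bar>w n x\<bar> <= B0 * (A * R)" for n x
 proof -
  have "\<bar>w n x\<bar> <= (LINT y|lborel. \<bar>k (x - y) * ps n y\<bar>)" unfolding w_def conv_def by (rule integral_abs_bound)
  also have "\<dots> <= (LINT y|lborel. B0 * \<bar>ps n y\<bar>)"
   by (intro integral_mono integrable_abs ci) (use psi B0(2) in \<open>auto simp: abs_mult mult_right_mono\<close>)
  also have "\<dots> = B0 * (LINT y|lborel. \<bar>ps n y\<bar>)" by simp
  also have "\<dots> <= B0 * (A * R)" using M1 B0(1) by (intro mult_left_mono) auto
  finally show ?thesis .
 qed
 have wl: "\<bar>w n x - w n y\<bar> <= B * (A * R) * dist x y" for n x y
 proof -
  have "w n x - w n y = (LINT z|lborel. (k (x - z) - k (y - z)) * ps n z)"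
   unfolding w_def conv_def using ci by (simp add: left_diff_distrib)
  also have "\<bar>\<dots>\<bar> <= (LINT z|lborel. \<bar>(k (x - z) - k (y - z)) * ps n z\<bar>)" by (rule integral_abs_bound)
  also have "\<dots> <= (LINT z|lborel. B * dist x y * \<bar>ps n z\<bar>)"
  proof (intro integral_mono integrable_abs)
   show "integrable lborel (%z. (k (x - z) - k (y - z)) * ps n z)" using ci by (simp add: left_diff_distrib)
   show "integrable lborel (%z. B * dist x y * \<bar>ps n z\<bar>)" using psi by simp
   show "\<bar>(k (x - z) - k (y - z)) * ps n z\<bar> <= B * dist x y * \<bar>ps n z\<bar>" for z
    using grad_bound_lipschitz[OF ks B(2), of "x - z" "y - z"]
    by (simp add: abs_mult dist_norm mult_right_mono)
  qed
  also have "\<dots> = B * dist x y * (LINT z|lborel. \<bar>ps n z\<bar>)" by simp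
  also have "\<dots> <= B * dist x y * (A * R)" using M1 B(1) by (intro mult_left_mono) auto
  finally show ?thesis by (simp add: mult_ac)
 qed
 have err: "L2_norm LO (%x. w n x - ps n x) <= \<eta> / 8" for n
 proof -
  have NG: "L2_norm lborel (grad (ps n)) = L2_norm LO (grad (ps n))"
   by (rule L2_norm_lebesgue_on_borel[symmetric, OF domain_borel test_functionsD(6)[OF ps]]) (rule test_functionsD(4)[OF ps])
  have E: "L2_norm lborel (%x. ps n (x - z) - ps n x) <= \<eta> / 8" if "dist z 0 < h" for z
  proof -
   have "L2_norm lborel (%x. ps n (x - z) - ps n x) <= norm z * L2_norm lborel (grad (ps n))"
    by (rule smooth_translation_le[OF test_functionsD(1,2)[OF ps]])
   also have "\<dots> <= h * R" using that b(2) h(1) by (intro mult_mono) (auto simp: NG)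
   finally show ?thesis using h(2) by simp
  qed
  have c: "(%x. conv k (ps n) x - ps n x) : L2 lborel" "L2_norm lborel (%x. conv k (ps n) x - ps n x) <= \<eta> / 8"
   using conv_kernel_error_le[OF k psi test_functions_L2(1)[OF ps] E] \<eta> by auto
  show ?thesis using L2_norm_LO_le(2)[OF c(1)] c(2) by (simp add: w_def)
 qed
 have wc: "continuous_on UNIV (w n)" for n
  unfolding w_def by (rule smooth_continuous[OF smooth_conv_kernel[OF k psi]])
 define \<eta>' where "\<eta>' = \<eta> / 8 / (A + 1)"
 have \<eta>': "\<eta>' > 0" unfolding \<eta>'_def by (intro divide_pos_pos) (use \<eta> A0 in auto)
 define Q where "Q = B * (A * R)"
 have Q0: "Q \<ge> 0" using B(1) A0 R by (simp add: Q_def)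
 define r0 where "r0 = \<eta>' / (2 * Q + 1)"
 have r0: "r0 > 0" "2 * (Q * r0) <= \<eta>'"
 proof -
  show "r0 > 0" using \<eta>' Q0 by (simp add: r0_def)
  then have "2 * Q * r0 <= (2 * Q + 1) * r0" by (simp add: distrib_right)
  also have "\<dots> = \<eta>'" using Q0 by (simp add: r0_def)
  finally show "2 * (Q * r0) <= \<eta>'" by simp
 qed
 have cc: "compact (closure Om)" using bounded_domain by (simp add: compact_closure)
 have cv: "closure Om \<subseteq> (\<Union>p\<in>closure Om. ball p r0)" using r0(1) by auto
 obtain I where I: "finite I" "closure Om \<subseteq> (\<Union>p\<in>I. ball p r0)"
  by (rule compactE_image[OF cc _ cv], simp, blast)
 \<comment> \<open>A finite form of the Arzela-Ascoli theorem: the values at the net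
   \<open>I\<close> are rounded down to multiples of \<eta>'. Boundedness leaves finitely many
   patterns. Functions with the same pattern differ by less than \<eta>' on \<open>I\<close> and, by
   the choice of \<open>r0\<close>, by at most \<open>2 * \<eta>'\<close> on
   \<open>Om\<close>.\<close>
 define g where "g n = restrict (%p. \<lfloor>w n p / \<eta>'\<rfloor>) I" for n
 define L where "L = \<lceil>B0 * (A * R) / \<eta>'\<rceil> + 1"
 have "range g \<subseteq> (\<Pi>\<^sub>E p\<in>I. {- L .. L})"
 proof (intro image_subsetI)
  fix n
  have "\<lfloor>w n p / \<eta>'\<rfloor> : {- L .. L}" for p
  proof -
   have "\<bar>w n p / \<eta>'\<bar> <= B0 * (A * R) / \<eta>'" using wb[of n p] \<eta>' by (simp add: divide_right_mono)
   then show ?thesis unfolding L_def atLeastAtMost_iff by linarith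
  qed
  then show "g n : (\<Pi>\<^sub>E p\<in>I. {- L .. L})" by (simp add: g_def restrict_PiE_iff)
 qed
 then have "finite (range g)" by (rule finite_subset) (intro finite_PiE I(1) finite_atLeastAtMost_int)
 then obtain F where F: "finite F" "!!n. \<exists>m\<in>F. g m = g n" using finite_representatives by blast
 show ?thesis
 proof (intro exI[of _ F] conjI allI F(1))
  fix n
  obtain m where m: "m : F" "g m = g n" using F(2) by blast
  have close: "\<bar>w n p - w m p\<bar> < \<eta>'" if "p : I" for p
  proof -
   have "\<lfloor>w n p / \<eta>'\<rfloor> = \<lfloor>w m p / \<eta>'\<rfloor>" using fun_cong[OF m(2), of p] that by (simp add: g_def)
   then have "\<bar>w n p / \<eta>' - w m p / \<eta>'\<bar> < 1" by linarith
   then have "\<bar>(w n p - w m p) / \<eta>'\<bar> < 1" by (simp add: diff_divide_distrib)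
   then show ?thesis using \<eta>' by (simp add: abs_divide)
  qed
  have ptw: "\<bar>w n x - w m x\<bar> <= 2 * \<eta>'" if "x : Om" for x
  proof -
   have "x : closure Om" using that closure_subset by (rule set_mp[rotated])
   then obtain p where p: "p : I" "dist p x < r0" using I(2) by (auto dest!: subsetD)
   have d: "Q * dist x p <= Q * r0" using p(2) Q0 by (intro mult_left_mono) (auto simp: dist_commute)
   have "\<bar>w n x - w n p\<bar> <= Q * dist x p" "\<bar>w m x - w m p\<bar> <= Q * dist x p"
    using wl[of n x p] wl[of m x p] by (simp_all add: Q_def)
   then show ?thesis using close[OF p(1)] d r0(2) by linarith
  qed
  have wL: "w i : L2 LO" for i by (rule continuous_L2[OF wc])
  have "L2_norm LO (%x. w n x - w m x) <= 2 * \<eta>' * A"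
   unfolding A_def
  proof (rule L2_norm_mono[OF one L2_measurable[OF L2_diff[OF wL wL]]])
   show "AE x in LO. norm (w n x - w m x) <= 2 * \<eta>' * norm (1::real)"
    by (intro AE_I2) (use ptw in simp)
  qed (use \<eta>' in simp)
  also have "\<dots> <= \<eta> / 4"
  proof -
   have "2 * \<eta>' * A <= 2 * (\<eta>' * (A + 1))" using \<eta>' by (simp add: algebra_simps)
   also have "\<eta>' * (A + 1) = \<eta> / 8"
   proof -
    have "A + 1 \<noteq> 0" using A0 by linarith
    then have "\<eta> / 8 = \<eta>' * (A + 1)"
     by (intro iffD1[OF nonzero_divide_eq_eq]) (auto simp only: \<eta>'_def)
    then show ?thesis by (rule sym)
   qed
   finally show ?thesis by simp
  qed
  finally have w: "L2_norm LO (%x. w n x - w m x) <= \<eta> / 4" .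
  note psL = test_L2_LO(1)[OF ps]
  have "L2_norm LO (%x. ps n x - ps m x) <= L2_norm LO (%x. ps n x - w n x) + L2_norm LO (%x. w n x - ps m x)"
   by (rule L2_norm_triangle_diff[OF psL wL psL])
  also have "L2_norm LO (%x. w n x - ps m x) <= L2_norm LO (%x. w n x - w m x) + L2_norm LO (%x. w m x - ps m x)"
   by (rule L2_norm_triangle_diff[OF wL wL psL])
  finally have "L2_norm LO (%x. ps n x - ps m x) < \<eta>"
   using w err[of n] err[of m] \<eta> L2_norm_minus_commute[of LO "ps n" "w n"] by linarith
  then show "\<exists>m\<in>F. L2_norm LO (%x. ps n x - ps m x) < \<eta>" using m(1) by blast
 qed
qed

end

section \<open>Normal derivatives in \<open>L2\<close> of the boundary\<close>

context lipschitz_domain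
begin

lemma weak_poisson_comb:
 assumes "weak_poisson f G" "weak_poisson f' G'"
 shows "weak_poisson (%x. f x + s * f' x) (%x. G x + s *\<^sub>R G' x)"
proof -
 obtain ps where ps: "!!n::nat. ps n : test_functions Om" "(%n. L2_norm LO (%x. grad (ps n) x - G x)) \<longlonglongrightarrow> 0"
  using assms(1) by (auto simp: weak_poisson_def)
 obtain ps' where ps': "!!n::nat. ps' n : test_functions Om" "(%n. L2_norm LO (%x. grad (ps' n) x - G' x)) \<longlonglongrightarrow> 0"
  using assms(2) by (auto simp: weak_poisson_def)
 have L: "f : L2 LO" "f' : L2 LO" "G : L2 LO" "G' : L2 LO" using assms by (auto simp: weak_poisson_def)
 let ?t = "%n x. ps n x + s * ps' n x"
 have g: "grad (?t n) x = grad (ps n) x + s *\<^sub>R grad (ps' n) x" for n x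
  using test_functionsD(1)[OF ps(1)] test_functionsD(1)[OF ps'(1)] by (simp add: grad_add grad_cmult smooth_mult smooth_const)
 have le: "L2_norm LO (%x. grad (?t n) x - (G x + s *\<^sub>R G' x)) \<le>
   L2_norm LO (%x. grad (ps n) x - G x) + \<bar>s\<bar> * L2_norm LO (%x. grad (ps' n) x - G' x)" for n
 proof -
  have "(%x. grad (?t n) x - (G x + s *\<^sub>R G' x)) = (%x. (grad (ps n) x - G x) + s *\<^sub>R (grad (ps' n) x - G' x))"
   by (auto simp: g algebra_simps)
  then show ?thesis
   using L2_norm_triangle[OF L2_diff[OF test_L2_LO(2)[OF ps(1)] L(3)] L2_scale[OF L2_diff[OF test_L2_LO(2)[OF ps'(1)] L(4)], of s]]
   by (simp add: L2_norm_scale)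
 qed
 have u: "(%n. L2_norm LO (%x. grad (ps n) x - G x) + \<bar>s\<bar> * L2_norm LO (%x. grad (ps' n) x - G' x)) \<longlonglongrightarrow> 0"
  using tendsto_add[OF ps(2) tendsto_mult_right_zero[OF ps'(2)]] by simp
 have lim: "(%n. L2_norm LO (%x. grad (?t n) x - (G x + s *\<^sub>R G' x))) \<longlonglongrightarrow> 0"
  by (rule tendsto_sandwich[OF _ _ tendsto_const u]) (use le in auto)
 have eq: "L2_inner LO (%x. G x + s *\<^sub>R G' x) (grad \<xi>) = L2_inner LO (%x. f x + s * f' x) \<xi>" if \<xi>: "\<xi> : test_functions Om" for \<xi>
 proof -
  have "L2_inner LO G (grad \<xi>) = L2_inner LO f \<xi>" "L2_inner LO G' (grad \<xi>) = L2_inner LO f' \<xi>"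
   using assms \<xi> by (auto simp: weak_poisson_def)
  then show ?thesis
   using L2_inner_add_left[OF L(3) L2_scale[OF L(4)] test_L2_LO(2)[OF \<xi>]]
    L2_inner_add_left[OF L(1) L2_cmult[OF L(2)] test_L2_LO(1)[OF \<xi>]]
   by (simp add: L2_inner_scale_left L2_inner_cmult_left)
 qed
 have ex: "\<exists>t. (\<forall>n::nat. t n : test_functions Om) \<and> (%n. L2_norm LO (%x. grad (t n) x - (G x + s *\<^sub>R G' x))) \<longlonglongrightarrow> 0"
  by (rule exI[of _ ?t]) (use lim test_functions_comb[OF ps(1) ps'(1)] in simp)
 show ?thesis unfolding weak_poisson_def
  by (intro conjI ballI L2_add[OF L(1) L2_cmult[OF L(2)]] L2_add[OF L(3) L2_scale[OF L(4)]] ex eq)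
qed

lemma Phi_poisson:
 assumes "\<phi> : Phi Om"
 shows "weak_poisson (%x. - weak_laplacian Om \<phi> x) (weak_grad Om \<phi>)"
proof (rule H10_approximation[OF Phi_weak_laplacian(2)[OF assms]])
 fix ps assume "!!n::nat. ps n : test_functions Om"
  "(%n. L2_norm LO (%x. grad (ps n) x - weak_grad Om \<phi> x)) \<longlonglongrightarrow> 0" "weak_grad Om \<phi> : L2 LO"
 then show ?thesis
  using Phi_weak_laplacian[OF assms] unfolding weak_poisson_def is_weak_laplacian_def
  by (intro conjI ballI exI[of _ ps] L2_uminus) (auto simp: L2_inner_uminus_left)
qed

text \<open>The equation holds for the test function \<open>\<omega> * zt\<close>, so the defect is
  that of \<open>\<xi> = (1 - \<omega>) * zt\<close>, which lives in the collar of width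
  \<open>3 * dl\<close>.\<close>

lemma cutoff_flux_estimate:
 assumes wp: "weak_poisson f G" and zt: "smooth zt" and dl: "dl > 0"
 shows "\<bar>L2_inner LO G (grad zt) - L2_inner LO f zt\<bar> \<le>
  L2_norm LO (%x. indicator (collar (3 * dl)) x *\<^sub>R G x) *
   (L2_norm LO (grad zt) + 1 / dl * L2_norm LO (%x. indicator (collar (3 * dl)) x *\<^sub>R zt x))
  + L2_norm LO f * L2_norm LO (%x. indicator (collar (3 * dl)) x *\<^sub>R zt x)"
proof -
 obtain \<omega> where \<omega>: "\<omega> : test_functions Om" "!!x. 0 <= \<omega> x" "!!x. \<omega> x <= 1"
  "!!x. infdist x (-Om) \<ge> 3 * dl ==> \<omega> x = 1 \<and> grad \<omega> x = 0" "!!x. norm (grad \<omega> x) <= 1 / dl"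
  by (rule infdist_boundary_cutoff[OF dl]) blast
 let ?D = "collar (3 * dl)"
 have L: "f : L2 LO" "G : L2 LO" using wp by (auto simp: weak_poisson_def)
 have ne: "-Om \<noteq> {}" using domain_ne_UNIV by auto
 have far: "\<omega> x = 1 \<and> grad \<omega> x = 0" if "x : Om" "x \<notin> ?D" for x
 proof (rule \<omega>(4))
  show "3 * dl <= infdist x (-Om)"
   unfolding infdist_notempty[OF ne]
  proof (rule cINF_greatest[OF ne])
   fix y assume "y : - Om"
   then show "3 * dl <= dist x y" using that by (auto simp: collar_def not_less)
  qed
 qed
 have s\<omega>: "smooth \<omega>" by (rule test_functionsD(1)[OF \<omega>(1)])
 have i: "(indicator ?D :: 'a => real) : borel_measurable LO" by (rule borel_measurable_lebesgue_onI) measurable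
 have iL: "(%x. indicator ?D x *\<^sub>R H x) : L2 LO" if "H : L2 LO" for H :: "'a => 'b::euclidean_space"
  by (rule L2_mult_bounded[OF that i, of 1]) (simp add: indicator_def)
 define \<xi> where "\<xi> x = (1 - \<omega> x) * zt x" for x
 have s1: "smooth (%x. 1 - \<omega> x)" by (intro smooth_diff smooth_const s\<omega>)
 have s\<xi>: "smooth \<xi>" unfolding \<xi>_def[abs_def] by (rule smooth_mult[OF s1 zt])
 have g\<xi>: "grad \<xi> x = (1 - \<omega> x) *\<^sub>R grad zt x - zt x *\<^sub>R grad \<omega> x" for x
  unfolding \<xi>_def[abs_def] by (simp add: grad_mult[OF s1 zt] grad_diff[OF smooth_const s\<omega>])
 have \<xi>L: "\<xi> : L2 LO" "grad \<xi> : L2 LO" using smooth_L2[OF s\<xi>] smooth_grad_L2[OF s\<xi>] by auto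
 have ztL: "zt : L2 LO" "grad zt : L2 LO" using smooth_L2[OF zt] smooth_grad_L2[OF zt] by auto
 have tT: "(%x. zt x * \<omega> x) : test_functions Om" by (rule test_functions_mult[OF \<omega>(1) zt])
 have "L2_inner LO G (grad (%x. zt x * \<omega> x)) = L2_inner LO f (%x. zt x * \<omega> x)" using wp tT by (simp add: weak_poisson_def)
 moreover have "L2_inner LO G (grad zt) = L2_inner LO G (grad \<xi>) + L2_inner LO G (grad (%x. zt x * \<omega> x))"
 proof -
  have "grad zt = (%x. grad \<xi> x + grad (%x. zt x * \<omega> x) x)"
   by (rule ext) (subst grad_mult[OF zt s\<omega>], simp add: g\<xi> algebra_simps)
  then show ?thesis using L2_inner_add_right[OF \<xi>L(2) test_L2_LO(2)[OF tT] L(2)] by simp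
 qed
 moreover have "L2_inner LO f zt = L2_inner LO f \<xi> + L2_inner LO f (%x. zt x * \<omega> x)"
 proof -
  have "zt = (%x. \<xi> x + zt x * \<omega> x)" by (rule ext) (simp add: \<xi>_def algebra_simps)
  then show ?thesis using L2_inner_add_right[OF \<xi>L(1) test_L2_LO(1)[OF tT] L(1)] by simp
 qed
 ultimately have eq: "L2_inner LO G (grad zt) - L2_inner LO f zt = L2_inner LO G (grad \<xi>) - L2_inner LO f \<xi>" by linarith
 let ?a = "L2_norm LO (%x. indicator ?D x *\<^sub>R G x)" and ?b = "L2_norm LO (%x. indicator ?D x *\<^sub>R zt x)"
 have "L2_inner LO G (grad \<xi>) = L2_inner LO (%x. indicator ?D x *\<^sub>R G x) (grad \<xi>)"
  unfolding L2_inner_def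
 proof (rule Bochner_Integration.integral_cong[OF refl])
  fix x assume "x : space LO"
  then have "x : Om" by simp
  then show "G x \<bullet> grad \<xi> x = indicator ?D x *\<^sub>R G x \<bullet> grad \<xi> x" using far[of x] by (cases "x : ?D") (auto simp: g\<xi>)
 qed
 then have "\<bar>L2_inner LO G (grad \<xi>)\<bar> <= ?a * L2_norm LO (grad \<xi>)" using L2_Cauchy_Schwarz[OF iL[OF L(2)] \<xi>L(2)] by simp
 also have "\<dots> <= ?a * (L2_norm LO (grad zt) + 1 / dl * ?b)"
 proof (rule mult_left_mono)
  have c\<omega>: "continuous_on UNIV (%x. 1 - \<omega> x)" by (rule smooth_continuous[OF s1])
  have l1: "(%x. (1 - \<omega> x) *\<^sub>R grad zt x) : L2 LO" by (rule L2_mult_continuous[OF ztL(2) c\<omega>])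
  have l2: "(%x. zt x *\<^sub>R grad \<omega> x) : L2 LO" by (rule L2_mult_continuous_vector[OF ztL(1) smooth_grad_continuous[OF s\<omega>]])
  have "L2_norm LO (grad \<xi>) = L2_norm LO (%x. (1 - \<omega> x) *\<^sub>R grad zt x - zt x *\<^sub>R grad \<omega> x)"
   by (simp add: g\<xi>[abs_def])
  also have "\<dots> <= L2_norm LO (%x. (1 - \<omega> x) *\<^sub>R grad zt x) + L2_norm LO (%x. zt x *\<^sub>R grad \<omega> x)"
   by (rule L2_norm_diff_le[OF l1 l2])
  also have "\<dots> <= 1 * L2_norm LO (grad zt) + 1 / dl * ?b"
  proof (rule add_mono)
   show "L2_norm LO (%x. (1 - \<omega> x) *\<^sub>R grad zt x) <= 1 * L2_norm LO (grad zt)"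
    by (rule L2_norm_mono[OF ztL(2) L2_measurable[OF l1]])
     (use \<omega>(2,3) in \<open>auto intro!: AE_I2 mult_left_le_one_le\<close>)
   show "L2_norm LO (%x. zt x *\<^sub>R grad \<omega> x) <= 1 / dl * ?b"
   proof (rule L2_norm_mono[OF iL[OF ztL(1)] L2_measurable[OF l2]], rule AE_I2)
    fix x assume "x : space LO"
    then have x: "x : Om" by simp
    show "norm (zt x *\<^sub>R grad \<omega> x) <= 1 / dl * norm (indicator ?D x *\<^sub>R zt x)"
    proof (cases "x : ?D")
     case True
     then show ?thesis using mult_left_mono[OF \<omega>(5)[of x] abs_ge_zero[of "zt x"]] by (simp add: mult.commute)
    qed (use far[OF x] in simp)
   qed (use dl in simp)
  qed
  finally show "L2_norm LO (grad \<xi>) <= L2_norm LO (grad zt) + 1 / dl * ?b" by simp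
 qed simp
 finally have e1: "\<bar>L2_inner LO G (grad \<xi>)\<bar> <= ?a * (L2_norm LO (grad zt) + 1 / dl * ?b)" .
 have "L2_norm LO \<xi> <= 1 * ?b"
 proof (rule L2_norm_mono[OF iL[OF ztL(1)] L2_measurable[OF \<xi>L(1)]], rule AE_I2)
  fix x assume "x : space LO"
  then have x: "x : Om" by simp
  show "norm (\<xi> x) <= 1 * norm (indicator ?D x *\<^sub>R zt x)"
  proof (cases "x : ?D")
   case True
   have "\<bar>1 - \<omega> x\<bar> * \<bar>zt x\<bar> <= 1 * \<bar>zt x\<bar>" using \<omega>(2,3)[of x] by (intro mult_right_mono) auto
   then show ?thesis using True by (simp add: \<xi>_def abs_mult)
  qed (use far[OF x] in \<open>simp add: \<xi>_def\<close>)
 qed simp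
 then have e2: "\<bar>L2_inner LO f \<xi>\<bar> <= L2_norm LO f * ?b"
  by (intro order_trans[OF L2_Cauchy_Schwarz[OF L(1) \<xi>L(1)] mult_left_mono]) auto
 show ?thesis unfolding eq using e1 e2 by linarith
qed

text \<open>In the limit only the product that carries \<open>1 / dl\<close> survives, and the
  collar width \<open>3 * dl\<close> gives it the factor 3. \<open>dl\<close> tends to 0 first,
  since its threshold depends on \<rho>, and \<rho> afterwards.\<close>

lemma flux_estimate:
 obtains C where "C \<ge> 0" "!!f G zt. weak_poisson f G ==> smooth zt ==>
  \<bar>L2_inner LO G (grad zt) - L2_inner LO f zt\<bar> \<le>
   C * sqrt ((L2_norm LO G)\<^sup>2 + L2_norm LO f * L2_norm LO G) * L2_norm sg zt"
proof -
 obtain K dl0 where K: "K \<ge> 0" "dl0 > 0" and gc: "!!f G dl. weak_poisson f G ==> 0 < dl ==> dl < dl0 ==>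
  (L2_norm LO (%x. indicator (collar dl) x *\<^sub>R G x))\<^sup>2 <= dl * (K * ((L2_norm LO G)\<^sup>2 + L2_norm LO f * L2_norm LO G))"
  using gradient_collar by blast
 obtain C where C: "C \<ge> 0" and tc: "!!zt \<rho>. smooth zt ==> \<rho> > 0 ==> \<exists>dl1>0. \<forall>dl. 0 < dl --> dl < dl1 \<longrightarrow>
   (L2_norm LO (%x. indicator (collar dl) x *\<^sub>R zt x))\<^sup>2 <= dl * (C * ((L2_norm sg zt)\<^sup>2 + \<rho>))"
  using trace_collar by blast
 show thesis
 proof (rule that[of "3 * sqrt (K * C)"])
  show "0 <= 3 * sqrt (K * C)" using K C by simp
  fix f :: "'a => real" and G :: "'a => 'a" and zt :: "'a => real" assume wp: "weak_poisson f G" and zt: "smooth zt"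
  let ?L = "\<bar>L2_inner LO G (grad zt) - L2_inner LO f zt\<bar>" and ?Q = "(L2_norm LO G)\<^sup>2 + L2_norm LO f * L2_norm LO G"
   and ?N = "L2_norm sg zt"
  define A where "A = K * ?Q"
  have A: "A \<ge> 0" using K by (simp add: A_def)
  have bound: "?L <= 3 * sqrt (A * (C * (?N\<^sup>2 + \<rho>)))" if \<rho>: "\<rho> > 0" for \<rho>
  proof -
   define B where "B = C * (?N\<^sup>2 + \<rho>)"
   have B: "B \<ge> 0" using C \<rho> by (simp add: B_def)
   obtain dl1 where dl1: "dl1 > 0" "!!dl. 0 < dl ==> dl < dl1 ==> (L2_norm LO (%x. indicator (collar dl) x *\<^sub>R zt x))\<^sup>2 <= dl * B"
    using tc[OF zt \<rho>] unfolding B_def by blast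
   let ?F = "%dl. sqrt (3 * dl * A) * L2_norm LO (grad zt) + L2_norm LO f * sqrt (3 * dl * B) + 3 * sqrt (A * B)"
   have le: "?L <= ?F dl" if dl: "0 < dl" "dl < min dl0 dl1 / 3" for dl
   proof -
    let ?a = "L2_norm LO (%x. indicator (collar (3 * dl)) x *\<^sub>R G x)" and ?b = "L2_norm LO (%x. indicator (collar (3 * dl)) x *\<^sub>R zt x)"
    have a: "?a <= sqrt (3 * dl * A)" using gc[OF wp, of "3 * dl"] dl by (intro real_le_rsqrt) (simp add: A_def)
    have b: "?b <= sqrt (3 * dl * B)" using dl1(2)[of "3 * dl"] dl by (intro real_le_rsqrt) simp
    have "?L <= ?a * (L2_norm LO (grad zt) + 1 / dl * ?b) + L2_norm LO f * ?b" by (rule cutoff_flux_estimate[OF wp zt dl(1)])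
    also have "\<dots> <= sqrt (3 * dl * A) * (L2_norm LO (grad zt) + 1 / dl * sqrt (3 * dl * B)) + L2_norm LO f * sqrt (3 * dl * B)"
     using dl(1) A by (intro add_mono mult_mono a b order_refl add_nonneg_nonneg) auto
    also have "\<dots> = sqrt (3 * dl * A) * L2_norm LO (grad zt) + 1 / dl * (sqrt (3 * dl * A) * sqrt (3 * dl * B)) + L2_norm LO f * sqrt (3 * dl * B)"
     by (simp add: distrib_left)
    also have "sqrt (3 * dl * A) * sqrt (3 * dl * B) = dl * (3 * sqrt (A * B))"
    proof -
     have "sqrt (3 * dl * A) * sqrt (3 * dl * B) = sqrt ((3 * dl)\<^sup>2 * (A * B))"
      by (simp add: real_sqrt_mult[symmetric] power2_eq_square mult_ac)
     also have "\<dots> = 3 * dl * sqrt (A * B)" using dl(1) by (simp add: real_sqrt_mult)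
     finally show ?thesis by simp
    qed
    finally show ?thesis using dl(1) by simp
   qed
   have "(?F \<longlongrightarrow> sqrt (3 * 0 * A) * L2_norm LO (grad zt) + L2_norm LO f * sqrt (3 * 0 * B) + 3 * sqrt (A * B)) (at_right 0)"
    by (intro tendsto_intros)
   then have lim: "(?F \<longlongrightarrow> 3 * sqrt (A * B)) (at_right 0)" by simp
   have "eventually (%dl. ?L <= ?F dl) (at_right 0)"
    unfolding eventually_at_right_field using le K(2) dl1(1) by (intro exI[of _ "min dl0 dl1 / 3"]) auto
   then show ?thesis using tendsto_lowerbound[OF lim] by (simp add: B_def)
  qed
  have "((%\<rho>. 3 * sqrt (A * (C * (?N\<^sup>2 + \<rho>)))) \<longlongrightarrow> 3 * sqrt (A * (C * (?N\<^sup>2 + 0)))) (at_right 0)"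
   by (intro tendsto_intros)
  moreover have "eventually (%\<rho>. ?L <= 3 * sqrt (A * (C * (?N\<^sup>2 + \<rho>)))) (at_right 0)"
   unfolding eventually_at_right_field using bound by (intro exI[of _ 1]) auto
  ultimately have "?L <= 3 * sqrt (A * (C * (?N\<^sup>2 + 0)))" by (rule tendsto_lowerbound) simp
  also have "\<dots> = 3 * sqrt (K * C) * sqrt ?Q * ?N" by (simp add: A_def real_sqrt_mult mult_ac)
  finally show "?L <= 3 * sqrt (K * C) * sqrt ?Q * ?N" .
 qed
qed

text \<open>Riesz representation on the smooth functions, mapped identically into \<open>L2\<close>
  of the boundary. As \<open>g\<close> is a limit of smooth functions, the bound on the functional
  may be evaluated at \<open>g\<close> itself, where it becomes a bound on the norm of
  \<open>g\<close>.\<close>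

lemma flux_exists:
 obtains C where "C \<ge> 0" "!!f G. weak_poisson f G ==>
  \<exists>g. g : L2 sg \<and> (\<forall>zt. smooth zt --> L2_inner sg g zt = L2_inner LO G (grad zt) - L2_inner LO f zt) \<and>
   L2_norm sg g <= C * sqrt ((L2_norm LO G)\<^sup>2 + L2_norm LO f * L2_norm LO G)"
proof -
 obtain C where C: "C \<ge> 0" "!!f G zt. weak_poisson f G ==> smooth zt ==>
  \<bar>L2_inner LO G (grad zt) - L2_inner LO f zt\<bar> \<le>
   C * sqrt ((L2_norm LO G)\<^sup>2 + L2_norm LO f * L2_norm LO G) * L2_norm sg zt"
  using flux_estimate by blast
 show thesis
 proof (rule that[OF C(1)])
  fix f :: "'a => real" and G :: "'a => 'a" assume wp: "weak_poisson f G"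
  have L: "f : L2 LO" "G : L2 LO" using wp by (auto simp: weak_poisson_def)
  define D where "D = C * sqrt ((L2_norm LO G)\<^sup>2 + L2_norm LO f * L2_norm LO G)"
  have D: "D \<ge> 0" using C(1) by (simp add: D_def)
  let ?l = "%zt. L2_inner LO G (grad zt) - L2_inner LO f zt" and ?T = "{zt. smooth zt} :: ('a => real) set"
  obtain t g where t: "!!n. t n : ?T" and g: "g : L2 sg" and lim: "(%n::nat. L2_norm sg (%x. t n x - g x)) \<longlonglongrightarrow> 0"
   and eq: "!!p. p : ?T ==> L2_inner sg g p = ?l p"
  proof (rule L2_Riesz[where T = ?T and j = "%p. p" and l = ?l and M = sg and C = D])
   show "?T \<noteq> {}" using smooth_const[of 0] by blast
   show "(%x. p x + s * q x) : ?T" if "p : ?T" "q : ?T" for p q s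
    using that by (simp add: smooth_add smooth_mult smooth_const)
   show "p : L2 sg" if "p : ?T" for p using that smooth_L2_sigma by blast
   show "AE x in sg. p x + s * q x = p x + s *\<^sub>R q x" for p q s by simp
   show "?l (%x. p x + s * q x) = ?l p + s * ?l q" if "p : ?T" "q : ?T" for p q s
   proof -
    have s: "smooth p" "smooth q" using that by auto
    have "grad (%x. p x + s * q x) = (%x. grad p x + s *\<^sub>R grad q x)"
     by (rule ext) (simp add: grad_add grad_cmult smooth_mult smooth_const s)
    then show ?thesis
     using L2_inner_add_right[OF smooth_grad_L2[OF s(1)] L2_scale[OF smooth_grad_L2[OF s(2)]] L(2), of s]
      L2_inner_add_right[OF smooth_L2[OF s(1)] L2_cmult[OF smooth_L2[OF s(2)]] L(1), of s]
     by (simp add: L2_inner_scale_right L2_inner_cmult_right algebra_simps)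
   qed
   show "\<bar>?l p\<bar> <= D * L2_norm sg p" if "p : ?T" for p using C(2)[OF wp] that by (simp add: D_def)
  qed blast
  have tL: "t n : L2 sg" for n using t smooth_L2_sigma by blast
  have a: "(%n. L2_inner sg g (t n)) \<longlonglongrightarrow> L2_inner sg g g" by (rule L2_norm_diff_const_tendsto[OF lim tL g g])
  have b: "(%n. D * L2_norm sg (t n)) \<longlonglongrightarrow> D * L2_norm sg g" by (rule tendsto_mult_left[OF L2_norm_tendsto[OF lim tL g]])
  have le: "L2_inner sg g (t n) <= D * L2_norm sg (t n)" for n
  proof -
   have "smooth (t n)" using t by blast
   then show ?thesis using eq[OF t[of n]] C(2)[OF wp, of "t n"] by (simp add: D_def)
  qed
  have "L2_inner sg g g <= D * L2_norm sg g" by (rule LIMSEQ_le[OF a b]) (use le in blast)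
  then have "L2_norm sg g * L2_norm sg g <= D * L2_norm sg g" by (simp add: L2_norm_power2[symmetric] power2_eq_square)
  then have "L2_norm sg g <= D"
   using D L2_norm_nonneg[of sg g] by (cases "L2_norm sg g = 0") (auto simp: order_less_le)
  then show "\<exists>g. g : L2 sg \<and> (\<forall>zt. smooth zt --> L2_inner sg g zt = ?l zt) \<and>
   L2_norm sg g <= C * sqrt ((L2_norm LO G)\<^sup>2 + L2_norm LO f * L2_norm LO G)"
   using g eq by (auto simp: D_def)
 qed
qed

lemma L2_sigma_eqI:
 assumes "g : L2 sg" "g' : L2 sg" "!!zt. smooth zt ==> L2_inner sg g zt = L2_inner sg g' zt"
 shows "AE x in sg. g x = g' x"
proof -
 have "AE x in sg. g x - g' x = 0"
  by (rule L2_sigma_orthogonal_smooth[OF L2_diff[OF assms(1,2)]])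
   (use assms L2_inner_diff_left[OF assms(1,2) smooth_L2_sigma] in simp)
 then show ?thesis by simp
qed

text \<open>The flux is determined almost everywhere by its pairing with smooth functions, so the
  bound known for one representative holds for all.\<close>

lemma flux_norm_le:
 obtains C where "C \<ge> 0" "!!f G g. weak_poisson f G ==> g : L2 sg ==>
  (!!zt. smooth zt ==> L2_inner sg g zt = L2_inner LO G (grad zt) - L2_inner LO f zt) ==>
  L2_norm sg g <= C * sqrt ((L2_norm LO G)\<^sup>2 + L2_norm LO f * L2_norm LO G)"
proof (rule flux_exists)
 fix C assume C: "C \<ge> 0" and ex: "!!f G. weak_poisson f G ==>
  \<exists>g. g : L2 sg \<and> (\<forall>zt. smooth zt --> L2_inner sg g zt = L2_inner LO G (grad zt) - L2_inner LO f zt) \<and>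
   L2_norm sg g <= C * sqrt ((L2_norm LO G)\<^sup>2 + L2_norm LO f * L2_norm LO G)"
 show thesis
 proof (rule that[OF C])
  fix f G g assume wp: "weak_poisson f G" and g: "g : L2 sg"
   "!!zt. smooth zt ==> L2_inner sg g zt = L2_inner LO G (grad zt) - L2_inner LO f zt"
  obtain h where h: "h : L2 sg" "!!zt. smooth zt ==> L2_inner sg h zt = L2_inner LO G (grad zt) - L2_inner LO f zt"
   "L2_norm sg h <= C * sqrt ((L2_norm LO G)\<^sup>2 + L2_norm LO f * L2_norm LO G)"
   using ex[OF wp] by blast
  have "AE x in sg. g x = h x" by (rule L2_sigma_eqI[OF g(1) h(1)]) (simp add: g(2) h(2))
  then have "L2_norm sg g = L2_norm sg h" by (rule L2_norm_cong_AE) (use g(1) h(1) in auto)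
  then show "L2_norm sg g <= C * sqrt ((L2_norm LO G)\<^sup>2 + L2_norm LO f * L2_norm LO G)" using h(3) by simp
 qed
qed

text \<open>The flux identity is known against smooth functions and passes to all of
  \<open>H1\<close> by \<open>trace_approximation\<close>, as every term is continuous in
  \<open>z\<close>, its gradient or its trace.\<close>

lemma normal_deriv_exists:
 assumes P: "\<phi> : Phi Om"
 shows "is_normal_deriv Om \<phi> (normal_deriv Om \<phi>)"
proof -
 let ?G = "weak_grad Om \<phi>" and ?w = "weak_laplacian Om \<phi>"
 note wp = Phi_poisson[OF P]
 have L: "?w : L2 LO" "?G : L2 LO" using wp Phi_weak_laplacian(3)[OF P] by (auto simp: weak_poisson_def)
 obtain g where g: "g : L2 sg" "!!zt. smooth zt ==> L2_inner sg g zt = L2_inner LO ?G (grad zt) + L2_inner LO ?w zt"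
 proof (rule flux_exists)
  fix C assume ex: "!!f G. weak_poisson f G ==>
  \<exists>g. g : L2 sg \<and> (\<forall>zt. smooth zt --> L2_inner sg g zt = L2_inner LO G (grad zt) - L2_inner LO f zt) \<and>
   L2_norm sg g <= C * sqrt ((L2_norm LO G)\<^sup>2 + L2_norm LO f * L2_norm LO G)"
  obtain g where "g : L2 sg" "!!zt. smooth zt ==> L2_inner sg g zt = L2_inner LO ?G (grad zt) - L2_inner LO (%x. - ?w x) zt"
   using ex[OF wp] by blast
  then show ?thesis by (intro that) (auto simp: L2_inner_uminus_left)
 qed
 have "is_normal_deriv Om \<phi> g"
  unfolding is_normal_deriv_def
 proof (intro conjI ballI g(1))
  fix z assume z: "z : H1 Om"
  have zL: "z : L2 LO" "weak_grad Om z : L2 LO" using z is_weak_grad_L2[OF H1_weak_grad[OF z]] by (auto simp: H1_def)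
  obtain zt where zt: "!!n::nat. smooth (zt n)" and l: "(%n. L2_norm LO (%x. zt n x - z x)) \<longlonglongrightarrow> 0"
   "(%n. L2_norm LO (%x. grad (zt n) x - weak_grad Om z x)) \<longlonglongrightarrow> 0"
   "(%n. L2_norm sg (%x. zt n x - boundary_trace Om z x)) \<longlonglongrightarrow> 0"
   and tL: "boundary_trace Om z : L2 sg"
   by (rule trace_approximation[OF z]) blast
  have "(%n. L2_inner LO ?G (grad (zt n)) + L2_inner LO ?w (zt n)) \<longlonglongrightarrow> L2_inner LO ?G (weak_grad Om z) + L2_inner LO ?w z"
   by (intro tendsto_add L2_norm_diff_const_tendsto l smooth_L2[OF zt] smooth_grad_L2[OF zt] zL L)
  then have "(%n. L2_inner sg g (zt n)) \<longlonglongrightarrow> L2_inner LO ?G (weak_grad Om z) + L2_inner LO ?w z" by (simp add: g(2)[OF zt])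
  then show "L2_inner sg g (boundary_trace Om z) = L2_inner LO ?G (weak_grad Om z) + L2_inner LO ?w z"
   by (rule LIMSEQ_unique[OF L2_norm_diff_const_tendsto[OF l(3) smooth_L2_sigma[OF zt] tL g(1)]])
 qed
 then show ?thesis unfolding normal_deriv_def by (rule someI[of "is_normal_deriv Om \<phi>"])
qed

lemma normal_deriv_smooth:
 assumes P: "\<phi> : Phi Om"
 shows "normal_deriv Om \<phi> : L2 sg"
  and "smooth zt ==> L2_inner sg (normal_deriv Om \<phi>) zt =
   L2_inner LO (weak_grad Om \<phi>) (grad zt) - L2_inner LO (%x. - weak_laplacian Om \<phi> x) zt"
proof -
 note nd = normal_deriv_exists[OF P]
 show n: "normal_deriv Om \<phi> : L2 sg" using nd by (simp add: is_normal_deriv_def)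
 assume zt: "smooth zt"
 note W = is_weak_grad_smooth[OF zt]
 have H: "zt : H1 Om" by (rule H1_I[OF smooth_L2[OF zt] W])
 have tL: "boundary_trace Om zt : L2 sg" by (rule trace_approximation[OF H]) blast
 have GL: "weak_grad Om \<phi> : L2 LO" using Phi_poisson[OF P] by (simp add: weak_poisson_def)
 have "L2_inner sg (normal_deriv Om \<phi>) zt = L2_inner sg (normal_deriv Om \<phi>) (boundary_trace Om zt)"
  by (rule L2_inner_cong_right[OF boundary_trace_smooth[OF zt] tL smooth_L2_sigma[OF zt] n, symmetric])
 also have "\<dots> = L2_inner LO (weak_grad Om \<phi>) (weak_grad Om zt) + L2_inner LO (weak_laplacian Om \<phi>) zt"
  using nd H by (simp add: is_normal_deriv_def)
 also have "L2_inner LO (weak_grad Om \<phi>) (weak_grad Om zt) = L2_inner LO (weak_grad Om \<phi>) (grad zt)"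
  by (rule L2_inner_cong_right[OF is_weak_grad_weak_grad(2)[OF W] is_weak_grad_L2[OF is_weak_grad_weak_grad(1)[OF W]] smooth_grad_L2[OF zt] GL])
 finally show "L2_inner sg (normal_deriv Om \<phi>) zt =
   L2_inner LO (weak_grad Om \<phi>) (grad zt) - L2_inner LO (%x. - weak_laplacian Om \<phi> x) zt"
  by (simp add: L2_inner_uminus_left)
qed

end

section \<open>The Newton-like method for an abstract operator with compact adjoint\<close>

text \<open>Collects what the method uses of the boundary value problem. Values of the operators are
  fixed only up to null sets, so linearity holds almost everywhere; compactness of \<open>Sa\<close>
  appears as total boundedness of the image of every sequence in the unit ball.\<close>

locale compact_adjoint_pair =
 fixes M :: "'a measure" and N :: "'b measure"
  and S :: "('a => real) => 'b => real" and Sa :: "('b => real) => 'a => real" and C :: real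
 assumes S_L2: "!!u. u : L2 M ==> S u : L2 N"
  and S_lin: "!!u v t. u : L2 M ==> v : L2 M ==> AE x in N. S (%x. u x + t * v x) x = S u x + t * S v x"
  and S_bound: "!!u. u : L2 M ==> L2_norm N (S u) <= C * L2_norm M u"
  and Sa_L2: "!!z. z : L2 N ==> Sa z : L2 M"
  and adj: "!!u z. u : L2 M ==> z : L2 N ==> L2_inner N (S u) z = L2_inner M u (Sa z)"
  and Sa_compact: "!!f \<eta>. (!!n::nat. f n : L2 N) ==> (!!n. L2_norm N (f n) <= 1) ==> \<eta> > 0 ==>
   \<exists>F. finite F \<and> (\<forall>n. \<exists>m\<in>F. L2_norm M (%x. Sa (f n) x - Sa (f m) x) < \<eta>)"
begin

lemma Sa_unique:
 assumes "z : L2 N" "h : L2 M" "!!u. u : L2 M ==> L2_inner N (S u) z = L2_inner M u h"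
 shows "AE x in M. Sa z x = h x"
proof -
 let ?d = "%x. Sa z x - h x"
 have d: "?d : L2 M" using Sa_L2 assms by auto
 have "L2_inner M ?d ?d = L2_inner M ?d (Sa z) - L2_inner M ?d h"
  using d Sa_L2 assms by (intro L2_inner_diff_right) auto
 also have "\<dots> = 0" using adj[OF d assms(1)] assms(3)[OF d] by simp
 finally have "L2_norm M ?d = 0" by (simp add: L2_norm_def)
 then show ?thesis using L2_norm_eq_0_iff[OF d] by simp
qed

lemma Sa_cong:
 assumes "z : L2 N" "w : L2 N" "AE x in N. z x = w x"
 shows "AE x in M. Sa z x = Sa w x"
proof (rule Sa_unique)
 fix u :: "'a => real" assume u: "u : L2 M"
 have "L2_inner N (S u) z = L2_inner N (S u) w"
  using assms S_L2[OF u] by (intro L2_inner_cong_AE) auto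
 then show "L2_inner N (S u) z = L2_inner M u (Sa w)" using adj u assms by simp
qed (use assms Sa_L2 in auto)

lemma Sa_lin:
 assumes "z : L2 N" "w : L2 N"
 shows "AE x in M. Sa (%x. z x + t * w x) x = Sa z x + t * Sa w x"
proof (rule Sa_unique)
 fix u :: "'a => real" assume u: "u : L2 M"
 show "L2_inner N (S u) (%x. z x + t * w x) = L2_inner M u (%x. Sa z x + t * Sa w x)"
  using assms S_L2[OF u] Sa_L2 u adj
  by (simp add: L2_inner_add_right L2_cmult L2_inner_cmult_right)
qed (use assms in \<open>auto intro!: L2_add L2_cmult Sa_L2\<close>)

definition J :: "real => ('b => real) => ('a => real) => real" where
 "J \<nu> y u = (1/2) * (L2_dist N (S u) y)\<^sup>2 + (\<nu>/2) * (L2_norm M u)\<^sup>2"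

definition K :: "('a => real) => 'a => real" where "K e = Sa (S e)"

lemma K_L2: "e : L2 M ==> K e : L2 M"
 unfolding K_def by (intro Sa_L2 S_L2)

lemma S_diff:
 assumes "u : L2 M" "v : L2 M"
 shows "AE x in N. S (%x. u x - v x) x = S u x - S v x"
 using S_lin[OF assms, of "-1"] by simp

lemma residual_diff:
 assumes u: "u : L2 M" and v: "v : L2 M" and y: "y : L2 N"
 shows "AE x in M. Sa (%\<xi>. S u \<xi> - y \<xi>) x = Sa (%\<xi>. S v \<xi> - y \<xi>) x + K (%x. u x - v x) x"
proof -
 have L: "S (%x. u x - v x) : L2 N" "(%\<xi>. S v \<xi> - y \<xi>) : L2 N" "(%\<xi>. S u \<xi> - y \<xi>) : L2 N"
  using u v y by (auto intro!: S_L2 L2_diff)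
 have "AE x in M. Sa (%\<xi>. S u \<xi> - y \<xi>) x = Sa (%\<xi>. (S v \<xi> - y \<xi>) + 1 * S (%x. u x - v x) \<xi>) x"
 proof (rule Sa_cong)
  show "AE x in N. S u x - y x = (S v x - y x) + 1 * S (%x. u x - v x) x"
   using S_diff[OF u v] by eventually_elim simp
 qed (use L in \<open>auto intro: L2_add\<close>)
 with Sa_lin[OF L(2,1), of 1] show ?thesis
  by eventually_elim (simp add: K_def)
qed

text \<open>\<open>L2_inner M (K f) f\<close> is the squared norm of \<open>S f\<close>, hence
  harmless; what remains is the coupling of \<open>f\<close> with \<open>a\<close>.\<close>

lemma K_nonneg_bound:
 assumes e: "e : L2 M" and a: "a : L2 M" and f: "f : L2 M" and sum: "!!x. e x = f x + a x"
 shows "L2_inner M (K e) f \<ge> - C\<^sup>2 * L2_norm M f * L2_norm M a"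
proof -
 have L: "S e : L2 N" "S f : L2 N" "S a : L2 N" using S_L2 e f a by auto
 have eq: "e = (%x. f x + 1 * a x)" using sum by auto
 have "L2_inner M (K e) f = L2_inner N (S f) (S e)"
  unfolding K_def by (subst adj[OF f L(1)]) (rule L2_inner_commute)
 also have "\<dots> = L2_inner N (S f) (%x. S f x + S a x)"
 proof (rule L2_inner_cong_AE)
  show "AE x in N. S e x = S f x + S a x" using S_lin[OF f a, of 1] unfolding eq by simp
 qed (use L in \<open>auto intro: borel_measurable_add\<close>)
 also have "\<dots> = L2_inner N (S f) (S f) + L2_inner N (S f) (S a)"
  using L by (intro L2_inner_add_right)
 also have "\<dots> \<ge> 0 - (C * L2_norm M f) * (C * L2_norm M a)"
 proof -
  have "\<bar>L2_inner N (S f) (S a)\<bar> <= L2_norm N (S f) * L2_norm N (S a)"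
   using L by (intro L2_Cauchy_Schwarz)
  also have "\<dots> <= (C * L2_norm M f) * (C * L2_norm M a)"
   using S_bound[OF f] S_bound[OF a] by (intro mult_mono) (auto intro: order_trans[OF L2_norm_nonneg])
  finally show ?thesis using L2_inner_self_nonneg[of N "S f"] by linarith
 qed
 finally show ?thesis by (simp add: power2_eq_square mult_ac)
qed

context
 fixes \<nu> :: real and y :: "'b => real" and \<beta> ubar :: "'a => real"
 assumes nu: "\<nu> > 0" and y: "y : L2 N" and beta: "\<beta> : L2 M"
  and min: "is_arg_min (J \<nu> y) (%u. u : L2 M \<and> (AE x in M. u x <= \<beta> x)) ubar"
begin

text \<open>The negative gradient of the tracking term. All iterates satisfy
  \<open>l + \<nu> * u = q u\<close>, so \<open>q\<close> combines both variables of the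
  method.\<close>

definition q :: "('a => real) => 'a => real" where
 "q u x = - Sa (%\<xi>. S u \<xi> - y \<xi>) x"

lemma ubar: "ubar : L2 M" "AE x in M. ubar x <= \<beta> x"
 using min by (auto simp: is_arg_min_def)

lemma q_L2: "u : L2 M ==> q u : L2 M"
 unfolding q_def[abs_def] using y by (auto intro!: L2_uminus Sa_L2 L2_diff S_L2)

lemma variational_inequality:
 assumes v: "v : L2 M" "AE x in M. v x <= \<beta> x"
 shows "0 <= L2_inner M (%x. \<nu> * ubar x - q ubar x) (%x. v x - ubar x)"
proof -
 define e where "e = (%x. v x - ubar x)"
 have e: "e : L2 M" using v ubar by (auto simp: e_def)
 define r where "r = (%x. S ubar x - y x)"
 have r: "r : L2 N" using S_L2[OF ubar(1)] y by (auto simp: r_def)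
 define B where "B = L2_inner N r (S e) + \<nu> * L2_inner M ubar e"
 define D where "D = (L2_norm N (S e))\<^sup>2 + \<nu> * (L2_norm M e)\<^sup>2"
 have exp: "J \<nu> y (%x. ubar x + t * e x) = J \<nu> y ubar + t * B + t\<^sup>2 / 2 * D" for t
 proof -
  have tL: "(%x. ubar x + t * e x) : L2 M" using ubar e by (auto intro: L2_add L2_cmult)
  have "L2_norm N (%x. S (%x. ubar x + t * e x) x - y x) = L2_norm N (%x. r x + t *\<^sub>R S e x)"
  proof (rule L2_norm_cong_AE)
   show "AE x in N. S (%x. ubar x + t * e x) x - y x = r x + t *\<^sub>R S e x"
    using S_lin[OF ubar(1) e, of t] by eventually_elim (simp add: r_def)
   show "(%x. S (%x. ubar x + t * e x) x - y x) : borel_measurable N"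
    using L2_measurable[OF L2_diff[OF S_L2[OF tL] y]] .
   show "(%x. r x + t *\<^sub>R S e x) : borel_measurable N"
    using L2_measurable[OF L2_add[OF r L2_scale[OF S_L2[OF e]]]] .
  qed
  moreover have "L2_norm M (%x. ubar x + t * e x) = L2_norm M (%x. ubar x + t *\<^sub>R e x)" by simp
  ultimately show ?thesis
   using L2_norm_add_scale_power2[OF r S_L2[OF e], of t] L2_norm_add_scale_power2[OF ubar(1) e, of t]
   by (simp add: J_def L2_dist_def B_def D_def r_def field_simps)
 qed
 have nn: "0 <= B + t / 2 * D" if t: "0 < t" "t <= 1" for t
 proof -
  have "AE x in M. ubar x + t * e x <= \<beta> x"
   using v(2) ubar(2)
  proof eventually_elim
   case (elim x)
   have "ubar x + t * e x = (1 - t) * ubar x + t * v x" by (simp add: e_def algebra_simps)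
   also have "\<dots> <= (1 - t) * \<beta> x + t * \<beta> x" using elim t by (intro add_mono mult_left_mono) auto
   finally show ?case by (simp add: algebra_simps)
  qed
  then have "J \<nu> y ubar <= J \<nu> y (%x. ubar x + t * e x)"
   using min e ubar(1) unfolding is_arg_min_def by (force simp: not_less intro: L2_add L2_cmult)
  then have "0 <= t * (B + t / 2 * D)" using exp[of t] by (simp add: power2_eq_square algebra_simps)
  then show ?thesis using t by (simp add: zero_le_mult_iff)
 qed
 have "0 <= B"
 proof (rule tendsto_lowerbound)
  have "((%t. B + t / 2 * D) \<longlongrightarrow> B + 0 / 2 * D) (at_right 0)" by (intro tendsto_intros) simp_all
  then show "((%t. B + t / 2 * D) \<longlongrightarrow> B) (at_right 0)" by simp
  show "\<forall>\<^sub>F t in at_right 0. 0 <= B + t / 2 * D"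
  proof -
   have "\<forall>\<^sub>F t in at_right 0. t : {0<..<1::real}" by (rule eventually_at_right_real) simp
   then show ?thesis by eventually_elim (rule nn, auto)
  qed
 qed simp
 also have "B = L2_inner M (%x. \<nu> * ubar x - q ubar x) e"
 proof -
  have "L2_inner N r (S e) = L2_inner M (Sa r) e"
   using adj[OF e r] by (simp add: L2_inner_commute)
  moreover have "Sa r = (%x. - q ubar x)" by (simp add: q_def r_def fun_eq_iff)
  ultimately show ?thesis
   using L2_inner_add_left[OF L2_cmult[OF ubar(1), of \<nu>] L2_uminus[OF q_L2[OF ubar(1)]] e]
   by (simp add: B_def L2_inner_cmult_left)
 qed
 finally show ?thesis by (simp add: e_def)
qed

text \<open>The variational inequality is tested with the projection \<open>v\<close> itself. The
  integrand then has one sign almost everywhere while its integral has the other, so it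
  vanishes.\<close>

lemma ubar_projection: "AE x in M. \<nu> * ubar x = min (\<nu> * \<beta> x) (q ubar x)"
proof -
 define p where "p = (%x. q ubar x / \<nu>)"
 have p: "p : L2 M" unfolding p_def using L2_cmult[OF q_L2[OF ubar(1)], of "1 / \<nu>"] by simp
 define v where "v = (%x. min (\<beta> x) (p x))"
 have m[measurable]: "\<beta> : borel_measurable M" "p : borel_measurable M" "ubar : borel_measurable M"
  using beta p ubar by auto
 have v: "v : L2 M"
 proof (rule L2_bound[where C = 1])
  show "(%x. \<bar>\<beta> x\<bar> + \<bar>p x\<bar>) : L2 M"
   by (intro L2_add L2_bound[OF beta, of "%x. \<bar>\<beta> x\<bar>" 1] L2_bound[OF p, of "%x. \<bar>p x\<bar>" 1]) auto
 qed (auto simp: v_def min_def)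
 have vb: "AE x in M. v x <= \<beta> x" by (simp add: v_def)
 have int: "integrable M (%x. (ubar x - p x) * (v x - ubar x))"
  using p v ubar by (intro L2_mult_integrable L2_diff)
 have "0 <= L2_inner M (%x. \<nu> * ubar x - q ubar x) (%x. v x - ubar x)"
  by (rule variational_inequality[OF v vb])
 also have "\<dots> = \<nu> * (LINT x|M. (ubar x - p x) * (v x - ubar x))"
 proof -
  have "(\<nu> * ubar x - q ubar x) * (v x - ubar x) = \<nu> * ((ubar x - p x) * (v x - ubar x))" for x
   using nu by (simp add: p_def field_simps)
  then have "L2_inner M (%x. \<nu> * ubar x - q ubar x) (%x. v x - ubar x) = (LINT x|M. \<nu> * ((ubar x - p x) * (v x - ubar x)))"
   by (simp only: L2_inner_def inner_real_def)
  then show ?thesis by (simp only: integral_mult_right_zero)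
 qed
 finally have ge: "0 <= (LINT x|M. (ubar x - p x) * (v x - ubar x))"
  using nu by (simp add: zero_le_mult_iff)
 have le: "AE x in M. 0 <= - ((ubar x - p x) * (v x - ubar x))"
  using ubar(2)
 proof eventually_elim
  case (elim x)
  show ?case
  proof (cases "p x <= \<beta> x")
   case True
   then have "- ((ubar x - p x) * (v x - ubar x)) = (ubar x - p x)\<^sup>2"
    by (simp add: v_def min_def power2_eq_square algebra_simps)
   then show ?thesis by simp
  next
   case False
   then have "ubar x - p x <= 0" "0 <= v x - ubar x" using elim by (auto simp: v_def min_def)
   then have "(ubar x - p x) * (v x - ubar x) <= 0" by (rule mult_nonpos_nonneg)
   then show ?thesis by simp
  qed
 qed
 have int': "integrable M (%x. - ((ubar x - p x) * (v x - ubar x)))" using int by auto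
 have "0 <= (LINT x|M. - ((ubar x - p x) * (v x - ubar x)))" using le by (rule integral_nonneg_AE)
 then have "(LINT x|M. - ((ubar x - p x) * (v x - ubar x))) = 0" using ge by simp
 then have "AE x in M. - ((ubar x - p x) * (v x - ubar x)) = 0"
  using integral_nonneg_eq_0_iff_AE[OF int' le] by simp
 with ubar(2) show ?thesis
 proof eventually_elim
  case (elim x)
  then have "ubar x = p x \<or> v x = ubar x" by auto
  then have "ubar x = v x"
  proof
   assume "ubar x = p x" then show ?thesis using elim(1) by (simp add: v_def min_def)
  qed simp
  then show ?case using nu by (auto simp: v_def p_def min_def field_simps)
 qed
qed

text \<open>Contains, up to a null set, all points where the activity predicted from the iterate
  with error \<open>e\<close> is wrong. Points with \<open>q ubar = \<nu> * \<beta>\<close> are left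
  out, because there either prediction gives the right value; therefore no strict complementarity
  enters when \<open>D e\<close> has to shrink to a null set.\<close>

definition D :: "('a => real) => 'a set" where
 "D e = {x. 0 < \<bar>q ubar x - \<nu> * \<beta> x\<bar> \<and> \<bar>q ubar x - \<nu> * \<beta> x\<bar> <= \<bar>K e x\<bar>}"

definition d :: "('a => real) => ('a => real) => 'a => real" where
 "d e h x = (if x : D e then h x else 0)"

lemma d_L2:
 assumes "e : L2 M" "h : L2 M"
 shows "d e h : L2 M" "L2_norm M (d e h) <= L2_norm M h"
proof -
 have [measurable]: "q ubar : borel_measurable M" "K e : borel_measurable M" "\<beta> : borel_measurable M" "h : borel_measurable M"
  using assms q_L2[OF ubar(1)] K_L2 beta by auto
 have [measurable]: "d e h : borel_measurable M"
  unfolding d_def[abs_def] D_def mem_Collect_eq by measurable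
 show "d e h : L2 M" by (rule L2_bound[OF assms(2), where C = 1]) (auto simp: d_def)
 show "L2_norm M (d e h) <= L2_norm M h"
  using L2_norm_mono[OF assms(2), of "d e h" 1] by (auto simp: d_def)
qed

text \<open>Multiplied by \<nu>, the activity test reads \<open>q u > \<nu> * \<beta>\<close>, and
  \<open>q u = q ubar - K e\<close>: the error enters through \<open>K\<close> alone. The residual
  \<open>R\<close> of the error \<open>e'\<close> vanishes outside \<open>D e\<close> and is at most
  \<open>K e\<close> in absolute value on it. The part \<open>a\<close> of \<open>e'\<close> on the
  active set is read off from \<open>R\<close>; the free part \<open>f\<close> results from testing
  with \<open>f\<close>.\<close>

lemma newton_estimate:
 assumes u: "u : L2 M" and l: "l : L2 M" and u': "u' : L2 M" and l': "l' : L2 M"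
  and ul: "AE x in M. l x + \<nu> * u x = q u x"
  and step: "AE x in M. \<nu> * u' x = q u' x - l' x"
  and act: "AE x in M. 1 / \<nu> * l x + u x > \<beta> x --> u' x = \<beta> x"
  and free: "AE x in M. \<not> (1 / \<nu> * l x + u x > \<beta> x) --> l' x = 0"
 defines "e \<equiv> %x. u x - ubar x"
 shows "L2_norm M (%x. u' x - ubar x) <= (1 / \<nu> + (1 + C\<^sup>2 / \<nu>) / \<nu>) * L2_norm M (d e (K e))"
proof -
 define e' where "e' = (%x. u' x - ubar x)"
 have e: "e : L2 M" and e': "e' : L2 M" using u u' ubar by (auto simp: e_def e'_def)
 define A where "A x \<longleftrightarrow> 1 / \<nu> * l x + u x > \<beta> x" for x
 define a f R where "a x = (if A x then e' x else 0)" and "f x = (if A x then 0 else e' x)"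
  and "R x = \<nu> * e' x + (if A x then 0 else K e' x)" for x
 have [measurable]: "e' : borel_measurable M" "l : borel_measurable M" "u : borel_measurable M"
  "\<beta> : borel_measurable M" "K e' : borel_measurable M"
  using e' l u beta K_L2[OF e'] by auto
 have [measurable]: "Measurable.pred M A" unfolding A_def[abs_def] by measurable
 have am: "a : borel_measurable M" "f : borel_measurable M" "(%x. if A x then 0 else K e' x) : borel_measurable M"
  unfolding a_def[abs_def] f_def[abs_def] by measurable
 have aL: "a : L2 M" and fL: "f : L2 M"
  by (rule L2_bound[OF e', where C = 1]; use am in \<open>auto simp: a_def f_def\<close>)+
 have "(%x. if A x then 0 else K e' x) : L2 M"
  by (rule L2_bound[OF K_L2[OF e'], where C = 1]) (use am in auto)
 then have RL: "R : L2 M" unfolding R_def[abs_def] using e' by (intro L2_add L2_cmult)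
 have q1: "AE x in M. q u x = q ubar x - K e x"
  using residual_diff[OF u ubar(1) y] by eventually_elim (simp add: q_def e_def)
 have q2: "AE x in M. q u' x = q ubar x - K e' x"
  using residual_diff[OF u' ubar(1) y] by eventually_elim (simp add: q_def e'_def)
 have Rd: "AE x in M. norm (R x) <= 1 * norm (d e (K e) x)"
  using q1 q2 ul step act free ubar_projection
 proof eventually_elim
  case (elim x)
  have A: "A x \<longleftrightarrow> q ubar x - K e x > \<nu> * \<beta> x"
  proof -
   have "A x \<longleftrightarrow> \<nu> * (1 / \<nu> * l x + u x) > \<nu> * \<beta> x" unfolding A_def using nu by simp
   also have "\<nu> * (1 / \<nu> * l x + u x) = q ubar x - K e x"
    using elim(1,3) nu by (simp add: algebra_simps)
   finally show ?thesis .
  qed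
  have "\<bar>R x\<bar> <= \<bar>d e (K e) x\<bar>"
  proof (cases "A x")
   case True
   then have "u' x = \<beta> x" using elim(5) by (simp add: A_def)
   then have R: "R x = \<nu> * \<beta> x - min (\<nu> * \<beta> x) (q ubar x)"
    using True elim(7) by (simp add: R_def e'_def right_diff_distrib)
   show ?thesis
   proof (cases "q ubar x < \<nu> * \<beta> x")
    case lt: True
    then have "x : D e" using True unfolding A D_def by auto
    then show ?thesis using True lt unfolding A R d_def by auto
   qed (simp add: R)
  next
   case False
   then have "l' x = 0" using elim(6) by (simp add: A_def)
   then have R: "R x = q ubar x - min (\<nu> * \<beta> x) (q ubar x)"
    using False elim(2,4,7) by (simp add: R_def e'_def right_diff_distrib)
   show ?thesis
   proof (cases "q ubar x > \<nu> * \<beta> x")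
    case gt: True
    then have "x : D e" using False unfolding A D_def by auto
    then show ?thesis using False gt unfolding A R d_def by auto
   qed (simp add: R)
  qed
  then show ?case by simp
 qed
 let ?dl = "L2_norm M (d e (K e))"
 have dL: "d e (K e) : L2 M" using d_L2(1)[OF e K_L2[OF e]] .
 have Rn: "L2_norm M R <= ?dl" using L2_norm_mono[OF dL L2_measurable[OF RL] Rd] by simp
 have an: "L2_norm M a <= (1 / \<nu>) * ?dl"
 proof (rule L2_norm_mono[OF dL am(1)])
  show "AE x in M. norm (a x) <= 1 / \<nu> * norm (d e (K e) x)"
   using Rd
  proof eventually_elim
   case (elim x)
   show ?case
   proof (cases "A x")
    case True
    then have "\<nu> * \<bar>e' x\<bar> <= \<bar>d e (K e) x\<bar>" using elim nu by (simp add: R_def abs_mult)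
    then show ?thesis using True nu by (simp add: a_def field_simps)
   qed (use nu in \<open>simp add: a_def\<close>)
  qed
 qed (use nu in simp)
 \<comment> \<open>On the free set \<open>R = \<nu> * f + K e'\<close>. Testing with
   \<open>f\<close> leaves, by \<open>K_nonneg_bound\<close>, only a coupling with \<open>a\<close>,
   which \<open>an\<close> has already bounded.\<close>
 have main: "\<nu> * (L2_norm M f)\<^sup>2 <= (1 + C\<^sup>2 / \<nu>) * ?dl * L2_norm M f"
 proof -
  have "L2_inner M R f = \<nu> * (L2_norm M f)\<^sup>2 + L2_inner M (K e') f"
  proof -
   have "L2_inner M R f = L2_inner M (%x. \<nu> * f x + K e' x) f"
    unfolding L2_inner_def by (intro Bochner_Integration.integral_cong) (auto simp: R_def f_def)
   then show ?thesis
    using L2_inner_add_left[OF L2_cmult[OF fL, of \<nu>] K_L2[OF e'] fL]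
    by (simp add: L2_inner_cmult_left L2_norm_power2)
  qed
  moreover have "L2_inner M (K e') f \<ge> - C\<^sup>2 * L2_norm M f * L2_norm M a"
   by (rule K_nonneg_bound[OF e' aL fL]) (simp add: a_def f_def)
  moreover have "L2_inner M R f <= L2_norm M R * L2_norm M f"
   using L2_Cauchy_Schwarz[OF RL fL] by simp
  moreover have "L2_norm M R * L2_norm M f <= ?dl * L2_norm M f"
   using Rn by (intro mult_right_mono) auto
  moreover have "C\<^sup>2 * L2_norm M f * L2_norm M a <= C\<^sup>2 * L2_norm M f * ((1 / \<nu>) * ?dl)"
   using an by (intro mult_left_mono) auto
  moreover have "C\<^sup>2 * L2_norm M f * ((1 / \<nu>) * ?dl) = C\<^sup>2 / \<nu> * ?dl * L2_norm M f" by simp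
  moreover have "(1 + C\<^sup>2 / \<nu>) * ?dl * L2_norm M f = ?dl * L2_norm M f + C\<^sup>2 / \<nu> * ?dl * L2_norm M f"
   by (simp only: distrib_right mult_1)
  ultimately show ?thesis by linarith
 qed
 have fn: "L2_norm M f <= (1 + C\<^sup>2 / \<nu>) / \<nu> * ?dl"
 proof (cases "L2_norm M f = 0")
  case False
  then have pos: "L2_norm M f > 0" by (simp add: order_less_le)
  have "(\<nu> * L2_norm M f) * L2_norm M f <= ((1 + C\<^sup>2 / \<nu>) * ?dl) * L2_norm M f"
   using main by (simp only: power2_eq_square mult.assoc)
  then have "\<nu> * L2_norm M f <= (1 + C\<^sup>2 / \<nu>) * ?dl" using pos by (rule mult_right_le_imp_le)
  then show ?thesis using nu by (simp add: pos_le_divide_eq mult.commute)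
 qed (use nu in simp)
 have "e' = (%x. a x + f x)" by (auto simp: a_def f_def)
 then have "L2_norm M e' <= L2_norm M a + L2_norm M f" using L2_norm_triangle[OF aL fL] by simp
 also have "\<dots> <= (1 / \<nu>) * ?dl + (1 + C\<^sup>2 / \<nu>) / \<nu> * ?dl" by (intro add_mono an fn)
 also have "\<dots> = (1 / \<nu> + (1 + C\<^sup>2 / \<nu>) / \<nu>) * ?dl" by (simp only: distrib_right)
 finally show ?thesis by (simp add: e'_def)
qed

text \<open>Compactness of \<open>K\<close> replaces the usual norm gap: the normalised increments \<open>K e / \<parallel>e\<parallel>\<close> form a
 totally bounded set, on which restriction to sets shrinking to a null set is uniformly small.\<close>

lemma residual_small:
 assumes \<eta>: "\<eta> > 0"
 shows "\<exists>\<epsilon>>0. \<forall>e\<in>L2 M. L2_norm M e < \<epsilon> --> L2_norm M (d e (K e)) <= \<eta> * L2_norm M e"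
proof (rule ccontr)
 assume "\<not> ?thesis"
 then have "\<forall>\<epsilon>>0. \<exists>e\<in>L2 M. L2_norm M e < \<epsilon> \<and> L2_norm M (d e (K e)) > \<eta> * L2_norm M e"
  by (meson not_le)
 then have "\<forall>n::nat. \<exists>e\<in>L2 M. L2_norm M e < (1/2)^n \<and> L2_norm M (d e (K e)) > \<eta> * L2_norm M e"
  by simp
 then obtain e where e: "!!n. e n : L2 M" and en: "!!n::nat. L2_norm M (e n) < (1/2)^n"
  and big: "!!n. L2_norm M (d (e n) (K (e n))) > \<eta> * L2_norm M (e n)"
  by metis
 have C0: "C * L2_norm M u \<ge> 0" if "u : L2 M" for u :: "'a => real"
  using S_bound[OF that] L2_norm_nonneg[of N "S u"] by linarith
 have Kb: "L2_norm M (K u) <= C\<^sup>2 * L2_norm M u" if u: "u : L2 M" for u :: "'a => real"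
 proof -
  have z: "S u : L2 N" using S_L2 u by auto
  have Ku: "K u : L2 M" using K_L2 u by auto
  have "(L2_norm M (K u))\<^sup>2 = L2_inner M (K u) (Sa (S u))" by (simp add: L2_norm_power2 K_def)
  also have "\<dots> = L2_inner N (S (K u)) (S u)" using adj[OF Ku z] by simp
  also have "\<dots> <= L2_norm N (S (K u)) * L2_norm N (S u)"
   using L2_Cauchy_Schwarz[OF S_L2[OF Ku] z] by simp
  also have "\<dots> <= (C * L2_norm M (K u)) * (C * L2_norm M u)"
   using S_bound[OF Ku] S_bound[OF u] C0[OF Ku] by (intro mult_mono) auto
  finally have *: "L2_norm M (K u) * L2_norm M (K u) <= (C\<^sup>2 * L2_norm M u) * L2_norm M (K u)"
   by (simp add: power2_eq_square mult_ac)
  show ?thesis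
  proof (cases "L2_norm M (K u) = 0")
   case False
   then have "L2_norm M (K u) > 0" by (simp add: order_less_le)
   with * show ?thesis by (rule mult_right_le_imp_le)
  qed simp
 qed
 have epos: "L2_norm M (e n) > 0" for n
 proof (rule ccontr)
  assume "\<not> ?thesis"
  then have "L2_norm M (e n) = 0" using L2_norm_nonneg[of M "e n"] by linarith
  then show False
   using big[of n] Kb[OF e[of n]] d_L2(2)[OF e[of n] K_L2[OF e[of n]]] by simp
 qed
 \<comment> \<open>Scales \<open>S (e n)\<close> into the unit ball; the added 1 covers
   \<open>C = 0\<close>.\<close>
 define c where "c n = 1 / ((\<bar>C\<bar> + 1) * L2_norm M (e n))" for n
 have cpos: "c n > 0" for n using epos[of n] by (simp add: c_def)
 define f where "f n = (%x. c n * S (e n) x)" for n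
 have fL: "f n : L2 N" for n using S_L2[OF e] by (auto simp: f_def)
 have f1: "L2_norm N (f n) <= 1" for n
 proof -
  have "L2_norm N (f n) = c n * L2_norm N (S (e n))"
   unfolding f_def L2_norm_cmult using cpos[of n] by simp
  also have "\<dots> <= c n * (\<bar>C\<bar> * L2_norm M (e n))"
  proof (intro mult_left_mono)
   have "C * L2_norm M (e n) <= \<bar>C\<bar> * L2_norm M (e n)" by (intro mult_right_mono) auto
   then show "L2_norm N (S (e n)) <= \<bar>C\<bar> * L2_norm M (e n)" using S_bound[OF e[of n]] by linarith
  qed (use cpos[of n] in simp)
  also have "\<dots> = \<bar>C\<bar> / (\<bar>C\<bar> + 1)" using epos[of n] by (simp add: c_def)
  also have "\<dots> <= 1" by simp
  finally show ?thesis .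
 qed
 define w where "w n = Sa (f n)" for n
 have wL: "w n : L2 M" for n unfolding w_def by (intro Sa_L2 fL)
 have wK: "AE x in M. w n x = c n * K (e n) x" for n
  using Sa_lin[OF L2_zero S_L2[OF e[of n]], of "c n"] Sa_lin[OF L2_zero L2_zero, of 1]
  by eventually_elim (simp add: w_def f_def K_def)
 define \<eta>' where "\<eta>' = \<eta> / (\<bar>C\<bar> + 1)"
 have \<eta>': "\<eta>' > 0" using \<eta> by (simp add: \<eta>'_def)
 have dw: "L2_norm M (d (e n) (w n)) > \<eta>'" for n
 proof -
  have "L2_norm M (d (e n) (w n)) = L2_norm M (%x. c n * d (e n) (K (e n)) x)"
  proof (rule L2_norm_cong_AE)
   show "AE x in M. d (e n) (w n) x = c n * d (e n) (K (e n)) x"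
    using wK[of n] by eventually_elim (simp add: d_def)
   show "d (e n) (w n) : borel_measurable M" using d_L2(1)[OF e wL] by auto
   show "(%x. c n * d (e n) (K (e n)) x) : borel_measurable M"
    using L2_measurable[OF L2_cmult[OF d_L2(1)[OF e K_L2[OF e]]]] .
  qed
  also have "\<dots> = c n * L2_norm M (d (e n) (K (e n)))"
   using cpos[of n] by (simp add: L2_norm_cmult)
  also have "\<dots> > c n * (\<eta> * L2_norm M (e n))" using cpos[of n] big[of n] by (intro mult_strict_left_mono)
  also have "c n * (\<eta> * L2_norm M (e n)) = \<eta>'"
   using epos[of n] by (simp add: c_def \<eta>'_def)
  finally show ?thesis .
 qed
 obtain F where F: "finite F" "!!n. \<exists>m\<in>F. L2_norm M (%x. w n x - w m x) < \<eta>' / 2"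
 proof -
  have "\<eta>' / 2 > 0" using \<eta>' by simp
  from Sa_compact[of f, OF fL f1 this] show thesis using that unfolding w_def by blast
 qed
 \<comment> \<open>Here the bounds \<open>(1/2)^n\<close> are used: the squared norms of
   \<open>K (e n)\<close> are summable, so the whole sequence tends to 0 almost everywhere and no
   subsequence has to be chosen.\<close>
 have Klim: "AE x in M. (%n. K (e n) x) \<longlonglongrightarrow> 0"
 proof -
  have Km[measurable]: "K (e n) : borel_measurable M" for n using K_L2[OF e] by auto
  have "(\<integral>\<^sup>+x. (\<Sum>n. ennreal ((norm (K (e n) x))\<^sup>2)) \<partial>M) = (\<Sum>n. \<integral>\<^sup>+x. ennreal ((norm (K (e n) x))\<^sup>2) \<partial>M)"
   by (rule nn_integral_suminf) measurable
  also have "\<dots> = (\<Sum>n. ennreal ((L2_norm M (K (e n)))\<^sup>2))"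
   by (simp only: L2_norm_nn_integral[OF K_L2[OF e]])
  also have "\<dots> <= (\<Sum>n. ennreal ((C\<^sup>2)\<^sup>2 * (1/4)^n))"
  proof (intro suminf_le summableI ennreal_leI)
   fix n
   have "L2_norm M (K (e n)) <= C\<^sup>2 * (1/2)^n"
    using Kb[OF e[of n]] mult_left_mono[OF less_imp_le[OF en[of n]], of "C\<^sup>2"] by simp
   then have "(L2_norm M (K (e n)))\<^sup>2 <= (C\<^sup>2 * (1/2)^n)\<^sup>2" by (intro power_mono) auto
   also have "\<dots> = (C\<^sup>2)\<^sup>2 * (((1/2)^n)\<^sup>2)" by (rule power_mult_distrib)
   also have "((1/2::real)^n)\<^sup>2 = (1/4)^n"
    by (simp add: power_mult[symmetric] power_even_eq mult.commute power_one_over power2_eq_square flip: power_mult_distrib)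
   finally show "(L2_norm M (K (e n)))\<^sup>2 <= (C\<^sup>2)\<^sup>2 * (1/4)^n" .
  qed
  also have "\<dots> < \<infinity>"
   by (subst suminf_ennreal2) (auto intro!: summable_mult summable_geometric)
  finally have "(\<integral>\<^sup>+x. (\<Sum>n. ennreal ((norm (K (e n) x))\<^sup>2)) \<partial>M) \<noteq> \<infinity>" by simp
  then have "AE x in M. (\<Sum>n. ennreal ((norm (K (e n) x))\<^sup>2)) \<noteq> \<infinity>"
   by (intro nn_integral_PInf_AE) measurable
  then show ?thesis
  proof eventually_elim
   case (elim x)
   then have "summable (%n. (norm (K (e n) x))\<^sup>2)" by (intro summable_suminf_not_top) auto
   then have "(%n. (norm (K (e n) x))\<^sup>2) \<longlonglongrightarrow> 0" by (rule summable_LIMSEQ_zero)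
   then have "(%n. sqrt ((norm (K (e n) x))\<^sup>2)) \<longlonglongrightarrow> sqrt 0" by (rule tendsto_real_sqrt)
   then show ?case by (simp add: tendsto_rabs_zero_iff)
  qed
 qed
 \<comment> \<open>For a fixed \<open>w m\<close>, almost every point is eventually outside
   \<open>D (e n)\<close>: a positive gap between \<open>q ubar\<close> and
   \<open>\<nu> * \<beta>\<close> finally exceeds \<open>K (e n)\<close>, and a zero gap is excluded
   by the definition of \<open>D\<close>.\<close>
 have dlim: "(%n. L2_norm M (d (e n) (w m))) \<longlonglongrightarrow> 0" for m
 proof -
  have "(%n. L2_norm M (%x. d (e n) (w m) x - 0)) \<longlonglongrightarrow> 0"
  proof (rule L2_dominated_convergence(2)[where h = "%x. \<bar>w m x\<bar>"])
   show "(%x. \<bar>w m x\<bar>) : L2 M" by (rule L2_bound[OF wL[of m], where C = 1]) (use wL[of m] in auto)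
   show "d (e n) (w m) : borel_measurable M" for n using d_L2(1)[OF e wL] by auto
   show "AE x in M. (%n. d (e n) (w m) x) \<longlonglongrightarrow> 0"
    using Klim
   proof eventually_elim
    case (elim x)
    let ?b = "\<bar>q ubar x - \<nu> * \<beta> x\<bar>"
    have "\<forall>\<^sub>F n in sequentially. d (e n) (w m) x = 0"
    proof (cases "?b = 0")
     case True
     then have "d (e n) (w m) x = 0" for n by (simp add: d_def D_def)
     then show ?thesis by simp
    next
     case False
     have "(%n. \<bar>K (e n) x\<bar>) \<longlonglongrightarrow> 0" using elim by (rule tendsto_rabs_zero)
     then have "\<forall>\<^sub>F n in sequentially. \<bar>K (e n) x\<bar> < ?b" using False by (intro order_tendstoD) auto
     then show ?thesis by eventually_elim (simp add: d_def D_def)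
    qed
    then show ?case by (rule tendsto_eventually)
   qed
  qed (auto simp: d_def)
  then show ?thesis by simp
 qed
 \<comment> \<open>Finitely many \<open>w m\<close> approximate all \<open>w n\<close> up to
   \<open>\<eta>' / 2\<close>, so a single \<open>n\<close> serves all of them and contradicts
   \<open>dw\<close>.\<close>
 have "\<forall>\<^sub>F n in sequentially. \<forall>m\<in>F. L2_norm M (d (e n) (w m)) < \<eta>' / 2"
  using F(1) \<eta>' by (intro eventually_ball_finite ballI order_tendstoD(2)[OF dlim]) auto
 then obtain n where n: "!!m. m : F ==> L2_norm M (d (e n) (w m)) < \<eta>' / 2"
  by (auto simp: eventually_sequentially)
 obtain m where m: "m : F" "L2_norm M (%x. w n x - w m x) < \<eta>' / 2" using F(2) by blast
 have "d (e n) (w n) = (%x. d (e n) (%x. w n x - w m x) x + d (e n) (w m) x)"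
  by (auto simp: d_def)
 then have "L2_norm M (d (e n) (w n)) <= L2_norm M (d (e n) (%x. w n x - w m x)) + L2_norm M (d (e n) (w m))"
  using L2_norm_triangle[OF d_L2(1)[OF e L2_diff[OF wL wL]] d_L2(1)[OF e wL]] by metis
 also have "\<dots> <= L2_norm M (%x. w n x - w m x) + L2_norm M (d (e n) (w m))"
  by (intro add_right_mono d_L2(2) e L2_diff wL)
 also have "\<dots> < \<eta>'" using m(2) n[OF m(1)] by simp
 finally show False using dw[of n] by simp
qed

text \<open>The prescribed \<open>l 0\<close> is exactly the relation
  \<open>l + \<nu> * u = q u\<close> that every step produces for the next iterate, so
  \<open>newton_estimate\<close> applies from the start. The ratio \<open>1 / (2 * G)\<close> at
  least halves the error, which keeps the iterates in the ball; once they converge, arbitrary ratios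
  \<open>c / G\<close> are available.\<close>

theorem newton_superlinear:
 "\<exists>\<epsilon>>0. \<forall>u l :: nat => 'a => real.
   u 0 : L2 M --> l 0 : L2 M --> L2_dist M (u 0) ubar < \<epsilon> \<longrightarrow>
   (AE x in M. l 0 x = Sa y x - (Sa (S (u 0)) x + \<nu> * u 0 x)) \<longrightarrow>
   (\<forall>k. u (Suc k) : L2 M \<and> l (Suc k) : L2 M \<and>
    (AE x in M. \<nu> * u (Suc k) x = q (u (Suc k)) x - l (Suc k) x) \<and>
    (AE x in M. 1 / \<nu> * l k x + u k x > \<beta> x --> u (Suc k) x = \<beta> x) \<and>
    (AE x in M. \<not> (1 / \<nu> * l k x + u k x > \<beta> x) --> l (Suc k) x = 0)) \<longrightarrow>
   q_superlinear_L2 M u ubar"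
proof -
 define G where "G = 1 / \<nu> + (1 + C\<^sup>2 / \<nu>) / \<nu>"
 have G: "G > 0" using nu unfolding G_def by (intro add_pos_nonneg) auto
 obtain \<epsilon> where \<epsilon>: "\<epsilon> > 0" and small: "!!e. e : L2 M ==> L2_norm M e < \<epsilon> ==>
   L2_norm M (d e (K e)) <= 1 / (2 * G) * L2_norm M e"
  using residual_small[of "1 / (2 * G)"] G by auto
 show ?thesis
 proof (intro exI[of _ \<epsilon>] conjI \<epsilon> allI impI)
  fix u l :: "nat => 'a => real"
  assume u0: "u 0 : L2 M" and l0: "l 0 : L2 M" and close: "L2_dist M (u 0) ubar < \<epsilon>"
   and init: "AE x in M. l 0 x = Sa y x - (Sa (S (u 0)) x + \<nu> * u 0 x)"
   and steps: "\<forall>k. u (Suc k) : L2 M \<and> l (Suc k) : L2 M \<and>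
    (AE x in M. \<nu> * u (Suc k) x = q (u (Suc k)) x - l (Suc k) x) \<and>
    (AE x in M. 1 / \<nu> * l k x + u k x > \<beta> x --> u (Suc k) x = \<beta> x) \<and>
    (AE x in M. \<not> (1 / \<nu> * l k x + u k x > \<beta> x) --> l (Suc k) x = 0)"
  have uL: "u k : L2 M" and lL: "l k : L2 M" for k
   using u0 l0 steps by (cases k; auto)+
  have ul: "AE x in M. l k x + \<nu> * u k x = q (u k) x" for k
  proof (cases k)
   case 0
   have "AE x in M. Sa (%\<xi>. S (u 0) \<xi> + (-1) * y \<xi>) x = Sa (S (u 0)) x + (-1) * Sa y x"
    by (rule Sa_lin[OF S_L2[OF u0] y])
   with init show ?thesis unfolding 0 by eventually_elim (simp add: q_def)
  next
   case (Suc j)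
   have "AE x in M. \<nu> * u (Suc j) x = q (u (Suc j)) x - l (Suc j) x" using steps by blast
   then show ?thesis unfolding Suc by eventually_elim simp
  qed
  define dl where "dl k = L2_norm M (%x. u k x - ubar x)" for k
  have eL: "(%x. u k x - ubar x) : L2 M" for k using uL ubar by auto
  have est: "dl (Suc k) <= G * L2_norm M (d (%x. u k x - ubar x) (K (%x. u k x - ubar x)))" for k
   unfolding dl_def G_def using steps by (intro newton_estimate[OF uL lL uL lL ul]) blast+
  have half: "dl (Suc k) <= dl k / 2" if "dl k < \<epsilon>" for k
  proof -
   have "dl (Suc k) <= G * (1 / (2 * G) * dl k)"
    using est[of k] small[OF eL[of k]] that G unfolding dl_def
    by (intro order_trans[OF est[of k, unfolded dl_def] mult_left_mono]) auto
   then show ?thesis using G by simp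
  qed
  have bound: "dl k < \<epsilon> \<and> dl k <= (1/2)^k * dl 0" for k
  proof (induction k)
   case 0
   then show ?case using close by (simp add: dl_def L2_dist_def)
  next
   case (Suc k)
   have "dl k \<ge> 0" by (simp add: dl_def)
   then show ?case using Suc half[of k] by auto
  qed
  have lim: "dl \<longlonglongrightarrow> 0"
  proof (rule Lim_null_comparison)
   show "\<forall>\<^sub>F k in sequentially. norm (dl k) <= (1/2)^k * dl 0"
    using bound by (simp add: dl_def)
   show "(%k. (1/2)^k * dl 0) \<longlonglongrightarrow> 0"
    by (intro tendsto_mult_left_zero LIMSEQ_realpow_zero) auto
  qed
  have "(%k. dl (Suc k)) : o(dl)"
  proof (rule landau_o.smallI)
   fix c :: real assume c: "c > 0"
   obtain \<epsilon>' where \<epsilon>': "\<epsilon>' > 0" and small': "!!e. e : L2 M ==> L2_norm M e < \<epsilon>' ==>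
     L2_norm M (d e (K e)) <= c / G * L2_norm M e"
    using residual_small[of "c / G"] G c by auto
   have "\<forall>\<^sub>F k in sequentially. dl k < \<epsilon>'" using \<epsilon>' by (intro order_tendstoD(2)[OF lim])
   then show "\<forall>\<^sub>F k in sequentially. norm (dl (Suc k)) <= c * norm (dl k)"
   proof eventually_elim
    case (elim k)
    have "dl (Suc k) <= G * (c / G * dl k)"
     using small'[OF eL[of k]] elim G unfolding dl_def
     by (intro order_trans[OF est[of k, unfolded dl_def] mult_left_mono]) auto
    then show ?case using G by (simp add: dl_def)
   qed
  qed
  with lim show "q_superlinear_L2 M u ubar"
   by (simp add: q_superlinear_L2_def L2_dist_def dl_def[abs_def])
 qed
qed

end

end

section \<open>The solution operator and its compact adjoint\<close>

context lipschitz_domain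
begin

definition poisson_solution :: "('a => real) => 'a => real" where
 "poisson_solution f = (SOME \<phi>. \<phi> : Phi Om \<and> (AE x in LO. weak_laplacian Om \<phi> x = - f x))"

abbreviation flux :: "('a => real) => 'a => real" where
 "flux f \<equiv> normal_deriv Om (poisson_solution f)"

abbreviation sol_grad :: "('a => real) => 'a => 'a" where
 "sol_grad f \<equiv> weak_grad Om (poisson_solution f)"

lemma poisson_solution:
 assumes "f : L2 LO"
 shows "poisson_solution f : Phi Om" "AE x in LO. weak_laplacian Om (poisson_solution f) x = - f x"
proof -
 have "\<exists>\<phi>. \<phi> : Phi Om \<and> (AE x in LO. weak_laplacian Om \<phi> x = - f x)"
  by (rule poisson_solution_exists[OF assms]) blast
 from someI_ex[OF this] show "poisson_solution f : Phi Om" "AE x in LO. weak_laplacian Om (poisson_solution f) x = - f x"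
  by (simp_all add: poisson_solution_def)
qed

lemma weak_poisson_cong:
 assumes wp: "weak_poisson f G" and g: "g : L2 LO" "AE x in LO. f x = g x"
 shows "weak_poisson g G"
proof -
 have "L2_inner LO f ps = L2_inner LO g ps" if "ps : test_functions Om" for ps
  by (rule L2_inner_cong_left[OF g(2) _ g(1) test_L2_LO(1)[OF that]]) (use wp in \<open>simp add: weak_poisson_def\<close>)
 then show ?thesis using wp g(1) by (simp add: weak_poisson_def)
qed

text \<open>Uniqueness of solutions: \<open>G\<close> is a limit of gradients of test functions and
  orthogonal to all of them, hence to itself.\<close>

lemma weak_poisson_zero:
 assumes wp: "weak_poisson f G" and 0: "AE x in LO. f x = 0"
 shows "AE x in LO. G x = 0"
proof -
 obtain ps where ps: "!!n::nat. ps n : test_functions Om" "(%n. L2_norm LO (%x. grad (ps n) x - G x)) \<longlonglongrightarrow> 0"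
  using wp by (auto simp: weak_poisson_def)
 have L: "f : L2 LO" "G : L2 LO" using wp by (auto simp: weak_poisson_def)
 have "L2_inner LO G (grad (ps n)) = 0" for n
 proof -
  have "L2_inner LO G (grad (ps n)) = L2_inner LO f (ps n)" using wp ps(1) by (simp add: weak_poisson_def)
  also have "\<dots> = L2_inner LO (%x. 0) (ps n)"
   by (rule L2_inner_cong_left[OF 0 L(1) L2_zero test_L2_LO(1)[OF ps(1)]])
  finally show ?thesis by simp
 qed
 then have "L2_inner LO G G = 0"
  using L2_norm_diff_const_tendsto[OF ps(2) test_L2_LO(2)[OF ps(1)] L(2) L(2)] by (simp add: LIMSEQ_const_iff)
 then show ?thesis using L2_norm_eq_0_iff[OF L(2)] by (simp add: L2_norm_def)
qed

lemma flux_smooth: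
 assumes f: "f : L2 LO"
 shows "flux f : L2 sg" "weak_poisson f (sol_grad f)" "sol_grad f : L2 LO"
  and "smooth zt ==> L2_inner sg (flux f) zt = L2_inner LO (sol_grad f) (grad zt) - L2_inner LO f zt"
proof -
 note P = poisson_solution(1)[OF f]
 have lap: "AE x in LO. - weak_laplacian Om (poisson_solution f) x = f x"
  using poisson_solution(2)[OF f] by eventually_elim simp
 show "flux f : L2 sg" by (rule normal_deriv_smooth(1)[OF P])
 show wp: "weak_poisson f (sol_grad f)" by (rule weak_poisson_cong[OF Phi_poisson[OF P] f lap])
 show "sol_grad f : L2 LO" using wp by (simp add: weak_poisson_def)
 assume zt: "smooth zt"
 have "L2_inner LO (%x. - weak_laplacian Om (poisson_solution f) x) zt = L2_inner LO f zt"
  by (rule L2_inner_cong_left[OF lap L2_uminus[OF Phi_weak_laplacian(3)[OF P]] f smooth_L2[OF zt]])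
 then show "L2_inner sg (flux f) zt = L2_inner LO (sol_grad f) (grad zt) - L2_inner LO f zt"
  using normal_deriv_smooth(2)[OF P zt] by simp
qed

text \<open>The gradient of \<phi> and that of the selected solution solve the same problem and
  agree almost everywhere. The normal derivative thus depends on the Laplacian alone, and elements
  of \<open>Phi Om\<close> can be replaced by right-hand sides.\<close>

lemma normal_deriv_flux:
 assumes P: "\<phi> : Phi Om"
 shows "AE x in sg. normal_deriv Om \<phi> x = flux (%x. - weak_laplacian Om \<phi> x) x"
proof -
 let ?f = "%x. - weak_laplacian Om \<phi> x"
 have f: "?f : L2 LO" using Phi_weak_laplacian(3)[OF P] by (rule L2_uminus)
 note wp = Phi_poisson[OF P]
 have GL: "weak_grad Om \<phi> : L2 LO" using wp by (simp add: weak_poisson_def)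
 have "AE x in LO. weak_grad Om \<phi> x + (-1) *\<^sub>R sol_grad ?f x = 0"
  by (rule weak_poisson_zero[OF weak_poisson_comb[OF wp flux_smooth(2)[OF f], of "-1"]]) simp
 then have G: "AE x in LO. weak_grad Om \<phi> x = sol_grad ?f x" by eventually_elim simp
 show ?thesis
 proof (rule L2_sigma_eqI[OF normal_deriv_smooth(1)[OF P] flux_smooth(1)[OF f]])
  fix zt :: "'a => real" assume zt: "smooth zt"
  have "L2_inner LO (weak_grad Om \<phi>) (grad zt) = L2_inner LO (sol_grad ?f) (grad zt)"
   by (rule L2_inner_cong_left[OF G GL flux_smooth(3)[OF f] smooth_grad_L2[OF zt]])
  then show "L2_inner sg (normal_deriv Om \<phi>) zt = L2_inner sg (flux ?f) zt"
   by (simp only: normal_deriv_smooth(2)[OF P zt] flux_smooth(4)[OF f zt])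
 qed
qed

lemma flux_comb:
 assumes f: "f : L2 LO" "g : L2 LO"
 shows "AE x in sg. flux (%x. f x + s * g x) x = flux f x + s * flux g x"
proof -
 let ?h = "%x. f x + s * g x"
 have h: "?h : L2 LO" by (rule L2_add[OF f(1) L2_cmult[OF f(2)]])
 have "AE x in LO. sol_grad ?h x + (-1) *\<^sub>R (sol_grad f x + s *\<^sub>R sol_grad g x) = 0"
 proof (rule weak_poisson_zero)
  show "weak_poisson (%x. (f x + s * g x) + (-1) * (f x + s * g x))
   (%x. sol_grad ?h x + (-1) *\<^sub>R (sol_grad f x + s *\<^sub>R sol_grad g x))"
   by (rule weak_poisson_comb[OF flux_smooth(2)[OF h] weak_poisson_comb[OF flux_smooth(2)[OF f(1)] flux_smooth(2)[OF f(2)]]])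
 qed simp
 then have G: "AE x in LO. sol_grad ?h x = sol_grad f x + s *\<^sub>R sol_grad g x"
  by eventually_elim (simp only: scaleR_minus_left scaleR_one add_uminus_conv_diff right_minus_eq)
 note GL = flux_smooth(3)[OF f(1)] flux_smooth(3)[OF f(2)] flux_smooth(3)[OF h]
 note nL = flux_smooth(1)[OF f(1)] flux_smooth(1)[OF f(2)] flux_smooth(1)[OF h]
 show ?thesis
 proof (rule L2_sigma_eqI[OF nL(3) L2_add[OF nL(1) L2_cmult[OF nL(2)]]])
  fix zt :: "'a => real" assume zt: "smooth zt"
  have "L2_inner LO (sol_grad ?h) (grad zt) = L2_inner LO (%x. sol_grad f x + s *\<^sub>R sol_grad g x) (grad zt)"
   by (rule L2_inner_cong_left[OF G GL(3) L2_add[OF GL(1) L2_scale[OF GL(2)]] smooth_grad_L2[OF zt]])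
  also have "\<dots> = L2_inner LO (sol_grad f) (grad zt) + s * L2_inner LO (sol_grad g) (grad zt)"
   using L2_inner_add_left[OF GL(1) L2_scale[OF GL(2)] smooth_grad_L2[OF zt]] by (simp add: L2_inner_scale_left)
  finally have e1: "L2_inner LO (sol_grad ?h) (grad zt) = L2_inner LO (sol_grad f) (grad zt) + s * L2_inner LO (sol_grad g) (grad zt)" .
  have e2: "L2_inner LO ?h zt = L2_inner LO f zt + s * L2_inner LO g zt"
   using L2_inner_add_left[OF f(1) L2_cmult[OF f(2)] smooth_L2[OF zt]] by (simp add: L2_inner_cmult_left)
  have e3: "L2_inner sg (%x. flux f x + s * flux g x) zt = L2_inner sg (flux f) zt + s * L2_inner sg (flux g) zt"
   using L2_inner_add_left[OF nL(1) L2_cmult[OF nL(2)] smooth_L2_sigma[OF zt]] by (simp add: L2_inner_cmult_left)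
  show "L2_inner sg (flux ?h) zt = L2_inner sg (%x. flux f x + s * flux g x) zt"
   unfolding e3 flux_smooth(4)[OF h zt] flux_smooth(4)[OF f(1) zt] flux_smooth(4)[OF f(2) zt] e1 e2
   by (simp add: algebra_simps)
 qed
qed

text \<open>The equation for the difference is tested with the difference of the solutions. For
  bounded data this turns closeness of solutions in \<open>L2\<close> into closeness of their
  gradients.\<close>

lemma solution_energy:
 assumes f: "f : L2 LO" "g : L2 LO"
 shows "(L2_norm LO (%x. sol_grad f x - sol_grad g x))\<^sup>2 \<le>
  L2_norm LO (%x. f x - g x) * L2_norm LO (%x. poisson_solution f x - poisson_solution g x)"
proof -
 let ?G = "%x. sol_grad f x - sol_grad g x" and ?h = "%x. f x - g x" and ?p = "%x. poisson_solution f x - poisson_solution g x"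
 have wp: "weak_poisson ?h ?G"
  using weak_poisson_comb[OF flux_smooth(2)[OF f(1)] flux_smooth(2)[OF f(2)], of "-1"] by simp
 have H: "poisson_solution f : H10 Om" "poisson_solution g : H10 Om" by (intro Phi_weak_laplacian(2) poisson_solution(1) f)+
 obtain ps where ps: "!!n::nat. ps n : test_functions Om" "(%n. L2_norm LO (%x. ps n x - poisson_solution f x)) \<longlonglongrightarrow> 0"
  "(%n. L2_norm LO (%x. grad (ps n) x - sol_grad f x)) \<longlonglongrightarrow> 0" "poisson_solution f : L2 LO" "sol_grad f : L2 LO"
  by (rule H10_approximation[OF H(1)]) blast
 obtain ps' where ps': "!!n::nat. ps' n : test_functions Om" "(%n. L2_norm LO (%x. ps' n x - poisson_solution g x)) \<longlonglongrightarrow> 0"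
  "(%n. L2_norm LO (%x. grad (ps' n) x - sol_grad g x)) \<longlonglongrightarrow> 0" "poisson_solution g : L2 LO" "sol_grad g : L2 LO"
  by (rule H10_approximation[OF H(2)]) blast
 have GL: "?G : L2 LO" by (rule L2_diff[OF ps(5) ps'(5)])
 have hL: "?h : L2 LO" by (rule L2_diff[OF f])
 have pL: "?p : L2 LO" by (rule L2_diff[OF ps(4) ps'(4)])
 let ?t = "%n x. ps n x - ps' n x"
 have t: "?t n : test_functions Om" for n using test_functions_comb[OF ps(1) ps'(1), of n "-1" n] by simp
 have gt: "grad (?t n) = (%x. grad (ps n) x - grad (ps' n) x)" for n
  by (rule ext) (simp add: grad_diff test_functionsD(1)[OF ps(1)] test_functionsD(1)[OF ps'(1)])
 have eq: "L2_inner LO ?G (grad (ps n)) - L2_inner LO ?G (grad (ps' n)) = L2_inner LO ?h (ps n) - L2_inner LO ?h (ps' n)" for n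
 proof -
  have "L2_inner LO ?G (grad (?t n)) = L2_inner LO ?h (?t n)" using wp t by (simp add: weak_poisson_def)
  then show ?thesis
   unfolding gt L2_inner_diff_right[OF test_L2_LO(2)[OF ps(1)] test_L2_LO(2)[OF ps'(1)] GL]
    L2_inner_diff_right[OF test_L2_LO(1)[OF ps(1)] test_L2_LO(1)[OF ps'(1)] hL] .
 qed
 have l1: "(%n. L2_inner LO ?G (grad (ps n)) - L2_inner LO ?G (grad (ps' n))) \<longlonglongrightarrow> L2_inner LO ?G (sol_grad f) - L2_inner LO ?G (sol_grad g)"
  by (rule tendsto_diff[OF L2_norm_diff_const_tendsto[OF ps(3) test_L2_LO(2)[OF ps(1)] ps(5) GL]
     L2_norm_diff_const_tendsto[OF ps'(3) test_L2_LO(2)[OF ps'(1)] ps'(5) GL]])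
 have l2: "(%n. L2_inner LO ?h (ps n) - L2_inner LO ?h (ps' n)) \<longlonglongrightarrow> L2_inner LO ?h (poisson_solution f) - L2_inner LO ?h (poisson_solution g)"
  by (rule tendsto_diff[OF L2_norm_diff_const_tendsto[OF ps(2) test_L2_LO(1)[OF ps(1)] ps(4) hL]
     L2_norm_diff_const_tendsto[OF ps'(2) test_L2_LO(1)[OF ps'(1)] ps'(4) hL]])
 have "L2_inner LO ?G (sol_grad f) - L2_inner LO ?G (sol_grad g) = L2_inner LO ?h (poisson_solution f) - L2_inner LO ?h (poisson_solution g)"
  by (rule LIMSEQ_unique[OF l1]) (use l2 eq in simp)
 then have "L2_inner LO ?G ?G = L2_inner LO ?h ?p"
  unfolding L2_inner_diff_right[OF ps(5) ps'(5) GL] L2_inner_diff_right[OF ps(4) ps'(4) hL] .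
 then show ?thesis using L2_Cauchy_Schwarz[OF hL pL] by (simp add: L2_norm_power2)
qed

lemma solution_bounds:
 obtains C where "C > 0" "!!f. f : L2 LO ==> L2_norm LO (sol_grad f) <= C * L2_norm LO f"
  "!!f. f : L2 LO ==> L2_norm LO (poisson_solution f) <= C * L2_norm LO (sol_grad f)"
proof -
 obtain C where C: "C > 0" "!!\<phi>. \<phi> : H10 Om ==> L2_norm LO \<phi> <= C * L2_norm LO (weak_grad Om \<phi>)"
  using H10_Poincare by blast
 have p: "L2_norm LO (poisson_solution f) <= C * L2_norm LO (sol_grad f)" if "f : L2 LO" for f
  using C(2) Phi_weak_laplacian(2) poisson_solution(1)[OF that] by blast
 have "L2_norm LO (sol_grad f) <= C * L2_norm LO f" if f: "f : L2 LO" for f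
 proof -
  note wp = flux_smooth(2)[OF f]
  have H: "poisson_solution f : H10 Om" by (rule Phi_weak_laplacian(2)[OF poisson_solution(1)[OF f]])
  obtain ps where ps: "!!n::nat. ps n : test_functions Om" "(%n. L2_norm LO (%x. ps n x - poisson_solution f x)) \<longlonglongrightarrow> 0"
   "(%n. L2_norm LO (%x. grad (ps n) x - sol_grad f x)) \<longlonglongrightarrow> 0" "poisson_solution f : L2 LO" "sol_grad f : L2 LO"
   by (rule H10_approximation[OF H]) blast
  have eq: "L2_inner LO (sol_grad f) (grad (ps n)) = L2_inner LO f (ps n)" for n
   using wp ps(1) by (simp add: weak_poisson_def)
  have "L2_inner LO (sol_grad f) (sol_grad f) = L2_inner LO f (poisson_solution f)"
   by (rule LIMSEQ_unique[OF L2_norm_diff_const_tendsto[OF ps(3) test_L2_LO(2)[OF ps(1)] ps(5) ps(5)]])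
    (use L2_norm_diff_const_tendsto[OF ps(2) test_L2_LO(1)[OF ps(1)] ps(4) f] eq in simp)
  then have "(L2_norm LO (sol_grad f))\<^sup>2 <= L2_norm LO f * L2_norm LO (poisson_solution f)"
   using L2_Cauchy_Schwarz[OF f ps(4)] by (simp add: L2_norm_power2)
  also have "\<dots> <= L2_norm LO f * (C * L2_norm LO (sol_grad f))" by (intro mult_left_mono p f) simp
  finally have "L2_norm LO (sol_grad f) * L2_norm LO (sol_grad f) <= (C * L2_norm LO f) * L2_norm LO (sol_grad f)"
   by (simp add: power2_eq_square mult_ac)
  then show ?thesis
   using C(1) L2_norm_nonneg[of LO "sol_grad f"] by (cases "L2_norm LO (sol_grad f) = 0") (auto simp: order_less_le)
 qed
 then show thesis using that C(1) p by blast
qed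

lemma flux_bounded:
 obtains C where "C \<ge> 0" "!!f. f : L2 LO ==> L2_norm sg (flux f) <= C * L2_norm LO f"
proof -
 obtain C1 where C1: "C1 \<ge> 0" and fl: "!!f G g. weak_poisson f G ==> g : L2 sg ==>
  (!!zt. smooth zt ==> L2_inner sg g zt = L2_inner LO G (grad zt) - L2_inner LO f zt) ==>
  L2_norm sg g <= C1 * sqrt ((L2_norm LO G)\<^sup>2 + L2_norm LO f * L2_norm LO G)"
  by (rule flux_norm_le) blast
 obtain C2 where C2: "C2 > 0" "!!f. f : L2 LO ==> L2_norm LO (sol_grad f) <= C2 * L2_norm LO f"
  by (rule solution_bounds) blast
 show thesis
 proof (rule that[of "C1 * (C2 + 1)"])
  show "0 <= C1 * (C2 + 1)" using C1 C2(1) by simp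
  fix f :: "'a => real" assume f: "f : L2 LO"
  let ?f = "L2_norm LO f" and ?G = "L2_norm LO (sol_grad f)"
  have "?G\<^sup>2 + ?f * ?G <= (C2 * ?f)\<^sup>2 + ?f * (C2 * ?f)"
   using C2(2)[OF f] by (intro add_mono power_mono mult_left_mono) auto
  also have "\<dots> <= ((C2 + 1) * ?f)\<^sup>2"
  proof -
   have "0 <= (C2 + 1) * ?f\<^sup>2" using C2(1) by simp
   then show ?thesis by (simp add: power2_eq_square algebra_simps)
  qed
  finally have "sqrt (?G\<^sup>2 + ?f * ?G) <= (C2 + 1) * ?f"
   using C2(1) by (intro real_le_lsqrt) auto
  then have "C1 * sqrt (?G\<^sup>2 + ?f * ?G) <= C1 * ((C2 + 1) * ?f)" using C1 by (rule mult_left_mono)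
  moreover have "L2_norm sg (flux f) <= C1 * sqrt (?G\<^sup>2 + ?f * ?G)"
   by (rule fl[OF flux_smooth(2)[OF f] flux_smooth(1)[OF f] flux_smooth(4)[OF f]])
  ultimately show "L2_norm sg (flux f) <= C1 * (C2 + 1) * ?f" by (simp add: mult.assoc)
 qed
qed

text \<open>Rellich's theorem makes solutions close, \<open>solution_energy\<close> makes their
  gradients close, and the flux bound, which has the gradient in both of its terms, makes the fluxes
  close.\<close>

lemma flux_compact:
 assumes f: "!!n::nat. f n : L2 LO" "!!n. L2_norm LO (f n) <= 1" and \<eta>: "\<eta> > 0"
 shows "\<exists>F. finite F \<and> (\<forall>n. \<exists>m\<in>F. L2_norm sg (%x. flux (f n) x - flux (f m) x) < \<eta>)"
proof -
 obtain C1 where C1: "C1 \<ge> 0" and fl: "!!f G g. weak_poisson f G ==> g : L2 sg ==>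
  (!!zt. smooth zt ==> L2_inner sg g zt = L2_inner LO G (grad zt) - L2_inner LO f zt) ==>
  L2_norm sg g <= C1 * sqrt ((L2_norm LO G)\<^sup>2 + L2_norm LO f * L2_norm LO G)"
  by (rule flux_norm_le) blast
 obtain C2 where C2: "C2 > 0" "!!f. f : L2 LO ==> L2_norm LO (sol_grad f) <= C2 * L2_norm LO f"
  "!!f. f : L2 LO ==> L2_norm LO (poisson_solution f) <= C2 * L2_norm LO (sol_grad f)"
  by (rule solution_bounds) blast
 \<comment> \<open>To be read backwards: \<open>2 * \<kappa>\<close> is what the square root may
   contain. \<open>2 * \<mu> <= \<kappa>\<close> and \<open>2 * \<mu> <= (\<kappa> / 2)^2\<close>
   make each of its two terms at most \<kappa>, since two of the data differ by at most 2.\<close>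
 define \<kappa> where "\<kappa> = (\<eta> / (C1 + 1))\<^sup>2 / 2"
 have \<kappa>: "\<kappa> > 0" using \<eta> C1 by (simp add: \<kappa>_def)
 define \<mu> where "\<mu> = min (\<kappa> / 2) ((\<kappa> / 2)\<^sup>2 / 2)"
 have \<mu>: "\<mu> > 0" using \<kappa> by (simp add: \<mu>_def)
 define R where "R = C2 * C2 + C2 + \<mu> + 1"
 have R: "R > 0" using C2(1) \<mu> by (simp add: R_def add_pos_pos)
 note H = Phi_weak_laplacian(2)[OF poisson_solution(1)[OF f(1)]]
 have G1: "L2_norm LO (sol_grad (f n)) <= C2" for n
  using order_trans[OF C2(2)[OF f(1)] mult_left_mono[OF f(2)]] C2(1) by simp
 have P1: "L2_norm LO (poisson_solution (f n)) <= C2 * C2" for n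
  using order_trans[OF C2(3)[OF f(1)] mult_left_mono[OF G1]] C2(1) by simp
 \<comment> \<open>\<open>test_functions_totally_bounded\<close> speaks of test functions, so each
   solution is replaced by one within \<open>\<mu> / 3\<close> whose norm and gradient obey a common
   bound \<open>R\<close>; three such errors add up to \<mu>.\<close>
 have "\<exists>ps. ps : test_functions Om \<and> L2_norm LO (%x. ps x - poisson_solution (f n) x) < \<mu> / 3 \<and>
   L2_norm LO ps <= R \<and> L2_norm LO (grad ps) <= R" for n
 proof (rule H10_approximation[OF H[of n]])
  fix ps assume ps: "!!k::nat. ps k : test_functions Om" and l: "(%k. L2_norm LO (%x. ps k x - poisson_solution (f n) x)) \<longlonglongrightarrow> 0"
   "(%k. L2_norm LO (%x. grad (ps k) x - sol_grad (f n) x)) \<longlonglongrightarrow> 0" and L: "poisson_solution (f n) : L2 LO" "sol_grad (f n) : L2 LO"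
  have "\<forall>\<^sub>F k in sequentially. L2_norm LO (%x. ps k x - poisson_solution (f n) x) < \<mu> / 3 \<and>
    L2_norm LO (%x. grad (ps k) x - sol_grad (f n) x) < 1"
   using \<mu> by (intro eventually_conj order_tendstoD(2)[OF l(1)] order_tendstoD(2)[OF l(2)]) auto
  then obtain k where k: "L2_norm LO (%x. ps k x - poisson_solution (f n) x) < \<mu> / 3"
    "L2_norm LO (%x. grad (ps k) x - sol_grad (f n) x) < 1"
   by (auto simp: eventually_sequentially)
  have "C2 * C2 \<ge> 0" by simp
  then have "L2_norm LO (ps k) <= R" "L2_norm LO (grad (ps k)) <= R"
   using L2_norm_reverse_triangle[OF test_L2_LO(1)[OF ps[of k]] L(1)] L2_norm_reverse_triangle[OF test_L2_LO(2)[OF ps[of k]] L(2)]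
    k G1[of n] P1[of n] \<mu> C2(1) unfolding R_def by linarith+
  then show ?thesis using ps[of k] k(1) by blast
 qed
 then have "\<forall>n. \<exists>ps. ps : test_functions Om \<and> L2_norm LO (%x. ps x - poisson_solution (f n) x) < \<mu> / 3 \<and>
   L2_norm LO ps <= R \<and> L2_norm LO (grad ps) <= R" by blast
 from choice[OF this] obtain ps where ps: "!!n. ps n : test_functions Om"
  "!!n. L2_norm LO (%x. ps n x - poisson_solution (f n) x) < \<mu> / 3"
  "!!n. L2_norm LO (ps n) <= R" "!!n. L2_norm LO (grad (ps n)) <= R" by blast
 have "\<mu> / 3 > 0" using \<mu> by simp
 from test_functions_totally_bounded[OF ps(1) R ps(3,4) this]
 obtain F where F0: "finite F \<and> (\<forall>n. \<exists>m\<in>F. L2_norm LO (%x. ps n x - ps m x) < \<mu> / 3)" ..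
 have F: "finite F" "\<exists>m\<in>F. L2_norm LO (%x. ps n x - ps m x) < \<mu> / 3" for n
  by (rule conjunct1[OF F0], rule spec[OF conjunct2[OF F0]])
 show ?thesis
 proof (intro exI[of _ F] conjI allI F(1))
  fix n
  obtain m where m: "m : F" "L2_norm LO (%x. ps n x - ps m x) < \<mu> / 3" using F(2)[of n] by (elim bexE)
  let ?p = "%i. poisson_solution (f i)"
  have pL: "?p i : L2 LO" for i using H[of i] by (auto simp: H10_def H1_def)
  note psL = test_L2_LO(1)[OF ps(1)]
  have "L2_norm LO (%x. ?p n x - ?p m x) <= L2_norm LO (%x. ?p n x - ps n x) + L2_norm LO (%x. ps n x - ?p m x)"
   by (rule L2_norm_triangle_diff[OF pL psL pL])
  moreover have "L2_norm LO (%x. ps n x - ?p m x) <= L2_norm LO (%x. ps n x - ps m x) + L2_norm LO (%x. ps m x - ?p m x)"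
   by (rule L2_norm_triangle_diff[OF psL psL pL])
  ultimately have pd: "L2_norm LO (%x. ?p n x - ?p m x) < \<mu>"
   using m(2) ps(2)[of n] ps(2)[of m] L2_norm_minus_commute[of LO "?p n" "ps n"] by linarith
  let ?G = "%x. sol_grad (f n) x - sol_grad (f m) x" and ?h = "%x. f n x - f m x"
  have h2: "L2_norm LO ?h <= 2" using L2_norm_diff_le[OF f(1) f(1), of n m] f(2)[of n] f(2)[of m] by linarith
  have "(L2_norm LO ?G)\<^sup>2 <= L2_norm LO ?h * L2_norm LO (%x. ?p n x - ?p m x)" by (rule solution_energy[OF f(1) f(1)])
  also have "\<dots> <= 2 * \<mu>" using h2 pd \<mu> by (intro mult_mono) auto
  finally have G2: "(L2_norm LO ?G)\<^sup>2 <= 2 * \<mu>" .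
  then have "(L2_norm LO ?G)\<^sup>2 <= (\<kappa> / 2)\<^sup>2" unfolding \<mu>_def by linarith
  then have G3: "L2_norm LO ?G <= \<kappa> / 2" by (rule power2_le_imp_le) (use \<kappa> in simp)
  have "L2_norm LO ?h * L2_norm LO ?G <= 2 * (\<kappa> / 2)" using h2 G3 \<kappa> by (intro mult_mono) auto
  moreover have "(L2_norm LO ?G)\<^sup>2 <= \<kappa>" using G2 unfolding \<mu>_def by linarith
  ultimately have Q: "(L2_norm LO ?G)\<^sup>2 + L2_norm LO ?h * L2_norm LO ?G <= 2 * \<kappa>" by linarith
  have "2 * \<kappa> = (\<eta> / (C1 + 1))\<^sup>2" by (simp add: \<kappa>_def)
  then have "sqrt ((L2_norm LO ?G)\<^sup>2 + L2_norm LO ?h * L2_norm LO ?G) <= \<eta> / (C1 + 1)"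
   using Q \<eta> C1 by (intro real_le_lsqrt) auto
  then have le: "C1 * sqrt ((L2_norm LO ?G)\<^sup>2 + L2_norm LO ?h * L2_norm LO ?G) <= C1 * (\<eta> / (C1 + 1))"
   using C1 by (rule mult_left_mono)
  have "C1 * (\<eta> / (C1 + 1)) < (C1 + 1) * (\<eta> / (C1 + 1))" using \<eta> C1 by (intro mult_strict_right_mono) auto
  also have "\<dots> = \<eta>"
  proof -
   have "C1 + 1 \<noteq> 0" using C1 by linarith
   then show ?thesis by simp
  qed
  finally have lt: "C1 * (\<eta> / (C1 + 1)) < \<eta>" .
  have "weak_poisson ?h ?G"
   using weak_poisson_comb[OF flux_smooth(2)[OF f(1)[of n]] flux_smooth(2)[OF f(1)[of m]], of "-1"] by simp
  moreover have "(%x. flux (f n) x - flux (f m) x) : L2 sg" by (intro L2_diff flux_smooth(1) f(1))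
  moreover have "L2_inner sg (%x. flux (f n) x - flux (f m) x) zt = L2_inner LO ?G (grad zt) - L2_inner LO ?h zt" if zt: "smooth zt" for zt
   unfolding L2_inner_diff_left[OF flux_smooth(1)[OF f(1)] flux_smooth(1)[OF f(1)] smooth_L2_sigma[OF zt]]
    L2_inner_diff_left[OF flux_smooth(3)[OF f(1)] flux_smooth(3)[OF f(1)] smooth_grad_L2[OF zt]]
    L2_inner_diff_left[OF f(1) f(1) smooth_L2[OF zt]] flux_smooth(4)[OF f(1) zt] by simp
  ultimately have "L2_norm sg (%x. flux (f n) x - flux (f m) x) <= C1 * sqrt ((L2_norm LO ?G)\<^sup>2 + L2_norm LO ?h * L2_norm LO ?G)"
   by (rule fl)
  then have "L2_norm sg (%x. flux (f n) x - flux (f m) x) < \<eta>" using le lt by linarith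
  then show "\<exists>m\<in>F. L2_norm sg (%x. flux (f n) x - flux (f m) x) < \<eta>" using m(1) by blast
 qed
qed

text \<open>Every \<open>f\<close> in \<open>L2\<close> is, almost everywhere, the negative
  Laplacian of an element of \<open>Phi Om\<close>, so the transposition equation prescribes all
  inner products of the solution. Boundedness of the flux makes this functional continuous, and
  Riesz representation supplies the solution.\<close>

lemma S_op_properties:
 assumes u: "u : L2 sg"
 shows "S_op Om u : L2 LO" "f : L2 LO ==> L2_inner LO (S_op Om u) f = - L2_inner sg u (flux f)"
proof -
 obtain C where C: "C \<ge> 0" "!!f. f : L2 LO ==> L2_norm sg (flux f) <= C * L2_norm LO f"
  by (rule flux_bounded) blast
 let ?l = "%f. - L2_inner sg u (flux f)"
 obtain y where y: "y : L2 LO" "!!f. f : L2 LO ==> L2_inner LO y f = ?l f"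
 proof (rule L2_Riesz[where T = "L2 LO" and j = "%p. p" and l = ?l and M = LO and C = "L2_norm sg u * C"])
  show "L2 LO \<noteq> ({} :: ('a => real) set)" using L2_zero by blast
  show "(%x. p x + s * q x) : L2 LO" if "p : L2 LO" "q : L2 LO" for p q :: "'a => real" and s
   by (rule L2_add[OF that(1) L2_cmult[OF that(2)]])
  show "AE x in LO. p x + s * q x = p x + s *\<^sub>R q x" for p q :: "'a => real" and s by simp
  show "?l (%x. p x + s * q x) = ?l p + s * ?l q" if pq: "p : L2 LO" "q : L2 LO" for p q s
  proof -
   note n = flux_smooth(1)[OF pq(1)] flux_smooth(1)[OF pq(2)]
   have c: "(%x. p x + s * q x) : L2 LO" by (rule L2_add[OF pq(1) L2_cmult[OF pq(2)]])
   have "L2_inner sg u (flux (%x. p x + s * q x)) = L2_inner sg u (%x. flux p x + s * flux q x)"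
    by (rule L2_inner_cong_right[OF flux_comb[OF pq] flux_smooth(1)[OF c] L2_add[OF n(1) L2_cmult[OF n(2)]] u])
   also have "\<dots> = L2_inner sg u (flux p) + s * L2_inner sg u (flux q)"
    using L2_inner_add_right[OF n(1) L2_cmult[OF n(2)] u] by (simp add: L2_inner_cmult_right)
   finally show ?thesis by simp
  qed
  show "\<bar>?l p\<bar> <= L2_norm sg u * C * L2_norm LO p" if p: "p : L2 LO" for p
   using order_trans[OF L2_Cauchy_Schwarz[OF u flux_smooth(1)[OF p]] mult_left_mono[OF C(2)[OF p], of "L2_norm sg u"]]
   by (simp add: mult.assoc)
 qed blast+
 have flux_eq: "L2_inner sg u (normal_deriv Om \<phi>) = L2_inner sg u (flux (%x. - weak_laplacian Om \<phi> x))" if P: "\<phi> : Phi Om" for \<phi>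
  by (rule L2_inner_cong_right[OF normal_deriv_flux[OF P] normal_deriv_smooth(1)[OF P] flux_smooth(1)[OF L2_uminus[OF Phi_weak_laplacian(3)[OF P]]] u])
 have "is_transposition_solution Om u y"
  unfolding is_transposition_solution_def
 proof (intro conjI ballI y(1))
  fix \<phi> assume P: "\<phi> : Phi Om"
  show "L2_inner LO y (%x. - weak_laplacian Om \<phi> x) = - L2_inner sg u (normal_deriv Om \<phi>)"
   unfolding flux_eq[OF P] by (rule y(2)[OF L2_uminus[OF Phi_weak_laplacian(3)[OF P]]])
 qed
 then have S: "is_transposition_solution Om u (S_op Om u)"
  unfolding S_op_def by (rule someI[of "is_transposition_solution Om u"])
 then show SL: "S_op Om u : L2 LO" by (simp add: is_transposition_solution_def)
 assume f: "f : L2 LO"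
 note P = poisson_solution(1)[OF f]
 have "L2_inner LO (S_op Om u) f = L2_inner LO (S_op Om u) (%x. - weak_laplacian Om (poisson_solution f) x)"
 proof (rule L2_inner_cong_right[OF _ f L2_uminus[OF Phi_weak_laplacian(3)[OF P]] SL])
  show "AE x in LO. f x = - weak_laplacian Om (poisson_solution f) x"
   using poisson_solution(2)[OF f] by eventually_elim simp
 qed
 also have "\<dots> = - L2_inner sg u (flux f)" using S P by (simp add: is_transposition_solution_def)
 finally show "L2_inner LO (S_op Om u) f = - L2_inner sg u (flux f)" .
qed

text \<open>\<open>- flux z\<close> is a witness for the choice in \<open>L2_adjoint\<close>;
  whatever is chosen has the same pairings with smooth functions and therefore agrees with it almost
  everywhere.\<close>

lemma S_adj_properties:
 assumes z: "z : L2 LO"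
 shows "S_adj Om z : L2 sg" "u : L2 sg ==> L2_inner LO (S_op Om u) z = L2_inner sg u (S_adj Om z)"
  "AE x in sg. S_adj Om z x = - flux z x"
proof -
 have "(%x. - flux z x) : L2 sg \<and> (\<forall>u\<in>L2 sg. L2_inner LO (S_op Om u) z = L2_inner sg u (%x. - flux z x))"
  using L2_uminus[OF flux_smooth(1)[OF z]] S_op_properties(2)[OF _ z] by (simp add: L2_inner_uminus_right)
 then have "S_adj Om z : L2 sg \<and> (\<forall>u\<in>L2 sg. L2_inner LO (S_op Om u) z = L2_inner sg u (S_adj Om z))"
  unfolding S_adj_def L2_adjoint_def by (rule someI[of "%g. g : L2 sg \<and> (\<forall>u\<in>L2 sg. L2_inner LO (S_op Om u) z = L2_inner sg u g)"])
 then show SaL: "S_adj Om z : L2 sg" and adj: "!!u. u : L2 sg ==> L2_inner LO (S_op Om u) z = L2_inner sg u (S_adj Om z)"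
  by blast+
 show "AE x in sg. S_adj Om z x = - flux z x"
 proof (rule L2_sigma_eqI[OF SaL L2_uminus[OF flux_smooth(1)[OF z]]])
  fix zt :: "'a => real" assume "smooth zt"
  then have zt: "zt : L2 sg" by (rule smooth_L2_sigma)
  show "L2_inner sg (S_adj Om z) zt = L2_inner sg (%x. - flux z x) zt"
   using adj[OF zt] S_op_properties(2)[OF zt z]
   by (simp add: L2_inner_uminus_left L2_inner_commute[of sg zt])
 qed
qed

theorem compact_adjoint_pair_S:
 obtains C where "compact_adjoint_pair sg LO (S_op Om) (S_adj Om) C"
proof -
 obtain C where C: "C \<ge> 0" "!!f. f : L2 LO ==> L2_norm sg (flux f) <= C * L2_norm LO f"
  by (rule flux_bounded) blast
 have "compact_adjoint_pair sg LO (S_op Om) (S_adj Om) C"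
 proof
  show SL: "S_op Om u : L2 LO" if "u : L2 sg" for u by (rule S_op_properties(1)[OF that])
  show "AE x in LO. S_op Om (%x. u x + t * v x) x = S_op Om u x + t * S_op Om v x" if uv: "u : L2 sg" "v : L2 sg" for u v t
  proof -
   have c: "(%x. u x + t * v x) : L2 sg" by (rule L2_add[OF uv(1) L2_cmult[OF uv(2)]])
   let ?r = "%x. S_op Om u x + t * S_op Om v x"
   have r: "?r : L2 LO" by (rule L2_add[OF SL[OF uv(1)] L2_cmult[OF SL[OF uv(2)]]])
   have "AE x in LO. S_op Om (%x. u x + t * v x) x - ?r x = 0"
   proof (rule L2_orthogonal_test_functions[OF L2_diff[OF SL[OF c] r]])
    fix ps assume "ps : test_functions Om"
    then have ps: "ps : L2 LO" by (rule test_L2_LO(1))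
    have "L2_inner LO ?r ps = L2_inner LO (S_op Om u) ps + t * L2_inner LO (S_op Om v) ps"
     using L2_inner_add_left[OF SL[OF uv(1)] L2_cmult[OF SL[OF uv(2)]] ps] by (simp add: L2_inner_cmult_left)
    moreover have "L2_inner sg (%x. u x + t * v x) (flux ps) = L2_inner sg u (flux ps) + t * L2_inner sg v (flux ps)"
     using L2_inner_add_left[OF uv(1) L2_cmult[OF uv(2)] flux_smooth(1)[OF ps]] by (simp add: L2_inner_cmult_left)
    ultimately show "L2_inner LO (%x. S_op Om (%x. u x + t * v x) x - ?r x) ps = 0"
     unfolding L2_inner_diff_left[OF SL[OF c] r ps] S_op_properties(2)[OF c ps]
     by (simp add: S_op_properties(2)[OF uv(1) ps] S_op_properties(2)[OF uv(2) ps])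
   qed
   then show ?thesis by eventually_elim simp
  qed
  \<comment> \<open>By duality the solution operator inherits the constant of the flux: the adjoint
    relation is evaluated at \<open>S_op Om u\<close> itself.\<close>
  show "L2_norm LO (S_op Om u) <= C * L2_norm sg u" if u: "u : L2 sg" for u
  proof -
   let ?y = "S_op Om u"
   have "(L2_norm LO ?y)\<^sup>2 = - L2_inner sg u (flux ?y)"
    by (simp add: L2_norm_power2 S_op_properties(2)[OF u SL[OF u]])
   also have "\<dots> <= L2_norm sg u * L2_norm sg (flux ?y)"
    using L2_Cauchy_Schwarz[OF u flux_smooth(1)[OF SL[OF u]]] by linarith
   also have "\<dots> <= L2_norm sg u * (C * L2_norm LO ?y)" by (intro mult_left_mono C(2) SL u) simp
   finally have "L2_norm LO ?y * L2_norm LO ?y <= (C * L2_norm sg u) * L2_norm LO ?y"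
    by (simp add: power2_eq_square mult_ac)
   then show ?thesis
    using C(1) L2_norm_nonneg[of LO ?y] by (cases "L2_norm LO ?y = 0") (auto simp: order_less_le)
  qed
  show SaL: "S_adj Om z : L2 sg" if "z : L2 LO" for z by (rule S_adj_properties(1)[OF that])
  show "L2_inner LO (S_op Om u) z = L2_inner sg u (S_adj Om z)" if "u : L2 sg" "z : L2 LO" for u z
   by (rule S_adj_properties(2)[OF that(2,1)])
  show "\<exists>F. finite F \<and> (\<forall>n. \<exists>m\<in>F. L2_norm sg (%x. S_adj Om (f n) x - S_adj Om (f m) x) < \<eta>)"
   if f: "!!n::nat. f n : L2 LO" "!!n. L2_norm LO (f n) <= 1" and \<eta>: "\<eta> > 0" for f \<eta>
  proof -
   have "L2_norm sg (%x. S_adj Om (f n) x - S_adj Om (f m) x) = L2_norm sg (%x. flux (f n) x - flux (f m) x)" for n m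
   proof -
    have "L2_norm sg (%x. S_adj Om (f n) x - S_adj Om (f m) x) = L2_norm sg (%x. flux (f m) x - flux (f n) x)"
    proof (rule L2_norm_cong_AE)
     show "AE x in sg. S_adj Om (f n) x - S_adj Om (f m) x = flux (f m) x - flux (f n) x"
      using S_adj_properties(3)[OF f(1)[of n]] S_adj_properties(3)[OF f(1)[of m]] by eventually_elim simp
    qed (use L2_diff[OF SaL[OF f(1)] SaL[OF f(1)]] L2_diff[OF flux_smooth(1)[OF f(1)] flux_smooth(1)[OF f(1)]] in blast)+
    then show ?thesis by (simp add: L2_norm_minus_commute[of sg "flux (f m)"])
   qed
   then show ?thesis using flux_compact[OF f \<eta>] by simp
  qed
 qed
 then show thesis by (rule that)
qed

lemma continuous_on_L2_sigma:
 assumes "continuous_on \<Gamma> (\<beta> :: 'a => real)"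
 shows "\<beta> : L2 sg"
proof -
 have "\<beta> : borel_measurable (restrict_space borel \<Gamma>)" by (rule borel_measurable_continuous_on_restrict[OF assms])
 moreover have "sets (restrict_space borel \<Gamma>) = sets sg"
  unfolding surface_measure_def by (rule sets_restrict_space_cong[symmetric]) simp
 ultimately have m: "\<beta> : borel_measurable sg" using measurable_cong_sets by blast
 have "bounded (\<beta> ` \<Gamma>)" by (rule compact_imp_bounded[OF compact_continuous_image[OF assms compact_Gamma]])
 then obtain B where "!!x. x : \<Gamma> ==> norm (\<beta> x) <= B" by (auto simp: bounded_iff)
 then show ?thesis by (intro finite_measure.L2_bounded[OF finite_measure_sigma m]) auto
qed

end

section \<open>Conclusion for the boundary control problem\<close>

text \<open>Whether \<open>measure_of\<close> keeps the given set function depends on a condition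
  that does not mention the set, so the two alternatives hold for all sets at once.\<close>

lemma hausdorff_measure_cases:
 fixes A :: "'a::euclidean_space set"
 shows "(\<forall>A\<in>sets borel. emeasure (hausdorff_measure s) A = hausdorff_outer s (A :: 'a set)) \<or>
  (\<forall>A. emeasure (hausdorff_measure s) (A :: 'a set) = 0)"
proof -
 have eq: "sigma_sets UNIV (sets borel) = (sets borel :: 'a set set)"
  using sets.sigma_sets_eq[of "borel :: 'a measure"] by (simp only: space_borel)
 have "emeasure (hausdorff_measure s) A =
   (if A : sets borel \<and> measure_space UNIV (sets borel) (hausdorff_outer s :: 'a set => ennreal) then hausdorff_outer s A else 0)" for A :: "'a set"
  unfolding hausdorff_measure_def emeasure_measure_of_conv eq by (rule refl)
 then show ?thesis by auto
qed

theorem theorem4p3: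
  fixes \<Omega> :: "'a::euclidean_space set"
    and y\<^sub>\<Omega> \<beta> ubar :: "'a \<Rightarrow> real"
    and \<nu> c :: real
  assumes dim: "DIM('a) = 2 \<or> DIM('a) = 3"
    and dom: "bounded_lipschitz_domain \<Omega>"
    and yd: "y\<^sub>\<Omega> \<in> L2 (lebesgue_on \<Omega>)"
    and beta: "continuous_on (frontier \<Omega>) \<beta>"
    and nu: "\<nu> > 0"
    and ubar: "is_arg_min (cost \<Omega> y\<^sub>\<Omega> \<nu>) (\<lambda>u. u \<in> admissible \<Omega> \<beta>) ubar"
    and c: "c = \<nu>"
  shows "\<exists>\<epsilon>>0. \<forall>u l :: nat \<Rightarrow> 'a \<Rightarrow> real.
           u 0 \<in> L2 (surface_measure \<Omega>) \<longrightarrow>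
           l 0 \<in> L2 (surface_measure \<Omega>) \<longrightarrow>
           L2_dist (surface_measure \<Omega>) (u 0) ubar < \<epsilon> \<longrightarrow>
           (AE x in surface_measure \<Omega>.
              l 0 x = S_adj \<Omega> y\<^sub>\<Omega> x - (S_adj \<Omega> (S_op \<Omega> (u 0)) x + \<nu> * u 0 x)) \<longrightarrow>
           (\<forall>k. newton_step \<Omega> y\<^sub>\<Omega> \<beta> \<nu> c (u k) (l k) (u (Suc k)) (l (Suc k))) \<longrightarrow>
           q_superlinear_L2 (surface_measure \<Omega>) u ubar"
 using hausdorff_measure_cases[of "real DIM('a) - 1"]
proof
 assume null: "\<forall>A. emeasure (hausdorff_measure (real DIM('a) - 1)) (A :: 'a set) = 0"
 have "emeasure (surface_measure \<Omega>) (space (surface_measure \<Omega>)) = 0"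
 proof (cases "frontier \<Omega> : sets (hausdorff_measure (real DIM('a) - 1) :: 'a measure)")
  case True
  then show ?thesis
   unfolding surface_measure_def using null
   by (subst emeasure_restrict_space) (auto simp: space_restrict_space)
 next
  case False
  moreover have "sets (hausdorff_measure (real DIM('a) - 1) :: 'a measure) = sets borel"
   by (rule sets_hausm)
  moreover have "frontier \<Omega> : sets borel" by simp
  ultimately show ?thesis by simp
 qed
 then have "space (surface_measure \<Omega>) : null_sets (surface_measure \<Omega>)" by auto
 then have ae: "AE x in surface_measure \<Omega>. P x" for P by (rule AE_I') auto
 \<comment> \<open>Over a null measure all distances vanish, so any radius serves and both limits
   are trivial.\<close>
 have "L2_dist (surface_measure \<Omega>) f g = 0" for f g :: "'a => real"
  unfolding L2_dist_def L2_norm_def L2_inner_def by (subst integral_eq_zero_AE[OF ae]) simp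
 then show ?thesis by (intro exI[of _ 1]) (simp add: q_superlinear_L2_def)
next
 assume H: "\<forall>A\<in>sets borel. emeasure (hausdorff_measure (real DIM('a) - 1)) A = hausdorff_outer (real DIM('a) - 1) (A :: 'a set)"
 interpret lipschitz_domain \<Omega>
  by unfold_locales (use dim dom H in \<open>auto simp: bounded_lipschitz_domain_def\<close>)
 obtain C where "compact_adjoint_pair sg LO (S_op \<Omega>) (S_adj \<Omega>) C" by (rule compact_adjoint_pair_S)
 then interpret S: compact_adjoint_pair sg LO "S_op \<Omega>" "S_adj \<Omega>" C .
 have "cost \<Omega> y\<^sub>\<Omega> \<nu> = S.J \<nu> y\<^sub>\<Omega>" by (rule ext) (simp add: cost_def S.J_def)
 then have min: "is_arg_min (S.J \<nu> y\<^sub>\<Omega>) (%u. u : L2 sg \<and> (AE x in sg. u x <= \<beta> x)) ubar"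
  using ubar by (simp add: admissible_def)
 obtain \<epsilon> where \<epsilon>: "\<epsilon> > 0" and main: "\<forall>u l :: nat => 'a => real.
   u 0 : L2 sg --> l 0 : L2 sg --> L2_dist sg (u 0) ubar < \<epsilon> \<longrightarrow>
   (AE x in sg. l 0 x = S_adj \<Omega> y\<^sub>\<Omega> x - (S_adj \<Omega> (S_op \<Omega> (u 0)) x + \<nu> * u 0 x)) \<longrightarrow>
   (\<forall>k. u (Suc k) : L2 sg \<and> l (Suc k) : L2 sg \<and>
    (AE x in sg. \<nu> * u (Suc k) x = S.q y\<^sub>\<Omega> (u (Suc k)) x - l (Suc k) x) \<and>
    (AE x in sg. 1 / \<nu> * l k x + u k x > \<beta> x --> u (Suc k) x = \<beta> x) \<and>
    (AE x in sg. \<not> (1 / \<nu> * l k x + u k x > \<beta> x) --> l (Suc k) x = 0)) \<longrightarrow>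
   q_superlinear_L2 sg u ubar"
  using S.newton_superlinear[OF nu yd continuous_on_L2_sigma[OF beta] min] by blast
 have step: "u' : L2 sg \<and> l' : L2 sg \<and>
    (AE x in sg. \<nu> * u' x = S.q y\<^sub>\<Omega> u' x - l' x) \<and>
    (AE x in sg. 1 / \<nu> * l x + u x > \<beta> x --> u' x = \<beta> x) \<and>
    (AE x in sg. \<not> (1 / \<nu> * l x + u x > \<beta> x) --> l' x = 0)"
  if N: "newton_step \<Omega> y\<^sub>\<Omega> \<beta> \<nu> c u l u' l'" for u l u' l'
 proof (intro conjI)
  show "u' : L2 sg" "l' : L2 sg" using N by (auto simp: newton_step_def)
  show "AE x in sg. \<nu> * u' x = S.q y\<^sub>\<Omega> u' x - l' x"
   using N by (simp add: newton_step_def S.q_def[OF nu yd continuous_on_L2_sigma[OF beta] min])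
  have "AE x in sg. x : active_set \<Omega> \<beta> c u l --> u' x = \<beta> x" using N by (simp add: newton_step_def)
  with AE_space show "AE x in sg. 1 / \<nu> * l x + u x > \<beta> x --> u' x = \<beta> x"
   by eventually_elim (simp add: active_set_def c)
  have "AE x in sg. x : free_set \<Omega> \<beta> c u l --> l' x = 0" using N by (simp add: newton_step_def)
  with AE_space show "AE x in sg. \<not> (1 / \<nu> * l x + u x > \<beta> x) --> l' x = 0"
   by eventually_elim (simp add: free_set_def active_set_def c)
 qed
 show ?thesis
  by (rule exI[of _ \<epsilon>]) (use \<epsilon> main step in blast)
qed

end
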